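(* Let $n\ge 2$ and let $B_1\subset\mathbb{R}^n$ be the open unit ball centered at the origin. Let $s\in(\tfrac12,1)$, and let $\vec b:B_1\to\mathbb{R}^n$ and $c:B_1\to\mathbb{R}$ satisfy $\|\vec b\|_{C^1(B_1)}+\|c\|_{L^\infty(B_1)}\le M$ for some constant $M$. Let $u\in\mathcal{L}_{2s}$ be a nonnegative function satisfying $$(-\Delta)^s u+\vec b\cdot\nabla u+c\,u\ge 0\quad\text{in }\mathcal{D}'(B_1\setminus\{0\}).$$ Then there exist a constant $a\ge 0$ and a nonnegative Radon measure $\mu$ on $B_1$ with $\mu(\{0\})=0$ such that $$(-\Delta)^s u+\vec b\cdot\nabla u+c\,u=\mu+a\,\delta_0\quad\text{in }\mathcal{D}'(B_1).$$ Furthermore, if $\vec b\equiv 0$, the same conclusion holds for every $s\in(0,1)$.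
   Context: $\mathcal{L}_{\alpha}=\{u:\mathbb{R}^n\to\mathbb{R}\ :\ \int_{\mathbb{R}^n}\frac{|u(y)|}{1+|y|^{n+\alpha}}\,dy<\infty\}$. For $\varphi\in C_c^\infty(\mathbb{R}^n)$, $(-\Delta)^s\varphi(x)=C_{n,s}\,\mathrm{P.V.}\int_{\mathbb{R}^n}\frac{\varphi(x)-\varphi(y)}{|x-y|^{n+2s}}\,dy$, where $C_{n,s}>0$ is the usual normalization constant. For $u\in\mathcal{L}_{2s}$ and an open set $U$ on which $\vec b,c$ are defined, $(-\Delta)^su+\vec b\cdot\nabla u+cu$ denotes the distribution on $U$ given by $\varphi\mapsto\int_{\mathbb{R}^n}u\,(-\Delta)^s\varphi\,dx+\int_U u\,[-\mathrm{div}(\vec b\,\varphi)+c\,\varphi]\,dx$ for $\varphi\in C_c^\infty(U)$. An inequality "$\ge0$ in $\mathcal{D}'(U)$" means that this is nonnegative for every nonnegative $\varphi\in C_c^\infty(U)$. $\delta_0$ is the Dirac delta distribution at the origin. *)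

theory Defs
  imports "HOL-Analysis.Analysis" "HOL-Probability.Essential_Supremum"
begin

text \<open>
  The dimension \<open>n\<close> is \<open>DIM('a)\<close>. Functions given only on a subset of \<open>\<real>\<^sup>n\<close> are total
  functions whose values outside that subset are never used.
\<close>

section \<open>Differentiability classes and norms\<close>

text \<open>
  \<open>C_k_on k U f\<close>, for open \<open>U\<close>: all partial derivatives of \<open>f\<close> of order at most \<open>k\<close> exist and
  are continuous on \<open>U\<close>. Asking for total differentiability at each stage loses nothing, since
  continuous first partials imply it; it makes \<^const>\<open>frechet_derivative\<close> meaningful.
\<close>

primrec C_k_on ::
  "nat \<Rightarrow> 'a::euclidean_space set \<Rightarrow> ('a \<Rightarrow> 'b::real_normed_vector) \<Rightarrow> bool" where
  "C_k_on 0 U f \<longleftrightarrow> continuous_on U f"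
| "C_k_on (Suc k) U f \<longleftrightarrow>
     (\<forall>x\<in>U. f differentiable (at x)) \<and>
     (\<forall>i\<in>Basis. C_k_on k U (\<lambda>x. frechet_derivative f (at x) i))"

text \<open>\<open>C\<^sub>c\<^sup>\<infinity>(U)\<close>, as functions on all of \<open>\<real>\<^sup>n\<close> (extended by zero).\<close>

definition test_functions :: "'a::euclidean_space set \<Rightarrow> ('a \<Rightarrow> real) set" where
  "test_functions U =
     {\<phi>. (\<forall>k. C_k_on k UNIV \<phi>) \<and>
         compact (closure {x. \<phi> x \<noteq> 0}) \<and> closure {x. \<phi> x \<noteq> 0} \<subseteq> U}"

text \<open>
  The two norms take values in \<^typ>\<open>ereal\<close>, so that they are infinite for unbounded functions
  (on nonempty \<open>U\<close>). Neither enforces regularity of its argument by itself: \<open>C1_norm\<close> is meant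
  for functions satisfying \<open>C_k_on 1 U\<close>, and \<open>Linf_norm\<close> for measurable functions.
\<close>

definition C1_norm ::
  "'a::euclidean_space set \<Rightarrow> ('a \<Rightarrow> 'b::real_normed_vector) \<Rightarrow> ereal" where
  "C1_norm U f =
     (SUP x\<in>U. ereal (norm (f x))) + (SUP x\<in>U. ereal (onorm (frechet_derivative f (at x))))"

definition Linf_norm :: "'a::euclidean_space set \<Rightarrow> ('a \<Rightarrow> real) \<Rightarrow> ereal" where
  "Linf_norm U f = esssup (lebesgue_on U) (\<lambda>x. ereal \<bar>f x\<bar>)"

definition divergence :: "('a::euclidean_space \<Rightarrow> 'a) \<Rightarrow> 'a \<Rightarrow> real" where
  "divergence F x = (\<Sum>i\<in>Basis. frechet_derivative F (at x) i \<bullet> i)"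

section \<open>The fractional Laplacian\<close>

definition weighted_L1 :: "real \<Rightarrow> ('a::euclidean_space \<Rightarrow> real) set" where
  "weighted_L1 \<alpha> =
     {u. u \<in> borel_measurable lebesgue \<and>
         integrable lebesgue (\<lambda>y. \<bar>u y\<bar> / (1 + norm y powr (real DIM('a) + \<alpha>)))}"

text \<open>
  The normalization for which the Fourier symbol of the fractional Laplacian is
  \<open>\<bar>\<xi>\<bar>\<close> to the power \<open>2s\<close>.
\<close>

definition frac_laplacian_const :: "nat \<Rightarrow> real \<Rightarrow> real" where
  "frac_laplacian_const n s =
     s * 2 powr (2 * s) * Gamma (real n / 2 + s) / (pi powr (real n / 2) * Gamma (1 - s))"

definition frac_laplacian :: "real \<Rightarrow> ('a::euclidean_space \<Rightarrow> real) \<Rightarrow> 'a \<Rightarrow> real" where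
  "frac_laplacian s \<phi> x =
     frac_laplacian_const DIM('a) s *
     Lim (at_right 0) (\<lambda>\<epsilon>. LINT y : - ball x \<epsilon> | lebesgue.
        (\<phi> x - \<phi> y) / norm (x - y) powr (real DIM('a) + 2 * s))"

section \<open>Distributions\<close>

text \<open>
  Distributions on \<open>U\<close> are represented by functionals on \<^typ>\<open>'a \<Rightarrow> real\<close>, of which only the
  values on \<^term>\<open>test_functions U\<close> matter.
\<close>

type_synonym 'a functional = "('a \<Rightarrow> real) \<Rightarrow> real"

definition nonneg_distr :: "'a::euclidean_space set \<Rightarrow> 'a functional \<Rightarrow> bool" where
  "nonneg_distr U T \<longleftrightarrow> (\<forall>\<phi>\<in>test_functions U. (\<forall>x. \<phi> x \<ge> 0) \<longrightarrow> T \<phi> \<ge> 0)"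

definition eq_distr :: "'a::euclidean_space set \<Rightarrow> 'a functional \<Rightarrow> 'a functional \<Rightarrow> bool" where
  "eq_distr U S T \<longleftrightarrow> (\<forall>\<phi>\<in>test_functions U. S \<phi> = T \<phi>)"

text \<open>The distribution \<open>(-\<Delta>)\<^sup>s u + b \<cdot> \<nabla>u + c u\<close> on \<open>U\<close>.\<close>

definition frac_operator_distr ::
  "real \<Rightarrow> ('a::euclidean_space \<Rightarrow> 'a) \<Rightarrow> ('a \<Rightarrow> real) \<Rightarrow> ('a \<Rightarrow> real) \<Rightarrow> 'a set \<Rightarrow> 'a functional"
  where
  "frac_operator_distr s b c u U \<phi> =
     (LINT x|lebesgue. u x * frac_laplacian s \<phi> x) +
     (LINT x:U|lebesgue. u x * (- divergence (\<lambda>z. \<phi> z *\<^sub>R b z) x + c x * \<phi> x))"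

definition measure_distr :: "'a::euclidean_space measure \<Rightarrow> 'a functional" where
  "measure_distr \<mu> \<phi> = (LINT x|\<mu>. \<phi> x)"

definition dirac_distr :: "'a::euclidean_space \<Rightarrow> 'a functional" where
  "dirac_distr p \<phi> = \<phi> p"

text \<open>
  Radon measures on an open set \<open>U\<close>. Nonnegativity is built into \<^typ>\<open>'a measure\<close>.
\<close>

definition radon_measure_on :: "'a::euclidean_space set \<Rightarrow> 'a measure \<Rightarrow> bool" where
  "radon_measure_on U \<mu> \<longleftrightarrow>
     sets \<mu> = sets (restrict_space borel U) \<and>
     (\<forall>K. compact K \<and> K \<subseteq> U \<longrightarrow> emeasure \<mu> K < \<infinity>) \<and>
     (\<forall>A\<in>sets \<mu>. emeasure \<mu> A = (SUP K\<in>{K. compact K \<and> K \<subseteq> A}. emeasure \<mu> K))"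

end

theory Submission
  imports Defs "HOL-Probability.Probability" "HOL-Real_Asymp.Real_Asymp"
begin

text \<open>
  Call the distribution \<open>T\<close>. If a test function \<open>\<phi> \<ge> 0\<close> vanishes at the origin, then \<open>T \<phi> \<ge> 0\<close>: the truncations
  \<open>\<phi> \<theta>(\<phi>/\<delta>)\<close> live away from the origin, and since \<open>|\<nabla>\<phi>|\<^sup>2 \<le> C \<phi>\<close> their second differences are bounded by
  \<open>C |z|\<^sup>2\<close> uniformly in \<open>\<delta>\<close>, so dominated convergence applies as \<open>\<delta> \<rightarrow> 0\<close>. If \<open>m = \<phi>(0) > 0\<close>, subtract from \<open>\<phi>\<close>
  a barrier \<open>z \<le> \<phi>\<close> with \<open>z(0) = m\<close>, namely \<open>m / w(0)\<close> times a cutoff times \<open>(1 + x \<bullet> g) w(x)\<close>, where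
  \<open>g = \<nabla>\<phi>(0) / m\<close> and \<open>w\<close> is the integral of the Gaussian heat kernels \<open>G\<^sub>\<tau>\<close> over \<open>\<tau> \<in> [e, 4r]\<close>.
  The kernel \<open>|z|\<close> to the power \<open>-n-2s\<close> is a mixture of Gaussians, so the semigroup law bounds \<open>(-\<Delta>)\<^sup>s\<close> of the barrier
  near the origin from below by a multiple of \<open>Q - C\<close>, where \<open>Q\<close> is the integral of \<open>\<tau>\<close> to the power \<open>-s\<close> times
  \<open>G\<^sub>\<tau>\<close>; for \<open>s > 1/2\<close> the main term \<open>Q\<close> absorbs the drift. Both the error \<open>C\<close> and the barrier off the origin
  carry the factor \<open>1 / w(0)\<close>, which tends to \<open>0\<close> with \<open>e\<close> because \<open>n \<ge> 2\<close>; hence \<open>T \<phi> \<ge> liminf T z \<ge> 0\<close>.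
  A nonnegative distribution is a Radon measure, and \<open>a\<close> is its atom at the origin.
\<close>

section \<open>Smooth functions\<close>

text \<open>The hypothesis reaches \<open>u\<close> only through its pairing with test functions, so
  every estimate is made on the test side. As \<open>u\<close> is nonnegative and integrable against
  \<open>weight\<close>, a one-sided bound for the operator on the barrier suffices. The potential w
  truncates the fundamental solution of -\<Delta>, because the heat kernel integrated over all times
  inverts -\<Delta>; without the lower cutoff its value at 0 is infinite exactly when n \<ge> 2. Up
  to constants, (-\<Delta>)^s maps |x|^(2-n) to the Riesz kernel |x|^(2-n-2s), of which Q is a
  truncation, while the gradient has size |x|^(1-n). The former dominates at 0 exactly when 2s > 1:
  this is the restriction on s in the presence of a drift. The factor 1 + x . g is forced, since
  \<phi> - z has a minimum at 0 and so the gradients of z and \<phi> agree there; it disturbs the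
  main term only by a multiple of |x . g|, small near 0. Gaussian mixtures keep the barrier smooth
  and treat n = 2, where the potential is logarithmic, like n > 2.\<close>

definition smooth_fun :: "('a::euclidean_space \<Rightarrow> real) \<Rightarrow> bool" where
  "smooth_fun f \<longleftrightarrow> (\<forall>k. C_k_on k UNIV f)"

lemma C_k_on_SucI:
  assumes "\<And>x. (f has_derivative f' x) (at x)" "\<And>i. i \<in> Basis \<Longrightarrow> C_k_on k UNIV (\<lambda>x. f' x i)"
  shows "C_k_on (Suc k) UNIV f"
proof -
  have "frechet_derivative f (at x) = f' x" for x
    using assms(1) by (metis frechet_derivative_at)
  then show ?thesis using assms by (auto simp: differentiable_def)
qed

lemma C_k_on_Suc_imp: "C_k_on (Suc k) UNIV f \<Longrightarrow> C_k_on k UNIV f"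
proof (induction k arbitrary: f)
  case 0
  then show ?case
    by (auto simp: continuous_on_eq_continuous_at differentiable_imp_continuous_within)
next
  case (Suc k)
  then show ?case by (metis C_k_on.simps(2))
qed

lemma C_k_on_Suc_has_derivative:
  "C_k_on (Suc k) UNIV f \<Longrightarrow> (f has_derivative frechet_derivative f (at x)) (at x)"
  by (simp add: frechet_derivative_works)

lemma C_k_on_const: "C_k_on k UNIV (\<lambda>x. c)"
proof (induction k arbitrary: c)
  case (Suc k)
  show ?case by (rule C_k_on_SucI[where f'="\<lambda>x h. 0"]) (auto simp: Suc)
qed auto

lemma C_k_on_add:
  "C_k_on k UNIV f \<Longrightarrow> C_k_on k UNIV g \<Longrightarrow> C_k_on k UNIV (\<lambda>x. f x + g x)"
proof (induction k arbitrary: f g)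
  case 0
  then show ?case by (auto intro: continuous_intros)
next
  case (Suc k)
  show ?case
  proof (rule C_k_on_SucI)
    show "((\<lambda>x. f x + g x) has_derivative
      (\<lambda>h. frechet_derivative f (at x) h + frechet_derivative g (at x) h)) (at x)" for x
      using Suc.prems by (intro has_derivative_add C_k_on_Suc_has_derivative)
  qed (use Suc in auto)
qed

lemma C_k_on_mult:
  fixes f g :: "'a::euclidean_space \<Rightarrow> real"
  shows "C_k_on k UNIV f \<Longrightarrow> C_k_on k UNIV g \<Longrightarrow> C_k_on k UNIV (\<lambda>x. f x * g x)"
proof (induction k arbitrary: f g)
  case 0
  then show ?case by (auto intro: continuous_intros)
next
  case (Suc k)
  show ?case
  proof (rule C_k_on_SucI)
    show "((\<lambda>x. f x * g x) has_derivative
      (\<lambda>h. f x * frechet_derivative g (at x) h + frechet_derivative f (at x) h * g x)) (at x)" for x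
      using Suc.prems by (intro has_derivative_mult C_k_on_Suc_has_derivative)
    show "C_k_on k UNIV
      (\<lambda>x. f x * frechet_derivative g (at x) i + frechet_derivative f (at x) i * g x)"
      if "i \<in> Basis" for i
      using that Suc.prems C_k_on_Suc_imp[OF Suc.prems(1)] C_k_on_Suc_imp[OF Suc.prems(2)]
      by (intro C_k_on_add Suc.IH) auto
  qed
qed

lemma C_k_on_inner: "C_k_on k UNIV (\<lambda>x. x \<bullet> a)"
proof (cases k)
  case (Suc m)
  have "C_k_on (Suc m) UNIV (\<lambda>x. x \<bullet> a)"
    by (rule C_k_on_SucI[where f'="\<lambda>x h. h \<bullet> a"])
      (auto intro!: derivative_eq_intros C_k_on_const)
  with Suc show ?thesis by simp
qed (auto intro: continuous_intros)

lemma C_k_on_compose: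
  fixes f :: "'a::euclidean_space \<Rightarrow> real" and g :: "real \<Rightarrow> real"
  shows "C_k_on k UNIV g \<Longrightarrow> C_k_on k UNIV f \<Longrightarrow> C_k_on k UNIV (\<lambda>x. g (f x))"
proof (induction k arbitrary: g)
  case 0
  then show ?case by (auto intro: continuous_on_compose2[of UNIV g])
next
  case (Suc k)
  let ?g = "\<lambda>t. frechet_derivative g (at t) 1"
  have lin: "frechet_derivative g (at t) h = ?g t * h" for t h
  proof -
    interpret bounded_linear "frechet_derivative g (at t)"
      using C_k_on_Suc_has_derivative[OF Suc.prems(1)] by (auto dest: has_derivative_bounded_linear)
    show ?thesis using scale[of h 1] by (simp add: mult.commute)
  qed
  show ?case
  proof (rule C_k_on_SucI)
    show "((\<lambda>x. g (f x)) has_derivative (\<lambda>h. ?g (f x) * frechet_derivative f (at x) h)) (at x)" for x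
      using has_derivative_compose[OF C_k_on_Suc_has_derivative[OF Suc.prems(2)]
          C_k_on_Suc_has_derivative[OF Suc.prems(1)]]
      by (subst (asm) lin) simp
    show "C_k_on k UNIV (\<lambda>x. ?g (f x) * frechet_derivative f (at x) i)" if "i \<in> Basis" for i
    proof (rule C_k_on_mult)
      show "C_k_on k UNIV (\<lambda>x. ?g (f x))"
        by (rule Suc.IH) (use Suc.prems C_k_on_Suc_imp[OF Suc.prems(2)] in auto)
    qed (use that Suc.prems in auto)
  qed
qed

lemma C_k_on_inverse:
  fixes f :: "'a::euclidean_space \<Rightarrow> real"
  assumes "\<And>x. f x \<noteq> 0"
  shows "C_k_on k UNIV f \<Longrightarrow> C_k_on k UNIV (\<lambda>x. inverse (f x))"
proof (induction k)
  case 0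
  then show ?case using assms by (auto intro: continuous_intros)
next
  case (Suc k)
  have i: "C_k_on k UNIV (\<lambda>x. inverse (f x))"
    by (rule Suc.IH) (rule C_k_on_Suc_imp[OF Suc.prems])
  show ?case
  proof (rule C_k_on_SucI)
    show "((\<lambda>x. inverse (f x)) has_derivative
      (\<lambda>h. - (inverse (f x) * frechet_derivative f (at x) h * inverse (f x)))) (at x)" for x
      using assms Suc.prems by (intro Deriv.has_derivative_inverse C_k_on_Suc_has_derivative)
    have "C_k_on k UNIV (\<lambda>x. (-1) * (inverse (f x) * frechet_derivative f (at x) j * inverse (f x)))"
      if "j \<in> Basis" for j
      using that i Suc.prems by (intro C_k_on_mult C_k_on_const) auto
    then show "C_k_on k UNIV (\<lambda>x. - (inverse (f x) * frechet_derivative f (at x) j * inverse (f x)))"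
      if "j \<in> Basis" for j
      using that by simp
  qed
qed

lemma smooth_fun_const [simp]: "smooth_fun (\<lambda>x. c)"
  by (simp add: smooth_fun_def C_k_on_const)

lemma smooth_fun_add: "smooth_fun f \<Longrightarrow> smooth_fun g \<Longrightarrow> smooth_fun (\<lambda>x. f x + g x)"
  unfolding smooth_fun_def using C_k_on_add[of _ f g] by blast

lemma smooth_fun_mult: "smooth_fun f \<Longrightarrow> smooth_fun g \<Longrightarrow> smooth_fun (\<lambda>x. f x * g x)"
  unfolding smooth_fun_def using C_k_on_mult[of _ f g] by blast

lemma smooth_fun_inner: "smooth_fun (\<lambda>x. x \<bullet> a)"
  by (simp add: smooth_fun_def C_k_on_inner)

lemma smooth_fun_compose: "smooth_fun h \<Longrightarrow> smooth_fun f \<Longrightarrow> smooth_fun (\<lambda>x. h (f x))"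
  unfolding smooth_fun_def using C_k_on_compose[of _ h f] by blast

lemma smooth_fun_inverse:
  "smooth_fun f \<Longrightarrow> (\<And>x. f x \<noteq> 0) \<Longrightarrow> smooth_fun (\<lambda>x. inverse (f x))"
  unfolding smooth_fun_def using C_k_on_inverse[of f] by blast

lemma smooth_fun_cmult: "smooth_fun f \<Longrightarrow> smooth_fun (\<lambda>x. c * f x)"
  by (rule smooth_fun_mult[OF smooth_fun_const])

lemma smooth_fun_diff:
  assumes "smooth_fun f" "smooth_fun g"
  shows "smooth_fun (\<lambda>x. f x - g x)"
  using smooth_fun_add[OF assms(1) smooth_fun_cmult[OF assms(2), of "-1"]] by simp

lemma smooth_fun_sum:
  "(\<And>i. i \<in> I \<Longrightarrow> smooth_fun (f i)) \<Longrightarrow> smooth_fun (\<lambda>x. \<Sum>i\<in>I. f i x)"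
  by (induction I rule: infinite_finite_induct) (auto intro: smooth_fun_add)

lemma smooth_fun_prod:
  "(\<And>i. i \<in> I \<Longrightarrow> smooth_fun (f i)) \<Longrightarrow> smooth_fun (\<lambda>x. \<Prod>i\<in>I. f i x)"
  by (induction I rule: infinite_finite_induct) (auto intro: smooth_fun_mult)

lemma smooth_fun_id: "smooth_fun (\<lambda>x::real. x)"
  using smooth_fun_inner[of "1::real"] by simp

lemma smooth_fun_norm_sq: "smooth_fun (\<lambda>x. (norm (x - p))\<^sup>2)"
proof -
  have "(norm (x - p))\<^sup>2 = (\<Sum>b\<in>Basis. (x \<bullet> b - p \<bullet> b) * (x \<bullet> b - p \<bullet> b))" for x
    unfolding power2_norm_eq_inner euclidean_inner[of "x - p" "x - p"] by (simp add: inner_diff_left)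
  then show ?thesis
    by (auto intro!: smooth_fun_sum smooth_fun_mult smooth_fun_diff smooth_fun_inner)
qed

lemma smooth_fun_has_derivative:
  "smooth_fun f \<Longrightarrow> (f has_derivative frechet_derivative f (at x)) (at x)"
  by (metis C_k_on_Suc_has_derivative smooth_fun_def)

lemma smooth_fun_continuous: "smooth_fun f \<Longrightarrow> continuous_on S f"
  using C_k_on.simps(1) continuous_on_subset smooth_fun_def by blast

lemma smooth_fun_partial: "smooth_fun f \<Longrightarrow> i \<in> Basis \<Longrightarrow> smooth_fun (\<lambda>x. frechet_derivative f (at x) i)"
  by (metis C_k_on.simps(2) smooth_fun_def)

section \<open>Smooth transition functions on the line, built from exp(-1/t)\<close>

definition flat_fun :: "nat \<Rightarrow> real \<Rightarrow> real" where
  "flat_fun m t = (if t > 0 then inverse t ^ m * exp (- inverse t) else 0)"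

text \<open>The family is closed under differentiation up to scalar factors, which is why it carries
  the exponent \<open>m\<close>: one induction on the order then gives smoothness of all members at
  once.\<close>

lemma flat_fun_has_derivative:
  "(flat_fun m has_field_derivative (flat_fun (m + 2) t - m * flat_fun (m + 1) t)) (at t)"
proof -
  consider "t > 0" | "t < 0" | "t = 0" by linarith
  then show ?thesis
  proof cases
    case 1
    have "((\<lambda>t. inverse t ^ m) has_field_derivative (- (m * inverse t ^ (m + 1)))) (at t)"
      using DERIV_power[OF DERIV_inverse[of t UNIV], of m] 1 by (cases m) (auto simp: algebra_simps)
    moreover have "((\<lambda>t. exp (- inverse t)) has_field_derivative inverse t ^ 2 * exp (- inverse t)) (at t)"
      using 1 by (auto intro!: derivative_eq_intros simp: field_simps power2_eq_square)
    ultimately have "((\<lambda>t. inverse t ^ m * exp (- inverse t)) has_field_derivative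
       (- (m * inverse t ^ (m + 1))) * exp (- inverse t) + (inverse t ^ 2 * exp (- inverse t)) * inverse t ^ m) (at t)"
      by (rule DERIV_mult)
    then have "((\<lambda>t. inverse t ^ m * exp (- inverse t)) has_field_derivative
       (flat_fun (m + 2) t - m * flat_fun (m + 1) t)) (at t)"
      using 1 by (simp add: flat_fun_def power2_eq_square algebra_simps)
    then show ?thesis
      by (rule has_field_derivative_transform_within_open[of _ _ _ "{0<..}"])
        (use 1 in \<open>auto simp: flat_fun_def\<close>)
  next
    case 2
    have "((\<lambda>t. 0) has_field_derivative (flat_fun (m + 2) t - m * flat_fun (m + 1) t)) (at t)"
      using 2 by (auto simp: flat_fun_def)
    then show ?thesis
      by (rule has_field_derivative_transform_within_open[of _ _ _ "{..<0}"])
        (use 2 in \<open>auto simp: flat_fun_def\<close>)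
  next
    case 3
    \<comment> \<open>At 0 the right difference quotient vanishes in the limit because the
      exponential beats every power of 1/h.\<close>
    have "((\<lambda>h::real. inverse h ^ m * exp (- inverse h) / h) \<longlongrightarrow> 0) (at_right 0)"
      by real_asymp
    then have r: "((\<lambda>h. flat_fun m h / h) \<longlongrightarrow> 0) (at_right 0)"
      by (rule filterlim_cong[THEN iffD1, rotated -1])
        (auto simp: flat_fun_def eventually_at_filter)
    have l: "((\<lambda>h. flat_fun m h / h) \<longlongrightarrow> 0) (at_left 0)"
      by (rule tendsto_eventually) (auto simp: flat_fun_def eventually_at_filter)
    show ?thesis using filterlim_split_at[OF l r] 3
      by (simp add: DERIV_def flat_fun_def)
  qed
qed

lemma smooth_fun_flat: "smooth_fun (flat_fun m)"
proof -
  have "C_k_on k UNIV (flat_fun m)" for k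
  proof (induction k arbitrary: m)
    case 0
    then show ?case
      using flat_fun_has_derivative by (auto simp: continuous_on_eq_continuous_at intro: DERIV_isCont)
  next
    case (Suc k)
    show ?case
    proof (rule C_k_on_SucI)
      show "(flat_fun m has_derivative (\<lambda>h. (flat_fun (m + 2) t - m * flat_fun (m + 1) t) * h)) (at t)"
        for t
        using flat_fun_has_derivative[of m t] by (simp add: has_field_derivative_def)
      have "C_k_on k UNIV (\<lambda>t. flat_fun (m + 2) t + (- real m) * flat_fun (m + 1) t)"
        by (intro C_k_on_add C_k_on_mult C_k_on_const Suc)
      then show "C_k_on k UNIV (\<lambda>t. (flat_fun (m + 2) t - m * flat_fun (m + 1) t) * i)"
        if "i \<in> Basis" for i
        using that by simp
    qed
  qed
  then show ?thesis by (simp add: smooth_fun_def)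
qed

text \<open>The rise takes place between 1/2 and 1 and not from 0 on: a composition with
  \<open>step_fun\<close> is then supported in a closed superlevel set, which lies inside the open
  set where the argument is positive.\<close>

definition step_fun :: "real \<Rightarrow> real" where
  "step_fun t = flat_fun 0 (t - 1/2) * inverse (flat_fun 0 (t - 1/2) + flat_fun 0 (1 - t))"

lemma step_fun_denom: "flat_fun 0 (t - 1/2) + flat_fun 0 (1 - t) > 0"
  by (auto simp: flat_fun_def add_pos_pos)

lemma smooth_fun_step: "smooth_fun step_fun"
proof -
  have a: "smooth_fun (\<lambda>t::real. t - 1/2)" "smooth_fun (\<lambda>t::real. 1 - t)"
    by (intro smooth_fun_diff smooth_fun_id smooth_fun_const)+
  have "smooth_fun (\<lambda>t. flat_fun 0 (t - 1/2) * inverse (flat_fun 0 (t - 1/2) + flat_fun 0 (1 - t)))"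
    using step_fun_denom
    by (intro smooth_fun_mult smooth_fun_inverse smooth_fun_add a
        smooth_fun_compose[OF smooth_fun_flat]) (auto simp: less_imp_neq[symmetric])
  then show ?thesis by (simp add: step_fun_def[abs_def])
qed

lemma flat_fun_nonneg: "flat_fun m t \<ge> 0"
  by (auto simp: flat_fun_def)

lemma step_fun_nonneg: "step_fun t \<ge> 0"
  and step_fun_le_1: "step_fun t \<le> 1"
  and step_fun_eq_0: "t \<le> 1/2 \<Longrightarrow> step_fun t = 0"
  and step_fun_eq_1: "t \<ge> 1 \<Longrightarrow> step_fun t = 1"
proof -
  note p = step_fun_denom[of t] and n = flat_fun_nonneg[of 0 "t - 1/2"] flat_fun_nonneg[of 0 "1 - t"]
  show "step_fun t \<ge> 0" using p n by (auto simp: step_fun_def)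
  show "step_fun t \<le> 1" using p n by (simp add: step_fun_def divide_inverse[symmetric])
  show "t \<le> 1/2 \<Longrightarrow> step_fun t = 0" by (simp add: step_fun_def flat_fun_def)
  show "t \<ge> 1 \<Longrightarrow> step_fun t = 1" using p by (simp add: step_fun_def flat_fun_def)
qed

section \<open>Test functions\<close>

lemma test_functionsI:
  assumes "smooth_fun f" "compact K" "K \<subseteq> U" "\<And>x. x \<notin> K \<Longrightarrow> f x = 0"
  shows "f \<in> test_functions U"
proof -
  have "closure {x. f x \<noteq> 0} \<subseteq> K"
    using assms(2,4) by (intro closure_minimal compact_imp_closed) auto
  moreover have "compact (closure {x. f x \<noteq> 0})"
    using calculation assms(2) by (metis closed_closure compact_Int_closed inf.absorb_iff2)
  ultimately show ?thesis using assms by (auto simp: test_functions_def smooth_fun_def)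
qed

lemma test_functionsD:
  assumes "f \<in> test_functions U"
  shows "smooth_fun f" "compact (closure {x. f x \<noteq> 0})" "closure {x. f x \<noteq> 0} \<subseteq> U"
  using assms by (auto simp: test_functions_def smooth_fun_def)

lemma test_functions_eq_0:
  assumes "f \<in> test_functions V" "x \<notin> V"
  shows "f x = 0"
  using test_functionsD(3)[OF assms(1)] closure_subset[of "{x. f x \<noteq> 0}"] assms(2) by auto

lemma test_functionsE:
  assumes "f \<in> test_functions U"
  obtains K where "smooth_fun f" "compact K" "K \<subseteq> U" "\<And>x. x \<notin> K \<Longrightarrow> f x = 0"
proof (rule that[OF test_functionsD[OF assms]])
  show "f x = 0" if "x \<notin> closure {x. f x \<noteq> 0}" for x
    using that closure_subset[of "{x. f x \<noteq> 0}"] by auto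
qed

lemma test_functions_mono: "U \<subseteq> V \<Longrightarrow> test_functions U \<subseteq> test_functions V"
  by (auto simp: test_functions_def)

lemma test_functions_zero: "(\<lambda>x. 0) \<in> test_functions U"
  by (rule test_functionsI[of _ "{}"]) auto

lemma test_functions_add:
  assumes "f \<in> test_functions U" "g \<in> test_functions U"
  shows "(\<lambda>x. f x + g x) \<in> test_functions U"
proof -
  obtain K where K: "smooth_fun f" "compact K" "K \<subseteq> U" "\<And>x. x \<notin> K \<Longrightarrow> f x = 0"
    using test_functionsE[OF assms(1)] by blast
  obtain L where L: "smooth_fun g" "compact L" "L \<subseteq> U" "\<And>x. x \<notin> L \<Longrightarrow> g x = 0"
    using test_functionsE[OF assms(2)] by blast
  show ?thesis
    by (rule test_functionsI[of _ "K \<union> L"]) (use K L in \<open>auto intro: smooth_fun_add\<close>)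
qed

lemma test_functions_mult:
  assumes "f \<in> test_functions U" "smooth_fun g"
  shows "(\<lambda>x. f x * g x) \<in> test_functions U"
proof -
  obtain K where K: "smooth_fun f" "compact K" "K \<subseteq> U" "\<And>x. x \<notin> K \<Longrightarrow> f x = 0"
    using test_functionsE[OF assms(1)] by blast
  show ?thesis
    by (rule test_functionsI[OF smooth_fun_mult[OF K(1) assms(2)] K(2,3)]) (use K in auto)
qed

lemma test_functions_cmult:
  "f \<in> test_functions U \<Longrightarrow> (\<lambda>x. c * f x) \<in> test_functions U"
  using test_functions_mult[of f U "\<lambda>x. c"] by (simp add: mult.commute[of c])

lemma test_functions_diff:
  assumes "f \<in> test_functions U" "g \<in> test_functions U"
  shows "(\<lambda>x. f x - g x) \<in> test_functions U"
  using test_functions_add[OF assms(1) test_functions_cmult[OF assms(2), of "-1"]] by simp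

lemma test_functions_sum:
  "(\<And>i. i \<in> I \<Longrightarrow> f i \<in> test_functions U) \<Longrightarrow> (\<lambda>x. \<Sum>i\<in>I. f i x) \<in> test_functions U"
  by (induction I rule: infinite_finite_induct) (auto intro: test_functions_add test_functions_zero)

lemma bump_exists:
  fixes p :: "'a::euclidean_space"
  assumes r: "r > 0"
  obtains f where "smooth_fun f" "\<And>x. 0 \<le> f x" "\<And>x. f x \<le> 1"
    "\<And>x. x \<in> cball p r \<Longrightarrow> f x = 1" "\<And>x. x \<notin> cball p (2 * r) \<Longrightarrow> f x = 0"
proof
  \<comment> \<open>The squared norm keeps \<open>f\<close> smooth at \<open>p\<close>. The argument
    is at least 1 on the ball of radius r and at most 1/2 as soon as |x - p|^2 \<ge> 3/2
    r^2.\<close>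
  define f where "f = (\<lambda>x::'a. step_fun (2 - (1 / r\<^sup>2) * (norm (x - p))\<^sup>2))"
  show "smooth_fun f"
    unfolding f_def
    by (intro smooth_fun_compose[OF smooth_fun_step] smooth_fun_diff smooth_fun_cmult
        smooth_fun_norm_sq smooth_fun_const)
  show "0 \<le> f x" "f x \<le> 1" for x by (simp_all add: f_def step_fun_nonneg step_fun_le_1)
  show "f x = 1" if "x \<in> cball p r" for x
  proof -
    have "(norm (x - p))\<^sup>2 \<le> r\<^sup>2"
      using that by (auto simp: dist_norm norm_minus_commute intro!: power_mono)
    then show ?thesis unfolding f_def using r by (intro step_fun_eq_1) (simp add: field_simps)
  qed
  show "f x = 0" if "x \<notin> cball p (2 * r)" for x
  proof -
    have "(norm (x - p))\<^sup>2 \<ge> (2 * r)\<^sup>2"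
      using that r by (intro power_mono) (auto simp: dist_norm norm_minus_commute)
    then have "4 * r\<^sup>2 \<le> (norm (x - p))\<^sup>2" by (simp add: power_mult_distrib)
    then have "3 * r\<^sup>2 \<le> 2 * (norm (x - p))\<^sup>2"
      using zero_le_power2[of r] by linarith
    then show ?thesis unfolding f_def using r by (intro step_fun_eq_0) (simp add: field_simps)
  qed
qed

text \<open>Finitely many bumps \<open>g x\<close> are merged into one minus the product of all
  \<open>1 - g x\<close>, which stays in [0, 1] and is 1 wherever one of them is. The value 1 is
  reached on a whole neighbourhood \<open>W\<close> of \<open>K\<close>, since the Riesz
  construction compares test functions with open sets.\<close>

lemma smooth_urysohn:
  fixes K V :: "'a::euclidean_space set"
  assumes "compact K" "open V" "K \<subseteq> V"
  shows "\<exists>f W. f \<in> test_functions V \<and> (\<forall>x. 0 \<le> f x) \<and> (\<forall>x. f x \<le> 1) \<and>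
    open W \<and> K \<subseteq> W \<and> (\<forall>x\<in>W. f x = 1)"
proof -
  have "\<exists>r>0. cball x (2 * r) \<subseteq> V" if xK: "x \<in> K" for x
  proof -
    have "\<forall>x\<in>V. \<exists>e>0. cball x e \<subseteq> V" using assms(2) by (simp add: open_contains_cball)
    then obtain e where "e > 0" "cball x e \<subseteq> V" using assms(3) xK by (meson subsetD)
    then show ?thesis by (intro exI[of _ "e/2"]) simp
  qed
  then obtain r where r: "\<And>x. x \<in> K \<Longrightarrow> r x > 0" "\<And>x. x \<in> K \<Longrightarrow> cball x (2 * r x) \<subseteq> V"
    by metis
  have cover: "K \<subseteq> (\<Union>x\<in>K. ball x (r x))" using r(1) by auto
  obtain F where F: "F \<subseteq> K" "finite F" "K \<subseteq> (\<Union>x\<in>F. ball x (r x))"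
    by (rule compactE_image[OF assms(1) _ cover]) auto
  have "\<exists>f. smooth_fun f \<and> (\<forall>y. 0 \<le> f y) \<and> (\<forall>y. f y \<le> 1) \<and> (\<forall>y. y \<in> cball x (r x) \<longrightarrow> f y = 1) \<and>
      (\<forall>y. y \<notin> cball x (2 * r x) \<longrightarrow> f y = 0)" if x: "x \<in> F" for x
  proof -
    have rx: "r x > 0" using r(1) F(1) x by auto
    show ?thesis
    proof (rule bump_exists[OF rx, of x])
      fix f assume "smooth_fun f" "\<And>y. 0 \<le> f y" "\<And>y. f y \<le> 1"
        "\<And>y. y \<in> cball x (r x) \<Longrightarrow> f y = 1" "\<And>y. y \<notin> cball x (2 * r x) \<Longrightarrow> f y = 0"
      then show ?thesis by (intro exI[of _ f]) simp
    qed
  qed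
  then have "\<forall>x\<in>F. \<exists>f. smooth_fun f \<and> (\<forall>y. 0 \<le> f y) \<and> (\<forall>y. f y \<le> 1) \<and>
      (\<forall>y. y \<in> cball x (r x) \<longrightarrow> f y = 1) \<and> (\<forall>y. y \<notin> cball x (2 * r x) \<longrightarrow> f y = 0)"
    by blast
  from bchoice[OF this] obtain g where "\<forall>x\<in>F. smooth_fun (g x) \<and> (\<forall>y. 0 \<le> g x y) \<and>
      (\<forall>y. g x y \<le> 1) \<and> (\<forall>y. y \<in> cball x (r x) \<longrightarrow> g x y = 1) \<and>
      (\<forall>y. y \<notin> cball x (2 * r x) \<longrightarrow> g x y = 0)"
    by blast
  then have g: "\<And>x. x \<in> F \<Longrightarrow> smooth_fun (g x)" "\<And>x y. x \<in> F \<Longrightarrow> 0 \<le> g x y"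
    "\<And>x y. x \<in> F \<Longrightarrow> g x y \<le> 1"
    "\<And>x y. x \<in> F \<Longrightarrow> y \<in> cball x (r x) \<Longrightarrow> g x y = 1"
    "\<And>x y. x \<in> F \<Longrightarrow> y \<notin> cball x (2 * r x) \<Longrightarrow> g x y = 0"
    by simp_all
  define f where "f = (\<lambda>y. 1 - (\<Prod>x\<in>F. 1 - g x y))"
  have "smooth_fun f" unfolding f_def
    by (intro smooth_fun_diff smooth_fun_const smooth_fun_prod g(1)) auto
  then have "f \<in> test_functions V"
  proof (rule test_functionsI)
    show "compact (\<Union>x\<in>F. cball x (2 * r x))" using F(2) by (intro compact_UN) auto
    show "(\<Union>x\<in>F. cball x (2 * r x)) \<subseteq> V" using r(2) F(1) by (intro UN_least) auto
    show "f y = 0" if "y \<notin> (\<Union>x\<in>F. cball x (2 * r x))" for y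
    proof -
      have "(\<Prod>x\<in>F. 1 - g x y) = 1" using that g(5) by (intro prod.neutral) auto
      then show ?thesis by (simp add: f_def)
    qed
  qed
  moreover have "0 \<le> f y" "f y \<le> 1" for y
    using prod_le_1[of F "\<lambda>x. 1 - g x y"] prod_nonneg[of F "\<lambda>x. 1 - g x y"] g(2,3)
    by (auto simp: f_def)
  moreover have "f y = 1" if y: "y \<in> (\<Union>x\<in>F. ball x (r x))" for y
  proof -
    obtain x where x: "x \<in> F" "y \<in> ball x (r x)" using y by auto
    then have "1 - g x y = 0" using g(4)[of x y] by (simp add: less_imp_le)
    then have "(\<Prod>x\<in>F. 1 - g x y) = 0" using F(2) x(1) by (intro prod_zero) auto
    then show ?thesis by (simp add: f_def)
  qed
  moreover have "open (\<Union>x\<in>F. ball x (r x))" by auto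
  ultimately show ?thesis
    using F(3) by (intro exI[of _ f] exI[of _ "\<Union>x\<in>F. ball x (r x)"]) blast
qed

section \<open>Nonnegative distributions are Radon measures\<close>

text \<open>A layer-cake count: up to an error of one the sum is the number of levels below
  \<open>t\<close>, whatever the shape of the step inside the unit interval. Smooth steps and the
  sharp steps at 0 and at 1 are all instances, so the corresponding sums can be compared with one
  another.\<close>

lemma sum_slices_bounds:
  fixes p :: "real \<Rightarrow> real"
  assumes p: "\<And>t. 0 \<le> p t" "\<And>t. p t \<le> 1" "\<And>t. t \<le> 0 \<Longrightarrow> p t = 0" "\<And>t. t > 1 \<Longrightarrow> p t = 1"
  shows "(\<Sum>i<N. p (t - real i)) \<le> max 0 (t + 1)" "min t (real N) - 1 \<le> (\<Sum>i<N. p (t - real i))"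
proof (induction N arbitrary: t)
  case (Suc N)
  \<comment> \<open>Splitting off the first slice shifts \<open>t\<close> by one, so both bounds go
    through by induction on \<open>N\<close> with \<open>t\<close> arbitrary.\<close>
  have eq: "(\<Sum>i<Suc N. p (t - real i)) = p t + (\<Sum>i<N. p ((t - 1) - real i))" for t
    by (subst sum.lessThan_Suc_shift) (simp add: algebra_simps)
  {
    case 1
    show ?case using Suc.IH(1)[of "t - 1"] p(2)[of t] p(3)[of t] unfolding eq
      by (cases "t \<le> 0") auto
  next
    case 2
    have "0 \<le> (\<Sum>i<N. p ((t - 1) - real i))" by (intro sum_nonneg p)
    then show ?case using Suc.IH(2)[of "t - 1"] p(1)[of t] p(4)[of t] unfolding eq
      by (cases "t > 1") auto
  }
qed auto

section \<open>The Riesz construction: content of open sets, outer measure, Caratheodory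
  measurability\<close>

locale nonneg_functional =
  fixes U :: "'a::euclidean_space set" and T :: "('a \<Rightarrow> real) \<Rightarrow> real"
  assumes open_U: "open U"
    and T_add: "\<And>f g. f \<in> test_functions U \<Longrightarrow> g \<in> test_functions U \<Longrightarrow> T (\<lambda>x. f x + g x) = T f + T g"
    and T_cmult: "\<And>f r. f \<in> test_functions U \<Longrightarrow> T (\<lambda>x. r * f x) = r * T f"
    and T_nonneg: "\<And>f. f \<in> test_functions U \<Longrightarrow> (\<And>x. 0 \<le> f x) \<Longrightarrow> 0 \<le> T f"
begin

lemma T_zero: "T (\<lambda>x. 0) = 0"
  using T_cmult[OF test_functions_zero, of 0] by simp

lemma T_diff:
  assumes "f \<in> test_functions U" "g \<in> test_functions U"
  shows "T (\<lambda>x. f x - g x) = T f - T g"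
  using T_add[OF assms(1) test_functions_cmult[OF assms(2), of "-1"]] T_cmult[OF assms(2), of "-1"] by simp

lemma T_mono:
  assumes "f \<in> test_functions U" "g \<in> test_functions U" "\<And>x. f x \<le> g x"
  shows "T f \<le> T g"
  using T_nonneg[OF test_functions_diff[OF assms(2,1)]] T_diff[OF assms(2,1)] assms(3) by simp

lemma T_sum:
  assumes "\<And>i. i \<in> I \<Longrightarrow> f i \<in> test_functions U"
  shows "T (\<lambda>x. \<Sum>i\<in>I. f i x) = (\<Sum>i\<in>I. T (f i))"
  using assms
proof (induction I rule: infinite_finite_induct)
  case (insert i I)
  then show ?case using T_add[of "f i" "\<lambda>x. \<Sum>i\<in>I. f i x"] test_functions_sum[of I f U] by simp
qed (simp_all add: T_zero)

text \<open>Supports are confined to \<open>V \<inter> U\<close>, so \<open>V\<close> may be any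
  open set of the whole space. The measure is thus built on all of \<open>UNIV\<close> and
  restricted to \<open>U\<close> only at the very end.\<close>

definition unit_tests :: "'a set \<Rightarrow> ('a \<Rightarrow> real) set" where
  "unit_tests V = {f \<in> test_functions (V \<inter> U). \<forall>x. 0 \<le> f x \<and> f x \<le> 1}"

definition tmass :: "'a set \<Rightarrow> ennreal" where
  "tmass V = (SUP f\<in>unit_tests V. ennreal (T f))"

definition outer :: "'a set \<Rightarrow> ennreal" where
  "outer A = (INF V\<in>{V. open V \<and> A \<subseteq> V}. tmass V)"

lemma unit_tests_mono: "V \<subseteq> W \<Longrightarrow> unit_tests V \<subseteq> unit_tests W"
  unfolding unit_tests_def using test_functions_mono[of "V \<inter> U" "W \<inter> U"] by auto

lemma unit_testsD:
  assumes "f \<in> unit_tests V"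
  shows "f \<in> test_functions U" "f \<in> test_functions V" "0 \<le> f x" "f x \<le> 1" "x \<notin> V \<Longrightarrow> f x = 0"
proof -
  show "f \<in> test_functions U" "f \<in> test_functions V" "0 \<le> f x" "f x \<le> 1"
    using assms test_functions_mono[of "V \<inter> U" U] test_functions_mono[of "V \<inter> U" V]
    by (auto simp: unit_tests_def)
  show "x \<notin> V \<Longrightarrow> f x = 0"
    using test_functions_eq_0[OF \<open>f \<in> test_functions V\<close>] by simp
qed

lemma tmass_mono: "V \<subseteq> W \<Longrightarrow> tmass V \<le> tmass W"
  unfolding tmass_def by (intro SUP_subset_mono unit_tests_mono) auto

lemma T_le_tmass: "f \<in> unit_tests V \<Longrightarrow> ennreal (T f) \<le> tmass V"
  unfolding tmass_def by (rule SUP_upper)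

lemma tmass_le_T:
  assumes "f \<in> test_functions U" "\<And>x. 0 \<le> f x" "\<And>x. x \<in> V \<Longrightarrow> 1 \<le> f x"
  shows "tmass V \<le> ennreal (T f)"
  unfolding tmass_def
proof (intro SUP_least ennreal_leI T_mono)
  fix g x assume g: "g \<in> unit_tests V"
  show "g \<in> test_functions U" using unit_testsD[OF g] by simp
  show "g x \<le> f x" using unit_testsD(3)[OF g, of x] unit_testsD(4)[OF g, of x] unit_testsD(5)[OF g, of x] assms(2,3)[of x] by (cases "x \<in> V") auto
qed (rule assms)

lemma tmass_empty: "tmass {} = 0"
  using tmass_le_T[OF test_functions_zero, of "{}"] T_zero by simp

text \<open>A partition of unity splits a test function of the union. The cutoff \<open>g\<close> is
  1 on an open set \<open>G\<close> around the part of the support that \<open>W\<close> misses, so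
  \<open>f * (1 - g)\<close> is supported in the compact set \<open>K - G\<close>, which lies in
  \<open>W\<close>.\<close>

lemma tmass_Un:
  assumes "open V" "open W"
  shows "tmass (V \<union> W) \<le> tmass V + tmass W"
  unfolding tmass_def[of "V \<union> W"]
proof (rule SUP_least)
  fix f assume f: "f \<in> unit_tests (V \<union> W)"
  define K where "K = closure {x. f x \<noteq> 0}"
  have f': "f \<in> test_functions ((V \<union> W) \<inter> U)" using f by (simp add: unit_tests_def)
  have K: "compact K" "K \<subseteq> (V \<union> W) \<inter> U" "\<And>x. x \<notin> K \<Longrightarrow> f x = 0"
    using test_functionsD[OF f'] closure_subset[of "{x. f x \<noteq> 0}"] by (auto simp: K_def)
  have "compact (K - W)" using K(1) assms(2) by (simp add: compact_diff)
  moreover have "K - W \<subseteq> V \<inter> U" using K(2) by auto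
  ultimately obtain g G where "g \<in> test_functions (V \<inter> U)" "\<forall>x. 0 \<le> g x" "\<forall>x. g x \<le> 1"
    "open G" "K - W \<subseteq> G" "\<forall>x\<in>G. g x = 1"
    using smooth_urysohn[of "K - W" "V \<inter> U"] assms open_U by blast
  then have g: "g \<in> test_functions (V \<inter> U)" "\<And>x. 0 \<le> g x" "\<And>x. g x \<le> 1"
    "open G" "K - W \<subseteq> G" "\<And>x. x \<in> G \<Longrightarrow> g x = 1" by auto
  have "(\<lambda>x. g x * f x) \<in> unit_tests V"
    using test_functions_mult[OF g(1) test_functionsD(1)[OF f']] g(2,3) unit_testsD(3,4)[OF f]
    by (auto simp: unit_tests_def intro: mult_le_one)
  moreover have "(\<lambda>x. f x * (1 - g x)) \<in> unit_tests W"
  proof -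
    have "(\<lambda>x. f x * (1 - g x)) \<in> test_functions (W \<inter> U)"
    proof (rule test_functionsI)
      show "smooth_fun (\<lambda>x. f x * (1 - g x))"
        by (intro smooth_fun_mult smooth_fun_diff smooth_fun_const test_functionsD(1)[OF f']
            test_functionsD(1)[OF g(1)])
      show "compact (K - G)" using K(1) g(4) by (simp add: compact_diff)
      show "K - G \<subseteq> W \<inter> U" using K(2) g(5) by auto
      show "f x * (1 - g x) = 0" if "x \<notin> K - G" for x
        using that K(3) g(6) by auto
    qed
    then show ?thesis
      using g(2,3) unit_testsD(3,4)[OF f] by (auto simp: unit_tests_def intro: mult_le_one)
  qed
  moreover have "T f = T (\<lambda>x. g x * f x) + T (\<lambda>x. f x * (1 - g x))"
    using T_add[OF unit_testsD(1)[OF calculation(1)] unit_testsD(1)[OF calculation(2)]]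
    by (simp add: algebra_simps)
  moreover have "0 \<le> T (\<lambda>x. g x * f x)" "0 \<le> T (\<lambda>x. f x * (1 - g x))"
    using T_nonneg unit_testsD(1,3)[OF calculation(1)] unit_testsD(1,3)[OF calculation(2)] by auto
  ultimately show "ennreal (T f) \<le> tmass V + tmass W"
    using add_mono[OF T_le_tmass T_le_tmass] by (simp add: ennreal_plus)
qed

lemma tmass_UN_finite:
  fixes V :: "nat \<Rightarrow> 'a set"
  assumes "\<And>i. open (V i)"
  shows "tmass (\<Union>i<N. V i) \<le> (\<Sum>i<N. tmass (V i))"
proof (induction N)
  case (Suc N)
  have "tmass (\<Union>i<Suc N. V i) = tmass ((\<Union>i<N. V i) \<union> V N)"
    by (simp add: lessThan_Suc Un_commute)
  also have "\<dots> \<le> tmass (\<Union>i<N. V i) + tmass (V N)"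
    using assms by (intro tmass_Un) auto
  finally show ?case using Suc by (simp add: add_right_mono order_trans)
qed (simp add: tmass_empty)

text \<open>The support of a test function is compact, so finitely many of the \<open>V i\<close>
  already contain it.\<close>

lemma tmass_UN:
  fixes V :: "nat \<Rightarrow> 'a set"
  assumes V: "\<And>i. open (V i)"
  shows "tmass (\<Union>i. V i) \<le> (\<Sum>i. tmass (V i))"
  unfolding tmass_def[of "\<Union>i. V i"]
proof (rule SUP_least)
  fix f assume f: "f \<in> unit_tests (\<Union>i. V i)"
  then have "f \<in> test_functions ((\<Union>i. V i) \<inter> U)" by (simp add: unit_tests_def)
  then obtain K where K: "smooth_fun f" "compact K" "K \<subseteq> (\<Union>i. V i) \<inter> U" "\<And>x. x \<notin> K \<Longrightarrow> f x = 0"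
    using test_functionsE by blast
  obtain F where F: "finite F" "K \<subseteq> (\<Union>i\<in>F. V i)"
    using compactE_image[OF K(2), of UNIV V] V K(3) by auto
  obtain N where N: "F \<subseteq> {..<N}" using F(1) by (meson finite_nat_bounded)
  have "f \<in> test_functions ((\<Union>i<N. V i) \<inter> U)"
    by (rule test_functionsI[OF K(1,2) _ K(4)]) (use K(3) F(2) N in blast)
  then have "f \<in> unit_tests (\<Union>i<N. V i)" using f by (simp add: unit_tests_def)
  then have "ennreal (T f) \<le> tmass (\<Union>i<N. V i)" by (rule T_le_tmass)
  also have "\<dots> \<le> (\<Sum>i<N. tmass (V i))" by (rule tmass_UN_finite[OF V])
  also have "\<dots> \<le> (\<Sum>i. tmass (V i))" by (intro sum_le_suminf) auto
  finally show "ennreal (T f) \<le> (\<Sum>i. tmass (V i))" .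
qed

lemma outer_open: "open V \<Longrightarrow> outer V = tmass V"
  unfolding outer_def by (intro antisym INF_lower INF_greatest tmass_mono) auto

lemma outer_mono: "A \<subseteq> B \<Longrightarrow> outer A \<le> outer B"
  unfolding outer_def by (intro INF_superset_mono) auto

lemma outer_UN:
  fixes A :: "nat \<Rightarrow> 'a set"
  shows "outer (\<Union>i. A i) \<le> (\<Sum>i. outer (A i))"
proof (rule ennreal_le_epsilon)
  fix e :: real
  assume fin: "(\<Sum>i. outer (A i)) < top" and e: "0 < e"
  \<comment> \<open>Finiteness of \<open>outer (A i)\<close> makes adding the tolerance a strict
    increase, so the infimum provides a good open cover. The tolerances sum to
    \<open>e\<close>.\<close>
  have "\<exists>V. open V \<and> A i \<subseteq> V \<and> tmass V \<le> outer (A i) + ennreal (e * (1/2) ^ Suc i)" for i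
  proof -
    have "outer (A i) < top"
      using fin ennreal_suminf_lessD by blast
    then have "outer (A i) < outer (A i) + ennreal (e * (1/2) ^ Suc i)"
      using e by (simp add: ennreal_add_left_cancel_less)
    then obtain V where "open V" "A i \<subseteq> V" "tmass V < outer (A i) + ennreal (e * (1/2) ^ Suc i)"
      unfolding outer_def[of "A i"] INF_less_iff by auto
    then show ?thesis by (intro exI[of _ V]) auto
  qed
  then obtain V where V: "\<And>i. open (V i)" "\<And>i. A i \<subseteq> V i"
    "\<And>i. tmass (V i) \<le> outer (A i) + ennreal (e * (1/2) ^ Suc i)"
    by metis
  have "outer (\<Union>i. A i) \<le> tmass (\<Union>i. V i)"
    unfolding outer_def using V by (intro INF_lower) auto
  also have "\<dots> \<le> (\<Sum>i. tmass (V i))" by (rule tmass_UN[OF V(1)])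
  also have "\<dots> \<le> (\<Sum>i. outer (A i) + ennreal (e * (1/2) ^ Suc i))"
    by (intro suminf_le V) auto
  also have "\<dots> = (\<Sum>i. outer (A i)) + (\<Sum>i. ennreal (e * (1/2) ^ Suc i))"
    by (intro suminf_add[symmetric]) auto
  also have "(\<Sum>i. ennreal (e * (1/2) ^ Suc i)) = ennreal e"
    using sums_mult[OF power_half_series, of e] e
    by (intro suminf_ennreal_eq) auto
  finally show "outer (\<Union>i. A i) \<le> (\<Sum>i. outer (A i)) + ennreal e" .
qed

lemma outer_empty: "outer {} = 0"
  using outer_open[of "{}"] tmass_empty by simp

lemma outer_measure_space_outer: "outer_measure_space (Pow UNIV) outer"
  unfolding outer_measure_space_def positive_def increasing_def countably_subadditive_def
  using outer_empty outer_mono outer_UN by auto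

lemma outer_Un: "outer (A \<union> B) \<le> outer A + outer B"
proof -
  have "outer (\<Union>i. binaryset A B i) \<le> (\<Sum>i. outer (binaryset A B i))" by (rule outer_UN)
  moreover have "(\<lambda>i. outer (binaryset A B i)) sums (outer A + outer B)"
    using binaryset_sums[of outer A B] outer_empty by simp
  ultimately show ?thesis by (simp add: UN_binaryset_eq sums_unique[symmetric])
qed

text \<open>The Caratheodory inequality with an open test set \<open>W\<close>. If \<open>f\<close>
  has its support \<open>K\<close> in \<open>V \<inter> W\<close> and \<open>g\<close> lives in
  \<open>W - K\<close>, the two are never nonzero together, so \<open>f + g\<close> is again at most
  1 and competes for \<open>tmass W\<close>. Suprema are taken over \<open>g\<close> first, then
  over \<open>f\<close>.\<close>

lemma tmass_split:
  assumes "open V" "open W"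
  shows "tmass (V \<inter> W) + outer (W - V) \<le> tmass W"
proof -
  have *: "ennreal (T f) + outer (W - V) \<le> tmass W" if f: "f \<in> unit_tests (V \<inter> W)" for f
  proof -
    define K where "K = closure {x. f x \<noteq> 0}"
    have f': "f \<in> test_functions ((V \<inter> W) \<inter> U)" using f by (simp add: unit_tests_def)
    have K: "compact K" "K \<subseteq> V \<inter> W \<inter> U" "\<And>x. x \<notin> K \<Longrightarrow> f x = 0"
      using test_functionsD[OF f'] closure_subset[of "{x. f x \<noteq> 0}"] by (auto simp: K_def)
    have "outer (W - V) \<le> tmass (W - K)"
      using K assms unfolding outer_def
      by (intro INF_lower) (auto intro: open_Diff compact_imp_closed)
    moreover have "ennreal (T f) + tmass (W - K) \<le> tmass W"
    proof -
      have "ennreal (T f) + ennreal (T g) \<le> tmass W" if g: "g \<in> unit_tests (W - K)" for g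
      proof -
        have "(\<lambda>x. f x + g x) \<in> test_functions (W \<inter> U)"
          using f' g test_functions_mono[of "V \<inter> W \<inter> U" "W \<inter> U"] test_functions_mono[of "(W - K) \<inter> U" "W \<inter> U"]
          by (intro test_functions_add) (auto simp: unit_tests_def)
        moreover have "0 \<le> f x + g x \<and> f x + g x \<le> 1" for x
          using unit_testsD(3)[OF f, of x] unit_testsD(4)[OF f, of x] unit_testsD(3)[OF g, of x]
            unit_testsD(4)[OF g, of x] unit_testsD(5)[OF g, of x] K(3)[of x] by (cases "x \<in> K") auto
        ultimately have "(\<lambda>x. f x + g x) \<in> unit_tests W" by (simp add: unit_tests_def)
        from T_le_tmass[OF this] show ?thesis
          using T_add[OF unit_testsD(1)[OF f] unit_testsD(1)[OF g]]
            T_nonneg[OF unit_testsD(1)[OF f]] T_nonneg[OF unit_testsD(1)[OF g]]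
            unit_testsD(3)[OF f] unit_testsD(3)[OF g] by (simp add: ennreal_plus)
      qed
      moreover have "(\<lambda>x. 0) \<in> unit_tests (W - K)" by (simp add: unit_tests_def test_functions_zero)
      ultimately show ?thesis
        unfolding tmass_def[of "W - K"] by (subst ennreal_SUP_add_right) (auto intro!: SUP_least)
    qed
    ultimately show ?thesis by (meson add_left_mono order_trans)
  qed
  have "(\<lambda>x. 0) \<in> unit_tests (V \<inter> W)" by (simp add: unit_tests_def test_functions_zero)
  with * show ?thesis
    unfolding tmass_def[of "V \<inter> W"] by (subst ennreal_SUP_add_left[symmetric]) (auto intro!: SUP_least)
qed

lemma open_in_lambda_system:
  assumes "open V"
  shows "V \<in> lambda_system UNIV (Pow UNIV) outer"
proof -
  have "outer (V \<inter> A) + outer (A - V) = outer A" for A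
  proof (rule antisym)
    have "A = (V \<inter> A) \<union> (A - V)" by auto
    then show "outer A \<le> outer (V \<inter> A) + outer (A - V)" by (metis outer_Un)
    show "outer (V \<inter> A) + outer (A - V) \<le> outer A"
      unfolding outer_def[of A]
    proof (rule INF_greatest)
      fix W assume "W \<in> {W. open W \<and> A \<subseteq> W}"
      then have W: "open W" "A \<subseteq> W" by auto
      have "outer (V \<inter> A) + outer (A - V) \<le> outer (V \<inter> W) + outer (W - V)"
        using W by (intro add_mono outer_mono) auto
      also have "\<dots> \<le> tmass W"
        using tmass_split[OF assms W(1)] assms W(1) by (simp add: outer_open open_Int)
      finally show "outer (V \<inter> A) + outer (A - V) \<le> tmass W" .
    qed
  qed
  then show ?thesis by (simp add: lambda_system_def Diff_eq inf_commute)
qed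

definition rep_measure :: "'a measure" where
  "rep_measure = measure_of UNIV (sets borel) outer"

lemma sets_rep_measure [simp, measurable_cong]: "sets rep_measure = sets borel"
  and space_rep_measure [simp]: "space rep_measure = UNIV"
  unfolding rep_measure_def by (simp_all add: sets.sigma_sets_eq[of borel, simplified])

text \<open>The Caratheodory-measurable sets form a sigma-algebra that contains the open sets, hence
  all Borel sets, and on it the outer measure is countably additive.\<close>

lemma emeasure_rep_measure:
  assumes "A \<in> sets borel"
  shows "emeasure rep_measure A = outer A"
proof -
  interpret P: sigma_algebra UNIV "Pow (UNIV :: 'a set)" by (rule sigma_algebra_Pow)
  have ms: "measure_space UNIV (lambda_system UNIV (Pow UNIV) outer) outer"
    by (rule P.caratheodory_lemma[OF outer_measure_space_outer])
  then interpret L: sigma_algebra UNIV "lambda_system UNIV (Pow UNIV) outer"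
    by (simp add: measure_space_def)
  have sub: "sets borel \<subseteq> lambda_system UNIV (Pow UNIV) outer"
  proof -
    have "sigma_sets UNIV (Collect open) \<subseteq> lambda_system UNIV (Pow UNIV) outer"
      by (rule L.sigma_sets_subset) (use open_in_lambda_system in blast)
    moreover have "sets borel = sigma_sets UNIV (Collect open :: 'a set set)"
      by (simp add: borel_def)
    ultimately show ?thesis by simp
  qed
  show ?thesis
  proof (rule emeasure_measure_of[OF rep_measure_def])
    show "positive (sets rep_measure) outer" by (simp add: positive_def outer_empty)
    show "countably_additive (sets rep_measure) outer"
      using ms sub unfolding measure_space_def countably_additive_def by (auto simp: subset_iff)
  qed (use assms in auto)
qed

lemma emeasure_rep_open: "open V \<Longrightarrow> emeasure rep_measure V = tmass V"
  by (simp add: emeasure_rep_measure outer_open)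

lemma emeasure_rep_compact:
  assumes "compact K" "K \<subseteq> U"
  shows "emeasure rep_measure K < \<infinity>"
proof -
  obtain f W where f: "f \<in> test_functions U" "\<forall>x. 0 \<le> f x" "open W" "K \<subseteq> W" "\<forall>x\<in>W. f x = 1"
    using smooth_urysohn[OF assms(1) open_U assms(2)] by blast
  have "emeasure rep_measure K \<le> tmass W"
    using emeasure_mono[of K W rep_measure] f by (simp add: emeasure_rep_open)
  also have "\<dots> \<le> ennreal (T f)" using f by (intro tmass_le_T) auto
  finally show ?thesis by (simp add: le_less_trans)
qed

section \<open>Integration of test functions against the constructed measure\<close>

lemma integrable_rep:
  assumes "f \<in> test_functions U"
  shows "integrable rep_measure f"
proof -
  obtain K where K: "smooth_fun f" "compact K" "K \<subseteq> U" "\<And>x. x \<notin> K \<Longrightarrow> f x = 0"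
    using test_functionsE[OF assms] by blast
  have "compact (f ` K)" using K by (intro compact_continuous_image smooth_fun_continuous)
  then obtain B where B: "\<And>x. x \<in> K \<Longrightarrow> norm (f x) \<le> B"
    by (metis bounded_iff compact_imp_bounded imageI)
  have "f \<in> borel_measurable borel"
    using smooth_fun_continuous[OF K(1)] by (rule borel_measurable_continuous_onI)
  moreover have "integrable rep_measure (\<lambda>x. indicator K x *\<^sub>R B)"
    using emeasure_rep_compact[OF K(2,3)] K(2)
    by (intro integrable_scaleR_left) (simp add: integrable_indicator_iff compact_imp_closed less_top[symmetric])
  ultimately show ?thesis
    by (rule_tac Bochner_Integration.integrable_bound[of _ "\<lambda>x. indicator K x *\<^sub>R B"])
      (use B K(4) in \<open>auto simp: indicator_def intro!: AE_I2 order_trans[OF _ abs_ge_self]\<close>)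
qed

text \<open>Slice \<open>f\<close> at the heights \<open>i * h\<close>. The smooth slice
  \<open>\<theta> i\<close> is supported in the superlevel set \<open>A i\<close> and equals 1 on
  \<open>A (i + 1)\<close>, so \<open>T (\<theta> i)\<close> lies between the measures of these
  sets. Both \<open>h\<close> times the sum of the slices and \<open>h\<close> times the sum of the
  indicators agree with \<open>f\<close> up to \<open>h\<close>, so \<open>T f\<close> and the
  integral differ by at most a constant times \<open>h\<close>.\<close>

lemma T_eq_integral_nonneg:
  assumes f: "f \<in> test_functions U" "\<And>x. 0 \<le> f x"
  shows "T f = (\<integral>x. f x \<partial>rep_measure)"
proof -
  define K where "K = closure {x. f x \<noteq> 0}"
  have K: "compact K" "K \<subseteq> U" "\<And>x. x \<notin> K \<Longrightarrow> f x = 0"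
    using test_functionsD[OF f(1)] closure_subset[of "{x. f x \<noteq> 0}"] by (auto simp: K_def)
  have sf: "smooth_fun f" using test_functionsD[OF f(1)] by simp
  have meas[measurable]: "f \<in> borel_measurable borel"
    using smooth_fun_continuous[OF sf] by (rule borel_measurable_continuous_onI)
  obtain g W where "g \<in> test_functions U" "\<forall>x. 0 \<le> g x" "K \<subseteq> W" "\<forall>x\<in>W. g x = 1"
    using smooth_urysohn[OF K(1) open_U K(2)] by blast
  then have g: "g \<in> test_functions U" "\<And>x. 0 \<le> g x" "K \<subseteq> W" "\<And>x. x \<in> W \<Longrightarrow> g x = 1" by auto
  have "compact (f ` K)" using K sf by (intro compact_continuous_image smooth_fun_continuous)
  then obtain B where B0: "\<And>x. x \<in> K \<Longrightarrow> norm (f x) \<le> B"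
    by (metis bounded_iff compact_imp_bounded imageI)
  have B: "f x \<le> max B 0" for x using B0[of x] K(3)[of x] by (cases "x \<in> K") auto
  have Kb: "K \<in> sets borel" using K(1) by (rule borel_compact)
  have Kfin: "emeasure rep_measure K < \<infinity>" by (rule emeasure_rep_compact[OF K(1,2)])
  have iK: "integrable rep_measure (indicator K :: 'a \<Rightarrow> real)"
    using Kfin Kb by (simp add: integrable_indicator_iff)
  have inf: "integrable rep_measure f" by (rule integrable_rep[OF f(1)])
  \<comment> \<open>A pointwise error of \<open>h\<close> on \<open>K\<close> costs
    \<open>h * T g\<close> under \<open>T\<close>, because \<open>g\<close> is 1 on
    \<open>K\<close>, and \<open>h\<close> times the measure of \<open>K\<close> under the integral.
    Neither factor depends on \<open>h\<close>.\<close>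
  have bound: "\<bar>T f - (\<integral>x. f x \<partial>rep_measure)\<bar> \<le> h * (T g + measure rep_measure K)" if h: "h > 0" for h :: real
  proof -
    obtain N where N: "max B 0 / h \<le> real N" using real_arch_simple by blast
    have fN: "f x / h \<le> real N" for x
      using B[of x] N h by (meson divide_right_mono less_imp_le order_trans)
    define \<theta> where "\<theta> = (\<lambda>i x. step_fun (f x / h - real i))"
    have tf: "\<theta> i \<in> test_functions U" for i
    proof (rule test_functionsI[OF _ K(1,2)])
      show "smooth_fun (\<theta> i)" unfolding \<theta>_def divide_inverse mult.commute[of _ "inverse h"]
        by (intro smooth_fun_compose[OF smooth_fun_step] smooth_fun_diff smooth_fun_cmult sf smooth_fun_const)
      show "\<theta> i x = 0" if "x \<notin> K" for x
        using K(3)[OF that] by (simp add: \<theta>_def step_fun_eq_0)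
    qed
    define A where "A = (\<lambda>r::real. {x. r * h < f x})"
    have openA: "open (A r)" for r unfolding A_def
      using smooth_fun_continuous[OF sf, of UNIV] by (intro open_Collect_less continuous_intros)
    have Ab: "A r \<in> sets borel" for r using openA by simp
    have AK: "A r \<subseteq> K" if "r \<ge> 0" for r
    proof
      fix x assume "x \<in> A r"
      moreover have "0 \<le> r * h" using that h by simp
      ultimately show "x \<in> K" using K(3)[of x] by (cases "x \<in> K") (auto simp: A_def)
    qed
    have Afin: "emeasure rep_measure (A r) < \<infinity>" if "r \<ge> 0" for r
      using emeasure_mono[OF AK[OF that], of rep_measure] Kfin Kb by (simp add: order_le_less_trans)
    have iA: "integrable rep_measure (indicator (A r) :: 'a \<Rightarrow> real)" if "r \<ge> 0" for r
      using Afin[OF that] Ab by (simp add: integrable_indicator_iff)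
    have up: "T (\<theta> i) \<le> measure rep_measure (A (real i))" for i
    proof -
      have "\<theta> i \<in> test_functions (A (real i) \<inter> U)"
      proof (rule test_functionsI)
        show "smooth_fun (\<theta> i)" using tf test_functionsD by blast
        \<comment> \<open>Here the start of the transition at 1/2 pays off: the support of the slice
          sits in a closed superlevel set strictly inside the open set \<open>A i\<close>.\<close>
        have "closed {x. (real i + 1/2) * h \<le> f x}"
          using smooth_fun_continuous[OF sf, of UNIV] by (intro closed_Collect_le continuous_intros)
        then show "compact (K \<inter> {x. (real i + 1/2) * h \<le> f x})" using K(1) by (simp add: compact_Int_closed)
        show "K \<inter> {x. (real i + 1/2) * h \<le> f x} \<subseteq> A (real i) \<inter> U"
          using K(2) h by (auto simp: A_def algebra_simps)
        show "\<theta> i x = 0" if "x \<notin> K \<inter> {x. (real i + 1/2) * h \<le> f x}" for x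
          using that K(3)[of x] h unfolding \<theta>_def
          by (intro step_fun_eq_0) (auto simp: field_simps)
      qed
      then have "\<theta> i \<in> unit_tests (A (real i))"
        by (auto simp: unit_tests_def \<theta>_def step_fun_nonneg step_fun_le_1)
      from T_le_tmass[OF this] have "ennreal (T (\<theta> i)) \<le> emeasure rep_measure (A (real i))"
        by (simp add: emeasure_rep_open openA)
      also have "\<dots> = ennreal (measure rep_measure (A (real i)))"
        using Afin[of "real i"] by (intro emeasure_eq_ennreal_measure) auto
      finally show ?thesis by (simp add: ennreal_le_iff)
    qed
    have low: "measure rep_measure (A (real i + 1)) \<le> T (\<theta> i)" for i
    proof -
      have "ennreal (measure rep_measure (A (real i + 1))) = emeasure rep_measure (A (real i + 1))"
        using Afin[of "real i + 1"] by (intro emeasure_eq_ennreal_measure[symmetric]) auto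
      also have "\<dots> = tmass (A (real i + 1))" by (simp add: emeasure_rep_open openA)
      also have "\<dots> \<le> ennreal (T (\<theta> i))"
      proof (rule tmass_le_T[OF tf])
        show "0 \<le> \<theta> i x" for x by (simp add: \<theta>_def step_fun_nonneg)
        show "1 \<le> \<theta> i x" if "x \<in> A (real i + 1)" for x
          using that h unfolding \<theta>_def A_def
          by (subst step_fun_eq_1) (auto simp: field_simps)
      qed
      finally show ?thesis
        using T_nonneg[OF tf] by (subst (asm) ennreal_le_iff) (auto simp: \<theta>_def step_fun_nonneg)
    qed
    have s1: "(\<Sum>i<N. \<theta> i x) \<le> max 0 (f x / h + 1)" "min (f x / h) (real N) - 1 \<le> (\<Sum>i<N. \<theta> i x)" for x
      unfolding \<theta>_def by (rule sum_slices_bounds; simp add: step_fun_nonneg step_fun_le_1 step_fun_eq_0 step_fun_eq_1)+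
    have s2: "(\<Sum>i<N. indicator (A (real i)) x :: real) \<le> max 0 (f x / h + 1)" for x
    proof -
      have "(\<Sum>i<N. indicator (A (real i)) x :: real) = (\<Sum>i<N. (if f x / h - real i > 0 then 1 else 0))"
        using h by (intro sum.cong) (auto simp: A_def indicator_def field_simps)
      also have "\<dots> \<le> max 0 (f x / h + 1)" by (rule sum_slices_bounds(1)) auto
      finally show ?thesis .
    qed
    have s3: "min (f x / h) (real N) - 1 \<le> (\<Sum>i<N. indicator (A (real i + 1)) x :: real)" for x
    proof -
      have "min (f x / h) (real N) - 1 \<le> (\<Sum>i<N. (if f x / h - real i > 1 then 1 else 0))"
        by (rule sum_slices_bounds(2)) auto
      also have "\<dots> = (\<Sum>i<N. indicator (A (real i + 1)) x :: real)"
        using h by (intro sum.cong) (auto simp: A_def indicator_def field_simps)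
      finally show ?thesis .
    qed
    have fh: "0 \<le> f x / h" for x using f(2) h by simp
    have Th: "T (\<lambda>x. h * (\<Sum>i<N. \<theta> i x)) = h * (\<Sum>i<N. T (\<theta> i))"
      using T_cmult[OF test_functions_sum[of "{..<N}" \<theta>]] T_sum[of "{..<N}" \<theta>] tf by simp
    have tfs: "(\<lambda>x. h * (\<Sum>i<N. \<theta> i x)) \<in> test_functions U"
      by (intro test_functions_cmult test_functions_sum tf)
    have tfg: "(\<lambda>x. h * g x) \<in> test_functions U" by (intro test_functions_cmult g)
    have "T f \<le> T (\<lambda>x. h * (\<Sum>i<N. \<theta> i x) + h * g x)"
    proof (rule T_mono[OF f(1) test_functions_add[OF tfs tfg]])
      show "f x \<le> h * (\<Sum>i<N. \<theta> i x) + h * g x" for x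
      proof (cases "x \<in> K")
        case True
        then have "g x = 1" using g by auto
        then show ?thesis using s1(2)[of x] fN[of x] h by (simp add: field_simps)
      next
        case False
        then show ?thesis using K(3) g(2)[of x] h
          by (auto intro!: add_nonneg_nonneg mult_nonneg_nonneg sum_nonneg simp: \<theta>_def step_fun_nonneg)
      qed
    qed
    also have "\<dots> = h * (\<Sum>i<N. T (\<theta> i)) + h * T g"
      using T_add[OF tfs tfg] Th T_cmult[OF g(1)] by simp
    also have "\<dots> \<le> h * (\<Sum>i<N. measure rep_measure (A (real i))) + h * T g"
      using h up by (intro add_right_mono mult_left_mono sum_mono) auto
    also have "h * (\<Sum>i<N. measure rep_measure (A (real i))) = (\<integral>x. h * (\<Sum>i<N. indicator (A (real i)) x) \<partial>rep_measure)"
      using iA Ab by (simp add: Bochner_Integration.integral_sum)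
    also have "\<dots> \<le> (\<integral>x. f x + h * indicator K x \<partial>rep_measure)"
    proof (rule integral_mono)
      show "h * (\<Sum>i<N. indicator (A (real i)) x) \<le> f x + h * indicator K x" for x
      proof (cases "x \<in> K")
        case True
        then show ?thesis using s2[of x] fh[of x] h by (simp add: field_simps)
      next
        case False
        then have "indicator (A (real i)) x = (0::real)" for i using AK[of "real i"] by (auto simp: indicator_def)
        then show ?thesis using f(2) False by simp
      qed
    qed (use iA inf iK in auto)
    also have "\<dots> = (\<integral>x. f x \<partial>rep_measure) + h * measure rep_measure K"
      using inf iK Kb by simp
    finally have 1: "T f \<le> (\<integral>x. f x \<partial>rep_measure) + h * (T g + measure rep_measure K)"
      by (simp add: algebra_simps)
    have "(\<integral>x. f x \<partial>rep_measure) \<le> (\<integral>x. h * (\<Sum>i<N. indicator (A (real i + 1)) x) + h * indicator K x \<partial>rep_measure)"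
    proof (rule integral_mono)
      show "f x \<le> h * (\<Sum>i<N. indicator (A (real i + 1)) x) + h * indicator K x" for x
      proof (cases "x \<in> K")
        case True
        then show ?thesis using s3[of x] fN[of x] h by (simp add: field_simps)
      next
        case False
        then show ?thesis using K(3) h by (auto intro!: mult_nonneg_nonneg sum_nonneg)
      qed
    qed (use iA inf iK in auto)
    also have "\<dots> = h * (\<Sum>i<N. measure rep_measure (A (real i + 1))) + h * measure rep_measure K"
      using iA iK Ab Kb by (simp add: Bochner_Integration.integral_sum)
    also have "\<dots> \<le> h * (\<Sum>i<N. T (\<theta> i)) + h * measure rep_measure K"
      using h low by (intro add_right_mono mult_left_mono sum_mono) auto
    also have "h * (\<Sum>i<N. T (\<theta> i)) \<le> T (\<lambda>x. f x + h * g x)"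
      unfolding Th[symmetric]
    proof (rule T_mono[OF tfs test_functions_add[OF f(1) tfg]])
      show "h * (\<Sum>i<N. \<theta> i x) \<le> f x + h * g x" for x
      proof (cases "x \<in> K")
        case True
        then have "g x = 1" using g by auto
        then show ?thesis using s1(1)[of x] fh[of x] h by (simp add: field_simps)
      next
        case False
        then have "\<theta> i x = 0" for i using K(3) by (simp add: \<theta>_def step_fun_eq_0)
        then show ?thesis using f(2) g(2)[of x] h by simp
      qed
    qed
    also have "T (\<lambda>x. f x + h * g x) = T f + h * T g"
      using T_add[OF f(1) tfg] T_cmult[OF g(1)] by simp
    finally have 2: "(\<integral>x. f x \<partial>rep_measure) \<le> T f + h * (T g + measure rep_measure K)"
      by (simp add: algebra_simps)
    show ?thesis using 1 2 by linarith
  qed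
  define C where "C = T g + measure rep_measure K"
  have C: "C \<ge> 0" using T_nonneg[OF g(1,2)] by (simp add: C_def)
  have "\<bar>T f - (\<integral>x. f x \<partial>rep_measure)\<bar> \<le> 0"
  proof (rule field_le_epsilon)
    fix e :: real assume e: "e > 0"
    have "\<bar>T f - (\<integral>x. f x \<partial>rep_measure)\<bar> \<le> (e / (C + 1)) * C"
      using bound[of "e / (C + 1)"] e C by (simp add: C_def)
    also have "\<dots> \<le> e" using e C by (simp add: field_simps)
    finally show "\<bar>T f - (\<integral>x. f x \<partial>rep_measure)\<bar> \<le> 0 + e" by simp
  qed
  then show ?thesis by simp
qed

text \<open>A large multiple of a cutoff that is 1 on the support makes \<open>f\<close>
  nonnegative; linearity on both sides removes it again.\<close>

theorem T_eq_integral: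
  assumes f: "f \<in> test_functions U"
  shows "T f = (\<integral>x. f x \<partial>rep_measure)"
proof -
  obtain K where K: "smooth_fun f" "compact K" "K \<subseteq> U" "\<And>x. x \<notin> K \<Longrightarrow> f x = 0"
    using test_functionsE[OF f] by blast
  have "compact (f ` K)" using K by (intro compact_continuous_image smooth_fun_continuous)
  then obtain B where B: "\<And>x. x \<in> K \<Longrightarrow> norm (f x) \<le> B"
    by (metis bounded_iff compact_imp_bounded imageI)
  obtain g W where "g \<in> test_functions U" "\<forall>x. 0 \<le> g x" "K \<subseteq> W" "\<forall>x\<in>W. g x = 1"
    using smooth_urysohn[OF K(2) open_U K(3)] by blast
  then have g: "g \<in> test_functions U" "\<And>x. 0 \<le> g x" "K \<subseteq> W" "\<And>x. x \<in> W \<Longrightarrow> g x = 1" by auto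
  have tg: "(\<lambda>x. \<bar>B\<bar> * g x) \<in> test_functions U" by (intro test_functions_cmult g)
  have nn: "0 \<le> f x + \<bar>B\<bar> * g x" for x
  proof (cases "x \<in> K")
    case True
    then show ?thesis using B[OF True] g by (auto simp: subset_iff)
  qed (use K(4) g(2) in auto)
  have "T f + \<bar>B\<bar> * T g = T (\<lambda>x. f x + \<bar>B\<bar> * g x)"
    using T_add[OF f tg] T_cmult[OF g(1)] by simp
  also have "\<dots> = (\<integral>x. f x + \<bar>B\<bar> * g x \<partial>rep_measure)"
    by (rule T_eq_integral_nonneg[OF test_functions_add[OF f tg] nn])
  also have "\<dots> = (\<integral>x. f x \<partial>rep_measure) + \<bar>B\<bar> * (\<integral>x. g x \<partial>rep_measure)"
    using integrable_rep[OF f] integrable_rep[OF g(1)] by simp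
  also have "(\<integral>x. g x \<partial>rep_measure) = T g" by (rule T_eq_integral_nonneg[OF g(1,2), symmetric])
  finally show ?thesis by simp
qed

end

text \<open>Inner regularity is the point. It is available for finite measures, so \<open>U\<close>
  is exhausted by compact sets \<open>C n\<close>, the part of \<open>N\<close> in each of them is
  finite, and continuity from below puts the pieces together.\<close>

lemma radon_measure_on_restrict_space:
  fixes N :: "'a::euclidean_space measure"
  assumes U: "open U" and N: "sets N = sets borel"
    and fin: "\<And>K. compact K \<Longrightarrow> K \<subseteq> U \<Longrightarrow> emeasure N K < \<infinity>"
  shows "radon_measure_on U (restrict_space N U)"
proof -
  have Ub: "U \<in> sets borel" using U by simp
  have sp: "space N = UNIV" using sets_eq_imp_space_eq[OF N] by simp
  have sub: "A \<subseteq> U" "A \<in> sets borel" if "A \<in> sets (restrict_space N U)" for A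
    using that N Ub sp by (auto simp: sets_restrict_space)
  have em: "emeasure (restrict_space N U) A = emeasure N A" if "A \<subseteq> U" for A
    using that Ub N sp by (intro emeasure_restrict_space) auto
  have inner: "emeasure N A = (SUP K\<in>{K. compact K \<and> K \<subseteq> A}. emeasure N K)"
    if A: "A \<subseteq> U" "A \<in> sets borel" for A
  proof (rule antisym)
    obtain C :: "nat \<Rightarrow> 'a set" where C: "\<And>n. compact (C n)" "\<And>n. C n \<subseteq> U" "\<And>n. C n \<subseteq> interior (C (Suc n))"
      "\<Union>(range C) = U"
      using open_Union_compact_subsets[OF U] by metis
    have Cb: "C n \<in> sets borel" for n using C(1) by (rule borel_compact)
    have inc: "incseq (\<lambda>n. A \<inter> C n)"
      using C(3) interior_subset by (intro incseq_SucI) blast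
    have "emeasure N A = emeasure N (\<Union>n. A \<inter> C n)"
      using A C(4) by (metis Int_UN_distrib Int_absorb2)
    also have "\<dots> = (SUP n. emeasure N (A \<inter> C n))"
      using A Cb N inc by (intro SUP_emeasure_incseq[symmetric]) auto
    also have "\<dots> \<le> (SUP K\<in>{K. compact K \<and> K \<subseteq> A}. emeasure N K)"
    proof (rule SUP_least)
      fix n
      let ?M = "density N (indicator (C n))"
      have eM: "emeasure ?M B = emeasure N (B \<inter> C n)" if "B \<in> sets borel" for B
        using that Cb[of n] N by (subst emeasure_restricted) (auto simp: Int_commute)
      have "emeasure N (A \<inter> C n) = emeasure ?M A" using A eM by simp
      also have "\<dots> = (SUP K\<in>{K. K \<subseteq> A \<and> compact K}. emeasure ?M K)"
        using N fin[OF C(1,2)[of n]] eM[of UNIV] A(2) sp by (intro inner_regular) auto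
      also have "\<dots> \<le> (SUP K\<in>{K. compact K \<and> K \<subseteq> A}. emeasure N K)"
      proof (rule SUP_least)
        fix K assume "K \<in> {K. K \<subseteq> A \<and> compact K}"
        then have K: "K \<subseteq> A" "compact K" by auto
        then have "emeasure ?M K = emeasure N (K \<inter> C n)" by (intro eM borel_compact)
        also have "\<dots> \<le> (SUP K\<in>{K. compact K \<and> K \<subseteq> A}. emeasure N K)"
          using K C(1)[of n] by (intro SUP_upper) (auto intro: compact_Int)
        finally show "emeasure ?M K \<le> (SUP K\<in>{K. compact K \<and> K \<subseteq> A}. emeasure N K)" .
      qed
      finally show "emeasure N (A \<inter> C n) \<le> (SUP K\<in>{K. compact K \<and> K \<subseteq> A}. emeasure N K)" .
    qed
    finally show "emeasure N A \<le> (SUP K\<in>{K. compact K \<and> K \<subseteq> A}. emeasure N K)" .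
    show "(SUP K\<in>{K. compact K \<and> K \<subseteq> A}. emeasure N K) \<le> emeasure N A"
      using A N by (intro SUP_least emeasure_mono) auto
  qed
  show ?thesis
    unfolding radon_measure_on_def
  proof (intro conjI allI impI ballI)
    show "sets (restrict_space N U) = sets (restrict_space borel U)"
      by (rule sets_restrict_space_cong[OF N])
    show "emeasure (restrict_space N U) K < \<infinity>" if "compact K \<and> K \<subseteq> U" for K
      using that fin em by simp
    show "emeasure (restrict_space N U) A = (SUP K\<in>{K. compact K \<and> K \<subseteq> A}. emeasure (restrict_space N U) K)"
      if "A \<in> sets (restrict_space N U)" for A
      using sub[OF that] em[of A] inner[of A] em by (auto intro!: SUP_cong)
  qed
qed

text \<open>The mass at \<open>p\<close> is deleted by the density \<open>indicator (- {p})\<close>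
  and comes back as the coefficient \<open>a\<close>; it is finite because the singleton is a
  compact subset of \<open>U\<close>.\<close>

theorem (in nonneg_functional) representation_with_atom:
  assumes p: "p \<in> U"
  shows "\<exists>a \<mu>. a \<ge> 0 \<and> radon_measure_on U \<mu> \<and> emeasure \<mu> {p} = 0 \<and>
    (\<forall>f\<in>test_functions U. T f = (\<integral>x. f x \<partial>\<mu>) + a * f p)"
proof -
  define N where "N = density rep_measure (indicator (- {p}))"
  define a where "a = measure rep_measure {p}"
  have Ub: "U \<in> sets borel" using open_U by simp
  have sN: "sets N = sets borel" by (simp add: N_def)
  have eN: "emeasure N A = emeasure rep_measure (A - {p})" if "A \<in> sets borel" for A
    using that unfolding N_def by (subst emeasure_restricted) (auto simp: Diff_eq Int_commute)
  have "emeasure N K < \<infinity>" if K: "compact K" "K \<subseteq> U" for K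
  proof -
    have "emeasure N K \<le> emeasure rep_measure K"
      using borel_compact[OF K(1)] by (subst eN) (auto intro!: emeasure_mono)
    also have "\<dots> < \<infinity>" by (rule emeasure_rep_compact[OF K])
    finally show ?thesis .
  qed
  then have radon: "radon_measure_on U (restrict_space N U)"
    by (rule radon_measure_on_restrict_space[OF open_U sN])
  have "emeasure (restrict_space N U) {p} = emeasure N {p}"
    using Ub sN p sets_eq_imp_space_eq[OF sN] by (intro emeasure_restrict_space) auto
  then have atom: "emeasure (restrict_space N U) {p} = 0" by (simp add: eN)
  have "T f = (\<integral>x. f x \<partial>restrict_space N U) + a * f p" if f: "f \<in> test_functions U" for f
  proof -
    have [measurable]: "f \<in> borel_measurable borel"
      using smooth_fun_continuous test_functionsD(1)[OF f] by (blast intro: borel_measurable_continuous_onI)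
    have fin: "emeasure rep_measure {p} < \<infinity>" using p by (intro emeasure_rep_compact) auto
    have "(\<integral>x. f x \<partial>restrict_space N U) = (\<integral>x. indicator U x *\<^sub>R f x \<partial>N)"
      using Ub sN sets_eq_imp_space_eq[OF sN] by (intro integral_restrict_space) auto
    also have "\<dots> = (\<integral>x. f x \<partial>N)"
      using test_functions_eq_0[OF f] by (intro Bochner_Integration.integral_cong) (auto simp: indicator_def)
    also have "\<dots> = (\<integral>x. indicator (- {p}) x *\<^sub>R f x \<partial>rep_measure)"
      unfolding N_def using integral_density[of f rep_measure "indicator (- {p})"]
      by (simp add: ennreal_indicator)
    finally have 1: "(\<integral>x. f x \<partial>restrict_space N U) = (\<integral>x. indicator (- {p}) x *\<^sub>R f x \<partial>rep_measure)" .
    have ip: "integrable rep_measure (\<lambda>x. indicator {p} x *\<^sub>R f p)"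
      using fin by (intro integrable_scaleR_left) (simp add: integrable_indicator_iff)
    have ic: "integrable rep_measure (\<lambda>x. indicator (- {p}) x *\<^sub>R f x)"
      by (intro integrable_mult_indicator integrable_rep[OF f]) auto
    have "T f = (\<integral>x. f x \<partial>rep_measure)" by (rule T_eq_integral[OF f])
    also have "\<dots> = (\<integral>x. indicator (- {p}) x *\<^sub>R f x + indicator {p} x *\<^sub>R f p \<partial>rep_measure)"
      by (intro Bochner_Integration.integral_cong) (auto simp: indicator_def)
    also have "\<dots> = (\<integral>x. f x \<partial>restrict_space N U) + (\<integral>x. indicator {p} x *\<^sub>R f p \<partial>rep_measure)"
      unfolding 1 by (rule Bochner_Integration.integral_add[OF ic ip])
    also have "(\<integral>x. indicator {p} x *\<^sub>R f p \<partial>rep_measure) = a * f p"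
      by (simp add: a_def)
    finally show ?thesis .
  qed
  then show ?thesis
    using radon atom by (intro exI[of _ a] exI[of _ "restrict_space N U"]) (simp add: a_def)
qed

section \<open>Gaussians and the fractional kernel\<close>

lemma has_bochner_integral_lborel_shift:
  fixes f :: "'a::euclidean_space \<Rightarrow> real"
  assumes "has_bochner_integral lborel f I"
  shows "has_bochner_integral lborel (\<lambda>z. f (c + z)) I"
proof -
  have f: "f \<in> borel_measurable borel" using assms by (auto dest: borel_measurable_has_bochner_integral)
  have m: "(+) c \<in> measurable lborel borel" by simp
  show ?thesis
    using assms integrable_distr_eq[OF m f] integral_distr[OF m f]
    unfolding lborel_distr_plus has_bochner_integral_iff by simp
qed

lemma has_bochner_integral_lborel_uminus:
  fixes f :: "'a::euclidean_space \<Rightarrow> real"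
  assumes "has_bochner_integral lborel f I"
  shows "has_bochner_integral lborel (\<lambda>z. f (- z)) I"
proof -
  have f: "f \<in> borel_measurable borel" using assms by (auto dest: borel_measurable_has_bochner_integral)
  have m: "uminus \<in> measurable lborel (borel :: 'a measure)" by simp
  have d: "distr lborel borel uminus = (lborel :: 'a measure)"
    using lborel_affine[of "-1" "0::'a"] by (simp add: density_1)
  show ?thesis
    using assms integrable_distr_eq[OF m f] integral_distr[OF m f]
    unfolding d has_bochner_integral_iff by simp
qed

text \<open>The exact maximum, attained at v = p, is smaller by the factor exp(-p). The cruder value
  follows from \<open>v / p \<le> exp (v / p)\<close> alone.\<close>

lemma powr_mult_exp_minus_le:
  fixes p v :: real
  assumes "p > 0" "v \<ge> 0"
  shows "v powr p * exp (- v) \<le> p powr p"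
proof (cases "v = 0")
  case False
  have "v / p \<le> exp (v / p)" using exp_ge_add_one_self[of "v / p"] by linarith
  then have "v \<le> p * exp (v / p)" using assms by (simp add: field_simps)
  then have "v powr p \<le> (p * exp (v / p)) powr p" using assms by (intro powr_mono2) auto
  also have "\<dots> = p powr p * exp v" using assms by (simp add: powr_mult exp_powr_real)
  finally show ?thesis by (simp add: exp_minus field_simps)
qed (use assms in auto)

text \<open>The heat kernel of the semigroup generated by \<Delta> and not by \<Delta>/2: each
  coordinate is normal with variance 2t.\<close>

definition gauss :: "real \<Rightarrow> 'a::euclidean_space \<Rightarrow> real" where
  "gauss t x = (4 * pi * t) powr (- (real DIM('a) / 2)) * exp (- ((norm x)\<^sup>2 / (4 * t)))"

lemma gauss_nonneg [simp]: "gauss t x \<ge> 0"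
  by (simp add: gauss_def)

lemma gauss_minus [simp]: "gauss t (- x) = gauss t x"
  by (simp add: gauss_def)

lemma gauss_measurable [measurable (raw)]:
  assumes [measurable]: "f \<in> borel_measurable M" "g \<in> borel_measurable M"
  shows "(\<lambda>p. gauss (f p) (g p)) \<in> borel_measurable M"
  unfolding gauss_def by measurable

lemma gauss_eq_prod:
  assumes t: "t > 0"
  shows "gauss t x = (\<Prod>b\<in>Basis. normal_density 0 (sqrt (2 * t)) (x \<bullet> b))"
proof -
  have "(\<Prod>b\<in>Basis. normal_density 0 (sqrt (2 * t)) (x \<bullet> b)) =
      (1 / sqrt (4 * pi * t)) ^ DIM('a) * exp (\<Sum>b\<in>Basis. - ((x \<bullet> b)\<^sup>2 / (4 * t)))"
  proof -
    have "normal_density 0 (sqrt (2 * t)) y = (1 / sqrt (4 * pi * t)) * exp (- (y\<^sup>2 / (4 * t)))" for y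
    proof -
      have "2 * pi * (sqrt (2 * t))\<^sup>2 = 4 * pi * t" "2 * (sqrt (2 * t))\<^sup>2 = 4 * t" using t by simp_all
      then show ?thesis unfolding normal_density_def by simp
    qed
    then show ?thesis by (simp only: prod.distrib prod_constant exp_sum[OF finite_Basis])
  qed
  also have "(\<Sum>b\<in>Basis. - ((x \<bullet> b)\<^sup>2 / (4 * t))) = - ((norm x)\<^sup>2 / (4 * t))"
    unfolding power2_norm_eq_inner euclidean_inner[of x x]
    by (simp add: sum_negf sum_divide_distrib power2_eq_square)
  also have "(1 / sqrt (4 * pi * t)) ^ DIM('a) = (4 * pi * t) powr (- (real DIM('a) / 2))"
  proof -
    have "1 / sqrt (4 * pi * t) = (4 * pi * t) powr (- (1 / 2))"
      using t by (simp add: powr_minus powr_half_sqrt inverse_eq_divide)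
    then have "(1 / sqrt (4 * pi * t)) ^ DIM('a) = ((4 * pi * t) powr (- (1 / 2))) powr real DIM('a)"
      using t by (simp add: powr_realpow)
    then show ?thesis by (simp add: powr_powr)
  qed
  finally show ?thesis by (simp add: gauss_def)
qed

lemma has_bochner_integral_gauss:
  assumes t: "t > 0"
  shows "has_bochner_integral lborel (gauss t :: 'a::euclidean_space \<Rightarrow> real) 1"
proof (rule has_bochner_integral_nn_integral)
  have "(\<integral>\<^sup>+x. ennreal (gauss t (x::'a)) \<partial>lborel) =
      (\<integral>\<^sup>+x. (\<Prod>b\<in>Basis. ennreal (normal_density 0 (sqrt (2 * t)) ((x::'a) \<bullet> b))) \<partial>lborel)"
    using t by (simp add: gauss_eq_prod prod_ennreal)
  also have "\<dots> = (\<Prod>b\<in>(Basis::'a set). (\<integral>\<^sup>+y. ennreal (normal_density 0 (sqrt (2 * t)) y) \<partial>lborel))"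
    by (rule nn_integral_lborel_prod) auto
  also have "(\<integral>\<^sup>+y. ennreal (normal_density 0 (sqrt (2 * t)) y) \<partial>lborel) = 1"
    using t by (subst nn_integral_eq_integral) auto
  finally show "(\<integral>\<^sup>+x. ennreal (gauss t (x::'a)) \<partial>lborel) = ennreal 1" by simp
qed auto

text \<open>Growth in x is paid for by doubling the time. With v = |x|^2/(4t) one has v exp(-v)
  \<le> exp(-v/2), the profile of \<open>gauss (2 * t)\<close>; the power of 2 corrects the
  normalisation. This takes the place of moment computations.\<close>

lemma norm_sq_gauss_le:
  fixes x :: "'a::euclidean_space"
  assumes t: "t > 0"
  shows "(norm x)\<^sup>2 * gauss t x \<le> 4 * 2 powr (real DIM('a) / 2) * t * gauss (2 * t) x"
proof -
  define v where "v = (norm x)\<^sup>2 / (4 * t)"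
  have v: "v \<ge> 0" using t by (simp add: v_def)
  \<comment> \<open>From (1 + v/4)^2 - v = (1 - v/4)^2 \<ge> 0 and 1 + v/4 \<le> exp(v/4).\<close>
  have "v \<le> exp (v / 2)"
  proof -
    have "(1 + v / 4)\<^sup>2 \<le> (exp (v / 4))\<^sup>2"
      using v by (intro power_mono exp_ge_add_one_self) auto
    also have "\<dots> = exp (v / 2)" by (simp add: exp_double[symmetric])
    finally have "(1 + v / 4)\<^sup>2 \<le> exp (v / 2)" .
    moreover have "v \<le> (1 + v / 4)\<^sup>2" using zero_le_power2[of "1 - v / 4"]
      unfolding power2_eq_square by (simp add: algebra_simps)
    ultimately show ?thesis by linarith
  qed
  then have "v * exp (- v) \<le> exp (v / 2) * exp (- v)" by (intro mult_right_mono) auto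
  also have "\<dots> = exp (- (v / 2))" by (simp add: exp_add[symmetric])
  finally have e: "v * exp (- v) \<le> exp (- (v / 2))" .
  have "(norm x)\<^sup>2 * gauss t x = 4 * t * (4 * pi * t) powr (- (real DIM('a) / 2)) * (v * exp (- v))"
    using t by (simp add: gauss_def v_def)
  also have "\<dots> \<le> 4 * t * (4 * pi * t) powr (- (real DIM('a) / 2)) * exp (- (v / 2))"
    using t e by (intro mult_left_mono) auto
  also have "\<dots> = 4 * 2 powr (real DIM('a) / 2) * t * gauss (2 * t) x"
  proof -
    have "(4 * pi * (2 * t)) powr (- (real DIM('a) / 2)) =
        (4 * pi * t) powr (- (real DIM('a) / 2)) * 2 powr (- (real DIM('a) / 2))"
      using t powr_mult[of "4 * pi * t" 2 "- (real DIM('a) / 2)"] by (simp add: mult_ac)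
    then have "2 powr (real DIM('a) / 2) * (4 * pi * (2 * t)) powr (- (real DIM('a) / 2)) =
        (4 * pi * t) powr (- (real DIM('a) / 2))"
      by (simp add: powr_minus field_simps)
    then show ?thesis using t by (simp add: gauss_def v_def)
  qed
  finally show ?thesis .
qed

text \<open>The integrand is odd. Integrability has to come first, and follows from |x| \<le> 1 +
  |x|^2 together with the doubling of time.\<close>

lemma has_bochner_integral_inner_gauss:
  fixes g :: "'a::euclidean_space"
  assumes t: "t > 0"
  shows "has_bochner_integral lborel (\<lambda>x. (x \<bullet> g) * gauss t x) 0"
proof -
  have ig: "integrable lborel (gauss r :: 'a \<Rightarrow> real)" if "r > 0" for r
    using has_bochner_integral_gauss[OF that] by (rule integrable.intros)
  have "integrable lborel (\<lambda>x. norm g * (gauss t x + 4 * 2 powr (real DIM('a) / 2) * t * gauss (2 * t) (x::'a)))"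
    using t by (intro integrable_mult_right Bochner_Integration.integrable_add ig) auto
  then have "integrable lborel (\<lambda>x. (x \<bullet> g) * gauss t x)"
  proof (rule Bochner_Integration.integrable_bound)
    show "AE x in lborel. norm ((x \<bullet> g) * gauss t x) \<le>
        norm (norm g * (gauss t x + 4 * 2 powr (real DIM('a) / 2) * t * gauss (2 * t) (x::'a)))"
    proof (rule AE_I2)
      fix x :: 'a
      have "norm x \<le> 1 + (norm x)\<^sup>2"
        using zero_le_power2[of "norm x - 1/2"] unfolding power2_eq_square by (simp add: algebra_simps)
      then have "norm x * gauss t x \<le> (1 + (norm x)\<^sup>2) * gauss t x" by (intro mult_right_mono) auto
      also have "\<dots> \<le> gauss t x + 4 * 2 powr (real DIM('a) / 2) * t * gauss (2 * t) x"
        using norm_sq_gauss_le[OF t, of x] by (simp add: algebra_simps)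
      finally have "norm g * (norm x * gauss t x) \<le> norm g * (gauss t x + 4 * 2 powr (real DIM('a) / 2) * t * gauss (2 * t) x)"
        by (intro mult_left_mono) auto
      moreover have "\<bar>x \<bullet> g\<bar> * gauss t x \<le> norm x * norm g * gauss t x"
        by (intro mult_right_mono Cauchy_Schwarz_ineq2) auto
      ultimately show "norm ((x \<bullet> g) * gauss t x) \<le>
        norm (norm g * (gauss t x + 4 * 2 powr (real DIM('a) / 2) * t * gauss (2 * t) x))"
        using t by (simp add: abs_mult mult_ac)
    qed
  qed auto
  then have "has_bochner_integral lborel (\<lambda>x. (x \<bullet> g) * gauss t x) (\<integral>x. (x \<bullet> g) * gauss t x \<partial>lborel)"
    by (rule has_bochner_integral_integrable)
  moreover from has_bochner_integral_lborel_uminus[OF this]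
  have "has_bochner_integral lborel (\<lambda>x. - ((x \<bullet> g) * gauss t x)) (\<integral>x. (x \<bullet> g) * gauss t x \<partial>lborel)"
    by simp
  then have "(\<integral>x. - ((x \<bullet> g) * gauss t x) \<partial>lborel) = (\<integral>x. (x \<bullet> g) * gauss t x \<partial>lborel)"
    by (rule has_bochner_integral_integral_eq)
  then have "(\<integral>x. (x \<bullet> g) * gauss t x \<partial>lborel) = 0" by simp
  ultimately show ?thesis by simp
qed

text \<open>Completing the square in \<open>z\<close>: as a function of \<open>z\<close> the product
  is a Gaussian of time t\<tau>/(t+\<tau>) centred at -(t/(t+\<tau>)) x, and the factor left over is
  the kernel of time t+\<tau>. The semigroup law and the mean of \<open>z\<close> can both be read
  off.\<close>

lemma gauss_mult_gauss:
  fixes x z :: "'a::euclidean_space"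
  assumes t: "t > 0" and \<tau>: "\<tau> > 0"
  shows "gauss t z * gauss \<tau> (x + z) =
    gauss (t + \<tau>) x * gauss (t * \<tau> / (t + \<tau>)) ((t / (t + \<tau>)) *\<^sub>R x + z)"
proof -
  let ?p = "- (real DIM('a) / 2)"
  have s: "t + \<tau> > 0" using t \<tau> by simp
  have 1: "(4 * pi * t) powr ?p * (4 * pi * \<tau>) powr ?p =
      (4 * pi * (t + \<tau>)) powr ?p * (4 * pi * (t * \<tau> / (t + \<tau>))) powr ?p"
  proof -
    have "(4 * pi * t) * (4 * pi * \<tau>) = (4 * pi * (t + \<tau>)) * (4 * pi * (t * \<tau> / (t + \<tau>)))"
      using s by (simp add: divide_simps)
    then show ?thesis using t \<tau> s
      powr_mult[of "4 * pi * t" "4 * pi * \<tau>" ?p]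
      powr_mult[of "4 * pi * (t + \<tau>)" "4 * pi * (t * \<tau> / (t + \<tau>))" ?p] by metis
  qed
  have "(norm z)\<^sup>2 / (4 * t) + (norm (x + z))\<^sup>2 / (4 * \<tau>) =
      (norm x)\<^sup>2 / (4 * (t + \<tau>)) + (norm ((t / (t + \<tau>)) *\<^sub>R x + z))\<^sup>2 / (4 * (t * \<tau> / (t + \<tau>)))"
  proof -
    define X where "X = x \<bullet> x" define Y where "Y = x \<bullet> z" define Z where "Z = z \<bullet> z"
    have "(norm (x + z))\<^sup>2 = X + 2 * Y + Z"
      by (simp add: power2_norm_eq_inner inner_add_left inner_add_right X_def Y_def Z_def inner_commute)
    moreover have "(norm ((t / (t + \<tau>)) *\<^sub>R x + z))\<^sup>2 = (t / (t + \<tau>))\<^sup>2 * X + 2 * (t / (t + \<tau>)) * Y + Z"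
      by (simp add: power2_norm_eq_inner inner_add_left inner_add_right X_def Y_def Z_def inner_commute
          power2_eq_square[of "t / (t + \<tau>)"])
    moreover have "(norm x)\<^sup>2 = X" "(norm z)\<^sup>2 = Z" by (simp_all add: power2_norm_eq_inner X_def Z_def)
    moreover have "Z / (4 * t) + (X + 2 * Y + Z) / (4 * \<tau>) =
      X / (4 * (t + \<tau>)) + ((t / (t + \<tau>))\<^sup>2 * X + 2 * (t / (t + \<tau>)) * Y + Z) / (4 * (t * \<tau> / (t + \<tau>)))"
    proof -
      have "((t / (t + \<tau>))\<^sup>2 * X + 2 * (t / (t + \<tau>)) * Y + Z) / (4 * (t * \<tau> / (t + \<tau>))) =
        t * X / (4 * \<tau> * (t + \<tau>)) + Y / (2 * \<tau>) + Z * (t + \<tau>) / (4 * t * \<tau>)"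
        using t \<tau> s by (simp add: divide_simps power2_eq_square) (simp add: algebra_simps)
      moreover have "X / (4 * (t + \<tau>)) + t * X / (4 * \<tau> * (t + \<tau>)) = X / (4 * \<tau>)"
        using t \<tau> s by (simp add: divide_simps) (simp add: algebra_simps)
      moreover have "Z * (t + \<tau>) / (4 * t * \<tau>) = Z / (4 * t) + Z / (4 * \<tau>)"
        using t \<tau> s by (simp add: divide_simps) (simp add: algebra_simps)
      moreover have "(X + 2 * Y + Z) / (4 * \<tau>) = X / (4 * \<tau>) + Y / (2 * \<tau>) + Z / (4 * \<tau>)"
        using \<tau> by (simp add: divide_simps)
      ultimately show ?thesis by linarith
    qed
    ultimately show ?thesis by simp
  qed
  then have "exp (- ((norm z)\<^sup>2 / (4 * t))) * exp (- ((norm (x + z))\<^sup>2 / (4 * \<tau>))) =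
      exp (- ((norm x)\<^sup>2 / (4 * (t + \<tau>)))) * exp (- ((norm ((t / (t + \<tau>)) *\<^sub>R x + z))\<^sup>2 / (4 * (t * \<tau> / (t + \<tau>)))))"
    by (simp add: exp_add[symmetric])
  with 1 show ?thesis unfolding gauss_def by (simp add: mult_ac)
qed

text \<open>Under the normalised product of the two Gaussians, x + z has mean (\<tau>/(t+\<tau>)) x.
  The affine factor therefore survives the heat flow with its slope damped by \<tau>/(t+\<tau>), and
  this damping is the whole effect of the tilt later on.\<close>

lemma has_bochner_integral_affine_gauss_conv:
  fixes x g :: "'a::euclidean_space"
  assumes t: "t > 0" and \<tau>: "\<tau> > 0"
  shows "has_bochner_integral lborel (\<lambda>z. ((1 + (x + z) \<bullet> g) * gauss \<tau> (x + z)) * gauss t z)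
    ((1 + \<tau> / (t + \<tau>) * (x \<bullet> g)) * gauss (t + \<tau>) x)"
proof -
  define r where "r = t * \<tau> / (t + \<tau>)"
  define a where "a = 1 + \<tau> / (t + \<tau>) * (x \<bullet> g)"
  have r: "r > 0" using t \<tau> by (simp add: r_def)
  have "has_bochner_integral lborel (\<lambda>y. a * gauss r y + (y \<bullet> g) * gauss r y) (a * 1 + 0)"
    by (intro has_bochner_integral_add has_bochner_integral_mult_right
        has_bochner_integral_gauss has_bochner_integral_inner_gauss r)
  then have "has_bochner_integral lborel
      (\<lambda>z. gauss (t + \<tau>) x * (a * gauss r ((t / (t + \<tau>)) *\<^sub>R x + z)
        + (((t / (t + \<tau>)) *\<^sub>R x + z) \<bullet> g) * gauss r ((t / (t + \<tau>)) *\<^sub>R x + z))) (gauss (t + \<tau>) x * a)"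
    by (intro has_bochner_integral_mult_right has_bochner_integral_lborel_shift) simp
  moreover have "gauss (t + \<tau>) x * (a * gauss r ((t / (t + \<tau>)) *\<^sub>R x + z)
        + (((t / (t + \<tau>)) *\<^sub>R x + z) \<bullet> g) * gauss r ((t / (t + \<tau>)) *\<^sub>R x + z))
      = ((1 + (x + z) \<bullet> g) * gauss \<tau> (x + z)) * gauss t z" for z
  proof -
    have "a + ((t / (t + \<tau>)) *\<^sub>R x + z) \<bullet> g = 1 + (x + z) \<bullet> g"
    proof -
      have "\<tau> / (t + \<tau>) + t / (t + \<tau>) = 1" using t \<tau> by (simp add: add_divide_distrib[symmetric])
      then have "\<tau> / (t + \<tau>) * (x \<bullet> g) + t / (t + \<tau>) * (x \<bullet> g) = x \<bullet> g"
        by (metis distrib_right mult_1_left)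
      then show ?thesis by (simp add: a_def inner_add_left)
    qed
    then show ?thesis
      using gauss_mult_gauss[OF t \<tau>, of z x] unfolding r_def[symmetric]
      by (metis (no_types, opaque_lifting) distrib_right mult.assoc mult.commute)
  qed
  ultimately show ?thesis by (simp add: a_def mult.commute)
qed

section \<open>Subordination: the fractional kernel as a mixture of Gaussians\<close>

definition kern :: "real \<Rightarrow> 'a::euclidean_space \<Rightarrow> real" where
  "kern s z = 1 / norm z powr (real DIM('a) + 2 * s)"

text \<open>The Levy density of the stable subordinator of index s without its constant, continued
  by 0 to nonpositive times so that time integrals run over the whole line.\<close>

definition stable_weight :: "real \<Rightarrow> real \<Rightarrow> real" where
  "stable_weight s t = indicator {0<..} t * t powr (- 1 - s)"

lemma kern_nonneg [simp]: "kern s z \<ge> 0"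
  by (simp add: kern_def)

lemma kern_minus [simp]: "kern s (- z) = kern s z"
  by (simp add: kern_def)

lemma kern_measurable [measurable]: "kern s \<in> borel_measurable borel"
  unfolding kern_def[abs_def] by measurable

lemma stable_weight_nonneg [simp]: "stable_weight s t \<ge> 0"
  by (simp add: stable_weight_def)

lemma stable_weight_measurable [measurable]: "stable_weight s \<in> borel_measurable borel"
  unfolding stable_weight_def[abs_def] by measurable

lemma nn_integral_powr_from_0:
  assumes "a > -1" "c \<ge> 0"
  shows "(\<integral>\<^sup>+x. ennreal (x powr a) * indicator {0..c} x \<partial>lborel) = ennreal (c powr (a+1) / (a+1))"
  by (rule nn_integral_has_integral_lebesgue'[OF _ has_integral_powr_from_0[OF assms]]) simp

lemma nn_integral_powr_to_inf:
  fixes a c :: real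
  assumes "a < -1" "c > 0"
  shows "(\<integral>\<^sup>+x. ennreal (x powr a) * indicator {c..} x \<partial>lborel) = ennreal (- (c powr (a+1)) / (a+1))"
  by (rule nn_integral_has_integral_lebesgue'[OF _ has_integral_powr_to_inf[OF assms]]) simp

text \<open>The subordination integrand at |z| = 1, to which the scaling t = |z|^2 r reduces every
  other nonzero z.\<close>

definition mix_density :: "nat \<Rightarrow> real \<Rightarrow> real \<Rightarrow> real" where
  "mix_density n s r = stable_weight s r * (4 * pi * r) powr (- (real n / 2)) * exp (- (1 / (4 * r)))"

definition mix_const :: "nat \<Rightarrow> real \<Rightarrow> real" where
  "mix_const n s = enn2real (\<integral>\<^sup>+r. ennreal (mix_density n s r) \<partial>lborel)"

lemma mix_density_measurable [measurable]: "mix_density n s \<in> borel_measurable borel"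
  unfolding mix_density_def[abs_def] by measurable

lemma nn_integral_mix_density_finite:
  assumes s: "s > 0"
  shows "(\<integral>\<^sup>+r. ennreal (mix_density n s r) \<partial>lborel) < \<infinity>"
proof -
  \<comment> \<open>The total negative power of r in the density. The exponential tames it on (0,
    1]; on [1, \<infinity>) the tail r^(-1-s) is integrable since s > 0.\<close>
  define q where "q = 1 + s + real n / 2"
  have q: "q > 0" using s by (simp add: q_def add_pos_nonneg)
  have bound: "mix_density n s r \<le> (4 * q) powr q * indicator {0..1} r + r powr (- 1 - s) * indicator {1..} r" for r
  proof -
    consider "r \<le> 0" | "0 < r" "r < 1" | "r \<ge> 1" by linarith
    then show ?thesis
    proof cases
      case 1
      then show ?thesis by (auto simp: mix_density_def stable_weight_def indicator_def)
    next
      case 2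
      have "mix_density n s r = (4 * pi) powr (- (real n / 2)) * (r powr (- q) * exp (- (1 / (4 * r))))"
        using 2 by (simp add: mix_density_def stable_weight_def powr_mult q_def powr_add[symmetric]
            mult_ac algebra_simps)
      also have "r powr (- q) * exp (- (1 / (4 * r))) = 4 powr q * ((1 / (4 * r)) powr q * exp (- (1 / (4 * r))))"
        using 2 by (simp add: powr_divide powr_mult powr_minus field_simps)
      also have "\<dots> \<le> 4 powr q * q powr q"
        using 2 q by (intro mult_left_mono powr_mult_exp_minus_le) auto
      also have "\<dots> = (4 * q) powr q" using q by (simp add: powr_mult)
      also have "(4 * pi) powr (- (real n / 2)) * (4 * q) powr q \<le> 1 * (4 * q) powr q"
      proof (intro mult_right_mono)
        have "1 \<le> 4 * pi" using pi_ge_two by linarith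
        then have "1 \<le> (4 * pi) powr (real n / 2)" by (intro ge_one_powr_ge_zero) auto
        then show "(4 * pi) powr (- (real n / 2)) \<le> 1" by (simp add: powr_minus inverse_le_1_iff)
      qed auto
      finally show ?thesis using 2 by (simp add: mult_left_mono)
    next
      case 3
      have "1 \<le> 4 * pi * r" using pi_ge_two 3 mult_mono[of 1 "4 * pi" 1 r] by simp
      then have "1 \<le> (4 * pi * r) powr (real n / 2)" by (intro ge_one_powr_ge_zero) auto
      then have a: "(4 * pi * r) powr (- (real n / 2)) \<le> 1" by (simp add: powr_minus inverse_le_1_iff)
      have "mix_density n s r \<le> r powr (- 1 - s) * 1 * 1"
        unfolding mix_density_def stable_weight_def using 3 a by (intro mult_mono) auto
      moreover have "0 \<le> (4 * q) powr q * indicator {0..1} r" by simp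
      moreover have "r powr (- 1 - s) * indicator {1..} r = r powr (- 1 - s)" using 3 by simp
      ultimately show ?thesis by linarith
    qed
  qed
  have "(\<integral>\<^sup>+r. ennreal (mix_density n s r) \<partial>lborel) \<le>
      (\<integral>\<^sup>+r. ennreal ((4 * q) powr q) * indicator {0..1} r + ennreal (r powr (- 1 - s)) * indicator {1..} r \<partial>lborel)"
  proof (rule nn_integral_mono)
    fix r :: real
    have "ennreal (mix_density n s r) \<le> ennreal ((4 * q) powr q * indicator {0..1} r + r powr (- 1 - s) * indicator {1..} r)"
      by (rule ennreal_leI[OF bound])
    also have "\<dots> = ennreal ((4 * q) powr q) * indicator {0..1} r + ennreal (r powr (- 1 - s)) * indicator {1..} r"
      by (simp add: ennreal_plus ennreal_mult ennreal_indicator)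
    finally show "ennreal (mix_density n s r) \<le> \<dots>" .
  qed
  also have "\<dots> = ennreal ((4 * q) powr q) * emeasure lborel {0..1::real}
      + (\<integral>\<^sup>+r. ennreal (r powr (- 1 - s)) * indicator {1..} r \<partial>lborel)"
    by (subst nn_integral_add) (auto simp: nn_integral_cmult_indicator)
  also have "\<dots> < \<infinity>"
    using s by (subst nn_integral_powr_to_inf) (auto simp: ennreal_mult_less_top)
  finally show ?thesis .
qed

lemma nn_integral_mix_density:
  "s > 0 \<Longrightarrow> (\<integral>\<^sup>+r. ennreal (mix_density n s r) \<partial>lborel) = ennreal (mix_const n s)"
  using nn_integral_mix_density_finite[of s n] by (simp add: mix_const_def)

lemma mix_const_pos:
  assumes s: "s > 0"
  shows "mix_const n s > 0"
proof -
  define m where "m = 2 powr (- 1 - s) * (8 * pi) powr (- (real n / 2)) * exp (- (1 / 4))"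
  have m: "m > 0" by (simp add: m_def)
  have "ennreal m = (\<integral>\<^sup>+r. ennreal m * indicator {1..2::real} r \<partial>lborel)"
    by (simp add: nn_integral_cmult_indicator)
  also have "\<dots> \<le> (\<integral>\<^sup>+r. ennreal (mix_density n s r) \<partial>lborel)"
  proof (rule nn_integral_mono)
    fix r :: real
    have "m \<le> mix_density n s r" if r: "1 \<le> r" "r \<le> 2"
    proof -
      have "2 powr (- 1 - s) \<le> r powr (- 1 - s)" using r s by (intro powr_mono2') auto
      moreover have "(8 * pi) powr (- (real n / 2)) \<le> (4 * pi * r) powr (- (real n / 2))"
        using r by (intro powr_mono2') auto
      moreover have "exp (- (1 / 4)) \<le> exp (- (1 / (4 * r)))" using r by (simp add: divide_simps)
      ultimately show ?thesis
        unfolding m_def mix_density_def stable_weight_def using r by (intro mult_mono) auto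
    qed
    then show "ennreal m * indicator {1..2} r \<le> ennreal (mix_density n s r)"
      by (auto simp: indicator_def intro: ennreal_leI)
  qed
  also have "\<dots> = ennreal (mix_const n s)" by (rule nn_integral_mix_density[OF s])
  finally show ?thesis using m by (meson ennreal_le_iff2 less_le_trans not_le)
qed

text \<open>Substitute t = |z|^2 r: the powers of |z| coming from the weight, from the Gaussian
  normalisation and from dt combine to |z|^(-n-2s). The remaining integral \<open>mix_const\<close>
  enters the rest of the argument only through being finite and positive.\<close>

lemma nn_integral_stable_gauss:
  fixes z :: "'a::euclidean_space"
  assumes s: "s > 0" and z: "z \<noteq> 0"
  shows "(\<integral>\<^sup>+t. ennreal (stable_weight s t * gauss t z) \<partial>lborel) = ennreal (mix_const DIM('a) s * kern s z)"
proof -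
  define c where "c = (norm z)\<^sup>2"
  have c: "c > 0" using z by (simp add: c_def)
  have pt: "stable_weight s (0 + c * r) * gauss (0 + c * r) z =
      c powr (- 1 - s - real DIM('a) / 2) * mix_density DIM('a) s r" for r
  proof (cases "r > 0")
    case True
    have "(c * r) powr (- 1 - s) = c powr (- 1 - s) * r powr (- 1 - s)"
      using c True by (simp add: powr_mult)
    moreover have "(4 * pi * (c * r)) powr (- (real DIM('a) / 2)) =
        c powr (- (real DIM('a) / 2)) * (4 * pi * r) powr (- (real DIM('a) / 2))"
      using c True by (subst powr_mult[symmetric]) (auto simp: mult_ac)
    moreover have "c powr (- 1 - s - real DIM('a) / 2) = c powr (- 1 - s) * c powr (- (real DIM('a) / 2))"
      by (simp add: powr_add[symmetric])
    moreover have "(norm z)\<^sup>2 / (4 * (c * r)) = 1 / (4 * r)"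
      using c True by (simp add: c_def[symmetric])
    ultimately show ?thesis
      using c True by (simp add: stable_weight_def gauss_def mix_density_def mult_ac)
  next
    case False
    then have "\<not> c * r > 0" using c by (simp add: zero_less_mult_iff)
    then show ?thesis using False by (simp add: stable_weight_def mix_density_def)
  qed
  have "(\<integral>\<^sup>+t. ennreal (stable_weight s t * gauss t z) \<partial>lborel) =
      ennreal \<bar>c\<bar> * (\<integral>\<^sup>+r. ennreal (stable_weight s (0 + c * r) * gauss (0 + c * r) z) \<partial>lborel)"
    using c by (intro nn_integral_real_affine) auto
  also have "\<dots> = ennreal c * (\<integral>\<^sup>+r. ennreal (c powr (- 1 - s - real DIM('a) / 2)) * ennreal (mix_density DIM('a) s r) \<partial>lborel)"
    unfolding pt using c by (simp add: ennreal_mult' )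
  also have "\<dots> = ennreal c * (ennreal (c powr (- 1 - s - real DIM('a) / 2)) * ennreal (mix_const DIM('a) s))"
    by (subst nn_integral_cmult) (auto simp: nn_integral_mix_density[OF s])
  also have "\<dots> = ennreal (mix_const DIM('a) s * (c * c powr (- 1 - s - real DIM('a) / 2)))"
    using c mix_const_pos[OF s, of "DIM('a)"] by (simp add: ennreal_mult[symmetric] mult_ac)
  also have "c * c powr (- 1 - s - real DIM('a) / 2) = kern s z"
  proof -
    have c2: "c = norm z powr 2" using z by (simp add: c_def)
    have "c * c powr (- 1 - s - real DIM('a) / 2) = c powr (- s - real DIM('a) / 2)"
      using c powr_add[of c 1 "- 1 - s - real DIM('a) / 2"] by simp
    also have "\<dots> = norm z powr (- (real DIM('a) + 2 * s))"
      unfolding c2 powr_powr by (rule arg_cong[of _ _ "(powr) (norm z)"]) (simp add: algebra_simps)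
    finally show ?thesis unfolding kern_def powr_minus_divide .
  qed
  finally show ?thesis .
qed

text \<open>An effect of the conventions that 0 to any real power is 0 and that division by 0 gives
  0. The value at this null point influences no integral.\<close>

lemma kern_zero [simp]: "kern s 0 = 0"
  by (simp add: kern_def)

lemma kern_le_far:
  fixes z :: "'a::euclidean_space"
  assumes "0 < \<rho>" "\<rho> \<le> norm z" "0 < s"
  shows "kern s z \<le> 1 / \<rho> powr (real DIM('a) + 2 * s)"
proof -
  have "\<rho> powr (real DIM('a) + 2 * s) \<le> norm z powr (real DIM('a) + 2 * s)"
    using assms by (intro powr_mono2) auto
  moreover have "0 < \<rho> powr (real DIM('a) + 2 * s)" using assms by simp
  ultimately show ?thesis unfolding kern_def by (intro divide_left_mono mult_pos_pos) auto
qed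

text \<open>Off a neighbourhood of the origin the kernel is dominated by its integrable version, so
  one integrability lemma serves the far parts as well.\<close>

lemma kern_le_min_kern:
  fixes z :: "'a::euclidean_space"
  assumes \<rho>: "0 < \<rho>" "\<rho> \<le> norm z"
  shows "kern s z \<le> (1 + 1 / \<rho>\<^sup>2) * (min 1 ((norm z)\<^sup>2) * kern s z)"
proof -
  have "\<rho>\<^sup>2 \<le> (norm z)\<^sup>2" using \<rho> by (intro power_mono) auto
  then have "1 \<le> (norm z)\<^sup>2 / \<rho>\<^sup>2" using \<rho> by simp
  then have "1 \<le> (1 + 1 / \<rho>\<^sup>2) * min 1 ((norm z)\<^sup>2)"
    using \<rho> by (cases "(norm z)\<^sup>2 \<le> 1") (auto simp: algebra_simps min_def add_increasing)
  then have "1 * kern s z \<le> ((1 + 1 / \<rho>\<^sup>2) * min 1 ((norm z)\<^sup>2)) * kern s z"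
    by (intro mult_right_mono) auto
  then show ?thesis by (simp add: mult.assoc)
qed

text \<open>Tonelli; the mixture formula is used for z \<noteq> 0, hence almost everywhere.\<close>

lemma nn_integral_kern_mixture:
  fixes h :: "'a::euclidean_space \<Rightarrow> ennreal"
  assumes s: "s > 0" and [measurable]: "h \<in> borel_measurable borel"
  shows "(\<integral>\<^sup>+t. \<integral>\<^sup>+z. ennreal (stable_weight s t * gauss t z) * h z \<partial>lborel \<partial>lborel) =
    ennreal (mix_const DIM('a) s) * (\<integral>\<^sup>+z. ennreal (kern s z) * h z \<partial>lborel)"
proof -
  have "(\<integral>\<^sup>+t. \<integral>\<^sup>+z. ennreal (stable_weight s t * gauss t z) * h z \<partial>lborel \<partial>lborel) =
      (\<integral>\<^sup>+z. \<integral>\<^sup>+t. ennreal (stable_weight s t * gauss t z) * h z \<partial>lborel \<partial>lborel)"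
    by (rule lborel_pair.Fubini') measurable
  also have "\<dots> = (\<integral>\<^sup>+z. ennreal (mix_const DIM('a) s) * (ennreal (kern s z) * h z) \<partial>lborel)"
  proof (rule nn_integral_cong_AE)
    show "AE z in lborel. (\<integral>\<^sup>+t. ennreal (stable_weight s t * gauss t z) * h z \<partial>lborel) =
        ennreal (mix_const DIM('a) s) * (ennreal (kern s z) * h z)"
      using AE_lborel_singleton[of "0::'a"]
    proof eventually_elim
      case (elim z)
      have "(\<integral>\<^sup>+t. ennreal (stable_weight s t * gauss t z) * h z \<partial>lborel) =
          (\<integral>\<^sup>+t. ennreal (stable_weight s t * gauss t z) \<partial>lborel) * h z"
        by (rule nn_integral_multc) measurable
      also have "\<dots> = ennreal (mix_const DIM('a) s * kern s z) * h z"
        by (simp only: nn_integral_stable_gauss[OF s elim])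
      finally show ?case
        using mix_const_pos[OF s, of "DIM('a)"] by (simp only: ennreal_mult kern_nonneg less_imp_le mult.assoc)
    qed
  qed
  also have "\<dots> = ennreal (mix_const DIM('a) s) * (\<integral>\<^sup>+z. ennreal (kern s z) * h z \<partial>lborel)"
    by (rule nn_integral_cmult) measurable
  finally show ?thesis .
qed

text \<open>Integrability of the Levy measure without polar coordinates: by subordination one
  integrates t^(-1-s) against the Gaussian mean of min(1, |z|^2), which is at most C t for t \<le> 1
  and at most 1 beyond. The powers t^(-s) near 0 and t^(-1-s) at infinity are integrable because 0 <
  s < 1.\<close>

lemma integrable_min_kern:
  assumes s: "0 < s" "s < 1"
  shows "integrable lborel (\<lambda>z::'a::euclidean_space. min 1 ((norm z)\<^sup>2) * kern s z)"
proof (rule integrableI_bounded)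
  define C where "C = 4 * 2 powr (real DIM('a) / 2)"
  have C: "C > 0" by (simp add: C_def)
  have inner: "(\<integral>\<^sup>+z. ennreal (stable_weight s t * gauss t z) * ennreal (min 1 ((norm (z::'a))\<^sup>2)) \<partial>lborel) \<le>
      ennreal C * (ennreal (t powr (- s)) * indicator {0..1} t) + ennreal (t powr (- 1 - s)) * indicator {1..} t" for t
  proof (cases "t > 0")
    case t: True
    have g: "(\<integral>\<^sup>+z. ennreal (gauss r (z::'a)) \<partial>lborel) = 1" if "r > 0" for r
      using has_bochner_integral_gauss[OF that, where 'a='a]
      by (subst nn_integral_eq_integral) (auto simp: has_bochner_integral_iff)
    have sw: "stable_weight s t = t powr (- 1 - s)" using t by (simp add: stable_weight_def)
    show ?thesis
    proof (cases "t \<le> 1")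
      case True
      have "(\<integral>\<^sup>+z. ennreal (stable_weight s t * gauss t z) * ennreal (min 1 ((norm (z::'a))\<^sup>2)) \<partial>lborel) \<le>
          (\<integral>\<^sup>+z. ennreal (C * t powr (- s)) * ennreal (gauss (2 * t) (z::'a)) \<partial>lborel)"
      proof (rule nn_integral_mono)
        fix z :: 'a
        have "stable_weight s t * gauss t z * min 1 ((norm z)\<^sup>2) \<le> t powr (- 1 - s) * ((norm z)\<^sup>2 * gauss t z)"
          unfolding sw using t by (simp add: mult_left_mono mult_right_mono mult_ac)
        also have "\<dots> \<le> t powr (- 1 - s) * (C * t * gauss (2 * t) z)"
          using norm_sq_gauss_le[OF t, of z] by (intro mult_left_mono) (auto simp: C_def)
        also have "\<dots> = C * t powr (- s) * gauss (2 * t) z"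
          using t powr_add[of t "- 1 - s" 1] by (simp add: mult_ac)
        finally show "ennreal (stable_weight s t * gauss t z) * ennreal (min 1 ((norm z)\<^sup>2)) \<le>
          ennreal (C * t powr (- s)) * ennreal (gauss (2 * t) z)"
          using C by (simp add: ennreal_mult[symmetric] ennreal_leI)
      qed
      also have "\<dots> = ennreal (C * t powr (- s))" using t g[of "2 * t"] by (simp add: nn_integral_cmult)
      also have "\<dots> = ennreal C * (ennreal (t powr (- s)) * indicator {0..1} t)"
        using True t C by (simp add: ennreal_mult)
      finally show ?thesis by (rule order_trans) simp
    next
      case False
      have "(\<integral>\<^sup>+z. ennreal (stable_weight s t * gauss t z) * ennreal (min 1 ((norm (z::'a))\<^sup>2)) \<partial>lborel) \<le>
          (\<integral>\<^sup>+z. ennreal (t powr (- 1 - s)) * ennreal (gauss t (z::'a)) \<partial>lborel)"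
      proof (rule nn_integral_mono)
        fix z :: 'a
        have "stable_weight s t * gauss t z * min 1 ((norm z)\<^sup>2) \<le> stable_weight s t * gauss t z * 1"
          by (intro mult_left_mono) auto
        then show "ennreal (stable_weight s t * gauss t z) * ennreal (min 1 ((norm z)\<^sup>2)) \<le>
            ennreal (t powr (- 1 - s)) * ennreal (gauss t z)"
          unfolding sw by (simp add: ennreal_mult[symmetric] ennreal_leI)
      qed
      also have "\<dots> = ennreal (t powr (- 1 - s))" using t g[of t] by (simp add: nn_integral_cmult)
      finally show ?thesis using False by simp
    qed
  next
    case False
    then show ?thesis by (simp add: stable_weight_def)
  qed
  have "ennreal (mix_const DIM('a) s) * (\<integral>\<^sup>+z. ennreal (kern s (z::'a)) * ennreal (min 1 ((norm z)\<^sup>2)) \<partial>lborel) \<le>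
      (\<integral>\<^sup>+t. ennreal C * (ennreal (t powr (- s)) * indicator {0..1} t) + ennreal (t powr (- 1 - s)) * indicator {1..} t \<partial>lborel)"
    by (subst nn_integral_kern_mixture[symmetric, OF s(1)]) (auto intro!: nn_integral_mono inner)
  also have "\<dots> = ennreal C * (\<integral>\<^sup>+t. ennreal (t powr (- s)) * indicator {0..1} t \<partial>lborel)
      + (\<integral>\<^sup>+t. ennreal (t powr (- 1 - s)) * indicator {1..} t \<partial>lborel)"
    by (subst nn_integral_add) (auto simp: nn_integral_cmult)
  also have "\<dots> < \<infinity>"
    using s by (subst nn_integral_powr_to_inf, simp, simp, subst nn_integral_powr_from_0)
      (auto simp: ennreal_mult_less_top)
  finally have "(\<integral>\<^sup>+z. ennreal (kern s (z::'a)) * ennreal (min 1 ((norm z)\<^sup>2)) \<partial>lborel) < \<infinity>"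
    using mix_const_pos[OF s(1), of "DIM('a)"] by (auto simp: ennreal_mult_less_top ennreal_mult_eq_top_iff less_top)
  then show "(\<integral>\<^sup>+z. ennreal (norm (min 1 ((norm (z::'a))\<^sup>2) * kern s z)) \<partial>lborel) < \<infinity>"
    by (simp add: ennreal_mult[symmetric] mult.commute abs_mult)
qed measurable

text \<open>Applied to second differences this expresses the fractional Laplacian as a stable
  average over t of a function minus its heat flow at time t. Absolute integrability against the
  kernel is what permits the exchange of integrals for signed \<open>h\<close>.\<close>

lemma integral_kern_mixture:
  fixes h :: "'a::euclidean_space \<Rightarrow> real"
  assumes s: "s > 0" and [measurable]: "h \<in> borel_measurable borel"
    and int: "integrable lborel (\<lambda>z. h z * kern s z)"
  shows "integrable lborel (\<lambda>t. stable_weight s t * (\<integral>z. h z * gauss t z \<partial>lborel))"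
    and "(\<integral>t. stable_weight s t * (\<integral>z. h z * gauss t z \<partial>lborel) \<partial>lborel) =
      mix_const DIM('a) s * (\<integral>z. h z * kern s z \<partial>lborel)"
proof -
  define F where "F = (\<lambda>t z. stable_weight s t * gauss t z * h z)"
  have [measurable]: "(\<lambda>p. F (fst p) (snd p)) \<in> borel_measurable (lborel \<Otimes>\<^sub>M lborel)"
    unfolding F_def by measurable
  have "(\<integral>\<^sup>+p. ennreal (norm (F (fst p) (snd p))) \<partial>(lborel \<Otimes>\<^sub>M lborel)) =
      (\<integral>\<^sup>+t. \<integral>\<^sup>+z. ennreal (norm (F t z)) \<partial>lborel \<partial>lborel)"
    by (subst lborel.nn_integral_fst[symmetric]) auto
  also have "\<dots> = (\<integral>\<^sup>+t. \<integral>\<^sup>+z. ennreal (stable_weight s t * gauss t z) * ennreal \<bar>h z\<bar> \<partial>lborel \<partial>lborel)"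
    by (simp add: F_def abs_mult ennreal_mult)
  also have "\<dots> = ennreal (mix_const DIM('a) s) * (\<integral>\<^sup>+z. ennreal (kern s z) * ennreal \<bar>h z\<bar> \<partial>lborel)"
    by (rule nn_integral_kern_mixture[OF s]) measurable
  also have "(\<integral>\<^sup>+z. ennreal (kern s z) * ennreal \<bar>h z\<bar> \<partial>lborel) = (\<integral>\<^sup>+z. ennreal (norm (h z * kern s z)) \<partial>lborel)"
    by (simp add: ennreal_mult[symmetric] abs_mult mult.commute)
  also have "ennreal (mix_const DIM('a) s) * \<dots> < \<infinity>"
    using int by (simp add: integrable_iff_bounded ennreal_mult_less_top)
  finally have Fint: "integrable (lborel \<Otimes>\<^sub>M lborel) (\<lambda>p. F (fst p) (snd p))"
    by (intro integrableI_bounded) auto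
  have sw: "(\<integral>z. F t z \<partial>lborel) = stable_weight s t * (\<integral>z. h z * gauss t z \<partial>lborel)" for t
  proof -
    have "F t z = stable_weight s t * (h z * gauss t z)" for z by (simp add: F_def)
    then show ?thesis by simp
  qed
  show "integrable lborel (\<lambda>t. stable_weight s t * (\<integral>z. h z * gauss t z \<partial>lborel))"
    using lborel_pair.integrable_fst'[OF Fint] by (simp add: sw)
  have tz: "(\<integral>t. F t z \<partial>lborel) = mix_const DIM('a) s * kern s z * h z" if "z \<noteq> 0" for z
  proof -
    have "(\<integral>t. stable_weight s t * gauss t z \<partial>lborel) = mix_const DIM('a) s * kern s z"
      using nn_integral_stable_gauss[OF s that] mix_const_pos[OF s, of "DIM('a)"]
      by (subst integral_eq_nn_integral) auto
    then show ?thesis by (simp add: F_def)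
  qed
  have "(\<integral>t. stable_weight s t * (\<integral>z. h z * gauss t z \<partial>lborel) \<partial>lborel) = (\<integral>t. \<integral>z. F t z \<partial>lborel \<partial>lborel)"
    by (simp add: sw)
  also have "\<dots> = (\<integral>z. \<integral>t. F t z \<partial>lborel \<partial>lborel)"
    using Fint by (intro lborel_pair.Fubini_integral[symmetric]) (simp add: case_prod_beta')
  also have "\<dots> = (\<integral>z. mix_const DIM('a) s * (h z * kern s z) \<partial>lborel)"
  proof (rule integral_cong_AE)
    show "AE z in lborel. (\<integral>t. F t z \<partial>lborel) = mix_const DIM('a) s * (h z * kern s z)"
      using AE_lborel_singleton[of "0::'a"] by eventually_elim (simp add: tz mult_ac)
    show "(\<lambda>z. \<integral>t. F t z \<partial>lborel) \<in> borel_measurable lborel" unfolding F_def by measurable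
  qed measurable
  finally show "(\<integral>t. stable_weight s t * (\<integral>z. h z * gauss t z \<partial>lborel) \<partial>lborel) =
      mix_const DIM('a) s * (\<integral>z. h z * kern s z \<partial>lborel)" by simp
qed

lemma gauss_le_of_time_ge:
  fixes x :: "'a::euclidean_space"
  assumes "0 < t0" "t0 \<le> t"
  shows "gauss t x \<le> (4 * pi * t0) powr (- (real DIM('a) / 2))"
proof -
  have "gauss t x \<le> (4 * pi * t0) powr (- (real DIM('a) / 2)) * 1"
    unfolding gauss_def using assms by (intro mult_mono powr_mono2') auto
  then show ?thesis by simp
qed

text \<open>A bound for the maximum over all times of t^(-q) exp(-r^2/(4t)) with q = k + n/2. At a
  fixed distance from the origin the Gaussian beats every negative power of t, which keeps later
  bounds uniform as the lower time cutoff tends to 0.\<close>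

lemma powr_gauss_le_away:
  fixes x :: "'a::euclidean_space"
  assumes r: "r > 0" "norm x \<ge> r" and t: "t > 0" and k: "k \<ge> 0"
  shows "t powr (- k) * gauss t x \<le>
    (4 * (k + real DIM('a) / 2) / r\<^sup>2) powr (k + real DIM('a) / 2)"
proof -
  define q where "q = k + real DIM('a) / 2"
  have q: "q > 0" using k by (simp add: q_def add_nonneg_pos)
  have a: "(4 * pi * t) powr (- (real DIM('a) / 2)) \<le> t powr (- (real DIM('a) / 2))"
    using t pi_ge_two mult_right_mono[of 1 "4 * pi" t] by (intro powr_mono2') auto
  have "r\<^sup>2 \<le> (norm x)\<^sup>2" using r by (intro power_mono) auto
  then have b: "exp (- ((norm x)\<^sup>2 / (4 * t))) \<le> exp (- (r\<^sup>2 / (4 * t)))"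
    using t by (simp add: divide_right_mono)
  have "t powr (- k) * gauss t x \<le> t powr (- k) * (t powr (- (real DIM('a) / 2)) * exp (- (r\<^sup>2 / (4 * t))))"
    unfolding gauss_def using a b by (intro mult_left_mono mult_mono) auto
  also have "\<dots> = t powr (- q) * exp (- (r\<^sup>2 / (4 * t)))"
    by (simp add: q_def powr_add[symmetric] mult.assoc[symmetric] algebra_simps)
  also have "t powr (- q) = (4 / r\<^sup>2) powr q * (r\<^sup>2 / (4 * t)) powr q"
    using t r by (subst powr_mult[symmetric]) (auto simp: powr_minus powr_divide field_simps inverse_powr)
  also have "(4 / r\<^sup>2) powr q * (r\<^sup>2 / (4 * t)) powr q * exp (- (r\<^sup>2 / (4 * t))) \<le> (4 / r\<^sup>2) powr q * q powr q"
    using t q powr_mult_exp_minus_le[of q "r\<^sup>2 / (4 * t)"] by (simp add: mult.assoc mult_left_mono)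
  also have "\<dots> = (4 * q / r\<^sup>2) powr q" using q by (subst powr_mult[symmetric]) auto
  finally show ?thesis by (simp add: q_def)
qed

section \<open>Second differences and the fractional Laplacian\<close>

definition sdiff :: "('a::euclidean_space \<Rightarrow> real) \<Rightarrow> 'a \<Rightarrow> 'a \<Rightarrow> real" where
  "sdiff f x z = 2 * f x - f (x + z) - f (x - z)"

text \<open>The symmetrised form of the principal value, absolutely convergent for functions with
  bounded second differences of quadratic size. It is twice the principal value and omits the
  normalisation, hence the factor 1/2 in \<open>frac_laplacian_eq_flap\<close>.\<close>

definition flap :: "real \<Rightarrow> ('a::euclidean_space \<Rightarrow> real) \<Rightarrow> 'a \<Rightarrow> real" where
  "flap s f x = (\<integral>z. sdiff f x z * kern s z \<partial>lborel)"

lemma sdiff_measurable [measurable]: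
  assumes [measurable]: "f \<in> borel_measurable borel"
  shows "sdiff f x \<in> borel_measurable borel"
  unfolding sdiff_def[abs_def] by measurable

text \<open>One constant \<open>A\<close> bounds both the function and its second differences, so
  small and large z share a single majorant. The 4 is the trivial bound for \<open>sdiff\<close> by
  values.\<close>

lemma sdiff_kern_le:
  assumes "\<And>y. \<bar>f y\<bar> \<le> A" "\<bar>sdiff f x z\<bar> \<le> A * (norm z)\<^sup>2"
  shows "\<bar>sdiff f x z * kern s z\<bar> \<le> 4 * A * (min 1 ((norm z)\<^sup>2) * kern s z)"
proof -
  have A: "A \<ge> 0" using assms(1)[of x] by linarith
  have "\<bar>sdiff f x z\<bar> \<le> 4 * A * min 1 ((norm z)\<^sup>2)"
  proof (cases "(norm z)\<^sup>2 \<le> 1")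
    case True
    have "A * (norm z)\<^sup>2 \<le> 4 * A * (norm z)\<^sup>2" using A by (intro mult_right_mono) auto
    then show ?thesis using True assms(2) by (simp add: min_absorb2)
  next
    case False
    have "\<bar>sdiff f x z\<bar> \<le> 4 * A"
      using assms(1)[of x] assms(1)[of "x + z"] assms(1)[of "x - z"] unfolding sdiff_def by linarith
    then show ?thesis using False by (simp add: min_absorb1)
  qed
  then have "\<bar>sdiff f x z\<bar> * kern s z \<le> (4 * A * min 1 ((norm z)\<^sup>2)) * kern s z"
    by (intro mult_right_mono) auto
  then show ?thesis by (simp add: abs_mult mult.assoc)
qed

lemma integrable_sdiff_kern:
  fixes f :: "'a::euclidean_space \<Rightarrow> real"
  assumes s: "0 < s" "s < 1" and f[measurable]: "f \<in> borel_measurable borel"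
    and b: "\<And>y. \<bar>f y\<bar> \<le> A" "\<And>z. \<bar>sdiff f x z\<bar> \<le> A * (norm z)\<^sup>2"
  shows "integrable lborel (\<lambda>z. sdiff f x z * kern s z)"
proof (rule Bochner_Integration.integrable_bound)
  show "integrable lborel (\<lambda>z::'a. 4 * A * (min 1 ((norm z)\<^sup>2) * kern s z))"
    by (intro integrable_mult_right integrable_min_kern s)
  show "AE z in lborel. norm (sdiff f x z * kern s z) \<le> norm (4 * A * (min 1 ((norm z)\<^sup>2) * kern s z))"
    using sdiff_kern_le[of f A x _ s] b by (intro AE_I2) (auto intro: order_trans[OF _ abs_ge_self])
qed measurable

text \<open>Outside a ball the integrand is integrable, so averaging it with its reflection is
  legitimate and produces half of \<open>sdiff\<close>; dominated convergence then removes the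
  ball.\<close>

lemma frac_laplacian_eq_flap:
  fixes f :: "'a::euclidean_space \<Rightarrow> real"
  assumes s: "0 < s" "s < 1" and f[measurable]: "f \<in> borel_measurable borel"
    and b: "\<And>y. \<bar>f y\<bar> \<le> A" "\<And>z. \<bar>sdiff f x z\<bar> \<le> A * (norm z)\<^sup>2"
  shows "frac_laplacian s f x = frac_laplacian_const DIM('a) s / 2 * flap s f x"
proof -
  define J where "J = (\<lambda>e::real. LINT y : - ball x e | lebesgue. (f x - f y) / norm (x - y) powr (real DIM('a) + 2 * s))"
  have J: "J e = (\<integral>z. indicator (- ball 0 e) z * (sdiff f x z * kern s z) \<partial>lborel) / 2" if e: "e > 0" for e
  proof -
    define I where "I = (\<lambda>z. indicator (- ball 0 e) z * ((f x - f (x + z)) * kern s z))"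
    define h where "h = (\<lambda>y. indicator (- ball x e) y * ((f x - f y) / norm (x - y) powr (real DIM('a) + 2 * s)))"
    have [measurable]: "h \<in> borel_measurable borel" "I \<in> borel_measurable borel"
      unfolding h_def I_def by measurable
    have A: "A \<ge> 0" using b(1)[of x] by linarith
    have intI: "integrable lborel I"
    proof (rule Bochner_Integration.integrable_bound)
      show "integrable lborel (\<lambda>z::'a. 2 * A * (1 + 1 / e\<^sup>2) * (min 1 ((norm z)\<^sup>2) * kern s z))"
        by (intro integrable_mult_right integrable_min_kern s)
      show "AE z in lborel. norm (I z) \<le> norm (2 * A * (1 + 1 / e\<^sup>2) * (min 1 ((norm z)\<^sup>2) * kern s z))"
      proof (rule AE_I2)
        fix z
        show "norm (I z) \<le> norm (2 * A * (1 + 1 / e\<^sup>2) * (min 1 ((norm z)\<^sup>2) * kern s z))"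
        proof (cases "z \<in> ball 0 e")
          case False
          then have "kern s z \<le> (1 + 1 / e\<^sup>2) * (min 1 ((norm z)\<^sup>2) * kern s z)"
            using e by (intro kern_le_min_kern) auto
          moreover have "\<bar>f x - f (x + z)\<bar> \<le> 2 * A" using b(1)[of x] b(1)[of "x + z"] by linarith
          ultimately have "\<bar>f x - f (x + z)\<bar> * kern s z \<le> 2 * A * ((1 + 1 / e\<^sup>2) * (min 1 ((norm z)\<^sup>2) * kern s z))"
            using A by (intro mult_mono) auto
          then show ?thesis using False A e by (simp add: I_def abs_mult mult.assoc)
        qed (simp add: I_def)
      qed
    qed measurable
    have sh: "h (x + z) = I z" for z
      by (simp add: h_def I_def kern_def indicator_def dist_norm)
    have I_sum: "I z + I (- z) = indicator (- ball 0 e) z * (sdiff f x z * kern s z)" for z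
      by (simp add: I_def sdiff_def indicator_def algebra_simps)
    have "has_bochner_integral lborel I (integral\<^sup>L lborel I)"
      using intI by (rule has_bochner_integral_integrable)
    then have hI: "has_bochner_integral lborel (\<lambda>z. I (- z)) (integral\<^sup>L lborel I)"
      by (rule has_bochner_integral_lborel_uminus)
    have "has_bochner_integral lborel (\<lambda>y. I (- x + y)) (integral\<^sup>L lborel I)"
      using intI by (intro has_bochner_integral_lborel_shift has_bochner_integral_integrable)
    moreover have "I (- x + y) = h y" for y using sh[of "- x + y"] by simp
    ultimately have "has_bochner_integral lborel h (integral\<^sup>L lborel I)" by simp
    then have "integral\<^sup>L lborel h = integral\<^sup>L lborel I" by (rule has_bochner_integral_integral_eq)
    moreover have "J e = integral\<^sup>L lebesgue h"
      by (simp add: J_def h_def set_lebesgue_integral_def)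
    moreover have "integral\<^sup>L lebesgue h = integral\<^sup>L lborel h"
      by (rule integral_completion) measurable
    moreover have "(\<integral>z. I z + I (- z) \<partial>lborel) = integral\<^sup>L lborel I + integral\<^sup>L lborel I"
      using intI hI by (simp add: has_bochner_integral_iff)
    ultimately show ?thesis unfolding I_sum by simp
  qed
  have "((\<lambda>e. \<integral>z. indicator (- ball 0 e) z * (sdiff f x z * kern s z) \<partial>lborel) \<longlongrightarrow> flap s f x) (at_right 0)"
  proof (rule tendsto_at_right_sequentially[of 0 1])
    fix S :: "nat \<Rightarrow> real"
    assume S: "\<And>n. 0 < S n" "S \<longlonglongrightarrow> 0"
    show "(\<lambda>n. \<integral>z. indicator (- ball 0 (S n)) z * (sdiff f x z * kern s z) \<partial>lborel) \<longlonglongrightarrow> flap s f x"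
      unfolding flap_def
    proof (rule integral_dominated_convergence)
      show "integrable lborel (\<lambda>z. \<bar>sdiff f x z * kern s z\<bar>)"
        by (intro integrable_abs integrable_sdiff_kern[OF s f b])
      show "AE z in lborel. (\<lambda>n. indicator (- ball 0 (S n)) z * (sdiff f x z * kern s z)) \<longlonglongrightarrow> sdiff f x z * kern s z"
      proof (rule AE_I2)
        fix z :: 'a
        show "(\<lambda>n. indicator (- ball 0 (S n)) z * (sdiff f x z * kern s z)) \<longlonglongrightarrow> sdiff f x z * kern s z"
        proof (cases "z = 0")
          case False
          then have "eventually (\<lambda>n. S n < norm z) sequentially"
            using S(2) by (intro order_tendstoD(2)) auto
          then have "eventually (\<lambda>n. indicator (- ball 0 (S n)) z * (sdiff f x z * kern s z) = sdiff f x z * kern s z) sequentially"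
            by eventually_elim (simp add: indicator_def)
          then show ?thesis by (rule tendsto_eventually)
        qed simp
      qed
      show "AE z in lborel. norm (indicator (- ball 0 (S n)) z * (sdiff f x z * kern s z)) \<le> \<bar>sdiff f x z * kern s z\<bar>" for n
        by (intro AE_I2) (auto simp: indicator_def)
    qed measurable
  qed simp
  then have "((\<lambda>e. (\<integral>z. indicator (- ball 0 e) z * (sdiff f x z * kern s z) \<partial>lborel) / 2) \<longlongrightarrow> flap s f x / 2) (at_right 0)"
    by (intro tendsto_divide) auto
  moreover have "eventually (\<lambda>e. (\<integral>z. indicator (- ball 0 e) z * (sdiff f x z * kern s z) \<partial>lborel) / 2 = J e) (at_right 0)"
    unfolding eventually_at_filter using J by auto
  ultimately have "(J \<longlongrightarrow> flap s f x / 2) (at_right 0)"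
    by (rule Lim_transform_eventually)
  then have "Lim (at_right 0) J = flap s f x / 2"
    by (intro tendsto_Lim) auto
  then show ?thesis unfolding frac_laplacian_def J_def by simp
qed

lemma frac_laplacian_const_pos:
  assumes "0 < s" "s < 1"
  shows "frac_laplacian_const n s > 0"
  unfolding frac_laplacian_const_def using assms
  by (intro divide_pos_pos mult_pos_pos Gamma_real_pos) (auto intro: add_nonneg_pos)

lemma one_plus_powr_pos: "1 + norm x powr p > 0"
  by (smt (verit) powr_ge_zero)

text \<open>For |x| > 2 only those z contribute for which x + z or x - z lies in the unit ball, and
  then |z| \<ge> |x|/2: this is precisely the decay matched by \<open>weighted_L1\<close>. The
  constant is uniform in \<open>f\<close> and the bound linear in \<open>A\<close>, so whole
  families of test functions share a majorant.\<close>

lemma flap_decay: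
  assumes s: "0 < s" "s < 1"
  shows "\<exists>C\<ge>0. \<forall>(f :: 'a::euclidean_space \<Rightarrow> real) A x. f \<in> borel_measurable borel \<longrightarrow>
    (\<forall>y. \<bar>f y\<bar> \<le> A) \<longrightarrow> (\<forall>y. y \<notin> ball 0 1 \<longrightarrow> f y = 0) \<longrightarrow>
    (\<forall>z. \<bar>sdiff f x z\<bar> \<le> A * (norm z)\<^sup>2) \<longrightarrow>
    \<bar>flap s f x\<bar> \<le> C * A / (1 + norm x powr (real DIM('a) + 2 * s))"
proof -
  define p where "p = real DIM('a) + 2 * s"
  have p: "p > 0" using s by (simp add: p_def add_nonneg_pos)
  define K0 where "K0 = (\<integral>z. min 1 ((norm (z::'a))\<^sup>2) * kern s z \<partial>lborel)"
  have K0: "K0 \<ge> 0" unfolding K0_def by (intro integral_nonneg_AE) auto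
  define V where "V = measure lborel (ball 0 1 :: 'a set)"
  define C where "C = 4 * K0 * (1 + 2 powr p) + 4 * 2 powr p * V"
  have C: "C \<ge> 0" using K0 by (simp add: C_def V_def)
  have main: "\<bar>flap s f x\<bar> \<le> C * A / (1 + norm x powr p)"
    if f[measurable]: "f \<in> borel_measurable borel" and b: "\<And>y. \<bar>f y\<bar> \<le> A"
      and supp: "\<And>y. y \<notin> ball 0 1 \<Longrightarrow> f y = 0" and sd: "\<And>z. \<bar>sdiff f x z\<bar> \<le> A * (norm z)\<^sup>2"
    for f :: "'a \<Rightarrow> real" and A x
  proof -
    have A: "A \<ge> 0" using b[of x] by linarith
    have int: "integrable lborel (\<lambda>z. sdiff f x z * kern s z)" by (rule integrable_sdiff_kern[OF s f b sd])
    have pp: "1 + norm x powr p > 0" by (rule one_plus_powr_pos)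
    have abs_le: "\<bar>flap s f x\<bar> \<le> (\<integral>z. \<bar>sdiff f x z * kern s z\<bar> \<partial>lborel)"
      unfolding flap_def by (rule integral_abs_bound)
    show ?thesis
    proof (cases "norm x \<le> 2")
      case True
      have "(\<integral>z. \<bar>sdiff f x z * kern s z\<bar> \<partial>lborel) \<le> (\<integral>z. 4 * A * (min 1 ((norm (z::'a))\<^sup>2) * kern s z) \<partial>lborel)"
        using sdiff_kern_le[of f A x _ s] b sd integrable_min_kern[OF s, where 'a='a]
        by (intro integral_mono integrable_abs int integrable_mult_right) auto
      also have "\<dots> = 4 * A * K0" by (simp add: K0_def)
      finally have 1: "\<bar>flap s f x\<bar> \<le> 4 * A * K0" using abs_le by linarith
      have "norm x powr p \<le> 2 powr p" using True p by (intro powr_mono2) auto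
      then have "4 * A * K0 * (1 + norm x powr p) \<le> 4 * A * K0 * (1 + 2 powr p)"
        using A K0 by (intro mult_left_mono) auto
      also have "\<dots> \<le> C * A" unfolding C_def using A by (simp add: algebra_simps V_def)
      finally have "4 * A * K0 \<le> C * A / (1 + norm x powr p)" using pp by (simp add: pos_le_divide_eq)
      then show ?thesis using 1 by linarith
    next
      case False
      then have x: "norm x > 2" by simp
      define D where "D = 2 powr p / norm x powr p"
      have D: "D \<ge> 0" by (simp add: D_def)
      have kz: "kern s z \<le> D" if "norm x \<le> norm z + 1" for z :: 'a
      proof -
        have "norm x / 2 \<le> norm z" using that x by linarith
        then have "(norm x / 2) powr p \<le> norm z powr p" using p by (intro powr_mono2) auto
        moreover have "norm x / 2 \<noteq> 0" using x by linarith
        then have pos: "0 < (norm x / 2) powr p" by simp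
        ultimately have "1 / norm z powr p \<le> 1 / (norm x / 2) powr p"
          by (intro divide_left_mono mult_pos_pos[OF less_le_trans[OF pos] pos]) auto
        then show ?thesis by (simp add: kern_def p_def[symmetric] D_def powr_divide)
      qed
      have fx: "f x = 0" using x by (intro supp) simp
      have tri: "norm x \<le> norm z + norm (x + z)" "norm x \<le> norm z + norm (x - z)" for z
        using norm_triangle_ineq4[of "x + z" z] norm_triangle_ineq[of "x - z" z] by simp_all
      have pt: "\<bar>sdiff f x z * kern s z\<bar> \<le> D * A * (indicator (ball 0 1) (x + z) + indicator (ball 0 1) (x - z))" for z
      proof -
        have 1: "\<bar>f (x + z)\<bar> * kern s z \<le> D * A * indicator (ball 0 1) (x + z)"
        proof (cases "x + z \<in> ball 0 1")
          case True
          then have "kern s z \<le> D" using tri(1)[of z] by (intro kz) simp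
          then have "\<bar>f (x + z)\<bar> * kern s z \<le> A * D" using b A by (intro mult_mono) auto
          then show ?thesis using True by (simp add: mult.commute)
        qed (simp add: supp)
        have 2: "\<bar>f (x - z)\<bar> * kern s z \<le> D * A * indicator (ball 0 1) (x - z)"
        proof (cases "x - z \<in> ball 0 1")
          case True
          then have "kern s z \<le> D" using tri(2)[of z] by (intro kz) simp
          then have "\<bar>f (x - z)\<bar> * kern s z \<le> A * D" using b A by (intro mult_mono) auto
          then show ?thesis using True by (simp add: mult.commute)
        qed (simp add: supp)
        have "\<bar>sdiff f x z\<bar> \<le> \<bar>f (x + z)\<bar> + \<bar>f (x - z)\<bar>" unfolding sdiff_def fx by linarith
        then have "\<bar>sdiff f x z\<bar> * kern s z \<le> (\<bar>f (x + z)\<bar> + \<bar>f (x - z)\<bar>) * kern s z"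
          by (intro mult_right_mono) auto
        then show ?thesis using 1 2 by (simp add: abs_mult algebra_simps)
      qed
      have i0: "has_bochner_integral lborel (indicator (ball 0 1) :: 'a \<Rightarrow> real) V"
        unfolding V_def by (intro has_bochner_integral_real_indicator) (auto simp del: infinity_ennreal_def intro!: emeasure_bounded_finite)
      have i1: "has_bochner_integral lborel (\<lambda>z::'a. indicator (ball 0 1) (x + z) :: real) V"
        by (rule has_bochner_integral_lborel_shift[OF i0])
      have i2: "has_bochner_integral lborel (\<lambda>z::'a. indicator (ball 0 1) (x - z) :: real) V"
        using has_bochner_integral_lborel_uminus[OF i1] by simp
      have i3: "has_bochner_integral lborel (\<lambda>z::'a. D * A * (indicator (ball 0 1) (x + z) + indicator (ball 0 1) (x - z))) (D * A * (V + V))"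
        by (intro has_bochner_integral_mult_right has_bochner_integral_add i1 i2)
      have "(\<integral>z. \<bar>sdiff f x z * kern s z\<bar> \<partial>lborel) \<le>
          (\<integral>z. D * A * (indicator (ball 0 1) (x + z) + indicator (ball 0 1) (x - z)) \<partial>lborel)"
        using i3 pt by (intro integral_mono integrable_abs int) (auto simp: has_bochner_integral_iff)
      also have "\<dots> = D * A * (V + V)" using i3 by (rule has_bochner_integral_integral_eq)
      finally have 1: "\<bar>flap s f x\<bar> \<le> 2 * D * A * V" using abs_le by simp
      have "1 \<le> norm x powr p" using x p by (intro ge_one_powr_ge_zero) auto
      then have "1 / norm x powr p \<le> 2 / (1 + norm x powr p)" by (simp add: divide_simps)
      then have "2 * A * V * 2 powr p * (1 / norm x powr p) \<le> 2 * A * V * 2 powr p * (2 / (1 + norm x powr p))"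
        using A by (intro mult_left_mono) (auto simp: V_def)
      then have "2 * D * A * V \<le> 4 * 2 powr p * V * A / (1 + norm x powr p)"
        by (simp add: D_def mult_ac)
      also have "\<dots> \<le> C * A / (1 + norm x powr p)"
        using pp A K0 unfolding C_def by (intro divide_right_mono mult_right_mono) auto
      finally show ?thesis using 1 by linarith
    qed
  qed
  show ?thesis
    unfolding p_def[symmetric] by (intro exI[of _ C] conjI C) (use main in blast)
qed

section \<open>Directional derivatives\<close>

definition ddir :: "('a::euclidean_space \<Rightarrow> real) \<Rightarrow> 'a \<Rightarrow> 'a \<Rightarrow> real" where
  "ddir f x h = frechet_derivative f (at x) h"

text \<open>The outer derivative falls on the coordinate partials, whose smoothness is given by
  \<open>smooth_fun_ddir\<close>; that lemma speaks of basis directions.\<close>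

definition ddir2 :: "('a::euclidean_space \<Rightarrow> real) \<Rightarrow> 'a \<Rightarrow> 'a \<Rightarrow> real" where
  "ddir2 f x h = (\<Sum>i\<in>Basis. (h \<bullet> i) * ddir (\<lambda>y. ddir f y i) x h)"

lemma smooth_fun_ddir: "smooth_fun f \<Longrightarrow> i \<in> Basis \<Longrightarrow> smooth_fun (\<lambda>x. ddir f x i)"
  unfolding ddir_def by (rule smooth_fun_partial)

lemma ddir_eq_sum:
  assumes "smooth_fun f"
  shows "ddir f x h = (\<Sum>i\<in>Basis. (h \<bullet> i) * ddir f x i)"
proof -
  interpret bounded_linear "frechet_derivative f (at x)"
    using smooth_fun_has_derivative[OF assms] by (rule has_derivative_bounded_linear)
  have "frechet_derivative f (at x) h = frechet_derivative f (at x) (\<Sum>i\<in>Basis. (h \<bullet> i) *\<^sub>R i)"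
    by (simp add: euclidean_representation)
  also have "\<dots> = (\<Sum>i\<in>Basis. (h \<bullet> i) * frechet_derivative f (at x) i)"
    by (simp add: sum scaleR)
  finally show ?thesis by (simp add: ddir_def)
qed

lemma ddir_unique: "(f has_derivative f') (at x) \<Longrightarrow> ddir f x h = f' h"
  unfolding ddir_def by (metis frechet_derivative_at)

lemma has_derivative_ddir: "smooth_fun f \<Longrightarrow> (f has_derivative ddir f x) (at x)"
  unfolding ddir_def[abs_def] by (rule smooth_fun_has_derivative)

lemma DERIV_along_line:
  assumes "smooth_fun f"
  shows "((\<lambda>t. f (x + t *\<^sub>R h)) has_real_derivative ddir f (x + t *\<^sub>R h) h) (at t)"
proof -
  have "((\<lambda>t. x + t *\<^sub>R h) has_derivative (\<lambda>r. r *\<^sub>R h)) (at t)"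
    by (auto intro!: derivative_eq_intros)
  from has_derivative_compose[OF this has_derivative_ddir[OF assms]]
  have "((\<lambda>t. f (x + t *\<^sub>R h)) has_derivative (\<lambda>r. ddir f (x + t *\<^sub>R h) (r *\<^sub>R h))) (at t)" .
  moreover have "ddir f (x + t *\<^sub>R h) (r *\<^sub>R h) = ddir f (x + t *\<^sub>R h) h * r" for r
  proof -
    interpret bounded_linear "ddir f (x + t *\<^sub>R h)"
      using has_derivative_ddir[OF assms] by (rule has_derivative_bounded_linear)
    show ?thesis by (simp add: scaleR)
  qed
  ultimately show ?thesis by (simp add: has_field_derivative_def)
qed

lemma DERIV_ddir_along_line:
  assumes "smooth_fun f"
  shows "((\<lambda>t. ddir f (x + t *\<^sub>R h) h) has_real_derivative ddir2 f (x + t *\<^sub>R h) h) (at t)"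
proof -
  have "((\<lambda>t. \<Sum>i\<in>Basis. (h \<bullet> i) * ddir f (x + t *\<^sub>R h) i) has_real_derivative
      (\<Sum>i\<in>Basis. (h \<bullet> i) * ddir (\<lambda>y. ddir f y i) (x + t *\<^sub>R h) h)) (at t)"
    by (intro DERIV_sum DERIV_cmult DERIV_along_line smooth_fun_ddir assms)
  then show ?thesis unfolding ddir2_def by (subst ddir_eq_sum[OF assms]) simp
qed

text \<open>Two mean value steps: for g(t) + g(-t) on [0, 1], and then for g' on [-\<xi>, \<xi>], an
  interval of length at most 2.\<close>

lemma second_difference_le:
  fixes g :: "real \<Rightarrow> real"
  assumes g: "\<And>t. \<bar>t\<bar> \<le> 1 \<Longrightarrow> (g has_real_derivative g' t) (at t)"
    and g': "\<And>t. \<bar>t\<bar> \<le> 1 \<Longrightarrow> (g' has_real_derivative g'' t) (at t)"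
    and M: "\<And>t. \<bar>t\<bar> \<le> 1 \<Longrightarrow> \<bar>g'' t\<bar> \<le> M"
  shows "\<bar>2 * g 0 - g 1 - g (- 1)\<bar> \<le> 2 * M"
proof -
  define k where "k = (\<lambda>t. g t + g (- t))"
  have k: "(k has_real_derivative (g' t - g' (- t))) (at t)" if "0 \<le> t" "t \<le> 1" for t
  proof -
    have "((\<lambda>t. g (- t)) has_real_derivative (g' (- t) * (- 1))) (at t)"
      by (rule DERIV_chain2[OF g]) (use that in \<open>auto intro!: derivative_eq_intros\<close>)
    from DERIV_add[OF g this] show ?thesis using that by (simp add: k_def[abs_def])
  qed
  obtain \<xi> where \<xi>: "0 < \<xi>" "\<xi> < 1" "k 1 - k 0 = (1 - 0) * (g' \<xi> - g' (- \<xi>))"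
    using MVT2[of 0 1 k "\<lambda>t. g' t - g' (- t)"] k by auto
  obtain \<eta> where \<eta>: "- \<xi> < \<eta>" "\<eta> < \<xi>" "g' \<xi> - g' (- \<xi>) = (\<xi> - (- \<xi>)) * g'' \<eta>"
    using MVT2[of "- \<xi>" \<xi> g' g''] g' \<xi> by auto
  have "\<bar>g'' \<eta>\<bar> \<le> M" using \<eta> \<xi> by (intro M) auto
  then have "2 * \<xi> * \<bar>g'' \<eta>\<bar> \<le> 2 * 1 * M" using \<xi> by (intro mult_mono) auto
  moreover have "\<bar>k 1 - k 0\<bar> = 2 * \<xi> * \<bar>g'' \<eta>\<bar>" using \<xi> \<eta>(3) by (simp add: abs_mult)
  ultimately show ?thesis by (simp add: k_def)
qed

lemma sdiff_le_ddir2: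
  assumes "smooth_fun f" "\<And>t. \<bar>t\<bar> \<le> 1 \<Longrightarrow> \<bar>ddir2 f (x + t *\<^sub>R z) z\<bar> \<le> M"
  shows "\<bar>sdiff f x z\<bar> \<le> 2 * M"
  using second_difference_le[of "\<lambda>t. f (x + t *\<^sub>R z)" "\<lambda>t. ddir f (x + t *\<^sub>R z) z"
      "\<lambda>t. ddir2 f (x + t *\<^sub>R z) z" M]
    DERIV_along_line[OF assms(1)] DERIV_ddir_along_line[OF assms(1)] assms(2)
  by (simp add: sdiff_def)

lemma test_functions_ddir:
  assumes f: "f \<in> test_functions U" and i: "i \<in> Basis"
  shows "(\<lambda>x. ddir f x i) \<in> test_functions U"
proof (rule test_functionsI)
  show "smooth_fun (\<lambda>x. ddir f x i)" by (rule smooth_fun_ddir[OF test_functionsD(1)[OF f] i])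
  show "ddir f x i = 0" if x: "x \<notin> closure {x. f x \<noteq> 0}" for x
  proof -
    have "((\<lambda>x. 0) has_derivative (\<lambda>h. 0)) (at x)" by simp
    then have "(f has_derivative (\<lambda>h. 0)) (at x)"
      by (rule has_derivative_transform_within_open[of _ _ _ _ "- closure {x. f x \<noteq> 0}"])
        (use x closure_subset[of "{x. f x \<noteq> 0}"] in auto)
    then show ?thesis by (rule ddir_unique)
  qed
qed (use test_functionsD[OF f] in auto)

lemma test_functions_bounded:
  assumes f: "f \<in> test_functions U"
  shows "\<exists>B. \<forall>x. \<bar>f x\<bar> \<le> B"
proof -
  let ?K = "closure {x. f x \<noteq> 0}"
  have "compact (f ` ?K)"
    using test_functionsD[OF f] by (intro compact_continuous_image smooth_fun_continuous)
  then obtain B where B: "\<And>y. y \<in> f ` ?K \<Longrightarrow> norm y \<le> B" by (meson compact_imp_bounded bounded_iff)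
  have "\<bar>f x\<bar> \<le> \<bar>B\<bar>" for x
  proof (cases "f x = 0")
    case False
    then have "x \<in> ?K" using closure_subset[of "{x. f x \<noteq> 0}"] by auto
    then have "norm (f x) \<le> B" by (intro B imageI)
    then show ?thesis by simp
  qed simp
  then show ?thesis by blast
qed

lemma test_functions_C2_bounded:
  fixes f :: "'a::euclidean_space \<Rightarrow> real"
  assumes f: "f \<in> test_functions U"
  shows "\<exists>M>0. \<forall>x h. \<bar>f x\<bar> \<le> M \<and> \<bar>ddir f x h\<bar> \<le> M * norm h \<and> \<bar>ddir2 f x h\<bar> \<le> M * (norm h)\<^sup>2"
proof -
  have sf: "smooth_fun f" using test_functionsD[OF f] by simp
  obtain B0 where B0: "\<forall>x. \<bar>f x\<bar> \<le> B0" using test_functions_bounded[OF f] by blast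
  have "\<forall>i\<in>Basis. \<exists>B. \<forall>x. \<bar>ddir f x i\<bar> \<le> B"
    using test_functions_bounded[OF test_functions_ddir[OF f]] by blast
  from bchoice[OF this] obtain B1 where B1: "\<forall>i\<in>Basis. \<forall>x. \<bar>ddir f x i\<bar> \<le> B1 i" by blast
  have "\<forall>i\<in>Basis. \<forall>j\<in>Basis. \<exists>B. \<forall>x. \<bar>ddir (\<lambda>y. ddir f y i) x j\<bar> \<le> B"
    using test_functions_bounded[OF test_functions_ddir[OF test_functions_ddir[OF f]]] by blast
  then have "\<forall>i\<in>Basis. \<exists>B. \<forall>j\<in>Basis. \<forall>x. \<bar>ddir (\<lambda>y. ddir f y i) x j\<bar> \<le> B j"
    by (intro ballI bchoice) blast
  from bchoice[OF this] obtain B2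
    where B2: "\<forall>i\<in>Basis. \<forall>j\<in>Basis. \<forall>x. \<bar>ddir (\<lambda>y. ddir f y i) x j\<bar> \<le> B2 i j" by blast
  define M where "M = 1 + \<bar>B0\<bar> + (\<Sum>i\<in>(Basis::'a set). \<bar>B1 i\<bar>) + (\<Sum>i\<in>(Basis::'a set). \<Sum>j\<in>(Basis::'a set). \<bar>B2 i j\<bar>)"
  have nn: "0 \<le> (\<Sum>i\<in>(Basis::'a set). \<bar>B1 i\<bar>)" "0 \<le> (\<Sum>i\<in>(Basis::'a set). \<Sum>j\<in>(Basis::'a set). \<bar>B2 i j\<bar>)"
    by (intro sum_nonneg abs_ge_zero)+
  have hi: "\<bar>h \<bullet> i\<bar> \<le> norm h" if "i \<in> Basis" for h i :: 'a
    using Basis_le_norm[OF that, of h] by simp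
  have 1: "\<bar>f x\<bar> \<le> M" for x using B0[rule_format, of x] nn unfolding M_def by linarith
  have 2: "\<bar>ddir f x h\<bar> \<le> M * norm h" for x h
  proof -
    have "\<bar>ddir f x h\<bar> \<le> (\<Sum>i\<in>Basis. \<bar>(h \<bullet> i) * ddir f x i\<bar>)"
      unfolding ddir_eq_sum[OF sf, of x h] by (rule sum_abs)
    also have "\<dots> \<le> (\<Sum>i\<in>(Basis::'a set). norm h * \<bar>B1 i\<bar>)"
      unfolding abs_mult
    proof (intro sum_mono mult_mono hi)
      show "\<bar>ddir f x i\<bar> \<le> \<bar>B1 i\<bar>" if "i \<in> Basis" for i
        using B1 that abs_ge_self order_trans by blast
    qed auto
    also have "\<dots> = (\<Sum>i\<in>(Basis::'a set). \<bar>B1 i\<bar>) * norm h" by (simp add: sum_distrib_left[symmetric])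
    also have "\<dots> \<le> M * norm h" using nn by (intro mult_right_mono) (auto simp: M_def)
    finally show ?thesis .
  qed
  have 3: "\<bar>ddir2 f x h\<bar> \<le> M * (norm h)\<^sup>2" for x h
  proof -
    have "\<bar>ddir2 f x h\<bar> \<le> (\<Sum>i\<in>Basis. \<bar>(h \<bullet> i) * ddir (\<lambda>y. ddir f y i) x h\<bar>)"
      unfolding ddir2_def by (rule sum_abs)
    also have "\<dots> \<le> (\<Sum>i\<in>(Basis::'a set). norm h * (norm h * (\<Sum>j\<in>(Basis::'a set). \<bar>B2 i j\<bar>)))"
      unfolding abs_mult
    proof (intro sum_mono mult_mono hi)
      fix i :: 'a assume i: "i \<in> Basis"
      have "\<bar>ddir (\<lambda>y. ddir f y i) x h\<bar> \<le> (\<Sum>j\<in>Basis. \<bar>(h \<bullet> j) * ddir (\<lambda>y. ddir f y i) x j\<bar>)"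
        unfolding ddir_eq_sum[OF smooth_fun_ddir[OF sf i], of x h] by (rule sum_abs)
      also have "\<dots> \<le> (\<Sum>j\<in>(Basis::'a set). norm h * \<bar>B2 i j\<bar>)"
        unfolding abs_mult
      proof (intro sum_mono mult_mono hi)
        show "\<bar>ddir (\<lambda>y. ddir f y i) x j\<bar> \<le> \<bar>B2 i j\<bar>" if "j \<in> Basis" for j
          using B2 i that abs_ge_self order_trans by blast
      qed auto
      finally show "\<bar>ddir (\<lambda>y. ddir f y i) x h\<bar> \<le> norm h * (\<Sum>j\<in>(Basis::'a set). \<bar>B2 i j\<bar>)"
        by (simp add: sum_distrib_left)
    qed auto
    also have "\<dots> = norm h * (norm h * (\<Sum>i\<in>(Basis::'a set). \<Sum>j\<in>(Basis::'a set). \<bar>B2 i j\<bar>))"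
      by (simp only: sum_distrib_left)
    also have "\<dots> = (\<Sum>i\<in>(Basis::'a set). \<Sum>j\<in>(Basis::'a set). \<bar>B2 i j\<bar>) * (norm h)\<^sup>2"
      by (simp add: power2_eq_square)
    also have "\<dots> \<le> M * (norm h)\<^sup>2" using nn by (intro mult_right_mono) (auto simp: M_def)
    finally show ?thesis .
  qed
  have "M > 0" using nn unfolding M_def by linarith
  with 1 2 3 show ?thesis by blast
qed

text \<open>The quadratic majorant of \<open>g\<close> at \<open>t\<close> has to be nonnegative at
  its minimiser r = -g'/(2L). The majorant comes from a mean value step and carries L r^2 instead of
  L r^2/2, hence 4L where the sharp constant is 2L.\<close>

lemma nonneg_deriv_sq_le:
  fixes g :: "real \<Rightarrow> real"
  assumes g: "\<And>t. (g has_real_derivative g' t) (at t)"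
    and g': "\<And>t. (g' has_real_derivative g'' t) (at t)"
    and L: "\<And>t. \<bar>g'' t\<bar> \<le> L" "L > 0" and nn: "\<And>t. 0 \<le> g t"
  shows "(g' t)\<^sup>2 \<le> 4 * L * g t"
proof -
  have le: "g (t + r) \<le> g t + g' t * r + L * r\<^sup>2" for r
  proof (cases "r = 0")
    case False
    \<comment> \<open>Ordering the endpoints lets one mean value step serve both signs of r.\<close>
    define a where "a = min t (t + r)" define b where "b = max t (t + r)"
    have ab: "a < b" using False by (auto simp: a_def b_def)
    obtain \<xi> where \<xi>: "a < \<xi>" "\<xi> < b" "g b - g a = (b - a) * g' \<xi>"
      using MVT2[OF ab, of g g'] g by blast
    have eq: "g (t + r) - g t = r * g' \<xi>"
      using \<xi>(3) by (cases "r > 0") (auto simp: a_def b_def min_def max_def algebra_simps split: if_splits)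
    have "\<bar>g' \<xi> - g' t\<bar> \<le> L * \<bar>\<xi> - t\<bar>"
      using field_differentiable_bound[of UNIV g' g'' L \<xi> t] g' L(1) by (auto simp: has_field_derivative_at_within)
    also have "\<dots> \<le> L * \<bar>r\<bar>" using \<xi>(1,2) L(2) by (intro mult_left_mono) (auto simp: a_def b_def)
    finally have "r * (g' \<xi> - g' t) \<le> \<bar>r\<bar> * (L * \<bar>r\<bar>)"
      by (metis abs_ge_self abs_ge_zero abs_mult mult_left_mono order_trans)
    then have "r * (g' \<xi> - g' t) \<le> L * r\<^sup>2" by (simp add: power2_eq_square mult_ac abs_mult_self_eq flip: abs_mult)
    then show ?thesis using eq by (simp add: algebra_simps)
  qed simp
  have "0 \<le> g t + g' t * (- (g' t / (2 * L))) + L * (- (g' t / (2 * L)))\<^sup>2"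
    using le[of "- (g' t / (2 * L))"] nn[of "t + - (g' t / (2 * L))"] by linarith
  also have "\<dots> = g t - (g' t)\<^sup>2 / (4 * L)" using L(2) by (simp add: field_simps power2_eq_square)
  finally show ?thesis using L(2) by (simp add: field_simps)
qed

lemma ddir2_unique:
  assumes f: "smooth_fun f" and d: "((\<lambda>t. ddir f (x + t *\<^sub>R h) h) has_real_derivative D) (at 0)"
  shows "ddir2 f x h = D"
  using DERIV_unique[OF DERIV_ddir_along_line[OF f, of x h 0] d] by simp

lemma ddir_mult:
  assumes "smooth_fun f" "smooth_fun g"
  shows "ddir (\<lambda>x. f x * g x) x h = f x * ddir g x h + ddir f x h * g x"
  by (rule ddir_unique) (intro has_derivative_mult has_derivative_ddir assms)

lemma ddir2_mult:
  assumes f: "smooth_fun f" and g: "smooth_fun g"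
  shows "ddir2 (\<lambda>x. f x * g x) x h = f x * ddir2 g x h + 2 * ddir f x h * ddir g x h + ddir2 f x h * g x"
proof (rule ddir2_unique[OF smooth_fun_mult[OF f g]])
  have "((\<lambda>t. f (x + t *\<^sub>R h) * ddir g (x + t *\<^sub>R h) h + ddir f (x + t *\<^sub>R h) h * g (x + t *\<^sub>R h)) has_real_derivative
      (ddir f (x + 0 *\<^sub>R h) h * ddir g (x + 0 *\<^sub>R h) h + ddir2 g (x + 0 *\<^sub>R h) h * f (x + 0 *\<^sub>R h)) +
      (ddir2 f (x + 0 *\<^sub>R h) h * g (x + 0 *\<^sub>R h) + ddir g (x + 0 *\<^sub>R h) h * ddir f (x + 0 *\<^sub>R h) h)) (at 0)"
    by (intro DERIV_add DERIV_mult DERIV_along_line DERIV_ddir_along_line f g)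
  then show "((\<lambda>t. ddir (\<lambda>x. f x * g x) (x + t *\<^sub>R h) h) has_real_derivative
      f x * ddir2 g x h + 2 * ddir f x h * ddir g x h + ddir2 f x h * g x) (at 0)"
    by (simp add: ddir_mult[OF f g] algebra_simps)
qed

section \<open>Averages against the stable weight\<close>

lemma integrable_of_nn_integral_le:
  fixes f :: "'a \<Rightarrow> real"
  assumes "f \<in> borel_measurable M" "\<And>x. 0 \<le> f x" "(\<integral>\<^sup>+x. ennreal (f x) \<partial>M) \<le> ennreal K" "0 \<le> K"
  shows "integrable M f" "(\<integral>x. f x \<partial>M) \<le> K"
proof -
  show i: "integrable M f"
    using assms by (intro integrableI_nonneg) (auto intro: le_less_trans)
  show "(\<integral>x. f x \<partial>M) \<le> K"
    using assms nn_integral_eq_integral[OF i] by (simp add: ennreal_le_iff)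
qed

text \<open>Read G \<tau> as \<open>gauss \<tau> x\<close> and p as x . g; then \<open>B t\<close>
  is the tilted potential at x minus its heat flow at time t. With \<sigma> = t + \<tau> the two
  time windows cancel except for three pieces: [e, e+t), the main term; [4r, 4r+t], where G \<le> A;
  and the damping of the slope, which costs |p| t G/\<sigma>. Integrated against t^(-1-s) they yield
  a positive multiple of Q, a multiple of A, and |p|/(1-s) times Q with a further multiple of
  A.\<close>

lemma stable_average_lower_bound:
  fixes G :: "real \<Rightarrow> real"
  assumes s: "0 < s" "s < 1" and e: "0 < e" "e < r" and p: "\<bar>p\<bar> \<le> 1/2"
    and G[measurable]: "G \<in> borel_measurable borel" and nn: "\<And>t. 0 \<le> G t"
    and A: "\<And>t. r \<le> t \<Longrightarrow> G t \<le> A" and A': "\<And>t. e \<le> t \<Longrightarrow> G t \<le> A'"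
    and B: "\<And>t. 0 < t \<Longrightarrow> B t = (\<integral>\<tau>. indicator {e..4 * r} \<tau> * ((1 + p) * G \<tau> - (1 + \<tau> / (t + \<tau>) * p) * G (t + \<tau>)) \<partial>lborel)"
    and int: "integrable lborel (\<lambda>t. stable_weight s t * B t)"
  shows "(2 powr (- 2 - s) - \<bar>p\<bar> / (1 - s)) * (\<integral>\<tau>. indicator {e..r} \<tau> * (\<tau> powr (- s) * G \<tau>) \<partial>lborel)
      - (3/2 * ((2 * r) powr (1 - s) / (1 - s)) + 5 / 2 * r powr (1 - s) / (1 - s) + 6 * r * ((2 * r) powr (- s) / s)) * A
    \<le> (\<integral>t. stable_weight s t * B t \<partial>lborel)"
proof -
  have r: "0 < r" using e by simp
  have A0: "0 \<le> A" using A[of r] nn[of r] by linarith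
  have A0': "0 \<le> A'" using A'[of r] nn[of r] e by linarith
  define Q where "Q = (\<integral>\<tau>. indicator {e..r} \<tau> * (\<tau> powr (- s) * G \<tau>) \<partial>lborel)"
  \<comment> \<open>From time e on G is bounded, so bounded weights supported in [e, L] are
    integrable against it.\<close>
  have iG: "integrable lborel (\<lambda>\<sigma>. k \<sigma> * G \<sigma>)"
    if [measurable]: "k \<in> borel_measurable borel" and k: "\<And>\<sigma>. \<bar>k \<sigma>\<bar> \<le> c * indicator {e..L} \<sigma>" for k c L
  proof (rule Bochner_Integration.integrable_bound)
    show "integrable lborel (\<lambda>\<sigma>. (c * A') * indicator {e..L} \<sigma>)"
      by (intro integrable_mult_right integrable_real_indicator) (auto simp: emeasure_lborel_Icc_eq)
    show "AE \<sigma> in lborel. norm (k \<sigma> * G \<sigma>) \<le> norm ((c * A') * indicator {e..L} \<sigma>)"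
    proof (rule AE_I2)
      fix \<sigma>
      show "norm (k \<sigma> * G \<sigma>) \<le> norm ((c * A') * indicator {e..L} \<sigma>)"
      proof (cases "\<sigma> \<in> {e..L}")
        case True
        then have "\<bar>k \<sigma>\<bar> * G \<sigma> \<le> c * A'"
          using k[of \<sigma>] A'[of \<sigma>] nn[of \<sigma>] by (intro mult_mono) auto
        then have "\<bar>k \<sigma>\<bar> * G \<sigma> \<le> \<bar>c * A'\<bar>" by linarith
        then show ?thesis using True nn[of \<sigma>] by (simp add: abs_mult)
      next
        case False
        then show ?thesis using k[of \<sigma>] by simp
      qed
    qed
  qed measurable
  \<comment> \<open>\<open>a\<close> is the main term; \<open>b1\<close> and \<open>b2\<close> carry
    the errors for t \<le> 2r, from the upper end of the window and from the damped slope;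
    \<open>b3\<close> is the tail. Cutting at 2r leaves room for t in [\<sigma>, 2\<sigma>] whenever
    \<sigma> \<le> r.\<close>
  define a where "a = (\<lambda>t. indicator {0<..2*r} t * t powr (- 1 - s) * (\<integral>\<sigma>. indicator {e..<e+t} \<sigma> * G \<sigma> \<partial>lborel))"
  define b1 where "b1 = (\<lambda>t. indicator {0<..2*r} t * t powr (- s))"
  define b2 where "b2 = (\<lambda>t. indicator {0<..2*r} t * t powr (- s) * (\<integral>\<sigma>. indicator {e+t..4*r+t} \<sigma> / \<sigma> * G \<sigma> \<partial>lborel))"
  define b3 where "b3 = (\<lambda>t. indicator {2*r<..} t * t powr (- 1 - s))"
  define E where "E = (\<lambda>t. 3/2 * A * b1 t + \<bar>p\<bar> * b2 t + 6 * r * A * b3 t)"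
  have [measurable]: "a \<in> borel_measurable borel" "b1 \<in> borel_measurable borel"
    "b2 \<in> borel_measurable borel" "b3 \<in> borel_measurable borel"
    unfolding a_def b1_def b2_def b3_def atLeastAtMost_iff atLeastLessThan_iff indicator_def of_bool_def by measurable
  have nna: "0 \<le> a t" "0 \<le> b1 t" "0 \<le> b2 t" "0 \<le> b3 t" for t
    unfolding a_def b1_def b2_def b3_def using nn e
    by (auto intro!: mult_nonneg_nonneg integral_nonneg_AE AE_I2 simp: indicator_def)
  have key: "1/2 * a t \<le> stable_weight s t * B t + E t" for t
  proof -
    consider "t \<le> 0" | "0 < t" "t \<le> 2 * r" | "t > 2 * r" by linarith
    then show ?thesis
    proof cases
      case 1
      then show ?thesis using r by (simp add: stable_weight_def a_def E_def b1_def b2_def b3_def)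
    next
      case 2
      have sw: "stable_weight s t = t powr (- 1 - s)" using 2 by (simp add: stable_weight_def)
      have ts: "t powr (- 1 - s) * t = t powr (- s)" using 2 powr_add[of t "- 1 - s" 1] by simp
      have i1: "integrable lborel (\<lambda>\<tau>. (indicator {e..4*r} \<tau> * (1 + p)) * G \<tau>)"
        by (rule iG[where c="\<bar>1 + p\<bar>" and L="4*r"]) (auto simp: indicator_def)
      have i2: "integrable lborel (\<lambda>\<sigma>. (indicator {e+t..4*r+t} \<sigma> * (1 + (\<sigma> - t) / \<sigma> * p)) * G \<sigma>)"
      proof (rule iG[where c="3/2" and L="4*r+t"])
        fix \<sigma>
        show "\<bar>indicator {e+t..4*r+t} \<sigma> * (1 + (\<sigma> - t) / \<sigma> * p)\<bar> \<le> 3/2 * indicator {e..4*r+t} \<sigma>"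
        proof (cases "\<sigma> \<in> {e+t..4*r+t}")
          case True
          then have "0 \<le> (\<sigma> - t) / \<sigma>" "(\<sigma> - t) / \<sigma> \<le> 1" using e 2 by auto
          then have "\<bar>(\<sigma> - t) / \<sigma> * p\<bar> \<le> 1 * (1/2)" unfolding abs_mult using p by (intro mult_mono) auto
          then have "\<bar>1 + (\<sigma> - t) / \<sigma> * p\<bar> \<le> 3/2" by linarith
          then show ?thesis using True 2 by simp
        qed simp
      qed measurable
      have sh: "(\<integral>\<tau>. indicator {e..4*r} \<tau> * ((1 + \<tau> / (t + \<tau>) * p) * G (t + \<tau>)) \<partial>lborel) =
          (\<integral>\<sigma>. (indicator {e+t..4*r+t} \<sigma> * (1 + (\<sigma> - t) / \<sigma> * p)) * G \<sigma> \<partial>lborel)"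
        and ish: "integrable lborel (\<lambda>\<tau>. indicator {e..4*r} \<tau> * ((1 + \<tau> / (t + \<tau>) * p) * G (t + \<tau>)))"
      proof -
        have *: "has_bochner_integral lborel (\<lambda>\<tau>. (indicator {e+t..4*r+t} (t + \<tau>) * (1 + (t + \<tau> - t) / (t + \<tau>) * p)) * G (t + \<tau>))
          (\<integral>\<sigma>. (indicator {e+t..4*r+t} \<sigma> * (1 + (\<sigma> - t) / \<sigma> * p)) * G \<sigma> \<partial>lborel)"
          by (rule has_bochner_integral_lborel_shift[OF has_bochner_integral_integrable[OF i2]])
        have eq: "(\<lambda>\<tau>. (indicator {e+t..4*r+t} (t + \<tau>) * (1 + (t + \<tau> - t) / (t + \<tau>) * p)) * G (t + \<tau>)) =
            (\<lambda>\<tau>. indicator {e..4*r} \<tau> * ((1 + \<tau> / (t + \<tau>) * p) * G (t + \<tau>)))"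
          by (auto simp: indicator_def)
        have "has_bochner_integral lborel (\<lambda>\<tau>. indicator {e..4*r} \<tau> * ((1 + \<tau> / (t + \<tau>) * p) * G (t + \<tau>)))
          (\<integral>\<sigma>. (indicator {e+t..4*r+t} \<sigma> * (1 + (\<sigma> - t) / \<sigma> * p)) * G \<sigma> \<partial>lborel)"
          using * unfolding eq .
        then show "(\<integral>\<tau>. indicator {e..4*r} \<tau> * ((1 + \<tau> / (t + \<tau>) * p) * G (t + \<tau>)) \<partial>lborel) =
          (\<integral>\<sigma>. (indicator {e+t..4*r+t} \<sigma> * (1 + (\<sigma> - t) / \<sigma> * p)) * G \<sigma> \<partial>lborel)"
          "integrable lborel (\<lambda>\<tau>. indicator {e..4*r} \<tau> * ((1 + \<tau> / (t + \<tau>) * p) * G (t + \<tau>)))"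
          unfolding has_bochner_integral_iff by blast+
      qed
      have Bt: "B t = (\<integral>\<sigma>. (indicator {e..4*r} \<sigma> * (1 + p)) * G \<sigma> \<partial>lborel)
          - (\<integral>\<sigma>. (indicator {e+t..4*r+t} \<sigma> * (1 + (\<sigma> - t) / \<sigma> * p)) * G \<sigma> \<partial>lborel)"
        unfolding sh[symmetric]
        using i1 ish by (subst Bochner_Integration.integral_diff[symmetric]) (auto simp: B[OF 2(1)] algebra_simps)
      have j1: "integrable lborel (\<lambda>\<sigma>. indicator {e..<e+t} \<sigma> * G \<sigma>)"
        by (rule iG[where c=1 and L="e+t"]) (auto simp: indicator_def)
      have j2: "integrable lborel (\<lambda>\<sigma>. indicator {4*r..4*r+t} \<sigma> * G \<sigma>)"
        by (rule iG[where c=1 and L="4*r+t"]) (use e in \<open>auto simp: indicator_def\<close>)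
      have j3: "integrable lborel (\<lambda>\<sigma>. indicator {e+t..4*r+t} \<sigma> / \<sigma> * G \<sigma>)"
        by (rule iG[where c="1/e" and L="4*r+t"]) (use e 2 in \<open>auto simp: indicator_def divide_simps\<close>)
      have "1/2 * (\<integral>\<sigma>. indicator {e..<e+t} \<sigma> * G \<sigma> \<partial>lborel) \<le> B t +
          (3/2 * (\<integral>\<sigma>. indicator {4*r..4*r+t} \<sigma> * G \<sigma> \<partial>lborel)
          + \<bar>p\<bar> * t * (\<integral>\<sigma>. indicator {e+t..4*r+t} \<sigma> / \<sigma> * G \<sigma> \<partial>lborel))"
      proof -
        define F1 where "F1 = (\<lambda>\<sigma>. indicator {e..<e+t} \<sigma> * G \<sigma>)"
        define F2 where "F2 = (\<lambda>\<sigma>. (indicator {e+t..4*r+t} \<sigma> * (1 + (\<sigma> - t) / \<sigma> * p)) * G \<sigma>)"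
        define F3 where "F3 = (\<lambda>\<sigma>. (indicator {e..4*r} \<sigma> * (1 + p)) * G \<sigma>)"
        define F4 where "F4 = (\<lambda>\<sigma>. indicator {4*r..4*r+t} \<sigma> * G \<sigma>)"
        define F5 where "F5 = (\<lambda>\<sigma>. indicator {e+t..4*r+t} \<sigma> / \<sigma> * G \<sigma>)"
        note defs = F1_def F2_def F3_def F4_def F5_def
        have iF: "integrable lborel F1" "integrable lborel F2" "integrable lborel F3" "integrable lborel F4" "integrable lborel F5"
          unfolding defs by (fact j1 i2 i1 j2 j3)+
        have "(\<integral>\<sigma>. 1/2 * F1 \<sigma> + F2 \<sigma> \<partial>lborel) \<le> (\<integral>\<sigma>. F3 \<sigma> + 3/2 * F4 \<sigma> + \<bar>p\<bar> * t * F5 \<sigma> \<partial>lborel)"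
        proof (rule integral_mono)
          fix \<sigma>
          \<comment> \<open>Comparison of the weights in front of G. Where the windows overlap they
            differ by p t/\<sigma>; the factors 1/2 and 3/2 are the bounds for 1 + p.\<close>
          have pt: "1/2 * indicator {e..<e+t} \<sigma> + indicator {e+t..4*r+t} \<sigma> * (1 + (\<sigma> - t) / \<sigma> * p)
            \<le> indicator {e..4*r} \<sigma> * (1 + p) + 3/2 * indicator {4*r..4*r+t} \<sigma>
              + \<bar>p\<bar> * t * (indicator {e+t..4*r+t} \<sigma> / \<sigma>)"
          proof (cases "\<sigma> \<in> {e+t..4*r+t}")
            case True
            then have \<sigma>: "\<sigma> > 0" "e + t \<le> \<sigma>" "\<sigma> \<le> 4 * r + t" using e 2 by auto
            have "(\<sigma> - t) / \<sigma> * p = p - p * t / \<sigma>" using \<sigma> by (simp add: field_simps)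
            moreover have "- p * t / \<sigma> \<le> \<bar>p\<bar> * t / \<sigma>"
              using \<sigma> 2 by (intro divide_right_mono mult_right_mono) auto
            ultimately have "1 + (\<sigma> - t) / \<sigma> * p \<le> 1 + p + \<bar>p\<bar> * t / \<sigma>" by linarith
            moreover have "1 + p \<le> indicator {e..4*r} \<sigma> * (1 + p) + 3/2 * indicator {4*r..4*r+t} \<sigma>"
              using \<sigma> e 2 p by (auto simp: indicator_def)
            ultimately show ?thesis using True by simp
          next
            case False
            then show ?thesis using e 2 p by (auto simp: indicator_def)
          qed
          show "1/2 * F1 \<sigma> + F2 \<sigma> \<le> F3 \<sigma> + 3/2 * F4 \<sigma> + \<bar>p\<bar> * t * F5 \<sigma>"
            unfolding defs using mult_right_mono[OF pt nn[of \<sigma>]] by (simp only: distrib_right mult.assoc)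
        qed (intro Bochner_Integration.integrable_add integrable_mult_right iF)+
        then show ?thesis unfolding Bt defs[symmetric] using iF by simp
      qed
      also have "(\<integral>\<sigma>. indicator {4*r..4*r+t} \<sigma> * G \<sigma> \<partial>lborel) \<le> A * t"
      proof -
        have "(\<integral>\<sigma>. indicator {4*r..4*r+t} \<sigma> * G \<sigma> \<partial>lborel) \<le> (\<integral>\<sigma>. A * indicator {4*r..4*r+t} \<sigma> \<partial>lborel)"
        proof (rule integral_mono[OF j2])
          show "integrable lborel (\<lambda>\<sigma>. A * indicator {4*r..4*r+t} \<sigma>)"
            by (intro integrable_mult_right integrable_real_indicator) (auto simp: emeasure_lborel_Icc_eq)
        qed (use A r in \<open>auto simp: indicator_def\<close>)
        also have "\<dots> = A * t" using 2 by simp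
        finally show ?thesis .
      qed
      finally have "1/2 * (\<integral>\<sigma>. indicator {e..<e+t} \<sigma> * G \<sigma> \<partial>lborel) \<le> B t +
          (3/2 * (A * t) + \<bar>p\<bar> * t * (\<integral>\<sigma>. indicator {e+t..4*r+t} \<sigma> / \<sigma> * G \<sigma> \<partial>lborel))"
        by simp
      from mult_left_mono[OF this, of "t powr (- 1 - s)"]
      have "1/2 * (t powr (- 1 - s) * (\<integral>\<sigma>. indicator {e..<e+t} \<sigma> * G \<sigma> \<partial>lborel)) \<le> t powr (- 1 - s) * B t +
          (3/2 * A * (t powr (- 1 - s) * t) + \<bar>p\<bar> * ((t powr (- 1 - s) * t) * (\<integral>\<sigma>. indicator {e+t..4*r+t} \<sigma> / \<sigma> * G \<sigma> \<partial>lborel)))"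
        by (simp add: algebra_simps)
      then show ?thesis
        unfolding ts using 2 by (simp add: sw a_def E_def b1_def b2_def b3_def)
    next
      case 3
      \<comment> \<open>For large t no cancellation is used: the first integral is nonnegative, and
        the heat flow is at most 3/2 A times a window of length at most 4r, that is 6 r A.\<close>
      have sw: "stable_weight s t = t powr (- 1 - s)" using 3 r by (simp add: stable_weight_def)
      have t0: "t > 0" using 3 r by simp
      have i1: "integrable lborel (\<lambda>\<tau>. (indicator {e..4*r} \<tau> * (1 + p)) * G \<tau>)"
        by (rule iG[where c="\<bar>1 + p\<bar>" and L="4*r"]) (auto simp: indicator_def)
      have pt: "(1 + \<tau> / (t + \<tau>) * p) * G (t + \<tau>) \<le> 3/2 * A" "0 \<le> (1 + \<tau> / (t + \<tau>) * p) * G (t + \<tau>)"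
        if "\<tau> \<in> {e..4*r}" for \<tau>
      proof -
        have "0 \<le> \<tau> / (t + \<tau>)" "\<tau> / (t + \<tau>) \<le> 1" using that e t0 by auto
        then have "\<bar>\<tau> / (t + \<tau>)\<bar> \<le> 1" by linarith
        then have "\<bar>\<tau> / (t + \<tau>) * p\<bar> \<le> 1 * (1/2)" unfolding abs_mult using p by (rule mult_mono) auto
        then have "0 \<le> 1 + \<tau> / (t + \<tau>) * p" "1 + \<tau> / (t + \<tau>) * p \<le> 3/2" by linarith+
        moreover have "G (t + \<tau>) \<le> A" using that e 3 r by (intro A) auto
        ultimately show "(1 + \<tau> / (t + \<tau>) * p) * G (t + \<tau>) \<le> 3/2 * A" "0 \<le> (1 + \<tau> / (t + \<tau>) * p) * G (t + \<tau>)"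
          using nn[of "t + \<tau>"] by (blast intro: mult_mono mult_nonneg_nonneg order_trans[of 0 "1 + \<tau> / (t + \<tau>) * p"])+
      qed
      have i2: "integrable lborel (\<lambda>\<tau>. indicator {e..4*r} \<tau> * ((1 + \<tau> / (t + \<tau>) * p) * G (t + \<tau>)))"
      proof (rule Bochner_Integration.integrable_bound)
        show "integrable lborel (\<lambda>\<tau>. (3/2 * A) * indicator {e..4*r} \<tau>)"
          by (intro integrable_mult_right integrable_real_indicator) (auto simp: emeasure_lborel_Icc_eq)
        show "AE \<tau> in lborel. norm (indicator {e..4*r} \<tau> * ((1 + \<tau> / (t + \<tau>) * p) * G (t + \<tau>))) \<le> norm ((3/2 * A) * indicator {e..4*r} \<tau>)"
          using pt A0 by (intro AE_I2) (auto simp: indicator_def)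
      qed measurable
      have Bt: "B t = (\<integral>\<tau>. (indicator {e..4*r} \<tau> * (1 + p)) * G \<tau> \<partial>lborel)
          - (\<integral>\<tau>. indicator {e..4*r} \<tau> * ((1 + \<tau> / (t + \<tau>) * p) * G (t + \<tau>)) \<partial>lborel)"
        using i1 i2 by (subst Bochner_Integration.integral_diff[symmetric]) (auto simp: B[OF t0] algebra_simps)
      have "0 \<le> (\<integral>\<tau>. (indicator {e..4*r} \<tau> * (1 + p)) * G \<tau> \<partial>lborel)"
        using p nn by (intro integral_nonneg_AE AE_I2) auto
      moreover have "(\<integral>\<tau>. indicator {e..4*r} \<tau> * ((1 + \<tau> / (t + \<tau>) * p) * G (t + \<tau>)) \<partial>lborel) \<le> (\<integral>\<tau>. (3/2 * A) * indicator {e..4*r} \<tau> \<partial>lborel)"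
        using pt by (intro integral_mono i2 integrable_mult_right integrable_real_indicator) (auto simp: emeasure_lborel_Icc_eq split: split_indicator)
      moreover have "(\<integral>\<tau>. (3/2 * A) * indicator {e..4*r} \<tau> \<partial>lborel) \<le> 6 * r * A"
      proof -
        have "(\<integral>\<tau>. (3/2 * A) * indicator {e..4*r} \<tau> \<partial>lborel) = (3/2 * A) * (4 * r - e)" using e by simp
        also have "\<dots> \<le> (3/2 * A) * (4 * r)" using A0 e by (intro mult_left_mono) auto
        finally show ?thesis by (simp add: algebra_simps)
      qed
      ultimately have "0 \<le> B t + 6 * r * A" unfolding Bt by linarith
      then have "0 \<le> t powr (- 1 - s) * (B t + 6 * r * A)" by simp
      then show ?thesis
        using 3 r by (simp add: sw a_def E_def b1_def b2_def b3_def algebra_simps)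
    qed
  qed
  have nb1: "(\<integral>\<^sup>+t. ennreal (b1 t) \<partial>lborel) \<le> ennreal ((2*r) powr (1 - s) / (1 - s))"
  proof -
    have "(\<integral>\<^sup>+t. ennreal (b1 t) \<partial>lborel) \<le> (\<integral>\<^sup>+t. ennreal (t powr (- s)) * indicator {0..2*r} t \<partial>lborel)"
      by (intro nn_integral_mono) (auto simp: b1_def indicator_def)
    also have "\<dots> = ennreal ((2*r) powr (- s + 1) / (- s + 1))"
      using s r by (intro nn_integral_powr_from_0) auto
    finally show ?thesis by simp
  qed
  have nb3: "(\<integral>\<^sup>+t. ennreal (b3 t) \<partial>lborel) \<le> ennreal ((2*r) powr (- s) / s)"
  proof -
    have "(\<integral>\<^sup>+t. ennreal (b3 t) \<partial>lborel) \<le> (\<integral>\<^sup>+t. ennreal (t powr (- 1 - s)) * indicator {2*r..} t \<partial>lborel)"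
      by (intro nn_integral_mono) (auto simp: b3_def indicator_def)
    also have "\<dots> = ennreal (- ((2*r) powr (- 1 - s + 1)) / (- 1 - s + 1))"
      using s r by (intro nn_integral_powr_to_inf) auto
    finally show ?thesis by simp
  qed
  have iQ: "integrable lborel (\<lambda>\<tau>. indicator {e..r} \<tau> * (\<tau> powr (- s) * G \<tau>))"
  proof -
    have "integrable lborel (\<lambda>\<tau>. (indicator {e..r} \<tau> * \<tau> powr (- s)) * G \<tau>)"
    proof (rule iG[where c="e powr (- s)" and L=r])
      fix \<sigma>
      show "\<bar>indicator {e..r} \<sigma> * \<sigma> powr (- s)\<bar> \<le> e powr (- s) * indicator {e..r} \<sigma>"
        using e s by (auto simp: indicator_def intro!: powr_mono2')
    qed measurable
    then show ?thesis by (simp add: mult.assoc)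
  qed
  have Q0: "0 \<le> Q" unfolding Q_def using nn by (intro integral_nonneg_AE AE_I2) auto
  have nQ: "(\<integral>\<^sup>+\<tau>. ennreal (indicator {e..r} \<tau> * (\<tau> powr (- s) * G \<tau>)) \<partial>lborel) = ennreal Q"
    unfolding Q_def using iQ nn by (intro nn_integral_eq_integral AE_I2) auto
  \<comment> \<open>Tonelli: for fixed \<sigma> the condition \<sigma> \<ge> e + t forces t \<le>
    \<sigma>, and the integral of t^(-s) over [0, \<sigma>] divided by \<sigma> is
    \<sigma>^(-s)/(1-s). The part \<sigma> \<le> r reproduces Q; the part in [r, 6r], of length 5r,
    is charged to A.\<close>
  have nb2: "(\<integral>\<^sup>+t. ennreal (b2 t) \<partial>lborel) \<le> ennreal ((Q + 5 * r * r powr (- s) * A) / (1 - s))"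
  proof -
    have "(\<integral>\<^sup>+t. ennreal (b2 t) \<partial>lborel) =
        (\<integral>\<^sup>+t. \<integral>\<^sup>+\<sigma>. ennreal (indicator {0<..2*r} t * t powr (- s) * (indicator {e+t..4*r+t} \<sigma> / \<sigma> * G \<sigma>)) \<partial>lborel \<partial>lborel)"
    proof (rule nn_integral_cong)
      fix t :: real
      show "ennreal (b2 t) = (\<integral>\<^sup>+\<sigma>. ennreal (indicator {0<..2*r} t * t powr (- s) * (indicator {e+t..4*r+t} \<sigma> / \<sigma> * G \<sigma>)) \<partial>lborel)"
      proof (cases "t \<in> {0<..2*r}")
        case True
        have j3: "integrable lborel (\<lambda>\<sigma>. indicator {e+t..4*r+t} \<sigma> / \<sigma> * G \<sigma>)"
          by (rule iG[where c="1/e" and L="4*r+t"]) (use e True in \<open>auto simp: indicator_def divide_simps\<close>)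
        have F0: "0 \<le> indicator {e+t..4*r+t} \<sigma> / \<sigma> * G \<sigma>" for \<sigma>
          using nn[of \<sigma>] e True by (auto simp: indicator_def)
        have k0: "0 \<le> indicator {0<..2*r} t * t powr (- s)" by simp
        have "integrable lborel (\<lambda>\<sigma>. indicator {0<..2*r} t * t powr (- s) * (indicator {e+t..4*r+t} \<sigma> / \<sigma> * G \<sigma>))"
          by (rule integrable_mult_right[OF j3])
        then have "(\<integral>\<^sup>+\<sigma>. ennreal (indicator {0<..2*r} t * t powr (- s) * (indicator {e+t..4*r+t} \<sigma> / \<sigma> * G \<sigma>)) \<partial>lborel) =
            ennreal (\<integral>\<sigma>. indicator {0<..2*r} t * t powr (- s) * (indicator {e+t..4*r+t} \<sigma> / \<sigma> * G \<sigma>) \<partial>lborel)"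
          by (rule nn_integral_eq_integral) (intro AE_I2 mult_nonneg_nonneg[OF k0 F0])
        then show ?thesis
          unfolding b2_def by (simp only: integral_mult_right_zero)
      qed (simp add: b2_def)
    qed
    also have "\<dots> = (\<integral>\<^sup>+\<sigma>. \<integral>\<^sup>+t. ennreal (indicator {0<..2*r} t * t powr (- s) * (indicator {e+t..4*r+t} \<sigma> / \<sigma> * G \<sigma>)) \<partial>lborel \<partial>lborel)"
      unfolding atLeastAtMost_iff indicator_def of_bool_def by (rule lborel_pair.Fubini') measurable
    also have "\<dots> \<le> (\<integral>\<^sup>+\<sigma>. ennreal (1 / (1 - s)) * ennreal (indicator {e..r} \<sigma> * (\<sigma> powr (- s) * G \<sigma>)
        + r powr (- s) * A * indicator {r..6*r} \<sigma>) \<partial>lborel)"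
    proof (rule nn_integral_mono)
      fix \<sigma> :: real
      show "(\<integral>\<^sup>+t. ennreal (indicator {0<..2*r} t * t powr (- s) * (indicator {e+t..4*r+t} \<sigma> / \<sigma> * G \<sigma>)) \<partial>lborel)
        \<le> ennreal (1 / (1 - s)) * ennreal (indicator {e..r} \<sigma> * (\<sigma> powr (- s) * G \<sigma>) + r powr (- s) * A * indicator {r..6*r} \<sigma>)"
      proof (cases "\<sigma> \<in> {e..6*r}")
        case True
        then have \<sigma>: "\<sigma> > 0" using e by auto
        have "(\<integral>\<^sup>+t. ennreal (indicator {0<..2*r} t * t powr (- s) * (indicator {e+t..4*r+t} \<sigma> / \<sigma> * G \<sigma>)) \<partial>lborel)
          \<le> (\<integral>\<^sup>+t. ennreal (G \<sigma> / \<sigma>) * (ennreal (t powr (- s)) * indicator {0..\<sigma>} t) \<partial>lborel)"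
          using nn[of \<sigma>] e \<sigma> by (intro nn_integral_mono) (auto simp: indicator_def ennreal_mult[symmetric] mult_ac)
        also have "\<dots> = ennreal (G \<sigma> / \<sigma>) * ennreal (\<sigma> powr (- s + 1) / (- s + 1))"
          using s \<sigma> by (subst nn_integral_cmult) (auto simp: nn_integral_powr_from_0)
        also have "\<dots> = ennreal (1 / (1 - s) * (\<sigma> powr (- s) * G \<sigma>))"
        proof -
          have "\<sigma> powr (- s + 1) = \<sigma> powr (- s) * \<sigma>" using \<sigma> powr_add[of \<sigma> "- s" 1] by simp
          then have "G \<sigma> / \<sigma> * (\<sigma> powr (- s + 1) / (- s + 1)) = 1 / (1 - s) * (\<sigma> powr (- s) * G \<sigma>)"
            using \<sigma> s by (simp only:) (simp add: field_simps)
          then show ?thesis using nn[of \<sigma>] \<sigma> s by (subst ennreal_mult[symmetric]) auto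
        qed
        also have "\<dots> \<le> ennreal (1 / (1 - s) * (indicator {e..r} \<sigma> * (\<sigma> powr (- s) * G \<sigma>) + r powr (- s) * A * indicator {r..6*r} \<sigma>))"
        proof (intro ennreal_leI mult_left_mono)
          show "\<sigma> powr (- s) * G \<sigma> \<le> indicator {e..r} \<sigma> * (\<sigma> powr (- s) * G \<sigma>) + r powr (- s) * A * indicator {r..6*r} \<sigma>"
          proof (cases "\<sigma> \<le> r")
            case False
            then have "\<sigma> powr (- s) * G \<sigma> \<le> r powr (- s) * A"
              using A[of \<sigma>] nn[of \<sigma>] s r by (intro mult_mono powr_mono2') auto
            then show ?thesis using True False by simp
          next
            case le: True
            have "0 \<le> r powr (- s) * A * indicator {r..6*r} \<sigma>" using A0 by simp
            then show ?thesis using True le by simp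
          qed
        qed (use s in auto)
        also have "\<dots> = ennreal (1 / (1 - s)) * ennreal (indicator {e..r} \<sigma> * (\<sigma> powr (- s) * G \<sigma>) + r powr (- s) * A * indicator {r..6*r} \<sigma>)"
          using s nn[of \<sigma>] A0 by (intro ennreal_mult) auto
        finally show ?thesis .
      next
        case False
        then have "indicator {0<..2*r} t * t powr (- s) * (indicator {e+t..4*r+t} \<sigma> / \<sigma> * G \<sigma>) = 0" for t
          by (auto simp: indicator_def)
        then have "(\<integral>\<^sup>+t. ennreal (indicator {0<..2*r} t * t powr (- s) * (indicator {e+t..4*r+t} \<sigma> / \<sigma> * G \<sigma>)) \<partial>lborel) = (\<integral>\<^sup>+t. 0 \<partial>(lborel :: real measure))"
          by (intro nn_integral_cong) (simp only: ennreal_0)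
        then show ?thesis by simp
      qed
    qed
    also have "\<dots> = ennreal (1 / (1 - s)) * (ennreal Q + ennreal (r powr (- s) * A * (5 * r)))"
    proof -
      have "(\<integral>\<^sup>+\<sigma>. ennreal (indicator {e..r} \<sigma> * (\<sigma> powr (- s) * G \<sigma>) + r powr (- s) * A * indicator {r..6*r} \<sigma>) \<partial>lborel)
          = (\<integral>\<^sup>+\<sigma>. ennreal (indicator {e..r} \<sigma> * (\<sigma> powr (- s) * G \<sigma>)) + ennreal (r powr (- s) * A) * indicator {r..6*r} \<sigma> \<partial>lborel)"
        using nn A0 by (intro nn_integral_cong) (simp add: ennreal_plus ennreal_mult ennreal_indicator)
      also have "\<dots> = ennreal Q + ennreal (r powr (- s) * A) * emeasure lborel {r..6*r}"
        by (subst nn_integral_add) (auto simp: nQ nn_integral_cmult_indicator)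
      also have "ennreal (r powr (- s) * A) * emeasure lborel {r..6*r} = ennreal (r powr (- s) * A * (5 * r))"
        using r A0 by (simp add: ennreal_mult[symmetric])
      finally show ?thesis by (subst nn_integral_cmult) auto
    qed
    also have "\<dots> = ennreal ((Q + 5 * r * r powr (- s) * A) / (1 - s))"
      using s Q0 r A0 by (simp add: ennreal_plus[symmetric] ennreal_mult[symmetric] mult_ac del: ennreal_plus)
    finally show ?thesis .
  qed
  \<comment> \<open>For \<sigma> \<le> r every t in [\<sigma>, 2\<sigma>] satisfies \<sigma> < e + t
    and t \<le> 2r. This range alone contributes at least \<sigma> (2\<sigma>)^(-1-s) = 2^(-1-s)
    \<sigma>^(-s).\<close>
  have na: "ennreal (2 powr (- 1 - s) * Q) \<le> (\<integral>\<^sup>+t. ennreal (a t) \<partial>lborel)"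
  proof -
    have "ennreal (2 powr (- 1 - s) * Q) = (\<integral>\<^sup>+\<sigma>. ennreal (2 powr (- 1 - s)) * ennreal (indicator {e..r} \<sigma> * (\<sigma> powr (- s) * G \<sigma>)) \<partial>lborel)"
      using Q0 by (subst nn_integral_cmult) (auto simp: nQ ennreal_mult)
    also have "\<dots> \<le> (\<integral>\<^sup>+\<sigma>. \<integral>\<^sup>+t. ennreal (indicator {0<..2*r} t * t powr (- 1 - s) * (indicator {e..<e+t} \<sigma> * G \<sigma>)) \<partial>lborel \<partial>lborel)"
    proof (rule nn_integral_mono)
      fix \<sigma> :: real
      show "ennreal (2 powr (- 1 - s)) * ennreal (indicator {e..r} \<sigma> * (\<sigma> powr (- s) * G \<sigma>))
        \<le> (\<integral>\<^sup>+t. ennreal (indicator {0<..2*r} t * t powr (- 1 - s) * (indicator {e..<e+t} \<sigma> * G \<sigma>)) \<partial>lborel)"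
      proof (cases "\<sigma> \<in> {e..r}")
        case True
        then have \<sigma>: "\<sigma> > 0" using e by auto
        have "ennreal (2 powr (- 1 - s)) * ennreal (indicator {e..r} \<sigma> * (\<sigma> powr (- s) * G \<sigma>))
            = ennreal ((2 * \<sigma>) powr (- 1 - s) * G \<sigma> * \<sigma>)"
        proof -
          have "\<sigma> powr (- 1 - s) * \<sigma> = \<sigma> powr (- s)" using \<sigma> powr_add[of \<sigma> "- 1 - s" 1] by simp
          then have "(2 * \<sigma>) powr (- 1 - s) * G \<sigma> * \<sigma> = 2 powr (- 1 - s) * (\<sigma> powr (- s) * G \<sigma>)"
            by (simp add: powr_mult)
          then show ?thesis using True nn[of \<sigma>] by (simp only:) (simp add: ennreal_mult[symmetric])
        qed
        also have "\<dots> = (\<integral>\<^sup>+t. ennreal ((2 * \<sigma>) powr (- 1 - s) * G \<sigma>) * indicator {\<sigma>..2*\<sigma>} t \<partial>lborel)"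
          using \<sigma> nn[of \<sigma>] by (simp add: nn_integral_cmult_indicator ennreal_mult[symmetric])
        also have "\<dots> \<le> (\<integral>\<^sup>+t. ennreal (indicator {0<..2*r} t * t powr (- 1 - s) * (indicator {e..<e+t} \<sigma> * G \<sigma>)) \<partial>lborel)"
        proof (rule nn_integral_mono)
          fix t :: real
          show "ennreal ((2 * \<sigma>) powr (- 1 - s) * G \<sigma>) * indicator {\<sigma>..2*\<sigma>} t
            \<le> ennreal (indicator {0<..2*r} t * t powr (- 1 - s) * (indicator {e..<e+t} \<sigma> * G \<sigma>))"
          proof (cases "t \<in> {\<sigma>..2*\<sigma>}")
            case t: True
            have "(2 * \<sigma>) powr (- 1 - s) \<le> t powr (- 1 - s)"
              using t \<sigma> s by (intro powr_mono2') auto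
            then have "(2 * \<sigma>) powr (- 1 - s) * G \<sigma> \<le> t powr (- 1 - s) * G \<sigma>"
              using nn[of \<sigma>] by (intro mult_right_mono)
            then show ?thesis using t True \<sigma> e by (simp add: ennreal_leI)
          qed simp
        qed
        finally show ?thesis .
      qed simp
    qed
    also have "\<dots> = (\<integral>\<^sup>+t. \<integral>\<^sup>+\<sigma>. ennreal (indicator {0<..2*r} t * t powr (- 1 - s) * (indicator {e..<e+t} \<sigma> * G \<sigma>)) \<partial>lborel \<partial>lborel)"
      unfolding atLeastLessThan_iff indicator_def of_bool_def by (rule lborel_pair.Fubini') measurable
    also have "\<dots> = (\<integral>\<^sup>+t. ennreal (a t) \<partial>lborel)"
    proof (rule nn_integral_cong)
      fix t :: real
      have j1: "integrable lborel (\<lambda>\<sigma>. indicator {e..<e+t} \<sigma> * G \<sigma>)"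
        by (rule iG[where c=1 and L="e+t"]) (auto simp: indicator_def)
      show "(\<integral>\<^sup>+\<sigma>. ennreal (indicator {0<..2*r} t * t powr (- 1 - s) * (indicator {e..<e+t} \<sigma> * G \<sigma>)) \<partial>lborel) = ennreal (a t)"
        unfolding a_def using j1 nn
        by (subst nn_integral_eq_integral) auto
    qed
    finally show ?thesis .
  qed
  have ib: "integrable lborel b1" "(\<integral>t. b1 t \<partial>lborel) \<le> (2*r) powr (1 - s) / (1 - s)"
    "integrable lborel b3" "(\<integral>t. b3 t \<partial>lborel) \<le> (2*r) powr (- s) / s"
    "integrable lborel b2" "(\<integral>t. b2 t \<partial>lborel) \<le> (Q + 5 * r * r powr (- s) * A) / (1 - s)"
    using nb1 nb2 nb3 nna s Q0 r A0
    by (auto intro!: integrable_of_nn_integral_le integrable_of_nn_integral_le(2) divide_nonneg_nonneg add_nonneg_nonneg)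
  have iE: "integrable lborel E" unfolding E_def using ib by simp
  have "ennreal (1/2 * (2 powr (- 1 - s) * Q)) \<le> (\<integral>\<^sup>+t. ennreal (1/2 * a t) \<partial>lborel)"
  proof -
    have "(\<integral>\<^sup>+t. ennreal (1/2 * a t) \<partial>lborel) = ennreal (1/2) * (\<integral>\<^sup>+t. ennreal (a t) \<partial>lborel)"
      using nna by (subst nn_integral_cmult[symmetric]) (auto simp: ennreal_mult[symmetric] simp del: ennreal_half)
    moreover have "ennreal (1/2 * (2 powr (- 1 - s) * Q)) = ennreal (1/2) * ennreal (2 powr (- 1 - s) * Q)"
      using Q0 by (intro ennreal_mult) auto
    ultimately show ?thesis using mult_left_mono[OF na, of "ennreal (1/2)"] by simp
  qed
  also have "\<dots> \<le> (\<integral>\<^sup>+t. ennreal (stable_weight s t * B t + E t) \<partial>lborel)"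
    by (intro nn_integral_mono ennreal_leI key)
  also have "\<dots> = ennreal (\<integral>t. stable_weight s t * B t + E t \<partial>lborel)"
    using int iE key nna by (intro nn_integral_eq_integral AE_I2) (auto intro: order_trans[OF _ key])
  finally have "1/2 * (2 powr (- 1 - s) * Q) \<le> (\<integral>t. stable_weight s t * B t + E t \<partial>lborel)"
  proof (subst (asm) ennreal_le_iff)
    show "0 \<le> (\<integral>t. stable_weight s t * B t + E t \<partial>lborel)"
      using nna by (intro integral_nonneg_AE AE_I2 order_trans[OF _ key]) simp
  qed
  also have "\<dots> = (\<integral>t. stable_weight s t * B t \<partial>lborel) + (\<integral>t. E t \<partial>lborel)"
    by (rule Bochner_Integration.integral_add[OF int iE])
  also have "(\<integral>t. E t \<partial>lborel) \<le> 3/2 * A * ((2*r) powr (1 - s) / (1 - s))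
      + \<bar>p\<bar> * ((Q + 5 * r * r powr (- s) * A) / (1 - s)) + 6 * r * A * ((2*r) powr (- s) / s)"
  proof -
    have "(\<integral>t. E t \<partial>lborel) = 3/2 * A * (\<integral>t. b1 t \<partial>lborel) + \<bar>p\<bar> * (\<integral>t. b2 t \<partial>lborel) + 6 * r * A * (\<integral>t. b3 t \<partial>lborel)"
      unfolding E_def using ib by simp
    also have "\<dots> \<le> 3/2 * A * ((2*r) powr (1 - s) / (1 - s))
      + \<bar>p\<bar> * ((Q + 5 * r * r powr (- s) * A) / (1 - s)) + 6 * r * A * ((2*r) powr (- s) / s)"
      using r A0 by (intro add_mono mult_left_mono ib) auto
    finally show ?thesis .
  qed
  finally have main: "1/2 * (2 powr (- 1 - s) * Q) \<le> (\<integral>t. stable_weight s t * B t \<partial>lborel)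
      + (3/2 * A * ((2*r) powr (1 - s) / (1 - s)) + \<bar>p\<bar> * ((Q + 5 * r * r powr (- s) * A) / (1 - s)) + 6 * r * A * ((2*r) powr (- s) / s))"
    by simp
  have h: "1/2 * (2 powr (- 1 - s) * Q) = 2 powr (- 2 - s) * Q"
    using powr_add[of 2 "- 1" "- 1 - s"] by (simp add: powr_minus)
  define X1 where "X1 = (2 * r) powr (1 - s) / (1 - s)"
  define X2 where "X2 = r powr (1 - s) / (1 - s)"
  define X3 where "X3 = (2 * r) powr (- s) / s"
  have "r * r powr (- s) = r powr (1 - s)" using r powr_add[of r 1 "- s"] by simp
  then have "5 * r * r powr (- s) * A / (1 - s) = 5 * X2 * A" by (simp add: X2_def)
  then have "\<bar>p\<bar> * ((Q + 5 * r * r powr (- s) * A) / (1 - s)) = \<bar>p\<bar> / (1 - s) * Q + \<bar>p\<bar> * (5 * X2 * A)"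
    by (simp add: add_divide_distrib distrib_left)
  also have "\<dots> \<le> \<bar>p\<bar> / (1 - s) * Q + 1/2 * (5 * X2 * A)"
    using p s A0 by (intro add_left_mono mult_right_mono mult_nonneg_nonneg) (auto simp: X2_def)
  finally have "2 powr (- 2 - s) * Q \<le> (\<integral>t. stable_weight s t * B t \<partial>lborel)
      + (3/2 * A * X1 + (\<bar>p\<bar> / (1 - s) * Q + 1/2 * (5 * X2 * A)) + 6 * r * A * X3)"
    using main unfolding h X1_def[symmetric] X3_def[symmetric] by linarith
  moreover have eq: "5 / 2 * r powr (1 - s) / (1 - s) = 5 / 2 * X2" by (simp add: X2_def)
  ultimately show ?thesis
    unfolding Q_def[symmetric] X1_def[symmetric] X3_def[symmetric] eq by (simp add: algebra_simps)
qed

section \<open>Truncated heat potentials\<close>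

text \<open>Differentiation in q multiplies the weight by -1/(4\<tau>), which is continuous on
  [e, R] because e > 0, so the class of these mixtures is closed under differentiation. Taking q =
  |x|^2 as the variable keeps the induction one-dimensional.\<close>

lemma smooth_fun_exp_mixture:
  fixes a :: "real \<Rightarrow> real"
  assumes e: "0 < e" and a: "continuous_on {e..R} a"
  shows "smooth_fun (\<lambda>q. integral {e..R} (\<lambda>\<tau>. a \<tau> * exp (- (q / (4 * \<tau>)))))"
    and "((\<lambda>q. integral {e..R} (\<lambda>\<tau>. a \<tau> * exp (- (q / (4 * \<tau>))))) has_field_derivative
      integral {e..R} (\<lambda>\<tau>. - (a \<tau> / (4 * \<tau>)) * exp (- (q0 / (4 * \<tau>))))) (at q0)"
proof -
  let ?H = "\<lambda>a q. integral {e..R} (\<lambda>\<tau>. a \<tau> * exp (- (q / (4 * \<tau>))))"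
  have der: "(?H a has_field_derivative ?H (\<lambda>\<tau>. - (a \<tau> / (4 * \<tau>))) q0) (at q0)"
    if a: "continuous_on {e..R} a" for a q0
  proof -
    have "((\<lambda>q. integral (cbox e R) (\<lambda>\<tau>. a \<tau> * exp (- (q / (4 * \<tau>))))) has_field_derivative
      integral (cbox e R) (\<lambda>\<tau>. - (a \<tau> / (4 * \<tau>)) * exp (- (q0 / (4 * \<tau>))))) (at q0 within UNIV)"
    proof (rule leibniz_rule_field_derivative)
      show "((\<lambda>q. a t * exp (- (q / (4 * t)))) has_field_derivative - (a t / (4 * t)) * exp (- (q / (4 * t)))) (at q within UNIV)"
        if "t \<in> cbox e R" for q t
        using that e by (auto intro!: derivative_eq_intros)
      show "(\<lambda>\<tau>. a \<tau> * exp (- (q / (4 * \<tau>)))) integrable_on cbox e R" for q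
        using e a by (intro integrable_continuous continuous_intros) auto
      have "continuous_on (UNIV \<times> cbox e R) (\<lambda>z::real\<times>real. a (snd z))"
        by (rule continuous_on_compose2[OF a]) (auto intro: continuous_intros)
      then show "continuous_on (UNIV \<times> cbox e R) (\<lambda>(q, t). - (a t / (4 * t)) * exp (- (q / (4 * t))))"
        unfolding case_prod_beta using e by (intro continuous_intros) auto
    qed auto
    then show ?thesis by simp
  qed
  have "C_k_on k UNIV (?H a)" if "continuous_on {e..R} a" for k a
    using that
  proof (induction k arbitrary: a)
    case 0
    then show ?case using der by (auto simp: continuous_on_eq_continuous_at intro!: DERIV_isCont)
  next
    case (Suc k)
    show ?case
    proof (rule C_k_on_SucI)
      show "(?H a has_derivative (\<lambda>h. ?H (\<lambda>\<tau>. - (a \<tau> / (4 * \<tau>))) q * h)) (at q)" for q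
        using der[OF Suc.prems, of q] unfolding has_field_derivative_def .
      have "continuous_on {e..R} (\<lambda>\<tau>. - (a \<tau> / (4 * \<tau>)))"
        using e Suc.prems by (intro continuous_intros) auto
      then have "C_k_on k UNIV (?H (\<lambda>\<tau>. - (a \<tau> / (4 * \<tau>))))" by (rule Suc.IH)
      then show "C_k_on k UNIV (\<lambda>q. ?H (\<lambda>\<tau>. - (a \<tau> / (4 * \<tau>))) q * i)" if "i \<in> Basis" for i
        using that by simp
    qed
  qed
  then show "smooth_fun (?H a)" using a by (simp add: smooth_fun_def)
  show "(?H a has_field_derivative ?H (\<lambda>\<tau>. - (a \<tau> / (4 * \<tau>))) q0) (at q0)" by (rule der[OF a])
qed

text \<open>One family for all potentials that occur: k = 0 is the potential w, differentiation
  raises k by one, k = s is the main term Q, and k = 1/2 bounds the gradient of w.\<close>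

definition heat_mix :: "real \<Rightarrow> real \<Rightarrow> real \<Rightarrow> 'a::euclidean_space \<Rightarrow> real" where
  "heat_mix k e R x = (\<integral>\<tau>. indicator {e..R} \<tau> * (\<tau> powr (- k) * gauss \<tau> x) \<partial>lborel)"

lemma heat_mix_nonneg: "0 \<le> heat_mix k e R x"
  unfolding heat_mix_def by (intro integral_nonneg_AE AE_I2) auto

lemma integrable_heat_mix:
  assumes e: "0 < e" and k: "0 \<le> k"
  shows "integrable lborel (\<lambda>\<tau>. indicator {e..R} \<tau> * (\<tau> powr (- k) * gauss \<tau> (x::'a::euclidean_space)))"
proof (rule Bochner_Integration.integrable_bound)
  define c where "c = e powr (- k) * (4 * pi * e) powr (- (real DIM('a) / 2))"
  show "integrable lborel (\<lambda>\<tau>. c * indicator {e..R} \<tau>)"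
    by (intro integrable_mult_right integrable_real_indicator) (auto simp: emeasure_lborel_Icc_eq)
  show "AE \<tau> in lborel. norm (indicator {e..R} \<tau> * (\<tau> powr (- k) * gauss \<tau> x)) \<le> norm (c * indicator {e..R} \<tau>)"
  proof (rule AE_I2)
    fix \<tau> :: real
    show "norm (indicator {e..R} \<tau> * (\<tau> powr (- k) * gauss \<tau> x)) \<le> norm (c * indicator {e..R} \<tau>)"
    proof (cases "\<tau> \<in> {e..R}")
      case True
      have "\<tau> powr (- k) * gauss \<tau> x \<le> c"
        unfolding c_def using True e k by (intro mult_mono powr_mono2' gauss_le_of_time_ge) auto
      moreover have "0 \<le> c" by (simp add: c_def)
      ultimately show ?thesis using True by (simp add: abs_mult)
    qed simp
  qed
qed measurable

lemma heat_mix_le: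
  fixes x :: "'a::euclidean_space"
  assumes e: "0 < e" and k: "0 \<le> k" and c: "\<And>\<tau>. e \<le> \<tau> \<Longrightarrow> \<tau> \<le> R \<Longrightarrow> \<tau> powr (- k) * gauss \<tau> x \<le> c"
    and c0: "0 \<le> c" and R: "0 \<le> R"
  shows "heat_mix k e R x \<le> R * c"
proof -
  have "heat_mix k e R x \<le> (\<integral>\<tau>. c * indicator {e..R} \<tau> \<partial>lborel)"
    unfolding heat_mix_def
  proof (rule integral_mono[OF integrable_heat_mix[OF e k]])
    show "integrable lborel (\<lambda>\<tau>. c * indicator {e..R} \<tau>)"
      by (intro integrable_mult_right integrable_real_indicator) (auto simp: emeasure_lborel_Icc_eq)
    show "indicator {e..R} \<tau> * (\<tau> powr (- k) * gauss \<tau> x) \<le> c * indicator {e..R} \<tau>" for \<tau>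
      using c[of \<tau>] by (cases "\<tau> \<in> {e..R}") auto
  qed
  also have "\<dots> = c * measure lborel {e..R}" by simp
  also have "\<dots> \<le> c * R" using c0 e R by (intro mult_left_mono) (auto simp: measure_def emeasure_lborel_Icc_eq)
  finally show ?thesis by (simp add: mult.commute)
qed

lemma heat_mix_eq_integral:
  fixes x :: "'a::euclidean_space"
  assumes e: "0 < e" and k: "0 \<le> k"
  shows "heat_mix k e R x = integral {e..R} (\<lambda>\<tau>. (\<tau> powr (- k) * (4 * pi * \<tau>) powr (- (real DIM('a) / 2)))
    * exp (- ((norm x)\<^sup>2 / (4 * \<tau>))))"
proof -
  have "set_integrable lborel {e..R} (\<lambda>\<tau>. \<tau> powr (- k) * gauss \<tau> x)"
    using integrable_heat_mix[OF e k] by (simp add: set_integrable_def)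
  from set_borel_integral_eq_integral(2)[OF this]
  show ?thesis by (simp add: heat_mix_def set_lebesgue_integral_def gauss_def mult.assoc)
qed

lemma continuous_on_heat_weight:
  assumes "0 < e"
  shows "continuous_on {e..R} (\<lambda>\<tau>. \<tau> powr (- k) * (4 * pi * \<tau>) powr (- (q / 2)))"
  using assms by (intro continuous_intros) auto

lemma smooth_fun_heat_mix:
  assumes e: "0 < e" and k: "0 \<le> k"
  shows "smooth_fun (heat_mix k e R :: 'a::euclidean_space \<Rightarrow> real)"
proof -
  have "smooth_fun (\<lambda>x::'a. (norm x)\<^sup>2)" using smooth_fun_norm_sq[of "0::'a"] by simp
  from smooth_fun_compose[OF smooth_fun_exp_mixture(1)[OF e continuous_on_heat_weight[OF e]] this]
  show ?thesis unfolding heat_mix_eq_integral[OF e k, abs_def] .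
qed

text \<open>Each Gaussian has gradient -x/(2\<tau>) times itself, and the factor 1/\<tau> moves into
  the index.\<close>

lemma ddir_heat_mix:
  fixes x h :: "'a::euclidean_space"
  assumes e: "0 < e" and k: "0 \<le> k"
  shows "ddir (heat_mix k e R) x h = - ((x \<bullet> h) / 2) * heat_mix (k + 1) e R x"
proof -
  let ?a = "\<lambda>\<tau>. \<tau> powr (- k) * (4 * pi * \<tau>) powr (- (real DIM('a) / 2))"
  let ?H = "\<lambda>q. integral {e..R} (\<lambda>\<tau>. ?a \<tau> * exp (- (q / (4 * \<tau>))))"
  let ?H' = "\<lambda>q. integral {e..R} (\<lambda>\<tau>. - (?a \<tau> / (4 * \<tau>)) * exp (- (q / (4 * \<tau>))))"
  have "((\<lambda>x::'a. x \<bullet> x) has_derivative (\<lambda>h. 2 * (x \<bullet> h))) (at x)"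
    by (auto intro!: derivative_eq_intros simp: inner_commute)
  then have "((\<lambda>x::'a. (norm x)\<^sup>2) has_derivative (\<lambda>h. 2 * (x \<bullet> h))) (at x)"
    by (simp add: power2_norm_eq_inner)
  moreover have "(?H has_derivative (\<lambda>v. ?H' ((norm x)\<^sup>2) * v)) (at ((norm x)\<^sup>2))"
    using smooth_fun_exp_mixture(2)[OF e continuous_on_heat_weight[OF e, where k=k and q="real DIM('a)"], of R "(norm x)\<^sup>2"]
    unfolding has_field_derivative_def .
  ultimately have "((\<lambda>x. ?H ((norm x)\<^sup>2)) has_derivative (\<lambda>h. ?H' ((norm x)\<^sup>2) * (2 * (x \<bullet> h)))) (at x)"
    by (rule has_derivative_compose)
  then have "(heat_mix k e R has_derivative (\<lambda>h. ?H' ((norm x)\<^sup>2) * (2 * (x \<bullet> h)))) (at x)"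
    unfolding heat_mix_eq_integral[OF e k, abs_def] .
  then have "ddir (heat_mix k e R) x h = ?H' ((norm x)\<^sup>2) * (2 * (x \<bullet> h))" by (rule ddir_unique)
  also have "?H' ((norm x)\<^sup>2) = integral {e..R} (\<lambda>\<tau>. (- 1/4) * ((\<tau> powr (- (k + 1)) * (4 * pi * \<tau>) powr (- (real DIM('a) / 2)))
    * exp (- ((norm x)\<^sup>2 / (4 * \<tau>)))))"
  proof (rule integral_cong)
    fix \<tau> assume "\<tau> \<in> {e..R}"
    then have "\<tau> > 0" using e by auto
    then have "\<tau> powr (- (k + 1)) = \<tau> powr (- k) / \<tau>"
      using powr_add[of \<tau> "- k" "- 1"] by (simp add: powr_minus_divide)
    then show "- (?a \<tau> / (4 * \<tau>)) * exp (- ((norm x)\<^sup>2 / (4 * \<tau>))) =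
      (- 1/4) * ((\<tau> powr (- (k + 1)) * (4 * pi * \<tau>) powr (- (real DIM('a) / 2))) * exp (- ((norm x)\<^sup>2 / (4 * \<tau>))))"
      by simp
  qed
  also have "\<dots> = (- 1/4) * heat_mix (k + 1) e R x"
    using k by (subst heat_mix_eq_integral[OF e]) (auto simp: integral_mult_right)
  finally show ?thesis by simp
qed

lemma ddir2_heat_mix:
  fixes x h :: "'a::euclidean_space"
  assumes e: "0 < e"
  shows "ddir2 (heat_mix 0 e R) x h =
    (x \<bullet> h)\<^sup>2 / 4 * heat_mix 2 e R x - (norm h)\<^sup>2 / 2 * heat_mix 1 e R x"
proof (rule ddir2_unique[OF smooth_fun_heat_mix[OF e]])
  have "((\<lambda>t. - (((x + t *\<^sub>R h) \<bullet> h) / 2) * heat_mix 1 e R (x + t *\<^sub>R h)) has_real_derivative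
     - ((h \<bullet> h) / 2) * heat_mix 1 e R (x + 0 *\<^sub>R h) + ddir (heat_mix 1 e R) (x + 0 *\<^sub>R h) h * (- (((x + 0 *\<^sub>R h) \<bullet> h) / 2))) (at 0)"
    by (intro DERIV_mult DERIV_along_line smooth_fun_heat_mix e)
      (auto intro!: derivative_eq_intros simp: inner_add_left)
  then show "((\<lambda>t. ddir (heat_mix 0 e R) (x + t *\<^sub>R h) h) has_real_derivative
     (x \<bullet> h)\<^sup>2 / 4 * heat_mix 2 e R x - (norm h)\<^sup>2 / 2 * heat_mix 1 e R x) (at 0)"
    by (simp add: ddir_heat_mix[OF e] power2_eq_square power2_norm_eq_inner[unfolded power2_eq_square])
      (simp add: algebra_simps)
qed simp

lemma norm_sq_heat_mix_le:
  fixes x :: "'a::euclidean_space"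
  assumes e: "0 < e" and k: "0 \<le> k"
    and c: "\<And>\<tau>. e \<le> \<tau> \<Longrightarrow> \<tau> \<le> R \<Longrightarrow> \<tau> powr (- k) * (\<tau> * gauss (2 * \<tau>) x) \<le> c" and c0: "0 \<le> c" and R: "0 \<le> R"
  shows "(norm x)\<^sup>2 * heat_mix k e R x \<le> R * (4 * 2 powr (real DIM('a) / 2) * c)"
proof -
  let ?c = "4 * 2 powr (real DIM('a) / 2) * c"
  have "(norm x)\<^sup>2 * heat_mix k e R x = (\<integral>\<tau>. (norm x)\<^sup>2 * (indicator {e..R} \<tau> * (\<tau> powr (- k) * gauss \<tau> x)) \<partial>lborel)"
    by (simp add: heat_mix_def)
  also have "\<dots> \<le> (\<integral>\<tau>. ?c * indicator {e..R} \<tau> \<partial>lborel)"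
  proof (rule integral_mono[OF integrable_mult_right[OF integrable_heat_mix[OF e k]]])
    show "integrable lborel (\<lambda>\<tau>. ?c * indicator {e..R} \<tau>)"
      by (intro integrable_mult_right integrable_real_indicator) (auto simp: emeasure_lborel_Icc_eq)
    fix \<tau> :: real
    show "(norm x)\<^sup>2 * (indicator {e..R} \<tau> * (\<tau> powr (- k) * gauss \<tau> x)) \<le> ?c * indicator {e..R} \<tau>"
    proof (cases "\<tau> \<in> {e..R}")
      case True
      have "\<tau> powr (- k) * ((norm x)\<^sup>2 * gauss \<tau> x) \<le> \<tau> powr (- k) * (4 * 2 powr (real DIM('a) / 2) * \<tau> * gauss (2 * \<tau>) x)"
        using True e by (intro mult_left_mono norm_sq_gauss_le) auto
      also have "\<dots> = 4 * 2 powr (real DIM('a) / 2) * (\<tau> powr (- k) * (\<tau> * gauss (2 * \<tau>) x))" by simp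
      also have "\<dots> \<le> ?c" using True by (intro mult_left_mono c) auto
      finally show ?thesis using True by (simp add: mult_ac)
    qed simp
  qed
  also have "\<dots> = ?c * measure lborel {e..R}" by simp
  also have "\<dots> \<le> ?c * R" using c0 e R by (intro mult_left_mono) (auto simp: measure_def emeasure_lborel_Icc_eq)
  finally show ?thesis by (simp add: mult.commute)
qed

text \<open>The constant is free of \<open>e\<close>: off the origin the Gaussian absorbs every
  negative power of \<tau>. The bound with the factor \<open>norm y\<close> is there for the affine
  factor of the barrier, which grows at infinity.\<close>

lemma heat_mix_away:
  assumes \<rho>: "0 < \<rho>" and R: "0 < R"
  shows "\<exists>C\<ge>0. \<forall>e (y::'a::euclidean_space) h. 0 < e \<longrightarrow> \<rho> \<le> norm y \<longrightarrow>
    heat_mix 0 e R y \<le> C \<and> norm y * heat_mix 0 e R y \<le> C \<and>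
    \<bar>ddir (heat_mix 0 e R) y h\<bar> \<le> C * norm h \<and> \<bar>ddir2 (heat_mix 0 e R) y h\<bar> \<le> C * (norm h)\<^sup>2"
proof -
  define c where "c = (\<lambda>k. (4 * (k + real DIM('a) / 2) / \<rho>\<^sup>2) powr (k + real DIM('a) / 2))"
  have c0: "0 \<le> c k" for k by (simp add: c_def)
  have cb: "t powr (- k) * gauss t y \<le> c k" if "\<rho> \<le> norm y" "0 < t" "0 \<le> k" for k t and y :: 'a
    unfolding c_def using that by (intro powr_gauss_le_away \<rho>) auto
  define D where "D = 4 * 2 powr (real DIM('a) / 2)"
  have D: "D \<ge> 0" by (simp add: D_def)
  define C where "C = R * c 0 + R * (D * (R * c 0)) + R * c 1 + R * (D * c 0) + R * (D * (2 * c 1))"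
  have C: "R * c 0 + R * (D * (R * c 0)) \<le> C" "R * c 1 + R * (D * c 0) \<le> C" "R * c 1 + R * (D * (2 * c 1)) \<le> C" "0 \<le> C"
    using R D c0[of 0] c0[of 1] by (simp_all add: C_def)
  have "heat_mix 0 e R y \<le> C \<and> norm y * heat_mix 0 e R y \<le> C \<and>
    \<bar>ddir (heat_mix 0 e R) y h\<bar> \<le> C * norm h \<and> \<bar>ddir2 (heat_mix 0 e R) y h\<bar> \<le> C * (norm h)\<^sup>2"
    if e: "0 < e" and y: "\<rho> \<le> norm y" for e and y h :: 'a
  proof -
    have pos: "0 < \<tau>" if "e \<le> \<tau>" for \<tau> using that e by simp
    have w0: "heat_mix 0 e R y \<le> R * c 0"
      using cb[OF y pos, of _ 0] R c0 by (intro heat_mix_le e) auto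
    have w1: "heat_mix 1 e R y \<le> R * c 1"
      using cb[OF y pos, of _ 1] R c0 by (intro heat_mix_le e) auto
    have g0: "gauss (2 * \<tau>) y \<le> c 0" if "e \<le> \<tau>" for \<tau>
      using cb[OF y, of "2 * \<tau>" 0] pos[OF that] by (simp add: powr_def split: if_splits)
    have g1: "gauss (2 * \<tau>) y / \<tau> \<le> 2 * c 1" if "e \<le> \<tau>" for \<tau>
      using cb[OF y, of "2 * \<tau>" 1] pos[OF that] by (simp add: powr_minus_divide field_simps)
    have q0: "(norm y)\<^sup>2 * heat_mix 0 e R y \<le> R * (D * (R * c 0))"
      unfolding D_def
    proof (rule norm_sq_heat_mix_le[OF e])
      show "\<tau> powr (- 0) * (\<tau> * gauss (2 * \<tau>) y) \<le> R * c 0" if "e \<le> \<tau>" "\<tau> \<le> R" for \<tau>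
        using g0[OF that(1)] that pos[OF that(1)] R c0[of 0] by (auto intro!: mult_mono)
    qed (use R c0 in auto)
    have q1: "(norm y)\<^sup>2 * heat_mix 1 e R y \<le> R * (D * c 0)"
      unfolding D_def
    proof (rule norm_sq_heat_mix_le[OF e])
      show "\<tau> powr (- 1) * (\<tau> * gauss (2 * \<tau>) y) \<le> c 0" if "e \<le> \<tau>" "\<tau> \<le> R" for \<tau>
        using g0[OF that(1)] pos[OF that(1)] by (simp add: powr_minus_divide)
    qed (use R c0 in auto)
    have q2: "(norm y)\<^sup>2 * heat_mix 2 e R y \<le> R * (D * (2 * c 1))"
      unfolding D_def
    proof (rule norm_sq_heat_mix_le[OF e])
      show "\<tau> powr (- 2) * (\<tau> * gauss (2 * \<tau>) y) \<le> 2 * c 1" if "e \<le> \<tau>" "\<tau> \<le> R" for \<tau>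
        using g1[OF that(1)] pos[OF that(1)] by (simp add: powr_minus_divide power2_eq_square)
    qed (use R c0 in auto)
    have ny: "norm y \<le> 1 + (norm y)\<^sup>2"
      using zero_le_power2[of "norm y - 1/2"] unfolding power2_eq_square by (simp add: algebra_simps)
    have n0: "norm y * heat_mix 0 e R y \<le> heat_mix 0 e R y + (norm y)\<^sup>2 * heat_mix 0 e R y"
      using mult_right_mono[OF ny heat_mix_nonneg[of 0 e R y]] by (simp add: algebra_simps)
    have n1: "norm y * heat_mix 1 e R y \<le> heat_mix 1 e R y + (norm y)\<^sup>2 * heat_mix 1 e R y"
      using mult_right_mono[OF ny heat_mix_nonneg[of 1 e R y]] by (simp add: algebra_simps)
    have cs: "\<bar>y \<bullet> h\<bar> \<le> norm y * norm h" by (rule Cauchy_Schwarz_ineq2)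
    have d1: "\<bar>ddir (heat_mix 0 e R) y h\<bar> \<le> C * norm h"
    proof -
      have "\<bar>ddir (heat_mix 0 e R) y h\<bar> = \<bar>y \<bullet> h\<bar> / 2 * heat_mix 1 e R y"
        using heat_mix_nonneg[of 1 e R y] by (simp add: ddir_heat_mix[OF e] abs_mult)
      also have "\<dots> \<le> (norm y * norm h) * heat_mix 1 e R y"
        using cs heat_mix_nonneg[of 1 e R y] by (intro mult_right_mono) auto
      also have "\<dots> = (norm y * heat_mix 1 e R y) * norm h" by simp
      also have "\<dots> \<le> C * norm h" using n1 w1 q1 C(2) by (intro mult_right_mono) auto
      finally show ?thesis .
    qed
    have d2: "\<bar>ddir2 (heat_mix 0 e R) y h\<bar> \<le> C * (norm h)\<^sup>2"
    proof -
      have "\<bar>ddir2 (heat_mix 0 e R) y h\<bar> \<le> (y \<bullet> h)\<^sup>2 / 4 * heat_mix 2 e R y + (norm h)\<^sup>2 / 2 * heat_mix 1 e R y"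
        unfolding ddir2_heat_mix[OF e]
        using heat_mix_nonneg[of 1 e R y] heat_mix_nonneg[of 2 e R y] by (intro abs_triangle_ineq4[THEN order_trans]) (simp add: abs_mult)
      also have "\<dots> \<le> (norm y)\<^sup>2 * (norm h)\<^sup>2 * heat_mix 2 e R y + (norm h)\<^sup>2 * heat_mix 1 e R y"
      proof (intro add_mono mult_right_mono heat_mix_nonneg)
        have "(y \<bullet> h)\<^sup>2 \<le> (norm y)\<^sup>2 * (norm h)\<^sup>2"
          using power_mono[OF cs, of 2] by (simp add: power_mult_distrib)
        then show "(y \<bullet> h)\<^sup>2 / 4 \<le> (norm y)\<^sup>2 * (norm h)\<^sup>2"
          using zero_le_power2[of "y \<bullet> h"] by linarith
      qed simp
      also have "\<dots> = (heat_mix 1 e R y + (norm y)\<^sup>2 * heat_mix 2 e R y) * (norm h)\<^sup>2"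
        by (simp add: algebra_simps)
      also have "\<dots> \<le> C * (norm h)\<^sup>2" using w1 q2 C(3) by (intro mult_right_mono) auto
      finally show ?thesis .
    qed
    have "0 \<le> R * c 0" "0 \<le> R * (D * (R * c 0))" using R D c0[of 0] by simp_all
    then have "heat_mix 0 e R y \<le> C" "norm y * heat_mix 0 e R y \<le> C" using w0 n0 q0 C(1) by linarith+
    then show ?thesis using d1 d2 by blast
  qed
  then show ?thesis using C(4) by blast
qed

section \<open>The potential with an affine factor: heat averages and fractional Laplacian\<close>

lemma smooth_fun_affine: "smooth_fun (\<lambda>x::'a::euclidean_space. 1 + x \<bullet> g)"
  by (intro smooth_fun_add smooth_fun_const smooth_fun_inner)

lemma affine_gauss_bounded:
  fixes g :: "'a::euclidean_space"
  assumes e: "0 < e" "e \<le> R"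
  shows "\<exists>C\<ge>0. \<forall>\<tau>\<in>{e..R}. \<forall>y. \<bar>(1 + y \<bullet> g) * gauss \<tau> y\<bar> \<le> C"
proof -
  define D where "D = 4 * 2 powr (real DIM('a) / 2)"
  define c where "c = (4 * pi * e) powr (- (real DIM('a) / 2))"
  have nn: "D \<ge> 0" "c \<ge> 0" by (simp_all add: D_def c_def)
  have "\<bar>(1 + y \<bullet> g) * gauss \<tau> y\<bar> \<le> (1 + norm g) * (c + D * (R * c))" if "\<tau> \<in> {e..R}" for \<tau> y
  proof -
    have \<tau>: "e \<le> \<tau>" "\<tau> \<le> R" "0 < \<tau>" using that e by auto
    have g1: "gauss \<tau> y \<le> c" unfolding c_def by (rule gauss_le_of_time_ge[OF e(1) \<tau>(1)])
    have g2: "gauss (2 * \<tau>) y \<le> c" unfolding c_def using \<tau> by (intro gauss_le_of_time_ge e) auto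
    have "(norm y)\<^sup>2 * gauss \<tau> y \<le> D * \<tau> * gauss (2 * \<tau>) y"
      unfolding D_def by (rule norm_sq_gauss_le[OF \<tau>(3)])
    also have "\<dots> = D * (\<tau> * gauss (2 * \<tau>) y)" by simp
    also have "\<dots> \<le> D * (R * c)" using \<tau> g2 nn by (intro mult_left_mono mult_mono) auto
    finally have q: "(norm y)\<^sup>2 * gauss \<tau> y \<le> D * (R * c)" .
    have "norm y \<le> 1 + (norm y)\<^sup>2"
      using zero_le_power2[of "norm y - 1/2"] unfolding power2_eq_square by (simp add: algebra_simps)
    then have "norm g * norm y \<le> norm g * (1 + (norm y)\<^sup>2)" by (intro mult_left_mono) auto
    moreover have "\<bar>y \<bullet> g\<bar> \<le> norm g * norm y" using Cauchy_Schwarz_ineq2[of y g] by (simp add: mult.commute)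
    ultimately have "\<bar>1 + y \<bullet> g\<bar> \<le> 1 + (norm y)\<^sup>2 + norm g * (1 + (norm y)\<^sup>2)"
      using zero_le_power2[of "norm y"] by linarith
    also have "\<dots> = (1 + norm g) * (1 + (norm y)\<^sup>2)" by (simp add: algebra_simps)
    finally have "\<bar>1 + y \<bullet> g\<bar> * gauss \<tau> y \<le> (1 + norm g) * (1 + (norm y)\<^sup>2) * gauss \<tau> y"
      by (intro mult_right_mono) auto
    also have "\<dots> = (1 + norm g) * (gauss \<tau> y + (norm y)\<^sup>2 * gauss \<tau> y)" by (simp add: algebra_simps)
    also have "\<dots> \<le> (1 + norm g) * (c + D * (R * c))" using g1 q by (intro mult_left_mono add_mono) auto
    finally show ?thesis by (simp add: abs_mult)
  qed
  then show ?thesis using nn e by (intro exI[of _ "(1 + norm g) * (c + D * (R * c))"]) auto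
qed

text \<open>The tilted potential has no compact support, so the bounds for test functions apply
  after multiplication by a cutoff that is 1 on the unit ball around \<open>x\<close>; longer
  increments are covered by boundedness. The constant may depend on \<open>x\<close>, as it only
  serves convergence of the integral at that point.\<close>

lemma sdiff_le_of_bounded_smooth:
  fixes f :: "'a::euclidean_space \<Rightarrow> real"
  assumes f: "smooth_fun f" and b: "\<And>y. \<bar>f y\<bar> \<le> B"
  shows "\<exists>A. (\<forall>y. \<bar>f y\<bar> \<le> A) \<and> (\<forall>z. \<bar>sdiff f x z\<bar> \<le> A * (norm z)\<^sup>2)"
proof -
  obtain ct W where ct: "ct \<in> test_functions (UNIV::'a set)" "cball x 1 \<subseteq> W" "\<forall>y\<in>W. ct y = 1"
    using smooth_urysohn[of "cball x 1" UNIV] by auto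
  have tf: "(\<lambda>y. ct y * f y) \<in> test_functions UNIV" by (rule test_functions_mult[OF ct(1) f])
  obtain M where M: "M > 0" "\<forall>y h. \<bar>ddir2 (\<lambda>y. ct y * f y) y h\<bar> \<le> M * (norm h)\<^sup>2"
    using test_functions_C2_bounded[OF tf] by blast
  have B: "0 \<le> B" using b[of x] by linarith
  have "\<bar>sdiff f x z\<bar> \<le> (2 * M + 4 * B) * (norm z)\<^sup>2" for z
  proof (cases "norm z \<le> 1")
    case True
    have "ct x = 1" "ct (x + z) = 1" "ct (x - z) = 1" using ct(2,3) True by (auto simp: subset_iff dist_norm)
    then have "sdiff f x z = sdiff (\<lambda>y. ct y * f y) x z" by (simp add: sdiff_def)
    moreover have "\<bar>sdiff (\<lambda>y. ct y * f y) x z\<bar> \<le> 2 * (M * (norm z)\<^sup>2)"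
      using M(2) by (intro sdiff_le_ddir2 test_functionsD(1)[OF tf]) auto
    moreover have "0 \<le> 4 * B * (norm z)\<^sup>2" using B by simp
    ultimately show ?thesis by (simp add: algebra_simps)
  next
    case False
    have "\<bar>sdiff f x z\<bar> \<le> 4 * B"
      using b[of x] b[of "x + z"] b[of "x - z"] unfolding sdiff_def by linarith
    also have "\<dots> \<le> (2 * M + 4 * B) * 1" using M(1) by simp
    also have "\<dots> \<le> (2 * M + 4 * B) * (norm z)\<^sup>2"
      using False M(1) B by (intro mult_left_mono one_le_power) auto
    finally show ?thesis .
  qed
  moreover have "\<bar>f y\<bar> \<le> 2 * M + 4 * B" for y using b[of y] M(1) B by linarith
  ultimately show ?thesis by blast
qed

lemma affine_heat_mix_eq:
  fixes x g :: "'a::euclidean_space"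
  assumes "0 < e"
  shows "(1 + x \<bullet> g) * heat_mix 0 e R x = (\<integral>\<tau>. indicator {e..R} \<tau> * ((1 + x \<bullet> g) * gauss \<tau> x) \<partial>lborel)"
proof -
  have "heat_mix 0 e R x = (\<integral>\<tau>. indicator {e..R} \<tau> * gauss \<tau> x \<partial>lborel)"
    unfolding heat_mix_def using assms
    by (intro Bochner_Integration.integral_cong) (auto simp: indicator_def)
  then show ?thesis by (simp flip: integral_mult_right_zero add: mult.left_commute)
qed

text \<open>The semigroup law with damped slope, integrated over the window; the uniform bound there
  justifies Fubini.\<close>

lemma gauss_average_affine_heat_mix:
  fixes x g :: "'a::euclidean_space"
  assumes e: "0 < e" "e \<le> R" and t: "0 < t"
  shows "has_bochner_integral lborel (\<lambda>z. ((1 + (x + z) \<bullet> g) * heat_mix 0 e R (x + z)) * gauss t z)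
    (\<integral>\<tau>. indicator {e..R} \<tau> * ((1 + \<tau> / (t + \<tau>) * (x \<bullet> g)) * gauss (t + \<tau>) x) \<partial>lborel)"
proof -
  define F where "F = (\<lambda>\<tau> z. indicator {e..R} \<tau> * (((1 + (x + z) \<bullet> g) * gauss \<tau> (x + z)) * gauss t z))"
  have [measurable]: "(\<lambda>p. F (fst p) (snd p)) \<in> borel_measurable (lborel \<Otimes>\<^sub>M lborel)"
    unfolding F_def by measurable
  obtain C where C: "C \<ge> 0" "\<forall>\<tau>\<in>{e..R}. \<forall>y. \<bar>(1 + y \<bullet> g) * gauss \<tau> y\<bar> \<le> C"
    using affine_gauss_bounded[OF e] by blast
  have g: "(\<integral>\<^sup>+z. ennreal (gauss t (z::'a)) \<partial>lborel) = 1"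
    using has_bochner_integral_gauss[OF t, where 'a='a]
    by (subst nn_integral_eq_integral) (auto simp: has_bochner_integral_iff)
  have "(\<integral>\<^sup>+p. ennreal (norm (F (fst p) (snd p))) \<partial>(lborel \<Otimes>\<^sub>M lborel)) =
      (\<integral>\<^sup>+\<tau>. \<integral>\<^sup>+z. ennreal (norm (F \<tau> z)) \<partial>lborel \<partial>lborel)"
    by (subst lborel.nn_integral_fst[symmetric]) auto
  also have "\<dots> \<le> (\<integral>\<^sup>+\<tau>. ennreal C * indicator {e..R} \<tau> \<partial>lborel)"
  proof (rule nn_integral_mono)
    fix \<tau> :: real
    have "(\<integral>\<^sup>+z. ennreal (norm (F \<tau> z)) \<partial>lborel) \<le> (\<integral>\<^sup>+z. ennreal (C * indicator {e..R} \<tau>) * ennreal (gauss t (z::'a)) \<partial>lborel)"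
    proof (rule nn_integral_mono)
      fix z :: 'a
      show "ennreal (norm (F \<tau> z)) \<le> ennreal (C * indicator {e..R} \<tau>) * ennreal (gauss t z)"
      proof (cases "\<tau> \<in> {e..R}")
        case True
        then have "\<bar>(1 + (x + z) \<bullet> g) * gauss \<tau> (x + z)\<bar> * gauss t z \<le> C * gauss t z"
          using C by (intro mult_right_mono) auto
        then show ?thesis using True C by (simp add: F_def abs_mult ennreal_mult[symmetric] ennreal_leI)
      qed (simp add: F_def)
    qed
    also have "\<dots> = ennreal C * indicator {e..R} \<tau>"
      using C by (subst nn_integral_cmult) (auto simp: g ennreal_mult ennreal_indicator)
    finally show "(\<integral>\<^sup>+z. ennreal (norm (F \<tau> z)) \<partial>lborel) \<le> ennreal C * indicator {e..R} \<tau>" .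
  qed
  also have "\<dots> < \<infinity>"
    by (subst nn_integral_cmult_indicator) (auto simp: emeasure_lborel_Icc_eq ennreal_mult_less_top)
  finally have Fint: "integrable (lborel \<Otimes>\<^sub>M lborel) (\<lambda>p. F (fst p) (snd p))"
    by (intro integrableI_bounded) auto
  have zint: "(\<integral>\<tau>. F \<tau> z \<partial>lborel) = ((1 + (x + z) \<bullet> g) * heat_mix 0 e R (x + z)) * gauss t z" for z
  proof -
    have "F \<tau> z = (indicator {e..R} \<tau> * ((1 + (x + z) \<bullet> g) * gauss \<tau> (x + z))) * gauss t z" for \<tau>
      by (simp add: F_def)
    then have "(\<integral>\<tau>. F \<tau> z \<partial>lborel) = (\<integral>\<tau>. indicator {e..R} \<tau> * ((1 + (x + z) \<bullet> g) * gauss \<tau> (x + z)) \<partial>lborel) * gauss t z"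
      by simp
    then show ?thesis by (simp only: affine_heat_mix_eq[OF e(1)])
  qed
  have "integrable lborel (\<lambda>z. \<integral>\<tau>. F \<tau> z \<partial>lborel)"
    using Fint by (intro lborel_pair.integrable_snd) (simp add: case_prod_beta')
  moreover have "(\<integral>z. \<integral>\<tau>. F \<tau> z \<partial>lborel \<partial>lborel) = (\<integral>\<tau>. \<integral>z. F \<tau> z \<partial>lborel \<partial>lborel)"
    using Fint by (intro lborel_pair.Fubini_integral) (simp add: case_prod_beta')
  moreover have "(\<integral>\<tau>. \<integral>z. F \<tau> z \<partial>lborel \<partial>lborel) =
      (\<integral>\<tau>. indicator {e..R} \<tau> * ((1 + \<tau> / (t + \<tau>) * (x \<bullet> g)) * gauss (t + \<tau>) x) \<partial>lborel)"
  proof (rule Bochner_Integration.integral_cong[OF refl])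
    fix \<tau> :: real
    show "(\<integral>z. F \<tau> z \<partial>lborel) = indicator {e..R} \<tau> * ((1 + \<tau> / (t + \<tau>) * (x \<bullet> g)) * gauss (t + \<tau>) x)"
    proof (cases "\<tau> \<in> {e..R}")
      case True
      then have "0 < \<tau>" using e by auto
      from has_bochner_integral_integral_eq[OF has_bochner_integral_affine_gauss_conv[OF t this, of x g]]
      show ?thesis using True by (simp add: F_def)
    qed (simp add: F_def)
  qed
  ultimately show ?thesis by (simp add: zint has_bochner_integral_iff)
qed

lemma affine_heat_mix_bounded:
  fixes g :: "'a::euclidean_space"
  assumes e: "0 < e" "e \<le> R"
  shows "\<exists>C. \<forall>x. \<bar>(1 + x \<bullet> g) * heat_mix 0 e R x\<bar> \<le> C"
proof -
  obtain C where C: "C \<ge> 0" "\<forall>\<tau>\<in>{e..R}. \<forall>y. \<bar>(1 + y \<bullet> g) * gauss \<tau> y\<bar> \<le> C"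
    using affine_gauss_bounded[OF e] by blast
  have "\<bar>(1 + x \<bullet> g) * heat_mix 0 e R x\<bar> \<le> (\<integral>\<tau>. C * indicator {e..R} \<tau> \<partial>lborel)" for x
    unfolding affine_heat_mix_eq[OF e(1)]
  proof (rule order_trans[OF integral_abs_bound integral_mono'])
    show "integrable lborel (\<lambda>\<tau>. C * indicator {e..R} \<tau>)"
      by (intro integrable_mult_right integrable_real_indicator) (auto simp: emeasure_lborel_Icc_eq)
    show "\<bar>indicator {e..R} \<tau> * ((1 + x \<bullet> g) * gauss \<tau> x)\<bar> \<le> C * indicator {e..R} \<tau>" for \<tau>
      using C(2) by (cases "\<tau> \<in> {e..R}") auto
  qed (use C(1) in auto)
  then show ?thesis by blast
qed

text \<open>Subordination reduces the claim to \<open>stable_average_lower_bound\<close>. The error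
  constant depends on r, s and the dimension but not on \<open>e\<close>, because it stems from
  times beyond r, where the Gaussian is bounded.\<close>

lemma flap_affine_heat_mix_lower_bound:
  fixes g :: "'a::euclidean_space"
  assumes s: "0 < s" "s < 1" and r: "0 < r"
  shows "\<exists>C. \<forall>e x. 0 < e \<longrightarrow> e < r \<longrightarrow> \<bar>x \<bullet> g\<bar> \<le> 1/2 \<longrightarrow>
    integrable lborel (\<lambda>z. sdiff (\<lambda>x. (1 + x \<bullet> g) * heat_mix 0 e (4 * r) x) x z * kern s z) \<and>
    2 * (2 powr (- 2 - s) - \<bar>x \<bullet> g\<bar> / (1 - s)) * heat_mix s e r x - C
      \<le> mix_const DIM('a) s * flap s (\<lambda>x. (1 + x \<bullet> g) * heat_mix 0 e (4 * r) x) x"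
proof -
  define A where "A = (4 * pi * r) powr (- (real DIM('a) / 2))"
  define C where "C = 2 * ((3/2 * ((2 * r) powr (1 - s) / (1 - s)) + 5 / 2 * r powr (1 - s) / (1 - s) + 6 * r * ((2 * r) powr (- s) / s)) * A)"
  have main: "integrable lborel (\<lambda>z. sdiff (\<lambda>x. (1 + x \<bullet> g) * heat_mix 0 e (4 * r) x) x z * kern s z) \<and>
    2 * (2 powr (- 2 - s) - \<bar>x \<bullet> g\<bar> / (1 - s)) * heat_mix s e r x - C
      \<le> mix_const DIM('a) s * flap s (\<lambda>x. (1 + x \<bullet> g) * heat_mix 0 e (4 * r) x) x"
    if e: "0 < e" "e < r" and p: "\<bar>x \<bullet> g\<bar> \<le> 1/2" for e and x :: 'a
  proof -
    define f where "f = (\<lambda>x. (1 + x \<bullet> g) * heat_mix 0 e (4 * r) (x::'a))"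
    define B where "B = (\<lambda>t. \<integral>\<tau>. indicator {e..4 * r} \<tau> * ((1 + x \<bullet> g) * gauss \<tau> x - (1 + \<tau> / (t + \<tau>) * (x \<bullet> g)) * gauss (t + \<tau>) x) \<partial>lborel)"
    have sf: "smooth_fun f" unfolding f_def
      using e by (intro smooth_fun_mult smooth_fun_affine smooth_fun_heat_mix) auto
    have fm[measurable]: "f \<in> borel_measurable borel"
      by (rule borel_measurable_continuous_onI[OF smooth_fun_continuous[OF sf]])
    have eR: "e \<le> 4 * r" using e by simp
    obtain Cb where Cb: "\<forall>x. \<bar>f x\<bar> \<le> Cb"
      using affine_heat_mix_bounded[OF e(1) eR, of g] unfolding f_def by blast
    obtain A0 where A0: "\<forall>y. \<bar>f y\<bar> \<le> A0" "\<forall>z. \<bar>sdiff f x z\<bar> \<le> A0 * (norm z)\<^sup>2"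
      using sdiff_le_of_bounded_smooth[OF sf, of Cb x] Cb by blast
    have int: "integrable lborel (\<lambda>z. sdiff f x z * kern s z)"
      using A0 by (intro integrable_sdiff_kern[OF s fm]) auto
    \<comment> \<open>The Gaussian is even, so f(x + z) and f(x - z) have the same average; hence
      the factor 2.\<close>
    have avg: "(\<integral>z. sdiff f x z * gauss t z \<partial>lborel) = 2 * B t" if t: "0 < t" for t
    proof -
      let ?P = "\<integral>\<tau>. indicator {e..4 * r} \<tau> * ((1 + \<tau> / (t + \<tau>) * (x \<bullet> g)) * gauss (t + \<tau>) x) \<partial>lborel"
      have h1: "has_bochner_integral lborel (\<lambda>z. f (x + z) * gauss t z) ?P"
        unfolding f_def by (rule gauss_average_affine_heat_mix[OF e(1) eR t])
      have h2: "has_bochner_integral lborel (\<lambda>z. f (x - z) * gauss t z) ?P"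
        using has_bochner_integral_lborel_uminus[OF h1] by simp
      have h3: "has_bochner_integral lborel (\<lambda>z. 2 * f x * gauss t z) (2 * f x * 1)"
        by (intro has_bochner_integral_mult_right has_bochner_integral_gauss t)
      have "has_bochner_integral lborel (\<lambda>z. 2 * f x * gauss t z - f (x + z) * gauss t z - f (x - z) * gauss t z) (2 * f x * 1 - ?P - ?P)"
        by (intro has_bochner_integral_diff h1 h2 h3)
      then have "(\<integral>z. sdiff f x z * gauss t z \<partial>lborel) = 2 * f x * 1 - ?P - ?P"
        by (intro has_bochner_integral_integral_eq) (simp add: sdiff_def algebra_simps)
      moreover have "f x - ?P = B t"
      proof -
        have i1: "integrable lborel (\<lambda>\<tau>. indicator {e..4 * r} \<tau> * ((1 + x \<bullet> g) * gauss \<tau> x))"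
          and i2: "integrable lborel (\<lambda>\<tau>. indicator {e..4 * r} \<tau> * ((1 + \<tau> / (t + \<tau>) * (x \<bullet> g)) * gauss (t + \<tau>) x))"
        proof -
          define c where "c = (4 * pi * e) powr (- (real DIM('a) / 2))"
          have ind: "integrable lborel (\<lambda>\<tau>. (3/2 * c) * indicator {e..4 * r} \<tau>)"
            by (intro integrable_mult_right integrable_real_indicator) (auto simp: emeasure_lborel_Icc_eq)
          have bd: "\<bar>q * gauss \<sigma> x\<bar> \<le> 3/2 * c" if "\<bar>q\<bar> \<le> 3/2" "e \<le> \<sigma>" for q \<sigma>
            unfolding abs_mult c_def using that e
            by (intro mult_mono) (auto intro: gauss_le_of_time_ge)
          have c0: "0 \<le> c" by (simp add: c_def)
          show "integrable lborel (\<lambda>\<tau>. indicator {e..4 * r} \<tau> * ((1 + x \<bullet> g) * gauss \<tau> x))"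
          proof (rule Bochner_Integration.integrable_bound[OF ind])
            have "\<bar>1 + x \<bullet> g\<bar> \<le> 3/2" using p by linarith
            then show "AE \<tau> in lborel. norm (indicator {e..4 * r} \<tau> * ((1 + x \<bullet> g) * gauss \<tau> x)) \<le> norm (3/2 * c * indicator {e..4 * r} \<tau>)"
              using bd c0 by (intro AE_I2) (auto split: split_indicator)
          qed measurable
          show "integrable lborel (\<lambda>\<tau>. indicator {e..4 * r} \<tau> * ((1 + \<tau> / (t + \<tau>) * (x \<bullet> g)) * gauss (t + \<tau>) x))"
          proof (rule Bochner_Integration.integrable_bound[OF ind])
            have "\<bar>1 + \<tau> / (t + \<tau>) * (x \<bullet> g)\<bar> \<le> 3/2" if "e \<le> \<tau>" for \<tau>
            proof -
              have "\<bar>\<tau> / (t + \<tau>)\<bar> \<le> 1" using that e t by simp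
              then have "\<bar>\<tau> / (t + \<tau>) * (x \<bullet> g)\<bar> \<le> 1 * (1/2)" unfolding abs_mult using p by (rule mult_mono) auto
              then show ?thesis by linarith
            qed
            then show "AE \<tau> in lborel. norm (indicator {e..4 * r} \<tau> * ((1 + \<tau> / (t + \<tau>) * (x \<bullet> g)) * gauss (t + \<tau>) x)) \<le> norm (3/2 * c * indicator {e..4 * r} \<tau>)"
              using bd c0 t by (intro AE_I2) (auto split: split_indicator)
          qed measurable
        qed
        have "f x - ?P = (\<integral>\<tau>. indicator {e..4 * r} \<tau> * ((1 + x \<bullet> g) * gauss \<tau> x) \<partial>lborel) - ?P"
          unfolding f_def by (simp only: affine_heat_mix_eq[OF e(1)])
        also have "\<dots> = B t"
          unfolding B_def right_diff_distrib by (rule Bochner_Integration.integral_diff[OF i1 i2, symmetric])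
        finally show ?thesis .
      qed
      ultimately show ?thesis by simp
    qed
    have swB: "stable_weight s t * (\<integral>z. sdiff f x z * gauss t z \<partial>lborel) = 2 * (stable_weight s t * B t)" for t
      using avg[of t] by (cases "0 < t") (auto simp: stable_weight_def)
    have intB: "integrable lborel (\<lambda>t. stable_weight s t * B t)"
      using integral_kern_mixture(1)[OF s(1) _ int] unfolding swB by simp
    have val: "mix_const DIM('a) s * flap s f x = 2 * (\<integral>t. stable_weight s t * B t \<partial>lborel)"
      using integral_kern_mixture(2)[OF s(1) _ int] unfolding swB flap_def by simp
    have "(2 powr (- 2 - s) - \<bar>x \<bullet> g\<bar> / (1 - s)) * (\<integral>\<tau>. indicator {e..r} \<tau> * (\<tau> powr (- s) * gauss \<tau> x) \<partial>lborel)
      - (3/2 * ((2 * r) powr (1 - s) / (1 - s)) + 5 / 2 * r powr (1 - s) / (1 - s) + 6 * r * ((2 * r) powr (- s) / s)) * A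
      \<le> (\<integral>t. stable_weight s t * B t \<partial>lborel)"
    proof (rule stable_average_lower_bound[OF s e p _ _ _ _ _ intB])
      show "gauss t x \<le> A" if "r \<le> t" for t
        unfolding A_def by (rule gauss_le_of_time_ge[OF r that])
      show "gauss t x \<le> (4 * pi * e) powr (- (real DIM('a) / 2))" if "e \<le> t" for t
        by (rule gauss_le_of_time_ge[OF e(1) that])
    qed (simp_all add: B_def)
    then have "2 * (2 powr (- 2 - s) - \<bar>x \<bullet> g\<bar> / (1 - s)) * heat_mix s e r x - C \<le> mix_const DIM('a) s * flap s f x"
      unfolding val heat_mix_def[symmetric] C_def by linarith
    then show ?thesis using int unfolding f_def by simp
  qed
  then show ?thesis by blast
qed

section \<open>The operator tested against smooth functions\<close>

lemma flap_measurable: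
  fixes f :: "'a::euclidean_space \<Rightarrow> real"
  assumes [measurable]: "f \<in> borel_measurable borel"
  shows "flap s f \<in> borel_measurable borel"
proof -
  have "(\<lambda>x. \<integral>z. sdiff f x z * kern s z \<partial>lborel) \<in> borel_measurable lborel"
    unfolding sdiff_def by measurable
  then show ?thesis unfolding flap_def[abs_def] by simp
qed

lemma flap_add:
  assumes "integrable lborel (\<lambda>z. sdiff f x z * kern s z)" "integrable lborel (\<lambda>z. sdiff g x z * kern s z)"
  shows "flap s (\<lambda>y. f y + g y) x = flap s f x + flap s g x"
proof -
  have "sdiff (\<lambda>y. f y + g y) x z * kern s z = sdiff f x z * kern s z + sdiff g x z * kern s z" for z
    by (simp add: sdiff_def algebra_simps)
  then show ?thesis using assms by (simp add: flap_def)
qed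

lemma flap_cmult: "flap s (\<lambda>y. r * f y) x = r * flap s f x"
proof -
  have "sdiff (\<lambda>y. r * f y) x z = r * sdiff f x z" for z
    by (simp add: sdiff_def algebra_simps)
  then show ?thesis by (simp add: flap_def mult.assoc)
qed

text \<open>Value, gradient and second difference are the three quantities that the majorants below
  are built from; one constant for all of them keeps those majorants simple.\<close>

lemma test_functions_tame:
  fixes f :: "'a::euclidean_space \<Rightarrow> real"
  assumes f: "f \<in> test_functions U"
  shows "\<exists>A>0. \<forall>x z. \<bar>f x\<bar> \<le> A \<and> \<bar>ddir f x z\<bar> \<le> A * norm z \<and> \<bar>sdiff f x z\<bar> \<le> A * (norm z)\<^sup>2"
proof -
  obtain M where M: "M > 0" "\<forall>x h. \<bar>f x\<bar> \<le> M \<and> \<bar>ddir f x h\<bar> \<le> M * norm h \<and> \<bar>ddir2 f x h\<bar> \<le> M * (norm h)\<^sup>2"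
    using test_functions_C2_bounded[OF f] by blast
  have "\<bar>f x\<bar> \<le> 2 * M \<and> \<bar>ddir f x z\<bar> \<le> 2 * M * norm z \<and> \<bar>sdiff f x z\<bar> \<le> 2 * M * (norm z)\<^sup>2" for x z
  proof (intro conjI)
    show "\<bar>f x\<bar> \<le> 2 * M" using M(1) M(2)[rule_format, of x 0] by linarith
    have "M * norm z \<le> 2 * M * norm z" using M(1) by (intro mult_right_mono) auto
    then show "\<bar>ddir f x z\<bar> \<le> 2 * M * norm z" using M(2)[rule_format, of x z] by linarith
    have "\<bar>sdiff f x z\<bar> \<le> 2 * (M * (norm z)\<^sup>2)"
      using M(2) by (intro sdiff_le_ddir2 test_functionsD(1)[OF f]) auto
    then show "\<bar>sdiff f x z\<bar> \<le> 2 * M * (norm z)\<^sup>2" by simp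
  qed
  then show ?thesis using M(1) by (intro exI[of _ "2 * M"]) auto
qed

lemma smooth_fun_borel: "smooth_fun f \<Longrightarrow> f \<in> borel_measurable borel"
  by (rule borel_measurable_continuous_onI[OF smooth_fun_continuous])

lemma ddir_zero: "smooth_fun f \<Longrightarrow> ddir f x 0 = 0"
  using ddir_eq_sum[of f x 0] by simp

lemma divergence_scaleR:
  fixes f :: "'a::euclidean_space \<Rightarrow> real"
  assumes f: "smooth_fun f" and b: "b differentiable (at x)"
  shows "divergence (\<lambda>z. f z *\<^sub>R b z) x = f x * divergence b x + ddir f x (b x)"
proof -
  have "((\<lambda>z. f z *\<^sub>R b z) has_derivative (\<lambda>h. f x *\<^sub>R frechet_derivative b (at x) h + ddir f x h *\<^sub>R b x)) (at x)"
    using b by (intro has_derivative_scaleR has_derivative_ddir[OF f]) (simp add: frechet_derivative_works)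
  then have "frechet_derivative (\<lambda>z. f z *\<^sub>R b z) (at x) = (\<lambda>h. f x *\<^sub>R frechet_derivative b (at x) h + ddir f x h *\<^sub>R b x)"
    by (metis frechet_derivative_at)
  then have "divergence (\<lambda>z. f z *\<^sub>R b z) x = (\<Sum>i\<in>Basis. f x * (frechet_derivative b (at x) i \<bullet> i)) + (\<Sum>i\<in>Basis. (b x \<bullet> i) * ddir f x i)"
    by (simp add: divergence_def inner_add_left sum.distrib mult.commute)
  then show ?thesis
    unfolding divergence_def ddir_eq_sum[OF f, of x "b x"] by (simp add: sum_distrib_left)
qed

lemma integrable_sdiff_kern_test:
  assumes s: "0 < s" "s < 1" and f: "f \<in> test_functions U"
  shows "integrable lborel (\<lambda>z. sdiff f x z * kern s z)"
proof -
  obtain A where A: "A > 0" "\<forall>x z. \<bar>f x\<bar> \<le> A \<and> \<bar>ddir f x z\<bar> \<le> A * norm z \<and> \<bar>sdiff f x z\<bar> \<le> A * (norm z)\<^sup>2"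
    using test_functions_tame[OF f] by blast
  show ?thesis
    using A(2) by (intro integrable_sdiff_kern[OF s smooth_fun_borel[OF test_functionsD(1)[OF f]], of A]) auto
qed

text \<open>The coefficients have a meaning on the unit ball only, so their measurability is stated
  after multiplication by its indicator. A single \<open>M\<close> bounds the drift, its divergence
  and the potential term.\<close>

locale drift_setting =
  fixes s M :: real and b :: "'a::euclidean_space \<Rightarrow> 'a" and c u :: "'a \<Rightarrow> real"
  assumes s: "0 < s" "s < 1"
    and u_meas: "u \<in> borel_measurable lebesgue"
    and u_int: "integrable lebesgue (\<lambda>y. \<bar>u y\<bar> / (1 + norm y powr (real DIM('a) + 2 * s)))"
    and u_nonneg: "\<And>x. u x \<ge> 0"
    and M: "0 \<le> M"
    and b_diff: "\<And>x. x \<in> ball 0 1 \<Longrightarrow> b differentiable (at x)"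
    and b_bound: "\<And>x. x \<in> ball 0 1 \<Longrightarrow> norm (b x) \<le> M"
    and div_bound: "\<And>x. x \<in> ball 0 1 \<Longrightarrow> \<bar>divergence b x\<bar> \<le> M"
    and b_meas: "(\<lambda>x. indicator (ball 0 1) x *\<^sub>R b x) \<in> borel_measurable lebesgue"
    and div_meas: "(\<lambda>x. indicator (ball 0 1) x * divergence b x) \<in> borel_measurable lebesgue"
    and c_meas: "(\<lambda>x. indicator (ball 0 1) x * c x) \<in> borel_measurable lebesgue"
    and c_bound: "AE x in lebesgue. x \<in> ball 0 1 \<longrightarrow> \<bar>c x\<bar> \<le> M"
begin

definition weight :: "'a \<Rightarrow> real" where
  "weight x = 1 / (1 + norm x powr (real DIM('a) + 2 * s))"

definition K :: real where
  "K = frac_laplacian_const DIM('a) s / 2"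

text \<open>The lower-order part after the product rule for the divergence. With the indicators
  inside, the integrand lives on the whole space and is the same for the ball and for the punctured
  ball.\<close>

definition low :: "('a \<Rightarrow> real) \<Rightarrow> 'a \<Rightarrow> real" where
  "low f x = u x * (- f x * (indicator (ball 0 1) x * divergence b x)
    - ddir f x (indicator (ball 0 1) x *\<^sub>R b x) + (indicator (ball 0 1) x * c x) * f x)"

definition T :: "('a \<Rightarrow> real) \<Rightarrow> real" where
  "T f = (\<integral>x. u x * (K * flap s f x) \<partial>lebesgue) + (\<integral>x. low f x \<partial>lebesgue)"

lemma K_pos: "K > 0"
  using frac_laplacian_const_pos[OF s] by (simp add: K_def)

lemma weight_pos: "weight x > 0"
  by (simp add: weight_def one_plus_powr_pos)

lemma u_weight_integrable: "integrable lebesgue (\<lambda>x. u x * weight x)"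
  using u_int u_nonneg by (simp add: weight_def)

lemma weight_ge_half: "x \<in> ball 0 1 \<Longrightarrow> 1 \<le> 2 * weight x"
proof -
  assume "x \<in> ball 0 1"
  then have "norm x powr (real DIM('a) + 2 * s) \<le> 1 powr (real DIM('a) + 2 * s)"
    using s by (intro powr_mono2) (auto simp: add_nonneg_nonneg)
  then show ?thesis using one_plus_powr_pos[of x "real DIM('a) + 2 * s"] by (simp add: weight_def divide_simps)
qed

lemma lebesgue_meas: "f \<in> borel_measurable borel \<Longrightarrow> f \<in> borel_measurable lebesgue"
  by (rule measurable_completion) simp

lemma low_measurable:
  assumes f: "smooth_fun f"
  shows "low f \<in> borel_measurable lebesgue"
proof -
  note [measurable] = u_meas b_meas div_meas c_meas lebesgue_meas[OF smooth_fun_borel[OF f]]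
    lebesgue_meas[OF smooth_fun_borel[OF smooth_fun_ddir[OF f]]]
  have "low f = (\<lambda>x. u x * (- f x * (indicator (ball 0 1) x * divergence b x)
    - (\<Sum>i\<in>Basis. ((indicator (ball 0 1) x *\<^sub>R b x) \<bullet> i) * ddir f x i) + (indicator (ball 0 1) x * c x) * f x))"
    unfolding low_def[abs_def] by (subst ddir_eq_sum[OF f]) simp
  also have "\<dots> \<in> borel_measurable lebesgue"
    by (intro borel_measurable_times borel_measurable_add borel_measurable_diff borel_measurable_uminus
        borel_measurable_sum borel_measurable_inner u_meas b_meas div_meas c_meas borel_measurable_const
        lebesgue_meas[OF smooth_fun_borel[OF f]] lebesgue_meas[OF smooth_fun_borel[OF smooth_fun_ddir[OF f]]])
  finally show ?thesis .
qed

text \<open>Three terms of size \<open>A * M\<close>, and 1 \<le> 2 \<open>weight\<close> on the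
  ball: this makes the 6. Outside the ball \<open>low\<close> vanishes.\<close>

lemma low_bound:
  assumes f: "smooth_fun f" and A: "\<And>x. \<bar>f x\<bar> \<le> A" "\<And>x h. \<bar>ddir f x h\<bar> \<le> A * norm h"
  shows "AE x in lebesgue. \<bar>low f x\<bar> \<le> 6 * A * M * (u x * weight x)"
  using c_bound
proof eventually_elim
  case (elim x)
  have A0: "0 \<le> A" using A(1)[of x] by linarith
  show ?case
  proof (cases "x \<in> ball 0 1")
    case True
    have 1: "\<bar>f x * divergence b x\<bar> \<le> A * M"
      unfolding abs_mult using A(1) div_bound[OF True] A0 by (intro mult_mono) auto
    have 2: "\<bar>ddir f x (b x)\<bar> \<le> A * M"
      using A(2)[of x "b x"] mult_left_mono[OF b_bound[OF True] A0] by linarith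
    have 3: "\<bar>c x * f x\<bar> \<le> M * A"
      unfolding abs_mult using A(1) elim True M by (intro mult_mono) auto
    have "\<bar>- f x * divergence b x - ddir f x (b x) + c x * f x\<bar> \<le> 3 * (A * M)"
      using 1 2 3 by (simp add: mult.commute[of M A])
    also have "\<dots> \<le> 3 * (A * M) * (2 * weight x)"
      using weight_ge_half[OF True] A0 M mult_left_mono[of 1 "2 * weight x" "3 * (A * M)"] by simp
    finally have "u x * \<bar>- f x * divergence b x - ddir f x (b x) + c x * f x\<bar> \<le> u x * (3 * (A * M) * (2 * weight x))"
      by (intro mult_left_mono u_nonneg)
    then show ?thesis using True u_nonneg[of x] by (simp add: low_def abs_mult mult_ac)
  next
    case False
    then show ?thesis using u_nonneg[of x] A0 M weight_pos[of x] by (simp add: low_def ddir_zero[OF f])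
  qed
qed

lemma low_integrable:
  assumes f: "f \<in> test_functions U"
  shows "integrable lebesgue (low f)"
proof -
  have sf: "smooth_fun f" using test_functionsD[OF f] by simp
  obtain A where A: "A > 0" "\<forall>x z. \<bar>f x\<bar> \<le> A \<and> \<bar>ddir f x z\<bar> \<le> A * norm z \<and> \<bar>sdiff f x z\<bar> \<le> A * (norm z)\<^sup>2"
    using test_functions_tame[OF f] by blast
  have "AE x in lebesgue. \<bar>low f x\<bar> \<le> 6 * A * M * (u x * weight x)"
    using A by (intro low_bound sf) auto
  then show ?thesis
    by (intro Bochner_Integration.integrable_bound[OF integrable_mult_right[OF u_weight_integrable, of "6 * A * M"]]
        low_measurable sf) (auto elim!: eventually_mono intro: order_trans[OF _ abs_ge_self])
qed

lemma u_flap_measurable: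
  "smooth_fun f \<Longrightarrow> (\<lambda>x. u x * (K * flap s f x)) \<in> borel_measurable lebesgue"
  by (intro borel_measurable_times borel_measurable_const u_meas lebesgue_meas flap_measurable smooth_fun_borel)

lemma flap_weight_bound:
  "\<exists>C\<ge>0. \<forall>f A x. f \<in> test_functions (ball 0 1) \<longrightarrow> (\<forall>y. \<bar>f y\<bar> \<le> A) \<longrightarrow>
    (\<forall>z. \<bar>sdiff f x z\<bar> \<le> A * (norm z)\<^sup>2) \<longrightarrow> \<bar>u x * (K * flap s f x)\<bar> \<le> C * A * (u x * weight x)"
proof -
  obtain C where C: "C \<ge> 0" "\<forall>(f :: 'a \<Rightarrow> real) A x. f \<in> borel_measurable borel \<longrightarrow>
    (\<forall>y. \<bar>f y\<bar> \<le> A) \<longrightarrow> (\<forall>y. y \<notin> ball 0 1 \<longrightarrow> f y = 0) \<longrightarrow>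
    (\<forall>z. \<bar>sdiff f x z\<bar> \<le> A * (norm z)\<^sup>2) \<longrightarrow>
    \<bar>flap s f x\<bar> \<le> C * A / (1 + norm x powr (real DIM('a) + 2 * s))"
    using flap_decay[OF s, where 'a='a] by blast
  have "\<bar>u x * (K * flap s f x)\<bar> \<le> (K * C) * A * (u x * weight x)"
    if f: "f \<in> test_functions (ball 0 1)" and A: "\<forall>y. \<bar>f y\<bar> \<le> A" "\<forall>z. \<bar>sdiff f x z\<bar> \<le> A * (norm z)\<^sup>2" for f A x
  proof -
    have "\<forall>y. y \<notin> ball 0 1 \<longrightarrow> f y = 0" using test_functions_eq_0[OF f] by blast
    then have "\<bar>flap s f x\<bar> \<le> C * A / (1 + norm x powr (real DIM('a) + 2 * s))"
      using C(2) smooth_fun_borel[OF test_functionsD(1)[OF f]] A by blast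
    then have "u x * K * \<bar>flap s f x\<bar> \<le> u x * K * (C * A / (1 + norm x powr (real DIM('a) + 2 * s)))"
      using u_nonneg[of x] K_pos by (intro mult_left_mono) auto
    then show ?thesis using u_nonneg[of x] K_pos by (simp add: abs_mult weight_def mult_ac)
  qed
  then show ?thesis using K_pos C(1) by (intro exI[of _ "K * C"]) auto
qed

lemma u_flap_integrable:
  assumes f: "f \<in> test_functions (ball 0 1)"
  shows "integrable lebesgue (\<lambda>x. u x * (K * flap s f x))"
proof -
  obtain A where A: "A > 0" "\<forall>x z. \<bar>f x\<bar> \<le> A \<and> \<bar>ddir f x z\<bar> \<le> A * norm z \<and> \<bar>sdiff f x z\<bar> \<le> A * (norm z)\<^sup>2"
    using test_functions_tame[OF f] by blast
  obtain C where C: "C \<ge> 0" "\<forall>f A x. f \<in> test_functions (ball 0 1) \<longrightarrow> (\<forall>y. \<bar>f y\<bar> \<le> A) \<longrightarrow>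
    (\<forall>z. \<bar>sdiff f x z\<bar> \<le> A * (norm z)\<^sup>2) \<longrightarrow> \<bar>u x * (K * flap s f x)\<bar> \<le> C * A * (u x * weight x)"
    using flap_weight_bound by blast
  have "\<bar>u x * (K * flap s f x)\<bar> \<le> C * A * (u x * weight x)" for x
    using C(2) f A(2) by blast
  then show ?thesis
    by (intro Bochner_Integration.integrable_bound[OF integrable_mult_right[OF u_weight_integrable, of "C * A"]]
        u_flap_measurable test_functionsD(1)[OF f]) (auto intro!: AE_I2 order_trans[OF _ abs_ge_self])
qed

lemma low_add: "smooth_fun f \<Longrightarrow> smooth_fun g \<Longrightarrow> low (\<lambda>x. f x + g x) x = low f x + low g x"
proof -
  assume f: "smooth_fun f" and g: "smooth_fun g"
  have "ddir (\<lambda>x. f x + g x) x h = ddir f x h + ddir g x h" for h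
    by (rule ddir_unique) (intro has_derivative_add has_derivative_ddir f g)
  then show ?thesis by (simp add: low_def algebra_simps)
qed

lemma low_cmult: "smooth_fun f \<Longrightarrow> low (\<lambda>x. r * f x) x = r * low f x"
proof -
  assume f: "smooth_fun f"
  have "ddir (\<lambda>x. r * f x) x h = r * ddir f x h" for h
    by (rule ddir_unique) (intro has_derivative_mult_right has_derivative_ddir f)
  then show ?thesis by (simp add: low_def algebra_simps)
qed

lemma T_add:
  assumes f: "f \<in> test_functions (ball 0 1)" and g: "g \<in> test_functions (ball 0 1)"
  shows "T (\<lambda>x. f x + g x) = T f + T g"
proof -
  have "u x * (K * flap s (\<lambda>x. f x + g x) x) = u x * (K * flap s f x) + u x * (K * flap s g x)" for x
    by (simp add: flap_add[OF integrable_sdiff_kern_test[OF s f] integrable_sdiff_kern_test[OF s g]] distrib_left)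
  then have "(\<integral>x. u x * (K * flap s (\<lambda>x. f x + g x) x) \<partial>lebesgue) =
      (\<integral>x. u x * (K * flap s f x) \<partial>lebesgue) + (\<integral>x. u x * (K * flap s g x) \<partial>lebesgue)"
    using u_flap_integrable[OF f] u_flap_integrable[OF g] by (simp only: Bochner_Integration.integral_add)
  moreover have "(\<integral>x. low (\<lambda>x. f x + g x) x \<partial>lebesgue) = (\<integral>x. low f x \<partial>lebesgue) + (\<integral>x. low g x \<partial>lebesgue)"
    using low_integrable[OF f] low_integrable[OF g] test_functionsD(1)[OF f] test_functionsD(1)[OF g]
    by (simp add: low_add)
  ultimately show ?thesis by (simp add: T_def)
qed

lemma T_cmult:
  assumes f: "f \<in> test_functions (ball 0 1)"
  shows "T (\<lambda>x. r * f x) = r * T f"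
proof -
  have "u x * (K * flap s (\<lambda>x. r * f x) x) = r * (u x * (K * flap s f x))" for x
    by (simp add: flap_cmult)
  then have "(\<integral>x. u x * (K * flap s (\<lambda>x. r * f x) x) \<partial>lebesgue) = r * (\<integral>x. u x * (K * flap s f x) \<partial>lebesgue)"
    by (simp only: integral_mult_right_zero)
  moreover have "(\<integral>x. low (\<lambda>x. r * f x) x \<partial>lebesgue) = r * (\<integral>x. low f x \<partial>lebesgue)"
    using test_functionsD(1)[OF f] by (simp add: low_cmult)
  ultimately show ?thesis by (simp add: T_def distrib_left)
qed

text \<open>Convergence is asked of values and gradients; second order enters through a bound
  uniform in j. This fits truncations near a zero set, whose second derivatives are merely bounded.
  Dominated convergence acts first in z, inside \<open>flap\<close>, and then in x against u times
  \<open>weight\<close>.\<close>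

lemma T_tendsto:
  fixes F :: "nat \<Rightarrow> 'a \<Rightarrow> real"
  assumes F: "\<And>j. F j \<in> test_functions (ball 0 1)" and f: "f \<in> test_functions (ball 0 1)"
    and A: "\<And>j x. \<bar>F j x\<bar> \<le> A" "\<And>j x z. \<bar>sdiff (F j) x z\<bar> \<le> A * (norm z)\<^sup>2" "\<And>j x h. \<bar>ddir (F j) x h\<bar> \<le> A * norm h"
    and lim: "\<And>x. (\<lambda>j. F j x) \<longlonglongrightarrow> f x" "\<And>x h. (\<lambda>j. ddir (F j) x h) \<longlonglongrightarrow> ddir f x h"
  shows "(\<lambda>j. T (F j)) \<longlonglongrightarrow> T f"
proof -
  have sF: "smooth_fun (F j)" for j using test_functionsD[OF F] by simp
  have sf: "smooth_fun f" using test_functionsD[OF f] by simp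
  have [measurable]: "F j \<in> borel_measurable borel" "f \<in> borel_measurable borel" for j
    by (intro smooth_fun_borel sF sf)+
  have flap_lim: "(\<lambda>j. flap s (F j) x) \<longlonglongrightarrow> flap s f x" for x
    unfolding flap_def
  proof (rule integral_dominated_convergence)
    show "integrable lborel (\<lambda>z::'a. 4 * A * (min 1 ((norm z)\<^sup>2) * kern s z))"
      by (intro integrable_mult_right integrable_min_kern s)
    show "AE z in lborel. norm (sdiff (F j) x z * kern s z) \<le> 4 * A * (min 1 ((norm z)\<^sup>2) * kern s z)" for j
      using sdiff_kern_le[of "F j" A x _ s] A by (intro AE_I2) auto
    show "AE z in lborel. (\<lambda>j. sdiff (F j) x z * kern s z) \<longlonglongrightarrow> sdiff f x z * kern s z"
      unfolding sdiff_def by (intro AE_I2 tendsto_intros lim)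
  qed measurable
  obtain C where C: "C \<ge> 0" "\<forall>f A x. f \<in> test_functions (ball 0 1) \<longrightarrow> (\<forall>y. \<bar>f y\<bar> \<le> A) \<longrightarrow>
    (\<forall>z. \<bar>sdiff f x z\<bar> \<le> A * (norm z)\<^sup>2) \<longrightarrow> \<bar>u x * (K * flap s f x)\<bar> \<le> C * A * (u x * weight x)"
    using flap_weight_bound by blast
  have "(\<lambda>j. \<integral>x. u x * (K * flap s (F j) x) \<partial>lebesgue) \<longlonglongrightarrow> (\<integral>x. u x * (K * flap s f x) \<partial>lebesgue)"
  proof (rule integral_dominated_convergence)
    show "integrable lebesgue (\<lambda>x. C * A * (u x * weight x))"
      by (intro integrable_mult_right u_weight_integrable)
    show "AE x in lebesgue. norm (u x * (K * flap s (F j) x)) \<le> C * A * (u x * weight x)" for j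
    proof (intro AE_I2)
      fix x
      have "\<bar>u x * (K * flap s (F j) x)\<bar> \<le> C * A * (u x * weight x)"
        using F[of j] A(1)[of j] A(2)[of j x] by (intro C(2)[rule_format]) auto
      then show "norm (u x * (K * flap s (F j) x)) \<le> C * A * (u x * weight x)" by simp
    qed
    show "AE x in lebesgue. (\<lambda>j. u x * (K * flap s (F j) x)) \<longlonglongrightarrow> u x * (K * flap s f x)"
      by (intro AE_I2 tendsto_intros flap_lim)
  qed (intro u_flap_measurable sF sf)+
  moreover have "(\<lambda>j. \<integral>x. low (F j) x \<partial>lebesgue) \<longlonglongrightarrow> (\<integral>x. low f x \<partial>lebesgue)"
  proof (rule integral_dominated_convergence)
    show "integrable lebesgue (\<lambda>x. 6 * A * M * (u x * weight x))"
      by (intro integrable_mult_right u_weight_integrable)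
    show "AE x in lebesgue. norm (low (F j) x) \<le> 6 * A * M * (u x * weight x)" for j
      using low_bound[OF sF A(1) A(3), of j] by simp
    show "AE x in lebesgue. (\<lambda>j. low (F j) x) \<longlonglongrightarrow> low f x"
      unfolding low_def by (intro AE_I2 tendsto_intros lim)
  qed (intro low_measurable sF sf)+
  ultimately show ?thesis unfolding T_def by (intro tendsto_add)
qed

text \<open>The origin is a null set and \<open>low\<close> vanishes off the ball, so the integrals
  over the ball, the punctured ball and the whole space coincide.\<close>

lemma frac_operator_distr_eq_T:
  assumes U: "U = ball 0 1 \<or> U = ball 0 1 - {0}" and f: "f \<in> test_functions U"
  shows "frac_operator_distr s b c u U f = T f"
proof -
  have sf: "smooth_fun f" using test_functionsD[OF f] by simp
  obtain A where A: "A > 0" "\<forall>x z. \<bar>f x\<bar> \<le> A \<and> \<bar>ddir f x z\<bar> \<le> A * norm z \<and> \<bar>sdiff f x z\<bar> \<le> A * (norm z)\<^sup>2"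
    using test_functions_tame[OF f] by blast
  have "frac_laplacian s f x = K * flap s f x" for x
    unfolding K_def using A by (intro frac_laplacian_eq_flap[OF s smooth_fun_borel[OF sf], of A]) auto
  moreover have "(LINT x:U|lebesgue. u x * (- divergence (\<lambda>z. f z *\<^sub>R b z) x + c x * f x)) = (\<integral>x. low f x \<partial>lebesgue)"
  proof -
    have eq: "indicator U x *\<^sub>R (u x * (- divergence (\<lambda>z. f z *\<^sub>R b z) x + c x * f x)) = indicator U x * low f x" for x
    proof (cases "x \<in> U")
      case True
      then have "x \<in> ball 0 1" using U by auto
      then show ?thesis
        using True by (simp add: divergence_scaleR[OF sf b_diff] low_def algebra_simps)
    qed simp
    have sU: "U \<in> sets lebesgue" using U by auto
    have "(\<integral>x. indicator U x * low f x \<partial>lebesgue) = (\<integral>x. low f x \<partial>lebesgue)"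
    proof (rule integral_cong_AE)
      have "AE x in lebesgue. x \<noteq> (0::'a)"
        by (rule AE_completion[OF AE_lborel_singleton])
      then show "AE x in lebesgue. indicator U x * low f x = low f x"
      proof eventually_elim
        case (elim x)
        show ?case
        proof (cases "x \<in> U")
          case False
          then have "x \<notin> ball 0 1" using elim U by auto
          then show ?thesis by (simp add: low_def ddir_zero[OF sf])
        qed simp
      qed
    qed (use sU low_measurable[OF sf] in \<open>auto intro!: borel_measurable_times borel_measurable_indicator\<close>)
    then show ?thesis unfolding set_lebesgue_integral_def eq .
  qed
  ultimately show ?thesis by (simp add: frac_operator_distr_def T_def)
qed

end

section \<open>Truncation near the zero set\<close>

text \<open>Used in the rescaled form \<open>d * trunc_fun (t / d)\<close>, which kills values below
  d/2 and leaves values above d unchanged.\<close>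

definition trunc_fun :: "real \<Rightarrow> real" where
  "trunc_fun t = t * step_fun t"

lemma smooth_fun_trunc: "smooth_fun trunc_fun"
  unfolding trunc_fun_def[abs_def] by (intro smooth_fun_mult smooth_fun_id smooth_fun_step)

text \<open>The bounds on F1 and on t F2 are the ones that survive the rescaling by d. On [1/2, 1]
  they are maxima of continuous functions; outside that interval F1 is 0 or 1 and F2 is 0.\<close>

lemma trunc_fun_derivs:
  obtains F1 F2 :: "real \<Rightarrow> real" and C where
    "\<And>t. (trunc_fun has_real_derivative F1 t) (at t)" "\<And>t. (F1 has_real_derivative F2 t) (at t)"
    "C > 0" "\<And>t. \<bar>F1 t\<bar> \<le> C" "\<And>t. \<bar>t * F2 t\<bar> \<le> C" "\<And>t. t > 1 \<Longrightarrow> F1 t = 1"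
proof -
  define F1 where "F1 = (\<lambda>t. ddir trunc_fun t 1)"
  define F2 where "F2 = (\<lambda>t. ddir F1 t 1)"
  have s1: "smooth_fun F1" unfolding F1_def by (rule smooth_fun_ddir[OF smooth_fun_trunc]) simp
  have s2: "smooth_fun F2" unfolding F2_def by (rule smooth_fun_ddir[OF s1]) simp
  have d1: "(trunc_fun has_real_derivative F1 t) (at t)" for t
    using DERIV_along_line[OF smooth_fun_trunc, of 0 1 t] by (simp add: F1_def)
  have d2: "(F1 has_real_derivative F2 t) (at t)" for t
    using DERIV_along_line[OF s1, of 0 1 t] by (simp add: F2_def)
  have F1_hi: "F1 t = 1" if "t > 1" for t
  proof -
    have "((\<lambda>t. t) has_real_derivative 1) (at t)" by simp
    then have "(trunc_fun has_real_derivative 1) (at t)"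
      by (rule has_field_derivative_transform_within_open[of _ _ _ "{1<..}"])
        (use that in \<open>auto simp: trunc_fun_def step_fun_eq_1\<close>)
    then show ?thesis using d1 DERIV_unique by blast
  qed
  have F1_lo: "F1 t = 0" if "t < 1/2" for t
  proof -
    have "((\<lambda>t. 0) has_real_derivative 0) (at t)" by simp
    then have "(trunc_fun has_real_derivative 0) (at t)"
      by (rule has_field_derivative_transform_within_open[of _ _ _ "{..<1/2}"])
        (use that in \<open>auto simp: trunc_fun_def step_fun_eq_0\<close>)
    then show ?thesis using d1 DERIV_unique by blast
  qed
  have F2_hi: "F2 t = 0" if "t > 1" for t
  proof -
    have "((\<lambda>t. 1) has_real_derivative 0) (at t)" by simp
    then have "(F1 has_real_derivative 0) (at t)"
      by (rule has_field_derivative_transform_within_open[of _ _ _ "{1<..}"])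
        (use that F1_hi in auto)
    then show ?thesis using d2 DERIV_unique by blast
  qed
  have F2_lo: "F2 t = 0" if "t < 1/2" for t
  proof -
    have "((\<lambda>t. 0) has_real_derivative 0) (at t)" by simp
    then have "(F1 has_real_derivative 0) (at t)"
      by (rule has_field_derivative_transform_within_open[of _ _ _ "{..<1/2}"])
        (use that F1_lo in auto)
    then show ?thesis using d2 DERIV_unique by blast
  qed
  have "compact (F1 ` {1/2..1})" "compact ((\<lambda>t. t * F2 t) ` {1/2..1})"
    by (intro compact_continuous_image continuous_intros smooth_fun_continuous s1 s2 compact_Icc)+
  then obtain C1 C2 where C: "\<forall>y\<in>F1 ` {1/2..1}. norm y \<le> C1" "\<forall>y\<in>(\<lambda>t. t * F2 t) ` {1/2..1}. norm y \<le> C2"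
    by (meson compact_imp_bounded bounded_iff)
  define C where "C = 1 + \<bar>C1\<bar> + \<bar>C2\<bar>"
  have "\<bar>F1 t\<bar> \<le> C" for t
  proof -
    consider "t < 1/2" | "t \<in> {1/2..1}" | "t > 1" by fastforce
    then show ?thesis
    proof cases
      case 2
      then have "\<bar>F1 t\<bar> \<le> C1" using C(1) by auto
      then show ?thesis by (simp add: C_def)
    qed (simp_all add: F1_lo F1_hi C_def)
  qed
  moreover have "\<bar>t * F2 t\<bar> \<le> C" for t
  proof -
    consider "t < 1/2" | "t \<in> {1/2..1}" | "t > 1" by fastforce
    then show ?thesis
    proof cases
      case 2
      then have "\<bar>t * F2 t\<bar> \<le> C2" using C(2) by auto
      then show ?thesis by (simp add: C_def)
    qed (simp_all add: F2_lo F2_hi C_def)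
  qed
  moreover have "C > 0" by (simp add: C_def)
  ultimately show thesis using that[of F1 F2 C] d1 d2 F1_hi by blast
qed

text \<open>Along a line the second derivative is F2(f/d) f'^2/d + F1(f/d) f''. Only the first term
  threatens to blow up as d \<rightarrow> 0, and f'^2 \<le> 4 L f turns it into at most 4 L times
  (f/d) |F2(f/d)|, bounded independently of d. The same inequality makes the gradient vanish at the
  zeros of f, so the gradients of the truncations converge there too.\<close>

lemma nonneg_truncation:
  fixes f :: "'a::euclidean_space \<Rightarrow> real"
  assumes f: "f \<in> test_functions U" and nn: "\<And>x. 0 \<le> f x"
  shows "\<exists>A F1. (\<forall>d>0. \<forall>x z. \<bar>d * trunc_fun (f x / d)\<bar> \<le> A \<and>
      \<bar>sdiff (\<lambda>x. d * trunc_fun (f x / d)) x z\<bar> \<le> A * (norm z)\<^sup>2 \<and>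
      \<bar>ddir (\<lambda>x. d * trunc_fun (f x / d)) x z\<bar> \<le> A * norm z \<and>
      ddir (\<lambda>x. d * trunc_fun (f x / d)) x z = F1 (f x / d) * ddir f x z) \<and>
      (\<forall>t>1. F1 t = 1) \<and> (\<forall>x z. f x = 0 \<longrightarrow> ddir f x z = 0)"
proof -
  obtain F1 F2 :: "real \<Rightarrow> real" and C where
    F: "\<And>t. (trunc_fun has_real_derivative F1 t) (at t)" "\<And>t. (F1 has_real_derivative F2 t) (at t)"
    "C > 0" "\<And>t. \<bar>F1 t\<bar> \<le> C" "\<And>t. \<bar>t * F2 t\<bar> \<le> C" "\<And>t. t > 1 \<Longrightarrow> F1 t = 1"
    using trunc_fun_derivs by blast
  have sf: "smooth_fun f" using test_functionsD[OF f] by simp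
  obtain M where M: "M > 0" "\<forall>x h. \<bar>f x\<bar> \<le> M \<and> \<bar>ddir f x h\<bar> \<le> M * norm h \<and> \<bar>ddir2 f x h\<bar> \<le> M * (norm h)\<^sup>2"
    using test_functions_C2_bounded[OF f] by blast
  define A where "A = M + C * M + 2 * (5 * C * M)"
  have A: "M \<le> A" "C * M \<le> A" "2 * (5 * C * M) \<le> A" using M(1) F(3) by (simp_all add: A_def)
  have grad: "(ddir f (x + t *\<^sub>R z) z)\<^sup>2 \<le> 4 * (M * (norm z)\<^sup>2) * f (x + t *\<^sub>R z)" if "z \<noteq> 0" for x z t
    using nonneg_deriv_sq_le[of "\<lambda>t. f (x + t *\<^sub>R z)" "\<lambda>t. ddir f (x + t *\<^sub>R z) z"
        "\<lambda>t. ddir2 f (x + t *\<^sub>R z) z" "M * (norm z)\<^sup>2" t]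
      DERIV_along_line[OF sf] DERIV_ddir_along_line[OF sf] M nn that by simp
  have zero: "ddir f x z = 0" if "f x = 0" for x z
  proof (cases "z = 0")
    case False
    then show ?thesis using grad[of z x 0] that by simp
  qed (simp add: ddir_zero[OF sf])
  have main: "\<bar>d * trunc_fun (f x / d)\<bar> \<le> A \<and>
      \<bar>sdiff (\<lambda>x. d * trunc_fun (f x / d)) x z\<bar> \<le> A * (norm z)\<^sup>2 \<and>
      \<bar>ddir (\<lambda>x. d * trunc_fun (f x / d)) x z\<bar> \<le> A * norm z \<and>
      ddir (\<lambda>x. d * trunc_fun (f x / d)) x z = F1 (f x / d) * ddir f x z" if d: "d > 0" for d x z
  proof (intro conjI)
    have "\<bar>d * trunc_fun (f x / d)\<bar> = f x * step_fun (f x / d)"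
      using d nn[of x] step_fun_nonneg by (simp add: trunc_fun_def abs_mult)
    also have "\<dots> \<le> f x * 1" using nn step_fun_le_1 by (intro mult_left_mono) auto
    also have "\<dots> \<le> A" using M(2)[rule_format, of x 0] A(1) by linarith
    finally show "\<bar>d * trunc_fun (f x / d)\<bar> \<le> A" .
    have der: "ddir (\<lambda>x. d * trunc_fun (f x / d)) x z = F1 (f x / d) * ddir f x z"
    proof (rule ddir_unique)
      have "((\<lambda>x. inverse d * f x) has_derivative (\<lambda>h. inverse d * ddir f x h)) (at x)"
        by (intro has_derivative_mult_right has_derivative_ddir sf)
      then have 1: "((\<lambda>x. f x / d) has_derivative (\<lambda>h. ddir f x h / d)) (at x)"
        by (simp add: divide_inverse mult.commute)
      have 2: "(trunc_fun has_derivative (\<lambda>h. F1 (f x / d) * h)) (at (f x / d))"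
        using F(1) by (simp add: has_field_derivative_def)
      have "((\<lambda>x. d * trunc_fun (f x / d)) has_derivative (\<lambda>h. d * (F1 (f x / d) * (ddir f x h / d)))) (at x)"
        by (intro has_derivative_mult_right has_derivative_compose[OF 1 2])
      then show "((\<lambda>x. d * trunc_fun (f x / d)) has_derivative (\<lambda>h. F1 (f x / d) * ddir f x h)) (at x)"
        using d by simp
    qed
    then show "ddir (\<lambda>x. d * trunc_fun (f x / d)) x z = F1 (f x / d) * ddir f x z" .
    have "\<bar>F1 (f x / d) * ddir f x z\<bar> \<le> C * (M * norm z)"
      unfolding abs_mult using F(3,4) M(2) by (intro mult_mono) auto
    also have "\<dots> \<le> A * norm z" using mult_right_mono[OF A(2), of "norm z"] by simp
    finally show "\<bar>ddir (\<lambda>x. d * trunc_fun (f x / d)) x z\<bar> \<le> A * norm z" unfolding der .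
    show "\<bar>sdiff (\<lambda>x. d * trunc_fun (f x / d)) x z\<bar> \<le> A * (norm z)\<^sup>2"
    proof (cases "z = 0")
      case False
      define g where "g = (\<lambda>t. f (x + t *\<^sub>R z))"
      define g' where "g' = (\<lambda>t. ddir f (x + t *\<^sub>R z) z)"
      define g'' where "g'' = (\<lambda>t. ddir2 f (x + t *\<^sub>R z) z)"
      have dg: "(g has_real_derivative g' t) (at t)" "(g' has_real_derivative g'' t) (at t)" for t
        unfolding g_def g'_def g''_def by (intro DERIV_along_line DERIV_ddir_along_line sf)+
      have dgd: "((\<lambda>t. g t / d) has_real_derivative g' t / d) (at t)" for t
        using DERIV_cdivide[OF dg(1)] by simp
      have e1: "((\<lambda>t. d * trunc_fun (g t / d)) has_real_derivative (F1 (g t / d) * g' t)) (at t)" for t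
        using DERIV_cmult[OF DERIV_chain2[OF F(1) dgd], of d t] d by simp
      have e2: "((\<lambda>t. F1 (g t / d) * g' t) has_real_derivative (F2 (g t / d) * (g' t / d) * g' t + g'' t * F1 (g t / d))) (at t)" for t
        by (intro DERIV_mult DERIV_chain2[OF F(2) dgd] dg)
      have e3: "\<bar>F2 (g t / d) * (g' t / d) * g' t + g'' t * F1 (g t / d)\<bar> \<le> 5 * C * (M * (norm z)\<^sup>2)" for t
      proof -
        have L: "0 \<le> M * (norm z)\<^sup>2" using M(1) by simp
        have "\<bar>F2 (g t / d) * (g' t / d) * g' t\<bar> = \<bar>F2 (g t / d)\<bar> / d * (g' t)\<^sup>2"
          using d by (simp add: abs_mult power2_eq_square)
        also have "\<dots> \<le> \<bar>F2 (g t / d)\<bar> / d * (4 * (M * (norm z)\<^sup>2) * g t)"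
          using grad[OF False] d by (intro mult_left_mono) (auto simp: g_def g'_def)
        also have "\<dots> = 4 * (M * (norm z)\<^sup>2) * \<bar>g t / d * F2 (g t / d)\<bar>"
          using d nn by (simp add: abs_mult g_def)
        also have "\<dots> \<le> 4 * (M * (norm z)\<^sup>2) * C" using L by (intro mult_left_mono[OF F(5)]) auto
        finally have 1: "\<bar>F2 (g t / d) * (g' t / d) * g' t\<bar> \<le> 4 * (M * (norm z)\<^sup>2) * C" .
        have "\<bar>g'' t * F1 (g t / d)\<bar> \<le> (M * (norm z)\<^sup>2) * C"
          unfolding abs_mult using M(2) F(4) L by (intro mult_mono) (auto simp: g''_def)
        then have "\<bar>F2 (g t / d) * (g' t / d) * g' t + g'' t * F1 (g t / d)\<bar> \<le> 4 * (M * (norm z)\<^sup>2) * C + (M * (norm z)\<^sup>2) * C"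
          using 1 by (intro order_trans[OF abs_triangle_ineq] add_mono)
        then show ?thesis by (simp add: algebra_simps)
      qed
      have "\<bar>2 * (d * trunc_fun (g 0 / d)) - d * trunc_fun (g 1 / d) - d * trunc_fun (g (- 1) / d)\<bar> \<le> 2 * (5 * C * (M * (norm z)\<^sup>2))"
        by (rule second_difference_le[OF e1 e2 e3])
      also have "\<dots> = 2 * (5 * C * M) * (norm z)\<^sup>2" by simp
      also have "\<dots> \<le> A * (norm z)\<^sup>2" using A(3) by (intro mult_right_mono) auto
      finally show ?thesis by (simp add: sdiff_def g_def)
    qed (simp add: sdiff_def)
  qed
  show ?thesis using main zero F(6) by (intro exI[of _ A] exI[of _ F1]) blast
qed

context drift_setting
begin

lemma T_nonneg_of_zero:
  assumes super: "\<And>f. f \<in> test_functions (ball 0 1 - {0}) \<Longrightarrow> (\<And>x. 0 \<le> f x) \<Longrightarrow> 0 \<le> T f"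
    and f: "f \<in> test_functions (ball 0 1)" and nn: "\<And>x. 0 \<le> f x" and f0: "f 0 = 0"
  shows "0 \<le> T f"
proof -
  obtain A F1 where A: "\<forall>d>0. \<forall>x z. \<bar>d * trunc_fun (f x / d)\<bar> \<le> A \<and>
      \<bar>sdiff (\<lambda>x. d * trunc_fun (f x / d)) x z\<bar> \<le> A * (norm z)\<^sup>2 \<and>
      \<bar>ddir (\<lambda>x. d * trunc_fun (f x / d)) x z\<bar> \<le> A * norm z \<and>
      ddir (\<lambda>x. d * trunc_fun (f x / d)) x z = F1 (f x / d) * ddir f x z"
    and F1: "\<forall>t>1. F1 t = 1" and zero: "\<forall>x z. f x = 0 \<longrightarrow> ddir f x z = 0"
    using nonneg_truncation[OF f nn] by blast
  have sf: "smooth_fun f" using test_functionsD[OF f] by simp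
  define d where "d = (\<lambda>j. 1 / real (Suc j))"
  have d: "d j > 0" for j by (simp add: d_def)
  have d_nz: "d j \<noteq> 0" for j by (simp add: d_def)
  have dlim: "d \<longlonglongrightarrow> 0" unfolding d_def using LIMSEQ_inverse_real_of_nat by (simp add: inverse_eq_divide)
  define F where "F = (\<lambda>j x. d j * trunc_fun (f x / d j))"
  have tf: "F j \<in> test_functions (ball 0 1 - {0})" for j
  proof (rule test_functionsI)
    have "smooth_fun (\<lambda>x. d j * trunc_fun (inverse (d j) * f x))"
      by (intro smooth_fun_cmult smooth_fun_compose[OF smooth_fun_trunc] sf)
    then show "smooth_fun (F j)" by (simp add: F_def divide_inverse mult.commute)
    \<comment> \<open>Compact as a closed part of the support, and free of the origin because f is 0
      there.\<close>
    let ?K = "closure {x. f x \<noteq> 0} \<inter> {x. d j / 2 \<le> f x}"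
    have "closed {x. d j / 2 \<le> f x}"
      by (intro closed_Collect_le continuous_intros smooth_fun_continuous sf)
    then show "compact ?K" using test_functionsD(2)[OF f] by (simp add: compact_Int_closed)
    show "?K \<subseteq> ball 0 1 - {0}" using test_functionsD(3)[OF f] f0 d[of j] by auto
    show "F j x = 0" if "x \<notin> ?K" for x
    proof (cases "f x = 0")
      case False
      then have "x \<in> closure {x. f x \<noteq> 0}" using closure_subset[of "{x. f x \<noteq> 0}"] by auto
      then have "f x < d j / 2" using that by auto
      then have "f x / d j \<le> 1/2" using d[of j] by (simp add: field_simps)
      then show ?thesis by (simp add: F_def trunc_fun_def step_fun_eq_0)
    qed (simp add: F_def trunc_fun_def)
  qed
  have tf1: "F j \<in> test_functions (ball 0 1)" for j
    using tf test_functions_mono[of "ball 0 1 - {0::'a}" "ball 0 1"] by blast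
  have ev: "eventually (\<lambda>j. f x / d j > 1) sequentially" if "f x \<noteq> 0" for x
  proof -
    have "f x > 0" using that nn[of x] by simp
    then have "eventually (\<lambda>j. d j < f x) sequentially" using dlim by (intro order_tendstoD(2)) auto
    then show ?thesis by eventually_elim (use d less_divide_eq_1_pos in blast)
  qed
  have lim: "(\<lambda>j. T (F j)) \<longlonglongrightarrow> T f"
  proof (rule T_tendsto[OF tf1 f])
    show "\<bar>F j x\<bar> \<le> A" "\<bar>sdiff (F j) x z\<bar> \<le> A * (norm z)\<^sup>2" "\<bar>ddir (F j) x z\<bar> \<le> A * norm z" for j x z
      using A d[of j] unfolding F_def by blast+
    show "(\<lambda>j. F j x) \<longlonglongrightarrow> f x" for x
    proof (cases "f x = 0")
      case False
      from ev[OF this] have "eventually (\<lambda>j. F j x = f x) sequentially"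
        by eventually_elim (simp add: F_def trunc_fun_def step_fun_eq_1 d_nz)
      then show ?thesis by (rule tendsto_eventually)
    next
      case True
      then have "F j x = f x" for j by (simp add: F_def trunc_fun_def)
      then show ?thesis by simp
    qed
    show "(\<lambda>j. ddir (F j) x h) \<longlonglongrightarrow> ddir f x h" for x h
    proof -
      have eq: "ddir (F j) x h = F1 (f x / d j) * ddir f x h" for j
        using A d[of j] unfolding F_def by blast
      show ?thesis
      proof (cases "f x = 0")
        case True
        then show ?thesis using zero by (simp add: eq)
      next
        case False
        from ev[OF this] have "eventually (\<lambda>j. ddir (F j) x h = ddir f x h) sequentially"
          by eventually_elim (use F1 in \<open>simp add: eq\<close>)
        then show ?thesis by (rule tendsto_eventually)
      qed
    qed
  qed
  have "0 \<le> T (F j)" for j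
  proof (rule super[OF tf])
    show "0 \<le> F j x" for x
      using d[of j] nn[of x] step_fun_nonneg by (simp add: F_def trunc_fun_def)
  qed
  then show ?thesis using LIMSEQ_le_const[OF lim, of 0] by blast
qed

end

section \<open>The barrier\<close>

lemma gauss_eq_zero_time: "gauss t x = gauss t (0::'a::euclidean_space) * exp (- ((norm x)\<^sup>2 / (4 * t)))"
  for x :: "'a::euclidean_space"
  by (simp add: gauss_def)

text \<open>Each Gaussian is compared with its own value at 0; the slowest decay in the window, at
  the largest time R, supplies the common factor.\<close>

lemma heat_mix_le_zero:
  fixes x :: "'a::euclidean_space"
  assumes e: "0 < e" and R: "0 < R"
  shows "heat_mix 0 e R x \<le> exp (- ((norm x)\<^sup>2 / (4 * R))) * heat_mix 0 e R (0::'a)"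
proof -
  have "heat_mix 0 e R x \<le> (\<integral>\<tau>. exp (- ((norm x)\<^sup>2 / (4 * R))) * (indicator {e..R} \<tau> * (\<tau> powr (- 0) * gauss \<tau> (0::'a))) \<partial>lborel)"
    unfolding heat_mix_def
  proof (rule integral_mono)
    show "integrable lborel (\<lambda>\<tau>. indicator {e..R} \<tau> * (\<tau> powr (- 0) * gauss \<tau> x))"
      by (rule integrable_heat_mix[OF e]) simp
    show "integrable lborel (\<lambda>\<tau>. exp (- ((norm x)\<^sup>2 / (4 * R))) * (indicator {e..R} \<tau> * (\<tau> powr (- 0) * gauss \<tau> (0::'a))))"
      by (rule integrable_mult_right[OF integrable_heat_mix[OF e]]) simp
    fix \<tau> :: real
    show "indicator {e..R} \<tau> * (\<tau> powr (- 0) * gauss \<tau> x) \<le>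
        exp (- ((norm x)\<^sup>2 / (4 * R))) * (indicator {e..R} \<tau> * (\<tau> powr (- 0) * gauss \<tau> (0::'a)))"
    proof (cases "\<tau> \<in> {e..R}")
      case True
      then have \<tau>: "0 < \<tau>" "\<tau> \<le> R" using e by auto
      have "(norm x)\<^sup>2 / (4 * R) \<le> (norm x)\<^sup>2 / (4 * \<tau>)" using \<tau> by (intro divide_left_mono) auto
      then have "gauss \<tau> (0::'a) * exp (- ((norm x)\<^sup>2 / (4 * \<tau>))) \<le> gauss \<tau> (0::'a) * exp (- ((norm x)\<^sup>2 / (4 * R)))"
        by (intro mult_left_mono) auto
      then show ?thesis using True \<tau> gauss_eq_zero_time[of \<tau> x] by (simp add: mult.commute)
    qed simp
  qed
  also have "\<dots> = exp (- ((norm x)\<^sup>2 / (4 * R))) * heat_mix 0 e R (0::'a)"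
    by (simp only: integral_mult_right_zero heat_mix_def)
  finally show ?thesis .
qed

text \<open>In dimension one \<open>heat_mix 0 e R 0\<close> stays bounded as \<open>e \<rightarrow> 0\<close>; this is where \<open>n \<ge> 2\<close> enters.\<close>

lemma heat_mix_at_zero_lower:
  assumes dim: "DIM('a::euclidean_space) \<ge> 2" and e: "0 < e" "e \<le> R" and R: "R \<le> 1"
  shows "(4 * pi) powr (- (real DIM('a) / 2)) * (ln R - ln e) \<le> heat_mix 0 e R (0::'a)"
proof -
  define c where "c = (4 * pi) powr (- (real DIM('a) / 2))"
  have "((\<lambda>\<tau>. c * (1 / \<tau>)) has_integral (c * ln R - c * ln e)) {e..R}"
  proof (rule fundamental_theorem_of_calculus[OF e(2)])
    fix \<tau> assume "\<tau> \<in> {e..R}"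
    then have "\<tau> > 0" using e by auto
    then have "((\<lambda>\<tau>. c * ln \<tau>) has_real_derivative c * (1 / \<tau>)) (at \<tau> within {e..R})"
      by (auto intro!: derivative_eq_intros)
    then show "((\<lambda>\<tau>. c * ln \<tau>) has_vector_derivative c * (1 / \<tau>)) (at \<tau> within {e..R})"
      by (simp add: has_real_derivative_iff_has_vector_derivative)
  qed
  moreover have "((\<lambda>\<tau>. (\<tau> powr (- 0) * (4 * pi * \<tau>) powr (- (real DIM('a) / 2))) * exp (- ((norm (0::'a))\<^sup>2 / (4 * \<tau>))))
      has_integral heat_mix 0 e R (0::'a)) {e..R}"
    unfolding heat_mix_eq_integral[OF e(1) order_refl]
    using e by (intro integrable_integral integrable_continuous_interval continuous_intros) auto
  ultimately have "c * ln R - c * ln e \<le> heat_mix 0 e R (0::'a)"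
  proof (rule has_integral_le)
    fix \<tau> assume "\<tau> \<in> {e..R}"
    then have \<tau>: "0 < \<tau>" "\<tau> \<le> 1" using e R by auto
    \<comment> \<open>On (0, 1] the power \<tau>^(-n/2) with n \<ge> 2 is at least 1/\<tau>, whose
      integral is the logarithm.\<close>
    have "\<tau> powr (- 1) \<le> \<tau> powr (- (real DIM('a) / 2))"
      using \<tau> dim by (intro powr_mono') auto
    then have "c * (1 / \<tau>) \<le> c * \<tau> powr (- (real DIM('a) / 2))"
      using \<tau> by (intro mult_left_mono) (auto simp: powr_minus_divide c_def)
    then show "c * (1 / \<tau>) \<le> (\<tau> powr (- 0) * (4 * pi * \<tau>) powr (- (real DIM('a) / 2))) * exp (- ((norm (0::'a))\<^sup>2 / (4 * \<tau>)))"
      using \<tau> by (simp add: c_def powr_mult)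
  qed
  then show ?thesis by (simp add: c_def right_diff_distrib)
qed

text \<open>Split the window at \<delta>. Below, \<tau>^(-k) \<le> \<delta>^(s-k) \<tau>^(-s), a
  small multiple of the integrand on the right when k < s; those times lie in [e, r] because e \<le>
  e' and \<delta> \<le> r. Above \<delta> the integrand is bounded.\<close>

lemma heat_mix_absorb:
  fixes x :: "'a::euclidean_space"
  assumes e: "0 < e" "e \<le> e'" and k: "0 \<le> k" "k \<le> s" and \<delta>: "0 < \<delta>" "\<delta> \<le> r" and R: "0 \<le> R"
  shows "heat_mix k e' R x \<le> \<delta> powr (s - k) * heat_mix s e r x
    + R * (\<delta> powr (- k) * (4 * pi * \<delta>) powr (- (real DIM('a) / 2)))"
proof -
  define c where "c = \<delta> powr (- k) * (4 * pi * \<delta>) powr (- (real DIM('a) / 2))"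
  have c: "0 \<le> c" by (simp add: c_def)
  have e': "0 < e'" using e by simp
  have i1: "integrable lborel (\<lambda>\<tau>. indicator {e..r} \<tau> * (\<tau> powr (- s) * gauss \<tau> x))"
    using e k by (intro integrable_heat_mix) auto
  have i2: "integrable lborel (\<lambda>\<tau>. c * indicator {0..R} \<tau>)"
    by (intro integrable_mult_right integrable_real_indicator) (auto simp: emeasure_lborel_Icc_eq)
  have "heat_mix k e' R x \<le> (\<integral>\<tau>. \<delta> powr (s - k) * (indicator {e..r} \<tau> * (\<tau> powr (- s) * gauss \<tau> x)) + c * indicator {0..R} \<tau> \<partial>lborel)"
    unfolding heat_mix_def
  proof (rule integral_mono[OF integrable_heat_mix[OF e' k(1)]])
    show "integrable lborel (\<lambda>\<tau>. \<delta> powr (s - k) * (indicator {e..r} \<tau> * (\<tau> powr (- s) * gauss \<tau> x)) + c * indicator {0..R} \<tau>)"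
      by (intro Bochner_Integration.integrable_add integrable_mult_right i1 i2)
    fix \<tau> :: real
    show "indicator {e'..R} \<tau> * (\<tau> powr (- k) * gauss \<tau> x) \<le>
      \<delta> powr (s - k) * (indicator {e..r} \<tau> * (\<tau> powr (- s) * gauss \<tau> x)) + c * indicator {0..R} \<tau>"
    proof (cases "\<tau> \<in> {e'..R}")
      case True
      then have \<tau>: "e' \<le> \<tau>" "\<tau> \<le> R" "0 < \<tau>" using e' by auto
      show ?thesis
      proof (cases "\<tau> \<le> \<delta>")
        case le: True
        have "\<tau> powr (- k) = \<tau> powr (s - k) * \<tau> powr (- s)" by (simp add: powr_add[symmetric])
        also have "\<dots> \<le> \<delta> powr (s - k) * \<tau> powr (- s)"
          using le \<tau> k by (intro mult_right_mono powr_mono2) auto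
        finally have "\<tau> powr (- k) * gauss \<tau> x \<le> \<delta> powr (s - k) * \<tau> powr (- s) * gauss \<tau> x"
          by (intro mult_right_mono) auto
        moreover have "\<tau> \<in> {e..r}" using le \<tau> e \<delta> by auto
        moreover have "0 \<le> c * indicator {0..R} \<tau>" using c by simp
        ultimately show ?thesis using True by (simp add: mult.assoc)
      next
        case False
        then have "\<tau> powr (- k) * gauss \<tau> x \<le> c"
          unfolding c_def using \<tau> \<delta> k by (intro mult_mono powr_mono2' gauss_le_of_time_ge) auto
        moreover have "0 \<le> \<delta> powr (s - k) * (indicator {e..r} \<tau> * (\<tau> powr (- s) * gauss \<tau> x))" by simp
        moreover have ind: "indicator {0..R} \<tau> = (1::real)" "indicator {e'..R} \<tau> = (1::real)" using \<tau> by auto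
        ultimately show ?thesis unfolding ind by linarith
      qed
    next
      case False
      then show ?thesis using c by simp
    qed
  qed
  also have "\<dots> = \<delta> powr (s - k) * heat_mix s e r x + c * R"
    using i1 i2 R by (simp add: heat_mix_def)
  finally show ?thesis by (simp add: c_def mult.commute)
qed

text \<open>One factor |x| is exchanged for a square root of time: 2 |x| sqrt \<tau> \<le> |x|^2 +
  \<tau>, and |x|^2 costs a doubling of time; the 5 is 4 + 1. So the gradient of the potential
  behaves like index 1/2, which lies below s exactly when s > 1/2. The rescaling \<sigma> = 2\<tau>
  accounts for the doubled window.\<close>

lemma norm_heat_mix_one_le:
  fixes x :: "'a::euclidean_space"
  assumes e: "0 < e"
  shows "norm x * heat_mix 1 e R x \<le> (5 * 2 powr (real DIM('a) / 2)) * heat_mix (1/2) (2 * e) (2 * R) x"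
proof -
  define D where "D = 5 * 2 powr (real DIM('a) / 2)"
  define F where "F = (\<lambda>\<sigma>. indicator {2*e..2*R} \<sigma> * (\<sigma> powr (- (1/2)) * gauss \<sigma> x))"
  have iF: "integrable lborel F" unfolding F_def using e by (intro integrable_heat_mix) auto
  have iF2: "integrable lborel (\<lambda>\<tau>. F (2 * \<tau>))"
    using lborel_integrable_real_affine[OF iF, of 2 0] by simp
  have sub: "(\<integral>\<tau>. F (2 * \<tau>) \<partial>lborel) = heat_mix (1/2) (2 * e) (2 * R) x / 2"
    using lborel_integral_real_affine[of 2 F 0] by (simp add: heat_mix_def F_def)
  have "norm x * heat_mix 1 e R x = (\<integral>\<tau>. norm x * (indicator {e..R} \<tau> * (\<tau> powr (- 1) * gauss \<tau> x)) \<partial>lborel)"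
    by (simp only: integral_mult_right_zero heat_mix_def)
  also have "\<dots> \<le> (\<integral>\<tau>. 2 * D * F (2 * \<tau>) \<partial>lborel)"
  proof (rule integral_mono)
    show "integrable lborel (\<lambda>\<tau>. norm x * (indicator {e..R} \<tau> * (\<tau> powr (- 1) * gauss \<tau> x)))"
      using e by (intro integrable_mult_right integrable_heat_mix) auto
    show "integrable lborel (\<lambda>\<tau>. 2 * D * F (2 * \<tau>))" by (intro integrable_mult_right iF2)
    fix \<tau> :: real
    show "norm x * (indicator {e..R} \<tau> * (\<tau> powr (- 1) * gauss \<tau> x)) \<le> 2 * D * F (2 * \<tau>)"
    proof (cases "\<tau> \<in> {e..R}")
      case True
      then have \<tau>: "0 < \<tau>" using e by auto
      define q where "q = sqrt \<tau>"
      have q: "0 < q" "q * q = \<tau>" using \<tau> by (simp_all add: q_def)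
      have p2: "2 powr (real DIM('a) / 2) * gauss (2 * \<tau>) x \<ge> gauss \<tau> x"
      proof -
        have "gauss \<tau> x \<le> (4 * pi * \<tau>) powr (- (real DIM('a) / 2)) * exp (- ((norm x)\<^sup>2 / (4 * (2 * \<tau>))))"
          unfolding gauss_def using \<tau> by (intro mult_left_mono) (auto simp: divide_simps)
        moreover have "(4 * pi * (2 * \<tau>)) powr (- (real DIM('a) / 2)) =
            (4 * pi * \<tau>) powr (- (real DIM('a) / 2)) * 2 powr (- (real DIM('a) / 2))"
          using powr_mult[of "4 * pi * \<tau>" 2 "- (real DIM('a) / 2)"] by (simp add: mult_ac)
        then have "2 powr (real DIM('a) / 2) * (4 * pi * (2 * \<tau>)) powr (- (real DIM('a) / 2)) =
            (4 * pi * \<tau>) powr (- (real DIM('a) / 2))"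
          by (simp add: powr_minus field_simps)
        then have "2 powr (real DIM('a) / 2) * gauss (2 * \<tau>) x =
            (4 * pi * \<tau>) powr (- (real DIM('a) / 2)) * exp (- ((norm x)\<^sup>2 / (4 * (2 * \<tau>))))"
          unfolding gauss_def by (simp only: mult.assoc[symmetric])
        ultimately show ?thesis by simp
      qed
      have "2 * norm x * q \<le> (norm x)\<^sup>2 + q * q"
        using zero_le_power2[of "norm x - q"] unfolding power2_eq_square by (simp add: algebra_simps)
      then have "2 * norm x * q * gauss \<tau> x \<le> ((norm x)\<^sup>2 + q * q) * gauss \<tau> x"
        by (intro mult_right_mono) auto
      also have "\<dots> = (norm x)\<^sup>2 * gauss \<tau> x + \<tau> * gauss \<tau> x" by (simp add: q algebra_simps)
      also have "\<dots> \<le> 4 * 2 powr (real DIM('a) / 2) * \<tau> * gauss (2 * \<tau>) x + \<tau> * (2 powr (real DIM('a) / 2) * gauss (2 * \<tau>) x)"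
        using \<tau> p2 by (intro add_mono norm_sq_gauss_le mult_left_mono) auto
      also have "\<dots> = D * \<tau> * gauss (2 * \<tau>) x" by (simp add: D_def algebra_simps)
      finally have "2 * norm x * q * gauss \<tau> x \<le> D * (q * q) * gauss (2 * \<tau>) x" unfolding q(2) .
      then have "q * (2 * (norm x * gauss \<tau> x)) \<le> q * (D * q * gauss (2 * \<tau>) x)"
        by (simp only: mult_ac)
      then have 1: "2 * (norm x * gauss \<tau> x) \<le> D * q * gauss (2 * \<tau>) x"
        using q(1) by (rule mult_left_le_imp_le)
      have "norm x * (\<tau> powr (- 1) * gauss \<tau> x) = (2 * (norm x * gauss \<tau> x)) / (2 * \<tau>)"
        using \<tau> by (simp add: powr_minus_divide)
      also have "\<dots> \<le> (D * q * gauss (2 * \<tau>) x) / (2 * \<tau>)" using 1 \<tau> by (intro divide_right_mono) auto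
      also have "\<dots> = D * gauss (2 * \<tau>) x / (2 * q)" using q \<tau> by (simp add: field_simps)
      also have "\<dots> \<le> 2 * D * ((2 * \<tau>) powr (- (1/2)) * gauss (2 * \<tau>) x)"
      proof -
        have "(2 * \<tau>) powr (- (1/2)) = 1 / sqrt (2 * \<tau>)" using \<tau> by (simp add: powr_minus_divide powr_half_sqrt)
        moreover have "sqrt (2 * \<tau>) \<le> 2 * q"
          using \<tau> by (simp add: q_def real_sqrt_mult) (simp add: real_sqrt_le_iff' sqrt2_less_2 less_imp_le)
        ultimately have "1 / (2 * q) \<le> (2 * \<tau>) powr (- (1/2))" using \<tau> q by (simp add: frac_le)
        then have "D * gauss (2 * \<tau>) x * (1 / (2 * q)) \<le> 2 * D * gauss (2 * \<tau>) x * (2 * \<tau>) powr (- (1/2))"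
          using q(1) by (intro mult_mono) (auto simp: D_def)
        then show ?thesis by (simp add: mult_ac)
      qed
      finally have "norm x * (\<tau> powr (- 1) * gauss \<tau> x) \<le> 2 * D * ((2 * \<tau>) powr (- (1/2)) * gauss (2 * \<tau>) x)" .
      then show ?thesis using True by (simp add: F_def)
    next
      case False
      then show ?thesis by (simp add: F_def D_def)
    qed
  qed
  also have "\<dots> = D * heat_mix (1/2) (2 * e) (2 * R) x" by (simp add: sub)
  finally show ?thesis by (simp add: D_def)
qed

text \<open>Both \<delta>^s and \<delta>^(s-1/2) tend to 0 with \<delta>, the second because s >
  1/2, so a fixed small \<delta> brings their combination below \<eta>. What remains is a constant
  free of \<open>e\<close> and \<open>x\<close>.\<close>

lemma heat_mix_gradient_absorb:
  assumes s: "1/2 < s" "s < 1" and r: "0 < r" and \<eta>: "0 < \<eta>" and G: "0 \<le> G"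
  shows "\<exists>C\<ge>0. \<forall>e (x::'a::euclidean_space). 0 < e \<longrightarrow> e < r \<longrightarrow>
    G * heat_mix 0 e (4 * r) x + norm x * heat_mix 1 e (4 * r) x \<le> \<eta> * heat_mix s e r x + C"
proof -
  define D where "D = 5 * 2 powr (real DIM('a) / 2)"
  have D: "0 < D" by (simp add: D_def)
  have "((\<lambda>\<delta>. G * \<delta> powr s + D * \<delta> powr (s - 1/2)) \<longlongrightarrow> G * 0 + D * 0) (at_right 0)"
    using s by (intro tendsto_intros tendsto_neg_powr tendsto_zero_powrI[where b="s"] tendsto_zero_powrI[where b="s - 1/2"])
      (auto simp: eventually_at_filter)
  then have "eventually (\<lambda>\<delta>. G * \<delta> powr s + D * \<delta> powr (s - 1/2) < \<eta>) (at_right 0)"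
    using \<eta> by (intro order_tendstoD(2)) auto
  moreover have "eventually (\<lambda>\<delta>. \<delta> \<in> {0<..<r}) (at_right 0)"
    using r by (rule eventually_at_right_real)
  ultimately have "eventually (\<lambda>\<delta>. G * \<delta> powr s + D * \<delta> powr (s - 1/2) < \<eta> \<and> \<delta> \<in> {0<..<r}) (at_right 0)"
    by (rule eventually_conj)
  then obtain \<delta> where \<delta>: "G * \<delta> powr s + D * \<delta> powr (s - 1/2) < \<eta>" "0 < \<delta>" "\<delta> < r"
    using eventually_happens' trivial_limit_at_right_real by (metis (no_types, lifting) greaterThanLessThan_iff)
  define c where "c = (\<lambda>k. \<delta> powr (- k) * (4 * pi * \<delta>) powr (- (real DIM('a) / 2)))"
  have c: "0 \<le> c k" for k by (simp add: c_def)
  define C where "C = G * (4 * r * c 0) + D * (8 * r * c (1/2))"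
  have "G * heat_mix 0 e (4 * r) x + norm x * heat_mix 1 e (4 * r) x \<le> \<eta> * heat_mix s e r x + C"
    if e: "0 < e" "e < r" for e and x :: 'a
  proof -
    have 1: "heat_mix 0 e (4 * r) x \<le> \<delta> powr (s - 0) * heat_mix s e r x + 4 * r * c 0"
      unfolding c_def using e s \<delta> r by (intro heat_mix_absorb) auto
    have 2: "heat_mix (1/2) (2 * e) (2 * (4 * r)) x \<le> \<delta> powr (s - 1/2) * heat_mix s e r x + 2 * (4 * r) * c (1/2)"
      unfolding c_def using e s \<delta> r by (intro heat_mix_absorb) auto
    have 3: "norm x * heat_mix 1 e (4 * r) x \<le> D * heat_mix (1/2) (2 * e) (2 * (4 * r)) x"
      unfolding D_def by (rule norm_heat_mix_one_le[OF e(1)])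
    have "G * heat_mix 0 e (4 * r) x + norm x * heat_mix 1 e (4 * r) x \<le>
        G * (\<delta> powr (s - 0) * heat_mix s e r x + 4 * r * c 0) + D * (\<delta> powr (s - 1/2) * heat_mix s e r x + 2 * (4 * r) * c (1/2))"
      using mult_left_mono[OF 1 G] mult_left_mono[OF 2 less_imp_le[OF D]] 3 by linarith
    also have "\<dots> = (G * \<delta> powr s + D * \<delta> powr (s - 1/2)) * heat_mix s e r x + C"
      by (simp add: C_def algebra_simps)
    also have "\<dots> \<le> \<eta> * heat_mix s e r x + C"
      using \<delta>(1) heat_mix_nonneg[of s e r x] by (intro add_right_mono mult_right_mono) auto
    finally show ?thesis .
  qed
  moreover have "0 \<le> C" using G D c[of 0] c[of "1/2"] r by (simp add: C_def)
  ultimately show ?thesis by blast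
qed

text \<open>Each Gaussian has mass 1, so the mass is at most the length of the window. Unlike the
  supremum, it stays bounded as e \<rightarrow> 0.\<close>

lemma heat_mix_integral:
  assumes e: "0 < e" "e \<le> R"
  shows "integrable lborel (heat_mix 0 e R :: 'a::euclidean_space \<Rightarrow> real)"
    "(\<integral>x. heat_mix 0 e R (x::'a) \<partial>lborel) \<le> R"
proof -
  have m: "heat_mix 0 e R \<in> borel_measurable (lborel :: 'a measure)"
    using smooth_fun_borel[OF smooth_fun_heat_mix[OF e(1) order_refl]] by simp
  have g: "(\<integral>\<^sup>+z. ennreal (gauss t (z::'a)) \<partial>lborel) = 1" if "t > 0" for t
    using has_bochner_integral_gauss[OF that, where 'a='a]
    by (subst nn_integral_eq_integral) (auto simp: has_bochner_integral_iff)
  have "(\<integral>\<^sup>+x. ennreal (heat_mix 0 e R (x::'a)) \<partial>lborel) =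
      (\<integral>\<^sup>+x. \<integral>\<^sup>+\<tau>. ennreal (indicator {e..R} \<tau> * (\<tau> powr (- 0) * gauss \<tau> (x::'a))) \<partial>lborel \<partial>lborel)"
    unfolding heat_mix_def using e
    by (intro nn_integral_cong nn_integral_eq_integral[symmetric] integrable_heat_mix) auto
  also have "\<dots> = (\<integral>\<^sup>+\<tau>. \<integral>\<^sup>+x. ennreal (indicator {e..R} \<tau> * (\<tau> powr (- 0) * gauss \<tau> (x::'a))) \<partial>lborel \<partial>lborel)"
    by (rule lborel_pair.Fubini') measurable
  also have "\<dots> = (\<integral>\<^sup>+\<tau>. indicator {e..R} \<tau> \<partial>(lborel :: real measure))"
  proof (rule nn_integral_cong)
    fix \<tau> :: real
    show "(\<integral>\<^sup>+x. ennreal (indicator {e..R} \<tau> * (\<tau> powr (- 0) * gauss \<tau> (x::'a))) \<partial>lborel) = indicator {e..R} \<tau>"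
      using g[of \<tau>] e by (cases "\<tau> \<in> {e..R}") auto
  qed
  also have "\<dots> \<le> ennreal R" using e by (simp add: ennreal_leI)
  finally have n: "(\<integral>\<^sup>+x. ennreal (heat_mix 0 e R (x::'a)) \<partial>lborel) \<le> ennreal R" .
  have R0: "0 \<le> R" using e by simp
  show "integrable lborel (heat_mix 0 e R :: 'a \<Rightarrow> real)"
    by (rule integrable_of_nn_integral_le(1)[OF m heat_mix_nonneg n R0])
  show "(\<integral>x. heat_mix 0 e R (x::'a) \<partial>lborel) \<le> R"
    by (rule integrable_of_nn_integral_le(2)[OF m heat_mix_nonneg n R0])
qed

text \<open>\<open>norm g * r1 \<le> 1/2\<close> keeps 1 + x . g between 1/2 and 3/2 on the support
  of the cutoff. The bound on \<open>norm g * \<rho>\<close> makes the loss |x . g|/(1-s) at most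
  half of 2^(-2-s), the coefficient of the main term. The cutoff is 1 up to radius 2\<rho>, so
  points of the \<rho>-ball do not see it within distance \<rho>.\<close>

locale barrier =
  fixes s r r1 \<rho> :: real and g :: "'a::euclidean_space" and ct :: "'a \<Rightarrow> real"
  assumes s: "0 < s" "s < 1" and r: "0 < r" and \<rho>: "0 < \<rho>" "2 * \<rho> \<le> r1" and r1: "r1 \<le> 1/2"
    and g: "norm g * r1 \<le> 1/2" "norm g * \<rho> \<le> (1 - s) * 2 powr (- 3 - s)"
    and ct: "ct \<in> test_functions (ball 0 r1)" "\<And>x. 0 \<le> ct x" "\<And>x. ct x \<le> 1"
      "\<And>x. x \<in> ball 0 (2 * \<rho>) \<Longrightarrow> ct x = 1"
begin

definition bump :: "real \<Rightarrow> 'a \<Rightarrow> real" where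
  "bump e x = (1 + x \<bullet> g) * heat_mix 0 e (4 * r) x"

definition zeta :: "real \<Rightarrow> 'a \<Rightarrow> real" where
  "zeta e x = ct x * bump e x"

lemma smooth_fun_bump: "0 < e \<Longrightarrow> smooth_fun (bump e)"
  unfolding bump_def[abs_def] by (intro smooth_fun_mult smooth_fun_affine smooth_fun_heat_mix) auto

lemma zeta_test: "0 < e \<Longrightarrow> zeta e \<in> test_functions (ball 0 r1)"
  unfolding zeta_def[abs_def] by (intro test_functions_mult ct smooth_fun_bump)

lemma inner_g_bound: "norm x \<le> r1 \<Longrightarrow> \<bar>x \<bullet> g\<bar> \<le> 1/2"
proof -
  assume "norm x \<le> r1"
  then have "norm x * norm g \<le> r1 * norm g" by (intro mult_right_mono) auto
  then show ?thesis using Cauchy_Schwarz_ineq2[of x g] g(1) by (simp add: mult.commute)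
qed

lemma zeta_eq_0: "x \<notin> ball 0 r1 \<Longrightarrow> zeta e x = 0"
  using test_functions_eq_0[OF ct(1)] by (simp add: zeta_def)

lemma zeta_bounds: "0 \<le> zeta e x" "zeta e x \<le> 3/2 * heat_mix 0 e (4 * r) x"
proof -
  have "0 \<le> zeta e x \<and> zeta e x \<le> 3/2 * heat_mix 0 e (4 * r) x"
  proof (cases "x \<in> ball 0 r1")
    case True
    then have "\<bar>x \<bullet> g\<bar> \<le> 1/2" by (intro inner_g_bound) simp
    then have a: "0 \<le> 1 + x \<bullet> g" "1 + x \<bullet> g \<le> 3/2" by linarith+
    have "0 \<le> bump e x" "bump e x \<le> 3/2 * heat_mix 0 e (4 * r) x"
      unfolding bump_def by (rule mult_nonneg_nonneg[OF a(1) heat_mix_nonneg] mult_right_mono[OF a(2) heat_mix_nonneg])+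
    moreover have "ct x * bump e x \<le> 1 * bump e x"
      using ct(3) calculation(1) by (intro mult_right_mono) auto
    ultimately show ?thesis using ct(2)[of x] by (simp add: zeta_def)
  next
    case False
    then show ?thesis using heat_mix_nonneg[of 0 e "4 * r" x] by (simp add: zeta_eq_0)
  qed
  then show "0 \<le> zeta e x" "zeta e x \<le> 3/2 * heat_mix 0 e (4 * r) x" by auto
qed

text \<open>The cutoff alters second differences at \<open>x\<close> only for |z| \<ge> \<rho>, and
  only through values of the tilted potential off the origin. Those are bounded uniformly in
  \<open>e\<close>, so against the kernel they cost a constant.\<close>

lemma flap_zeta_inner:
  "\<exists>C\<ge>0. \<forall>e x. 0 < e \<longrightarrow> e < r \<longrightarrow> norm x < \<rho> \<longrightarrow>
    2 powr (- 2 - s) / mix_const DIM('a) s * heat_mix s e r x - C \<le> flap s (zeta e) x"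
proof -
  define k where "k = mix_const DIM('a) s"
  have k: "k > 0" unfolding k_def by (rule mix_const_pos[OF s(1)])
  define K0 where "K0 = (\<integral>z. min 1 ((norm (z::'a))\<^sup>2) * kern s z \<partial>lborel)"
  have K0: "0 \<le> K0" unfolding K0_def by (intro integral_nonneg_AE) auto
  obtain C2 where C2: "\<forall>e x. 0 < e \<longrightarrow> e < r \<longrightarrow> \<bar>x \<bullet> g\<bar> \<le> 1/2 \<longrightarrow>
    integrable lborel (\<lambda>z. sdiff (\<lambda>x. (1 + x \<bullet> g) * heat_mix 0 e (4 * r) x) x z * kern s z) \<and>
    2 * (2 powr (- 2 - s) - \<bar>x \<bullet> g\<bar> / (1 - s)) * heat_mix s e r x - C2
      \<le> mix_const DIM('a) s * flap s (\<lambda>x. (1 + x \<bullet> g) * heat_mix 0 e (4 * r) x) x"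
    using flap_affine_heat_mix_lower_bound[OF s r, of g] by blast
  have \<rho>2: "0 < 2 * \<rho>" and R: "0 < 4 * r" using \<rho> r by auto
  obtain Ca where Ca: "Ca \<ge> 0" "\<forall>e (y::'a) h. 0 < e \<longrightarrow> 2 * \<rho> \<le> norm y \<longrightarrow>
    heat_mix 0 e (4 * r) y \<le> Ca \<and> norm y * heat_mix 0 e (4 * r) y \<le> Ca \<and>
    \<bar>ddir (heat_mix 0 e (4 * r)) y h\<bar> \<le> Ca * norm h \<and> \<bar>ddir2 (heat_mix 0 e (4 * r)) y h\<bar> \<le> Ca * (norm h)\<^sup>2"
    using heat_mix_away[OF \<rho>2 R, where 'a='a] by blast
  define C1 where "C1 = (1 + norm g) * Ca"
  have C1: "0 \<le> C1" using Ca(1) by (simp add: C1_def)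
  define L where "L = 2 * C1 * (1 + 1 / \<rho>\<^sup>2)"
  have L: "0 \<le> L" using C1 by (simp add: L_def)
  define C where "C = \<bar>C2\<bar> / k + L * K0"
  have "2 powr (- 2 - s) / k * heat_mix s e r x - C \<le> flap s (zeta e) x"
    if e: "0 < e" "e < r" and x: "norm x < \<rho>" for e x
  proof -
    have x1: "\<bar>x \<bullet> g\<bar> \<le> 1/2" using x \<rho> by (intro inner_g_bound) auto
    have intf: "integrable lborel (\<lambda>z. sdiff (bump e) x z * kern s z)"
      and low: "2 * (2 powr (- 2 - s) - \<bar>x \<bullet> g\<bar> / (1 - s)) * heat_mix s e r x - C2 \<le> k * flap s (bump e) x"
      using C2 e x1 unfolding bump_def[abs_def] k_def by blast+
    have inth: "integrable lborel (\<lambda>z. sdiff (zeta e) x z * kern s z)"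
      by (rule integrable_sdiff_kern_test[OF s zeta_test[OF e(1)]])
    have intm: "integrable lborel (\<lambda>z::'a. L * (min 1 ((norm z)\<^sup>2) * kern s z))"
      by (intro integrable_mult_right integrable_min_kern s)
    have far: "- C1 \<le> (1 - ct y) * bump e y" for y
    proof (cases "y \<in> ball 0 (2 * \<rho>)")
      case True
      then show ?thesis using ct(4) C1 by simp
    next
      case False
      then have y: "2 * \<rho> \<le> norm y" by simp
      have "\<bar>1 + y \<bullet> g\<bar> \<le> 1 + norm y * norm g" using Cauchy_Schwarz_ineq2[of y g] by linarith
      then have "\<bar>bump e y\<bar> \<le> (1 + norm y * norm g) * heat_mix 0 e (4 * r) y"
        unfolding bump_def abs_mult using heat_mix_nonneg[of 0 e "4 * r" y] by (simp add: mult_right_mono)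
      also have "\<dots> = heat_mix 0 e (4 * r) y + norm g * (norm y * heat_mix 0 e (4 * r) y)"
        by (simp add: algebra_simps)
      also have "\<dots> \<le> Ca + norm g * Ca" using Ca(2) e(1) y by (intro add_mono mult_left_mono) auto
      also have "\<dots> = C1" by (simp add: C1_def algebra_simps)
      finally have 1: "\<bar>bump e y\<bar> \<le> C1" .
      have "\<bar>(1 - ct y) * bump e y\<bar> \<le> 1 * C1"
        unfolding abs_mult using ct(2,3)[of y] 1 by (intro mult_mono) auto
      then show ?thesis by linarith
    qed
    have cx: "ct x = 1" using x \<rho> by (intro ct(4)) auto
    have sd: "sdiff (zeta e) x z = sdiff (bump e) x z + (1 - ct (x + z)) * bump e (x + z) + (1 - ct (x - z)) * bump e (x - z)" for z
      by (simp add: sdiff_def zeta_def cx algebra_simps)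
    have pt: "sdiff (bump e) x z * kern s z - L * (min 1 ((norm z)\<^sup>2) * kern s z) \<le> sdiff (zeta e) x z * kern s z" for z
    proof (cases "norm z < \<rho>")
      case True
      have "norm (x + z) < 2 * \<rho>" "norm (x - z) < 2 * \<rho>"
        using norm_triangle_ineq[of x z] norm_triangle_ineq4[of x z] x True by linarith+
      then have "ct (x + z) = 1" "ct (x - z) = 1" by (auto intro: ct(4))
      then have eq: "sdiff (zeta e) x z = sdiff (bump e) x z" by (simp add: sd)
      have "0 \<le> L * (min 1 ((norm z)\<^sup>2) * kern s z)" using L by simp
      then show ?thesis unfolding eq by linarith
    next
      case False
      have "sdiff (bump e) x z - 2 * C1 \<le> sdiff (zeta e) x z"
        unfolding sd using far[of "x + z"] far[of "x - z"] by linarith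
      then have "(sdiff (bump e) x z - 2 * C1) * kern s z \<le> sdiff (zeta e) x z * kern s z"
        by (intro mult_right_mono) auto
      moreover have "2 * C1 * kern s z \<le> 2 * C1 * ((1 + 1 / \<rho>\<^sup>2) * (min 1 ((norm z)\<^sup>2) * kern s z))"
        using C1 \<rho>(1) False by (intro mult_left_mono kern_le_min_kern) auto
      ultimately show ?thesis unfolding L_def by (simp add: algebra_simps)
    qed
    have "(\<integral>z. sdiff (bump e) x z * kern s z - L * (min 1 ((norm z)\<^sup>2) * kern s z) \<partial>lborel) \<le> flap s (zeta e) x"
      unfolding flap_def using pt by (intro integral_mono Bochner_Integration.integrable_diff intf intm inth)
    then have 1: "flap s (bump e) x - L * K0 \<le> flap s (zeta e) x"
      using intf intm by (simp add: flap_def K0_def)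
    have "\<bar>x \<bullet> g\<bar> \<le> norm g * \<rho>"
      using Cauchy_Schwarz_ineq2[of x g] mult_right_mono[of "norm x" \<rho> "norm g"] x by (simp add: mult.commute)
    then have "\<bar>x \<bullet> g\<bar> \<le> (1 - s) * 2 powr (- 3 - s)" using g(2) by linarith
    then have p: "\<bar>x \<bullet> g\<bar> / (1 - s) \<le> 2 powr (- 3 - s)" using s by (simp add: divide_le_eq mult.commute)
    have two: "2 powr (- 2 - s) = 2 * 2 powr (- 3 - s)"
      using powr_add[of 2 1 "- 3 - s"] by simp
    \<comment> \<open>The loss eats at most half of the coefficient, and the factor 2 in front of
      the bracket restores it.\<close>
    have "2 powr (- 2 - s) \<le> 2 * (2 powr (- 2 - s) - \<bar>x \<bullet> g\<bar> / (1 - s))"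
      unfolding two using p by simp
    then have "2 powr (- 2 - s) * heat_mix s e r x \<le> 2 * (2 powr (- 2 - s) - \<bar>x \<bullet> g\<bar> / (1 - s)) * heat_mix s e r x"
      by (intro mult_right_mono heat_mix_nonneg)
    then have "2 powr (- 2 - s) * heat_mix s e r x - \<bar>C2\<bar> \<le> k * flap s (bump e) x"
      using low by linarith
    then have "(2 powr (- 2 - s) * heat_mix s e r x - \<bar>C2\<bar>) / k \<le> flap s (bump e) x"
      using k by (simp add: divide_le_eq mult.commute)
    then show ?thesis using 1 by (simp add: C_def diff_divide_distrib)
  qed
  moreover have "0 \<le> C" using k L K0 by (simp add: C_def)
  ultimately show ?thesis unfolding k_def by blast
qed

lemma zeta_integral:
  assumes e: "0 < e" "e < r"
  shows "integrable lborel (zeta e)" "(\<integral>x. zeta e x \<partial>lborel) \<le> 6 * r"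
proof -
  have eR: "e \<le> 4 * r" using e by simp
  have i: "integrable lborel (\<lambda>x::'a. 3/2 * heat_mix 0 e (4 * r) x)"
    by (intro integrable_mult_right heat_mix_integral(1)[OF e(1) eR])
  show iz: "integrable lborel (zeta e)"
  proof (rule Bochner_Integration.integrable_bound[OF i])
    show "zeta e \<in> borel_measurable lborel"
      using smooth_fun_borel[OF test_functionsD(1)[OF zeta_test[OF e(1)]]] by simp
    have "norm (zeta e x) \<le> norm (3/2 * heat_mix 0 e (4 * r) x)" for x
      using zeta_bounds[of e x] unfolding real_norm_def by linarith
    then show "AE x in lborel. norm (zeta e x) \<le> norm (3/2 * heat_mix 0 e (4 * r) x)" by simp
  qed
  have "(\<integral>x. zeta e x \<partial>lborel) \<le> (\<integral>x. 3/2 * heat_mix 0 e (4 * r) (x::'a) \<partial>lborel)"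
    by (rule integral_mono[OF iz i zeta_bounds(2)])
  also have "\<dots> \<le> 6 * r" using heat_mix_integral(2)[OF e(1) eR, where 'a='a] by simp
  finally show "(\<integral>x. zeta e x \<partial>lborel) \<le> 6 * r" .
qed

text \<open>Seen from outside, the danger is the core of the barrier, whose supremum grows as e
  \<rightarrow> 0. It enters only through the neighbours x + z and x - z with |z| bounded below, so
  its mass, at most 6r, is what counts, and a lower bound is all that a nonnegative u asks
  for.\<close>

lemma flap_zeta_outer:
  "\<exists>C\<ge>0. \<forall>e x. 0 < e \<longrightarrow> e < r \<longrightarrow> \<rho> \<le> norm x \<longrightarrow>
    - (C / (1 + norm x powr (real DIM('a) + 2 * s))) \<le> flap s (zeta e) x \<and>
    (\<forall>v. \<bar>ddir (zeta e) x v\<bar> \<le> C * norm v)"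
proof -
  define p where "p = real DIM('a) + 2 * s"
  have p: "p > 0" using s by (simp add: p_def add_nonneg_pos)
  define K0 where "K0 = (\<integral>z. min 1 ((norm (z::'a))\<^sup>2) * kern s z \<partial>lborel)"
  have K0: "0 \<le> K0" unfolding K0_def by (intro integral_nonneg_AE) auto
  have \<rho>2: "0 < \<rho> / 2" and R: "0 < 4 * r" using \<rho> r by auto
  obtain Ca where Ca: "Ca \<ge> 0" "\<forall>e (y::'a) h. 0 < e \<longrightarrow> \<rho> / 2 \<le> norm y \<longrightarrow>
    heat_mix 0 e (4 * r) y \<le> Ca \<and> norm y * heat_mix 0 e (4 * r) y \<le> Ca \<and>
    \<bar>ddir (heat_mix 0 e (4 * r)) y h\<bar> \<le> Ca * norm h \<and> \<bar>ddir2 (heat_mix 0 e (4 * r)) y h\<bar> \<le> Ca * (norm h)\<^sup>2"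
    using heat_mix_away[OF \<rho>2 R, where 'a='a] by blast
  define a where "a = (\<lambda>x. ct x * (1 + x \<bullet> g))"
  have ta: "a \<in> test_functions (ball 0 r1)" unfolding a_def by (intro test_functions_mult ct smooth_fun_affine)
  have sa: "smooth_fun a" using test_functionsD[OF ta] by simp
  obtain Ma where Ma: "Ma > 0" "\<forall>x h. \<bar>a x\<bar> \<le> Ma \<and> \<bar>ddir a x h\<bar> \<le> Ma * norm h \<and> \<bar>ddir2 a x h\<bar> \<le> Ma * (norm h)\<^sup>2"
    using test_functions_C2_bounded[OF ta] by blast
  define P where "P = 1 / (\<rho> / 2) powr p"
  have P: "0 \<le> P" by (simp add: P_def)
  \<comment> \<open>The three summands serve, in this order, the gradient, the region |x| \<le> 2
    and the region |x| > 2. The 12r is the mass bound 6r counted for both neighbours.\<close>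
  define C where "C = 2 * Ma * Ca + (8 * Ma * Ca * K0 + P * (12 * r)) * (1 + 2 powr p) + 2 * 2 powr p * (12 * r)"
  have Cparts: "0 \<le> 2 * Ma * Ca" "0 \<le> (8 * Ma * Ca * K0 + P * (12 * r)) * (1 + 2 powr p)" "0 \<le> 2 * 2 powr p * (12 * r)"
    using Ma(1) Ca(1) K0 P r by (auto intro!: mult_nonneg_nonneg add_nonneg_nonneg)
  have Cle: "2 * Ma * Ca \<le> C" "(8 * Ma * Ca * K0 + P * (12 * r)) * (1 + 2 powr p) \<le> C" "2 * 2 powr p * (12 * r) \<le> C"
    using Cparts unfolding C_def by linarith+
  have "- (C / (1 + norm x powr p)) \<le> flap s (zeta e) x \<and> (\<forall>v. \<bar>ddir (zeta e) x v\<bar> \<le> C * norm v)"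
    if e: "0 < e" "e < r" and x: "\<rho> \<le> norm x" for e x
  proof -
    have sw: "smooth_fun (heat_mix 0 e (4 * r) :: 'a \<Rightarrow> real)" by (rule smooth_fun_heat_mix[OF e(1) order_refl])
    have zw: "zeta e = (\<lambda>x. a x * heat_mix 0 e (4 * r) x)"
      by (auto simp: zeta_def bump_def a_def)
    have w: "heat_mix 0 e (4 * r) y \<le> Ca" "\<bar>ddir (heat_mix 0 e (4 * r)) y h\<bar> \<le> Ca * norm h"
      "\<bar>ddir2 (heat_mix 0 e (4 * r)) y h\<bar> \<le> Ca * (norm h)\<^sup>2" if "\<rho> / 2 \<le> norm y" for y h :: 'a
      using Ca(2) e(1) that by blast+
    have d1: "\<bar>ddir (zeta e) x v\<bar> \<le> C * norm v" for v
    proof -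
      have y: "\<rho> / 2 \<le> norm x" using x \<rho> by linarith
      have "\<bar>a x * ddir (heat_mix 0 e (4 * r)) x v\<bar> \<le> Ma * (Ca * norm v)"
        unfolding abs_mult using Ma w(2)[OF y, of v] by (intro mult_mono) auto
      moreover have "\<bar>ddir a x v * heat_mix 0 e (4 * r) x\<bar> \<le> (Ma * norm v) * Ca"
        unfolding abs_mult using Ma w(1)[OF y] heat_mix_nonneg[of 0 e "4 * r" x] by (intro mult_mono) auto
      ultimately have "\<bar>ddir (zeta e) x v\<bar> \<le> Ma * (Ca * norm v) + (Ma * norm v) * Ca"
        unfolding zw ddir_mult[OF sa sw] by linarith
      also have "\<dots> = 2 * Ma * Ca * norm v" by simp
      also have "\<dots> \<le> C * norm v" using Cle(1) by (intro mult_right_mono) auto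
      finally show ?thesis .
    qed
    have d2: "\<bar>ddir2 (zeta e) y v\<bar> \<le> 4 * Ma * Ca * (norm v)\<^sup>2" if y: "\<rho> / 2 \<le> norm y" for y v
    proof -
      have "\<bar>a y * ddir2 (heat_mix 0 e (4 * r)) y v\<bar> \<le> Ma * (Ca * (norm v)\<^sup>2)"
        unfolding abs_mult using Ma w(3)[OF y, of v] by (intro mult_mono) auto
      moreover have "\<bar>ddir a y v * ddir (heat_mix 0 e (4 * r)) y v\<bar> \<le> (Ma * norm v) * (Ca * norm v)"
        unfolding abs_mult using Ma w(2)[OF y, of v] by (intro mult_mono) auto
      moreover have "\<bar>ddir2 a y v * heat_mix 0 e (4 * r) y\<bar> \<le> (Ma * (norm v)\<^sup>2) * Ca"
        unfolding abs_mult using Ma w(1)[OF y] heat_mix_nonneg[of 0 e "4 * r" y] by (intro mult_mono) auto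
      ultimately have "\<bar>ddir2 (zeta e) y v\<bar> \<le> Ma * (Ca * (norm v)\<^sup>2) + 2 * ((Ma * norm v) * (Ca * norm v)) + (Ma * (norm v)\<^sup>2) * Ca"
        unfolding zw ddir2_mult[OF sa sw] by linarith
      also have "\<dots> = 4 * Ma * Ca * (norm v)\<^sup>2" by (simp add: power2_eq_square)
      finally show ?thesis .
    qed
    have near: "\<bar>sdiff (zeta e) x z\<bar> \<le> 8 * Ma * Ca * (norm z)\<^sup>2" if z: "norm z \<le> \<rho> / 2" for z
    proof -
      have "\<bar>sdiff (zeta e) x z\<bar> \<le> 2 * (4 * Ma * Ca * (norm z)\<^sup>2)"
      proof (rule sdiff_le_ddir2)
        show "smooth_fun (zeta e)" using test_functionsD(1)[OF zeta_test[OF e(1)]] .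
        show "\<bar>ddir2 (zeta e) (x + t *\<^sub>R z) z\<bar> \<le> 4 * Ma * Ca * (norm z)\<^sup>2" if t: "\<bar>t\<bar> \<le> 1" for t
        proof (rule d2)
          have "norm (t *\<^sub>R z) \<le> 1 * (\<rho> / 2)" unfolding norm_scaleR using t z by (intro mult_mono) auto
          then show "\<rho> / 2 \<le> norm (x + t *\<^sub>R z)"
            using x norm_triangle_ineq4[of "x + t *\<^sub>R z" "t *\<^sub>R z"] by simp
        qed
      qed
      then show ?thesis by simp
    qed
    have inth: "integrable lborel (\<lambda>z. sdiff (zeta e) x z * kern s z)"
      by (rule integrable_sdiff_kern_test[OF s zeta_test[OF e(1)]])
    define I where "I = (\<integral>x. zeta e x \<partial>lborel)"
    have I: "I \<le> 6 * r" "has_bochner_integral lborel (zeta e) I"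
      using zeta_integral[OF e] by (simp_all add: I_def has_bochner_integral_iff)
    have I1: "has_bochner_integral lborel (\<lambda>z. zeta e (x + z)) I"
      by (rule has_bochner_integral_lborel_shift[OF I(2)])
    have I2: "has_bochner_integral lborel (\<lambda>z. zeta e (x - z)) I"
      using has_bochner_integral_lborel_uminus[OF I1] by simp
    have lowpart: "- (\<integral>z. q z \<partial>lborel) \<le> flap s (zeta e) x"
      if q: "integrable lborel q" "\<And>z. - q z \<le> sdiff (zeta e) x z * kern s z" for q
    proof -
      have "(\<integral>z. - q z \<partial>lborel) \<le> flap s (zeta e) x"
        unfolding flap_def using q inth by (intro integral_mono) auto
      then show ?thesis by simp
    qed
    have pp: "1 + norm x powr p > 0" by (rule one_plus_powr_pos)
    have "- (C / (1 + norm x powr p)) \<le> flap s (zeta e) x"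
    proof (cases "norm x \<le> 2")
      case True
      define q where "q = (\<lambda>z. 8 * Ma * Ca * (min 1 ((norm z)\<^sup>2) * kern s z) + P * (zeta e (x + z) + zeta e (x - z)))"
      have hq: "has_bochner_integral lborel q (8 * Ma * Ca * K0 + P * (I + I))"
        unfolding q_def K0_def
        by (intro has_bochner_integral_add has_bochner_integral_mult_right I1 I2
            has_bochner_integral_integrable integrable_min_kern s)
      have "- (\<integral>z. q z \<partial>lborel) \<le> flap s (zeta e) x"
      proof (rule lowpart)
        show "integrable lborel q" using hq by (simp add: has_bochner_integral_iff)
        fix z
        have zz: "0 \<le> zeta e (x + z) + zeta e (x - z)" by (intro add_nonneg_nonneg zeta_bounds)
        show "- q z \<le> sdiff (zeta e) x z * kern s z"
        proof (cases "norm z \<le> \<rho> / 2")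
          case True
          then have "norm z \<le> 1" using \<rho> r1 by linarith
          then have m: "min 1 ((norm z)\<^sup>2) = (norm z)\<^sup>2" by (simp add: power_le_one min_absorb2)
          have "\<bar>sdiff (zeta e) x z\<bar> * kern s z \<le> 8 * Ma * Ca * (norm z)\<^sup>2 * kern s z"
            using near[OF True] by (intro mult_right_mono) auto
          then have "\<bar>sdiff (zeta e) x z * kern s z\<bar> \<le> 8 * Ma * Ca * (norm z)\<^sup>2 * kern s z"
            by (simp only: abs_mult abs_of_nonneg[OF kern_nonneg])
          then have "- (8 * Ma * Ca * (norm z)\<^sup>2 * kern s z) \<le> sdiff (zeta e) x z * kern s z"
            by (simp only: abs_le_iff minus_le_iff)
          moreover have "0 \<le> P * (zeta e (x + z) + zeta e (x - z))" using P zz by simp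
          ultimately show ?thesis by (simp add: q_def m mult.assoc)
        next
          case False
          have kP: "kern s z \<le> P" unfolding P_def p_def using \<rho> s False by (intro kern_le_far) auto
          \<comment> \<open>The nonnegative term 2 \<open>zeta e x\<close> is dropped; it only helps
            a lower bound.\<close>
          have "- (zeta e (x + z) + zeta e (x - z)) \<le> sdiff (zeta e) x z"
            unfolding sdiff_def using zeta_bounds(1)[of e x] by linarith
          then have "- (zeta e (x + z) + zeta e (x - z)) * kern s z \<le> sdiff (zeta e) x z * kern s z"
            by (intro mult_right_mono) auto
          moreover have "(zeta e (x + z) + zeta e (x - z)) * kern s z \<le> (zeta e (x + z) + zeta e (x - z)) * P"
            by (intro mult_left_mono kP zz)
          then have "(zeta e (x + z) + zeta e (x - z)) * kern s z \<le> P * (zeta e (x + z) + zeta e (x - z))"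
            by (simp only: mult.commute)
          moreover have "0 \<le> 8 * Ma * Ca * (min 1 ((norm z)\<^sup>2) * kern s z)" using Ma(1) Ca(1) by simp
          ultimately show ?thesis unfolding q_def mult_minus_left by linarith
        qed
      qed
      also have "(\<integral>z. q z \<partial>lborel) = 8 * Ma * Ca * K0 + P * (I + I)" by (rule has_bochner_integral_integral_eq[OF hq])
      finally have 1: "- (8 * Ma * Ca * K0 + P * (I + I)) \<le> flap s (zeta e) x" .
      have "P * (I + I) \<le> P * (12 * r)" using I(1) P by (intro mult_left_mono) auto
      then have 2: "- (8 * Ma * Ca * K0 + P * (12 * r)) \<le> flap s (zeta e) x" using 1 by linarith
      have "norm x powr p \<le> 2 powr p" using True p by (intro powr_mono2) auto
      then have "(8 * Ma * Ca * K0 + P * (12 * r)) * (1 + norm x powr p) \<le> (8 * Ma * Ca * K0 + P * (12 * r)) * (1 + 2 powr p)"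
        using Ma(1) Ca(1) K0 P r by (intro mult_left_mono) auto
      then have "(8 * Ma * Ca * K0 + P * (12 * r)) * (1 + norm x powr p) \<le> C" using Cle(2) by linarith
      then have "8 * Ma * Ca * K0 + P * (12 * r) \<le> C / (1 + norm x powr p)" using pp by (simp add: pos_le_divide_eq)
      then show ?thesis using 2 by linarith
    next
      case False
      then have x2: "norm x > 2" by simp
      define D where "D = 1 / (norm x / 2) powr p"
      have D: "0 \<le> D" by (simp add: D_def)
      define q where "q = (\<lambda>z. D * (zeta e (x + z) + zeta e (x - z)))"
      have hq: "has_bochner_integral lborel q (D * (I + I))"
        unfolding q_def by (intro has_bochner_integral_add has_bochner_integral_mult_right I1 I2)
      have zx: "zeta e x = 0" using x2 r1 by (intro zeta_eq_0) auto
      have kD: "zeta e y * kern s z \<le> zeta e y * D" if "norm x \<le> norm z + norm y" for y z :: 'a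
      proof (cases "y \<in> ball 0 r1")
        case True
        then have "norm x / 2 \<le> norm z" using that x2 r1 by simp
        then have "kern s z \<le> D" unfolding D_def p_def using x2 s by (intro kern_le_far) auto
        then show ?thesis by (intro mult_left_mono zeta_bounds)
      qed (simp add: zeta_eq_0)
      have "- (\<integral>z. q z \<partial>lborel) \<le> flap s (zeta e) x"
      proof (rule lowpart)
        show "integrable lborel q" using hq by (simp add: has_bochner_integral_iff)
        fix z
        have "norm x \<le> norm z + norm (x + z)" "norm x \<le> norm z + norm (x - z)"
          using norm_triangle_ineq4[of "x + z" z] norm_triangle_ineq[of "x - z" z] by simp_all
        from this[THEN kD] show "- q z \<le> sdiff (zeta e) x z * kern s z"
          unfolding q_def sdiff_def zx by (simp add: algebra_simps)
      qed
      also have "(\<integral>z. q z \<partial>lborel) = D * (I + I)" by (rule has_bochner_integral_integral_eq[OF hq])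
      finally have 1: "- (D * (I + I)) \<le> flap s (zeta e) x" .
      have "D * (I + I) \<le> D * (12 * r)" using I(1) D by (intro mult_left_mono) auto
      moreover have "D * (12 * r) \<le> C / (1 + norm x powr p)"
      proof -
        have "1 \<le> norm x powr p" using x2 p by (intro ge_one_powr_ge_zero) auto
        then have "1 / norm x powr p \<le> 2 / (1 + norm x powr p)" by (simp add: divide_simps)
        then have "(2 powr p * (12 * r)) * (1 / norm x powr p) \<le> (2 powr p * (12 * r)) * (2 / (1 + norm x powr p))"
          using r by (intro mult_left_mono) auto
        then have "D * (12 * r) \<le> 2 * 2 powr p * (12 * r) / (1 + norm x powr p)"
          by (simp add: D_def powr_divide mult_ac)
        also have "\<dots> \<le> C / (1 + norm x powr p)" using Cle(3) pp by (intro divide_right_mono) auto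
        finally show ?thesis .
      qed
      ultimately show ?thesis using 1 by linarith
    qed
    then show ?thesis using d1 by blast
  qed
  moreover have "0 \<le> C" using Cparts Cle by linarith
  ultimately show ?thesis unfolding p_def by blast
qed

text \<open>Near the origin the cutoff is 1. Differentiating the tilt and the potential gives the
  index 0 and index 1 terms for which \<open>heat_mix_gradient_absorb\<close> is made.\<close>

lemma ddir_zeta_inner:
  assumes e: "0 < e" and x: "norm x < \<rho>"
  shows "\<bar>ddir (zeta e) x v\<bar> \<le> norm v * (norm g * heat_mix 0 e (4 * r) x + norm x * heat_mix 1 e (4 * r) x)"
proof -
  have sw: "smooth_fun (heat_mix 0 e (4 * r) :: 'a \<Rightarrow> real)" by (rule smooth_fun_heat_mix[OF e order_refl])
  have "(bump e has_derivative ddir (bump e) x) (at x)"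
    by (rule has_derivative_ddir[OF smooth_fun_bump[OF e]])
  then have "(zeta e has_derivative ddir (bump e) x) (at x)"
    by (rule has_derivative_transform_within_open[of _ _ _ _ "ball 0 (2 * \<rho>)"])
      (use x \<rho> ct(4) in \<open>auto simp: zeta_def\<close>)
  then have "ddir (zeta e) x v = ddir (bump e) x v" by (rule ddir_unique)
  also have "\<dots> = (1 + x \<bullet> g) * ddir (heat_mix 0 e (4 * r)) x v + ddir (\<lambda>x. 1 + x \<bullet> g) x v * heat_mix 0 e (4 * r) x"
    unfolding bump_def[abs_def] by (rule ddir_mult[OF smooth_fun_affine sw])
  also have "ddir (\<lambda>x. 1 + x \<bullet> g) x v = v \<bullet> g"
    by (rule ddir_unique) (auto intro!: derivative_eq_intros)
  also have "ddir (heat_mix 0 e (4 * r)) x v = - ((x \<bullet> v) / 2) * heat_mix 1 e (4 * r) x"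
    using ddir_heat_mix[OF e order_refl] by simp
  finally have eq: "ddir (zeta e) x v = (1 + x \<bullet> g) * (- ((x \<bullet> v) / 2) * heat_mix 1 e (4 * r) x) + (v \<bullet> g) * heat_mix 0 e (4 * r) x" .
  have "\<bar>x \<bullet> g\<bar> \<le> 1/2" using x \<rho> by (intro inner_g_bound) auto
  then have "\<bar>1 + x \<bullet> g\<bar> \<le> 2" by linarith
  moreover have "\<bar>- ((x \<bullet> v) / 2) * heat_mix 1 e (4 * r) x\<bar> \<le> norm x * norm v / 2 * heat_mix 1 e (4 * r) x"
    using Cauchy_Schwarz_ineq2[of x v] heat_mix_nonneg[of 1 e "4 * r" x] by (simp add: abs_mult mult_right_mono)
  ultimately have 1: "\<bar>(1 + x \<bullet> g) * (- ((x \<bullet> v) / 2) * heat_mix 1 e (4 * r) x)\<bar> \<le> 2 * (norm x * norm v / 2 * heat_mix 1 e (4 * r) x)"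
    unfolding abs_mult[of "1 + x \<bullet> g"] by (intro mult_mono) auto
  have 2: "\<bar>(v \<bullet> g) * heat_mix 0 e (4 * r) x\<bar> \<le> norm v * norm g * heat_mix 0 e (4 * r) x"
    using Cauchy_Schwarz_ineq2[of v g] heat_mix_nonneg[of 0 e "4 * r" x] by (simp add: abs_mult mult_right_mono)
  have "\<bar>ddir (zeta e) x v\<bar> \<le> 2 * (norm x * norm v / 2 * heat_mix 1 e (4 * r) x) + norm v * norm g * heat_mix 0 e (4 * r) x"
    unfolding eq using 1 2 by linarith
  then show ?thesis by (simp add: algebra_simps)
qed

end

section \<open>Lower bound for the full operator on the barrier\<close>

context drift_setting
begin

text \<open>In the \<rho>-ball the main term, with coefficient \<open>K * c1\<close>, pays for the
  drift; elsewhere both parts are controlled by \<open>weight\<close>. The constant is uniform in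
  \<open>e\<close>, so it disappears once the barrier is divided by its diverging potential at
  0.\<close>

lemma zeta_operator_lower_bound:
  assumes drift: "1/2 < s \<or> (\<forall>x\<in>ball 0 1. b x = 0)" and bar: "barrier s r r1 \<rho> g ct"
  shows "\<exists>C\<ge>0. \<forall>e x. 0 < e \<longrightarrow> e < r \<longrightarrow>
    - (C * weight x) \<le> K * flap s (barrier.zeta r g ct e) x
      - ddir (barrier.zeta r g ct e) x (indicator (ball 0 1) x *\<^sub>R b x)"
proof -
  interpret B: barrier s r r1 \<rho> g ct by (rule bar)
  define c1 where "c1 = 2 powr (- 2 - s) / mix_const DIM('a) s"
  have c1: "c1 > 0" using mix_const_pos[OF s(1), of "DIM('a)"] by (simp add: c1_def)
  obtain Ci where Ci: "Ci \<ge> 0" "\<forall>e x. 0 < e \<longrightarrow> e < r \<longrightarrow> norm x < \<rho> \<longrightarrow>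
      c1 * heat_mix s e r x - Ci \<le> flap s (B.zeta e) x"
    using B.flap_zeta_inner unfolding c1_def by blast
  obtain Co where Co: "Co \<ge> 0" "\<forall>e x. 0 < e \<longrightarrow> e < r \<longrightarrow> \<rho> \<le> norm x \<longrightarrow>
    - (Co / (1 + norm x powr (real DIM('a) + 2 * s))) \<le> flap s (B.zeta e) x \<and>
    (\<forall>v. \<bar>ddir (B.zeta e) x v\<bar> \<le> Co * norm v)"
    using B.flap_zeta_outer by blast
  have sz: "smooth_fun (B.zeta e)" if "0 < e" for e
    using test_functionsD(1)[OF B.zeta_test[OF that]] .
  have "\<exists>Cg\<ge>0. \<forall>e x. 0 < e \<longrightarrow> e < r \<longrightarrow> norm x < \<rho> \<longrightarrow>
      \<bar>ddir (B.zeta e) x (b x)\<bar> \<le> K * c1 * heat_mix s e r x + Cg"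
    using drift
  proof
    assume s2: "1/2 < s"
    \<comment> \<open>Chosen so that M \<eta> \<le> K c1; the added 1 avoids division by 0 when M =
      0.\<close>
    define \<eta> where "\<eta> = K * c1 / (M + 1)"
    have \<eta>: "0 < \<eta>" using K_pos c1 M by (simp add: \<eta>_def)
    obtain C where C: "C \<ge> 0" "\<forall>e (x::'a). 0 < e \<longrightarrow> e < r \<longrightarrow>
        norm g * heat_mix 0 e (4 * r) x + norm x * heat_mix 1 e (4 * r) x \<le> \<eta> * heat_mix s e r x + C"
      using heat_mix_gradient_absorb[OF s2 s(2) B.r \<eta> norm_ge_zero[of g], where 'a='a] by blast
    have "\<bar>ddir (B.zeta e) x (b x)\<bar> \<le> K * c1 * heat_mix s e r x + M * C"
      if e: "0 < e" "e < r" and x: "norm x < \<rho>" for e x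
    proof -
      have xb: "x \<in> ball 0 1" using x B.\<rho> B.r1 by simp
      have "\<bar>ddir (B.zeta e) x (b x)\<bar> \<le> norm (b x) * (norm g * heat_mix 0 e (4 * r) x + norm x * heat_mix 1 e (4 * r) x)"
        by (rule B.ddir_zeta_inner[OF e(1) x])
      also have "\<dots> \<le> M * (norm g * heat_mix 0 e (4 * r) x + norm x * heat_mix 1 e (4 * r) x)"
        by (intro mult_right_mono b_bound xb add_nonneg_nonneg mult_nonneg_nonneg heat_mix_nonneg) auto
      also have "\<dots> \<le> M * (\<eta> * heat_mix s e r x + C)" using C(2) e M by (intro mult_left_mono) auto
      also have "\<dots> = M * \<eta> * heat_mix s e r x + M * C" by (simp add: algebra_simps)
      also have "M * \<eta> \<le> K * c1" using M K_pos c1 by (simp add: \<eta>_def field_simps)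
      finally show ?thesis using heat_mix_nonneg[of s e r x] by (simp add: mult_right_mono)
    qed
    moreover have "0 \<le> M * C" using M C(1) by simp
    ultimately show ?thesis by blast
  next
    assume b0: "\<forall>x\<in>ball 0 1. b x = 0"
    have "\<bar>ddir (B.zeta e) x (b x)\<bar> \<le> K * c1 * heat_mix s e r x + 0"
      if e: "0 < e" "e < r" and x: "norm x < \<rho>" for e x
    proof -
      have "b x = 0" using b0 x B.\<rho> B.r1 by auto
      then show ?thesis using K_pos c1 heat_mix_nonneg[of s e r x] by (simp add: ddir_zero[OF sz[OF e(1)]])
    qed
    then show ?thesis by blast
  qed
  then obtain Cg where Cg: "Cg \<ge> 0" "\<forall>e x. 0 < e \<longrightarrow> e < r \<longrightarrow> norm x < \<rho> \<longrightarrow>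
      \<bar>ddir (B.zeta e) x (b x)\<bar> \<le> K * c1 * heat_mix s e r x + Cg" by blast
  define C where "C = 2 * (K * Ci + Cg) + K * Co + 2 * (Co * M)"
  have parts: "0 \<le> K * Ci + Cg" "0 \<le> K * Co" "0 \<le> Co * M"
    using K_pos Ci(1) Co(1) Cg(1) M by auto
  have "- (C * weight x) \<le> K * flap s (B.zeta e) x - ddir (B.zeta e) x (indicator (ball 0 1) x *\<^sub>R b x)"
    if e: "0 < e" "e < r" for e x
  proof (cases "norm x < \<rho>")
    case True
    then have xb: "x \<in> ball 0 1" using B.\<rho> B.r1 by simp
    have "c1 * heat_mix s e r x - Ci \<le> flap s (B.zeta e) x" using Ci(2) e True by blast
    then have "K * (c1 * heat_mix s e r x - Ci) \<le> K * flap s (B.zeta e) x" using K_pos by (intro mult_left_mono) auto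
    moreover have "\<bar>ddir (B.zeta e) x (b x)\<bar> \<le> K * c1 * heat_mix s e r x + Cg" using Cg(2) e True by blast
    ultimately have 1: "- (K * Ci + Cg) \<le> K * flap s (B.zeta e) x - ddir (B.zeta e) x (b x)"
      by (simp add: right_diff_distrib mult.assoc)
    have "K * Ci + Cg \<le> (K * Ci + Cg) * (2 * weight x)"
      using mult_left_mono[OF weight_ge_half[OF xb] parts(1)] by simp
    also have "\<dots> = 2 * (K * Ci + Cg) * weight x" by simp
    also have "\<dots> \<le> C * weight x" using parts weight_pos[of x] by (intro mult_right_mono) (auto simp: C_def)
    finally show ?thesis using 1 xb by simp
  next
    case False
    then have o: "- (Co * weight x) \<le> flap s (B.zeta e) x" "\<bar>ddir (B.zeta e) x v\<bar> \<le> Co * norm v" for v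
      using Co(2)[rule_format, OF e, of x] by (auto simp: weight_def)
    have f: "- (K * Co * weight x) \<le> K * flap s (B.zeta e) x"
      using mult_left_mono[OF o(1), of K] K_pos by (simp add: mult.assoc)
    have d: "\<bar>ddir (B.zeta e) x (indicator (ball 0 1) x *\<^sub>R b x)\<bar> \<le> 2 * (Co * M) * weight x"
    proof (cases "x \<in> ball 0 1")
      case True
      have "\<bar>ddir (B.zeta e) x (b x)\<bar> \<le> Co * norm (b x)" by (rule o(2))
      also have "\<dots> \<le> Co * M" using Co(1) by (intro mult_left_mono b_bound True)
      also have "\<dots> \<le> (Co * M) * (2 * weight x)"
        using mult_left_mono[OF weight_ge_half[OF True] parts(3)] by simp
      finally show ?thesis using True by simp
    next
      case False
      then show ?thesis using parts(3) weight_pos[of x] by (simp add: ddir_zero[OF sz[OF e(1)]])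
    qed
    have "K * Co * weight x + 2 * (Co * M) * weight x \<le> C * weight x"
      unfolding distrib_right[symmetric] using parts weight_pos[of x] by (intro mult_right_mono) (auto simp: C_def)
    then show ?thesis using f d by linarith
  qed
  moreover have "0 \<le> C" using parts by (simp add: C_def)
  ultimately show ?thesis by blast
qed

text \<open>The part of \<open>low\<close> without the gradient. It tends to 0 by dominated
  convergence, as the normalised barrier is bounded and vanishes in the limit off the origin. The
  gradient has no bound near the origin uniform in \<open>e\<close>, so it stays paired with the
  fractional Laplacian.\<close>

definition rest :: "('a \<Rightarrow> real) \<Rightarrow> 'a \<Rightarrow> real" where
  "rest f x = u x * (- f x * (indicator (ball 0 1) x * divergence b x) + (indicator (ball 0 1) x * c x) * f x)"

lemma rest_measurable: "f \<in> borel_measurable borel \<Longrightarrow> rest f \<in> borel_measurable lebesgue"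
  unfolding rest_def[abs_def]
  by (intro borel_measurable_times borel_measurable_add borel_measurable_uminus u_meas div_meas c_meas lebesgue_meas)

lemma rest_bound:
  assumes A: "\<And>x. \<bar>f x\<bar> \<le> A"
  shows "AE x in lebesgue. \<bar>rest f x\<bar> \<le> 4 * A * M * (u x * weight x)"
  using c_bound
proof eventually_elim
  case (elim x)
  have A0: "0 \<le> A" using A[of x] by linarith
  show ?case
  proof (cases "x \<in> ball 0 1")
    case True
    have 1: "\<bar>f x * divergence b x\<bar> \<le> A * M"
      unfolding abs_mult using A div_bound[OF True] A0 by (intro mult_mono) auto
    have 3: "\<bar>c x * f x\<bar> \<le> M * A"
      unfolding abs_mult using A elim True M by (intro mult_mono) auto
    have "\<bar>- f x * divergence b x + c x * f x\<bar> \<le> 2 * (A * M)"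
      using 1 3 by (simp add: mult.commute[of M A])
    also have "\<dots> \<le> 2 * (A * M) * (2 * weight x)"
      using weight_ge_half[OF True] A0 M mult_left_mono[of 1 "2 * weight x" "2 * (A * M)"] by simp
    finally have "u x * \<bar>- f x * divergence b x + c x * f x\<bar> \<le> u x * (2 * (A * M) * (2 * weight x))"
      by (intro mult_left_mono u_nonneg)
    then show ?thesis using True u_nonneg[of x] by (simp add: rest_def abs_mult mult_ac)
  next
    case False
    then show ?thesis using u_nonneg[of x] A0 M weight_pos[of x] by (simp add: rest_def)
  qed
qed

lemma rest_integrable:
  assumes f: "f \<in> borel_measurable borel" and A: "\<And>x. \<bar>f x\<bar> \<le> A"
  shows "integrable lebesgue (rest f)"
  by (intro Bochner_Integration.integrable_bound[OF integrable_mult_right[OF u_weight_integrable, of "4 * A * M"]]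
      rest_measurable f) (use rest_bound[of f, OF A] in \<open>auto elim!: eventually_mono intro: order_trans[OF _ abs_ge_self]\<close>)

text \<open>Since u is nonnegative, a pointwise lower bound for the operator integrates to one for
  the pairing.\<close>

lemma T_lower_bound:
  assumes f: "f \<in> test_functions (ball 0 1)"
    and low: "\<And>x. - (C * weight x) \<le> K * flap s f x - ddir f x (indicator (ball 0 1) x *\<^sub>R b x)"
  shows "- (C * (\<integral>x. u x * weight x \<partial>lebesgue)) + (\<integral>x. rest f x \<partial>lebesgue) \<le> T f"
proof -
  have sf: "smooth_fun f" using test_functionsD[OF f] by simp
  obtain A where A: "\<forall>x. \<bar>f x\<bar> \<le> A" using test_functions_bounded[OF f] by blast
  have ir: "integrable lebesgue (rest f)" using A by (intro rest_integrable smooth_fun_borel sf) auto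
  have "(\<integral>x. - C * (u x * weight x) + rest f x \<partial>lebesgue) \<le> (\<integral>x. u x * (K * flap s f x) + low f x \<partial>lebesgue)"
  proof (rule integral_mono)
    show "integrable lebesgue (\<lambda>x. - C * (u x * weight x) + rest f x)"
      by (intro Bochner_Integration.integrable_add integrable_mult_right u_weight_integrable ir)
    show "integrable lebesgue (\<lambda>x. u x * (K * flap s f x) + low f x)"
      by (intro Bochner_Integration.integrable_add u_flap_integrable[OF f] low_integrable[OF f])
    fix x
    have "u x * (- (C * weight x)) \<le> u x * (K * flap s f x - ddir f x (indicator (ball 0 1) x *\<^sub>R b x))"
      by (intro mult_left_mono low u_nonneg)
    then show "- C * (u x * weight x) + rest f x \<le> u x * (K * flap s f x) + low f x"
      by (simp add: rest_def low_def algebra_simps)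
  qed
  then show ?thesis
    using u_weight_integrable ir u_flap_integrable[OF f] low_integrable[OF f] by (simp add: T_def)
qed

end

text \<open>Two mean value steps along the segment from 0 to x; they give the remainder without the
  factor 1/2.\<close>

lemma taylor_lower:
  fixes f :: "'a::euclidean_space \<Rightarrow> real"
  assumes f: "smooth_fun f" and M: "\<And>x h. \<bar>ddir2 f x h\<bar> \<le> M * (norm h)\<^sup>2"
  shows "f 0 + ddir f 0 x - M * (norm x)\<^sup>2 \<le> f x"
proof -
  let ?g = "\<lambda>t. f (0 + t *\<^sub>R x)" and ?g' = "\<lambda>t. ddir f (0 + t *\<^sub>R x) x" and ?g'' = "\<lambda>t. ddir2 f (0 + t *\<^sub>R x) x"
  have d: "(?g has_real_derivative ?g' t) (at t)" "(?g' has_real_derivative ?g'' t) (at t)" for t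
    by (rule DERIV_along_line[OF f] DERIV_ddir_along_line[OF f])+
  obtain \<xi> where \<xi>: "0 < \<xi>" "\<xi> < 1" "?g 1 - ?g 0 = (1 - 0) * ?g' \<xi>"
    using MVT2[of 0 1 ?g ?g', OF zero_less_one d(1)] by blast
  obtain \<eta> where \<eta>: "0 < \<eta>" "\<eta> < \<xi>" "?g' \<xi> - ?g' 0 = (\<xi> - 0) * ?g'' \<eta>"
    using MVT2[of 0 \<xi> ?g' ?g'', OF \<xi>(1) d(2)] by blast
  have "\<bar>\<xi> * ?g'' \<eta>\<bar> \<le> 1 * (M * (norm x)\<^sup>2)"
    unfolding abs_mult using \<xi> M[of "0 + \<eta> *\<^sub>R x" x] by (intro mult_mono) auto
  then show ?thesis using \<xi>(3) \<eta>(3) by simp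
qed

text \<open>It makes the Gaussian decay of the barrier quadratic, hence comparable with a Taylor
  remainder.\<close>

lemma exp_minus_le_one_minus_half:
  fixes v :: real
  assumes "0 \<le> v" "v \<le> 1"
  shows "exp (- v) \<le> 1 - v / 2"
proof -
  have "1 \<le> (1 + v) * (1 - v / 2)" using assms mult_left_mono[of v 1 v] by (simp add: algebra_simps)
  also have "\<dots> \<le> exp v * (1 - v / 2)" using assms by (intro mult_right_mono exp_ge_add_one_self) auto
  finally show ?thesis by (simp add: exp_minus field_simps)
qed

section \<open>Nonnegativity of the functional on all nonnegative test functions of the ball\<close>

context drift_setting
begin

theorem T_nonneg:
  assumes dim: "DIM('a) \<ge> 2" and drift: "1/2 < s \<or> (\<forall>x\<in>ball 0 1. b x = 0)"
    and super: "\<And>f. f \<in> test_functions (ball 0 1 - {0}) \<Longrightarrow> (\<And>x. 0 \<le> f x) \<Longrightarrow> 0 \<le> T f"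
    and f: "f \<in> test_functions (ball 0 1)" and nn: "\<And>x. 0 \<le> f x"
  shows "0 \<le> T f"
proof (cases "f 0 = 0")
  case True
  then show ?thesis using T_nonneg_of_zero[OF super f nn] by blast
next
  case False
  define m where "m = f 0"
  have m: "m > 0" using False nn[of 0] by (simp add: m_def)
  have sf: "smooth_fun f" using test_functionsD[OF f] by simp
  obtain M2 where M2: "M2 > 0" "\<forall>x h. \<bar>f x\<bar> \<le> M2 \<and> \<bar>ddir f x h\<bar> \<le> M2 * norm h \<and> \<bar>ddir2 f x h\<bar> \<le> M2 * (norm h)\<^sup>2"
    using test_functions_C2_bounded[OF f] by blast
  \<comment> \<open>With this choice m (1 + x . g) is the first-order Taylor polynomial of f at
    0.\<close>
  define g where "g = (\<Sum>i\<in>Basis. (ddir f 0 i / m) *\<^sub>R i)"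
  have xg: "m * (x \<bullet> g) = ddir f 0 x" for x
    using m by (subst ddir_eq_sum[OF sf]) (simp add: g_def inner_sum_right sum_distrib_left mult.commute)
  \<comment> \<open>With \<open>4 * (4 * r) = r1\<^sup>2\<close> the Gaussian decay of the barrier beats the quadratic Taylor remainder
    of \<open>f\<close> on the ball of radius \<open>r1\<close>; the bound on \<open>\<rho>\<close> keeps the main term of the operator positive.\<close>
  define r1 where "r1 = min (1/2) (min (1 / (2 * (norm g + 1))) (m / (4 * M2)))"
  have ng: "0 < norm g + 1" by (simp add: add_nonneg_pos)
  have r1: "0 < r1" "r1 \<le> 1/2" "r1 \<le> 1 / (2 * (norm g + 1))" "r1 \<le> m / (4 * M2)"
    using m M2(1) ng by (auto simp: r1_def)
  define \<rho> where "\<rho> = min (r1 / 4) ((1 - s) * 2 powr (- 3 - s) / (norm g + 1))"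
  have \<rho>: "0 < \<rho>" "\<rho> \<le> r1 / 4" "\<rho> \<le> (1 - s) * 2 powr (- 3 - s) / (norm g + 1)"
  proof -
    show "0 < \<rho>" using r1 s ng by (simp add: \<rho>_def)
    show "\<rho> \<le> r1 / 4" "\<rho> \<le> (1 - s) * 2 powr (- 3 - s) / (norm g + 1)"
      unfolding \<rho>_def by (rule min.cobounded1 min.cobounded2)+
  qed
  define r where "r = r1\<^sup>2 / 16"
  have r: "0 < r" using r1 by (simp add: r_def)
  have r4: "4 * (4 * r) = r1\<^sup>2" by (simp add: r_def)
  have r1sq: "r1\<^sup>2 \<le> r1" using r1 by (simp add: power2_eq_square mult_left_le)
  have sub: "cball (0::'a) (2 * \<rho>) \<subseteq> ball 0 r1" using \<rho> r1 by (auto simp: subset_iff)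
  obtain ct W where ctW: "ct \<in> test_functions (ball (0::'a) r1)" "\<forall>x. 0 \<le> ct x" "\<forall>x. ct x \<le> 1"
    "cball 0 (2 * \<rho>) \<subseteq> W" "\<forall>x\<in>W. ct x = 1"
    using smooth_urysohn[OF compact_cball open_ball sub] by blast
  have bar: "barrier s r r1 \<rho> g ct"
  proof
    have "norm g * r1 \<le> (norm g + 1) * (1 / (2 * (norm g + 1)))" using r1 ng by (intro mult_mono) auto
    also have "\<dots> = 1/2" using ng by (simp add: field_simps)
    finally show "norm g * r1 \<le> 1/2" .
    have "norm g * \<rho> \<le> (norm g + 1) * ((1 - s) * 2 powr (- 3 - s) / (norm g + 1))" using \<rho> ng by (intro mult_mono) auto
    also have "\<dots> = (1 - s) * 2 powr (- 3 - s)" using ng by simp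
    finally show "norm g * \<rho> \<le> (1 - s) * 2 powr (- 3 - s)" .
    show "ct x = 1" if "x \<in> ball 0 (2 * \<rho>)" for x using that ctW(4,5) by (auto simp: subset_iff)
  qed (use s r \<rho> r1 ctW in auto)
  interpret B: barrier s r r1 \<rho> g ct by (rule bar)
  obtain C where C: "C \<ge> 0" "\<forall>e x. 0 < e \<longrightarrow> e < r \<longrightarrow>
    - (C * weight x) \<le> K * flap s (B.zeta e) x - ddir (B.zeta e) x (indicator (ball 0 1) x *\<^sub>R b x)"
    using zeta_operator_lower_bound[OF drift bar] by blast
  \<comment> \<open>The shift by 2 keeps \<open>e j\<close> below r already at j = 0. The ratio 4r /
    e j is 4 (j + 2), whose logarithm drives the divergence of \<open>w j 0\<close>.\<close>
  define e where "e = (\<lambda>j. r / real (j + 2))"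
  have e: "0 < e j" "e j < r" for j using r by (auto simp: e_def divide_simps)
  define w where "w = (\<lambda>j (x::'a). heat_mix 0 (e j) (4 * r) x)"
  have w_nn: "0 \<le> w j x" for j x by (simp add: w_def heat_mix_nonneg)
  define cc where "cc = (4 * pi) powr (- (real DIM('a) / 2))"
  have cc: "cc > 0" by (simp add: cc_def)
  have W_low: "cc * ln (4 * (real j + 2)) \<le> w j 0" for j
  proof -
    have "4 * r \<le> 1" using r4 r1sq r1 by linarith
    moreover have "e j \<le> 4 * r" using e[of j] r by linarith
    ultimately have "cc * (ln (4 * r) - ln (e j)) \<le> w j 0"
      unfolding cc_def w_def using e(1) by (intro heat_mix_at_zero_lower[OF dim]) auto
    moreover have "ln (4 * r) - ln (e j) = ln (4 * (real j + 2))"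
    proof -
      have "4 * r = 4 * (real j + 2) * e j" by (simp add: e_def field_simps)
      then show ?thesis using e(1)[of j] using ln_mult_pos[of "4 * (real j + 2)" "e j"] by simp
    qed
    ultimately show ?thesis by simp
  qed
  have W_pos: "0 < w j 0" for j
    using W_low[of j] cc by (intro less_le_trans[OF mult_pos_pos[OF cc] W_low]) (simp add: ln_gt_zero)
  have W_lim: "filterlim (\<lambda>j. w j 0) at_top sequentially"
  proof (rule filterlim_at_top_mono)
    have "filterlim (\<lambda>j::nat. ln (4 * (real j + 2))) at_top sequentially" by real_asymp
    then show "filterlim (\<lambda>j::nat. cc * ln (4 * (real j + 2))) at_top sequentially"
      by (intro filterlim_tendsto_pos_mult_at_top[OF tendsto_const cc])
  qed (use W_low in auto)
  define z where "z = (\<lambda>j x. (m / w j 0) * B.zeta (e j) x)"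
  have tzeta: "B.zeta (e j) \<in> test_functions (ball 0 1)" for j
  proof -
    have "ball (0::'a) r1 \<subseteq> ball 0 1" using r1 by (intro subset_ball) linarith
    from test_functions_mono[OF this] show ?thesis using B.zeta_test[OF e(1)] by blast
  qed
  have tz: "z j \<in> test_functions (ball 0 1)" for j
    unfolding z_def by (intro test_functions_cmult tzeta)
  have z_nn: "0 \<le> z j x" for j x
    using m W_pos[of j] B.zeta_bounds(1)[of "e j" x] by (simp add: z_def)
  have z_w: "z j x \<le> (m / w j 0) * (3/2 * w j x)" for j x
    unfolding z_def w_def[symmetric] using m W_pos[of j] B.zeta_bounds(2)[of "e j" x]
    by (intro mult_left_mono) (auto simp: w_def)
  have w_max: "w j x \<le> exp (- ((norm x)\<^sup>2 / r1\<^sup>2)) * w j 0" for j x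
    using heat_mix_le_zero[OF e(1)[of j], of "4 * r" x] r unfolding w_def r4 by simp
  \<comment> \<open>By the decay estimate w j x / w j 0 \<le> 1 - v/2, and 1 + x . g \<ge> 1/2, the
    barrier is at most the Taylor polynomial minus m v/4. Since M2 r1^2 \<le> m/4, this gap covers
    the remainder M2 |x|^2 = M2 r1^2 v.\<close>
  have z_le_f: "z j x \<le> f x" for j x
  proof (cases "x \<in> ball 0 r1")
    case True
    define v where "v = (norm x)\<^sup>2 / r1\<^sup>2"
    have "(norm x)\<^sup>2 \<le> r1\<^sup>2" using True by (intro power_mono) auto
    then have v: "0 \<le> v" "v \<le> 1" using r1 by (auto simp: v_def)
    have "w j x \<le> (1 - v / 2) * w j 0"
      using w_max[of j x] mult_right_mono[OF exp_minus_le_one_minus_half[OF v] w_nn[of j 0]]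
      unfolding v_def[symmetric] by linarith
    then have q: "w j x / w j 0 \<le> 1 - v / 2" using W_pos[of j] by (simp add: divide_le_eq)
    have xg1: "\<bar>x \<bullet> g\<bar> \<le> 1/2" using True by (intro B.inner_g_bound) auto
    then have l: "1/2 \<le> 1 + x \<bullet> g" by linarith
    have "z j x = ct x * (m * (1 + x \<bullet> g) * (w j x / w j 0))"
      by (simp add: z_def B.zeta_def B.bump_def w_def)
    also have "\<dots> \<le> 1 * (m * (1 + x \<bullet> g) * (w j x / w j 0))"
      using ctW(3) m l w_nn[of j x] W_pos[of j] by (intro mult_right_mono) auto
    also have "\<dots> \<le> m * (1 + x \<bullet> g) * (1 - v / 2)"
      unfolding mult_1 using q m l by (intro mult_left_mono mult_nonneg_nonneg) auto
    also have "\<dots> = m + ddir f 0 x - m * (1 + x \<bullet> g) * (v / 2)"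
      by (simp add: xg[symmetric] algebra_simps)
    also have "\<dots> \<le> m + ddir f 0 x - M2 * (norm x)\<^sup>2"
    proof -
      have "r1\<^sup>2 \<le> m / (4 * M2)" using r1sq r1(4) by linarith
      then have "M2 * r1\<^sup>2 \<le> m / 4" using M2(1) by (simp add: field_simps)
      then have "M2 * r1\<^sup>2 * v \<le> m / 4 * v" using v by (intro mult_right_mono) auto
      moreover have "M2 * r1\<^sup>2 * v = M2 * (norm x)\<^sup>2" using r1 by (simp add: v_def)
      moreover have "m * (1/2) * (v / 2) \<le> m * (1 + x \<bullet> g) * (v / 2)"
        using l m v by (intro mult_right_mono mult_left_mono) auto
      ultimately show ?thesis by simp
    qed
    also have "\<dots> \<le> f x" unfolding m_def using M2(2) by (intro taylor_lower sf) auto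
    finally show ?thesis .
  next
    case False
    then show ?thesis using nn by (simp add: z_def B.zeta_eq_0)
  qed
  \<comment> \<open>The difference f - z j is nonnegative and vanishes at 0, which is the case
    already settled.\<close>
  have step: "T (z j) \<le> T f" for j
  proof -
    have td: "(\<lambda>x. f x - z j x) \<in> test_functions (ball 0 1)" by (intro test_functions_diff f tz)
    have "ct 0 = 1" using \<rho> by (intro B.ct(4)) auto
    then have "z j 0 = m" using W_pos[of j] by (simp add: z_def B.zeta_def B.bump_def w_def)
    then have "0 \<le> T (\<lambda>x. f x - z j x)"
      using z_le_f[of j] by (intro T_nonneg_of_zero[OF super td]) (auto simp: m_def)
    moreover have "T f = T (\<lambda>x. f x - z j x) + T (z j)"
      using T_add[OF td tz[of j]] by simp
    ultimately show ?thesis by simp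
  qed
  define I where "I = (\<integral>x. u x * weight x \<partial>lebesgue)"
  have low: "- (m * C * I) * inverse (w j 0) + (\<integral>x. rest (z j) x \<partial>lebesgue) \<le> T f" for j
  proof -
    have "- (C * (m / w j 0) * I) + (\<integral>x. rest (z j) x \<partial>lebesgue) \<le> T (z j)"
      unfolding I_def
    proof (rule T_lower_bound[OF tz])
      fix x
      let ?v = "indicator (ball 0 1) x *\<^sub>R b x"
      have fl: "flap s (z j) x = (m / w j 0) * flap s (B.zeta (e j)) x" unfolding z_def by (rule flap_cmult)
      have dd: "ddir (z j) x ?v = (m / w j 0) * ddir (B.zeta (e j)) x ?v"
        unfolding z_def
        by (rule ddir_unique) (intro has_derivative_mult_right has_derivative_ddir test_functionsD(1)[OF tzeta])
      have "(m / w j 0) * (- (C * weight x)) \<le> (m / w j 0) * (K * flap s (B.zeta (e j)) x - ddir (B.zeta (e j)) x ?v)"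
        using C(2) e[of j] m W_pos[of j] by (intro mult_left_mono) auto
      then show "- (C * (m / w j 0) * weight x) \<le> K * flap s (z j) x - ddir (z j) x ?v"
        unfolding fl dd by (simp add: algebra_simps)
    qed
    moreover have "- (m * C * I) * inverse (w j 0) = - (C * (m / w j 0) * I)"
      by (simp only: divide_inverse mult_minus_left mult_minus_right mult_ac)
    ultimately show ?thesis using step[of j] by linarith
  qed
  \<comment> \<open>All z j are at most 3/2 m, and off the origin they tend to 0 because
    \<open>w j x\<close> stays bounded there while \<open>w j 0\<close> diverges.\<close>
  have "(\<lambda>j. \<integral>x. rest (z j) x \<partial>lebesgue) \<longlonglongrightarrow> (\<integral>x. (0::real) \<partial>(lebesgue::'a measure))"
  proof (rule integral_dominated_convergence)
    have zb: "\<bar>z j x\<bar> \<le> 3/2 * m" for j x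
    proof -
      have "exp (- ((norm x)\<^sup>2 / r1\<^sup>2)) * w j 0 \<le> 1 * w j 0" using w_nn by (intro mult_right_mono) auto
      then have "w j x \<le> w j 0" using w_max[of j x] by linarith
      then have "(m / w j 0) * (3/2 * w j x) \<le> (m / w j 0) * (3/2 * w j 0)"
        using m W_pos[of j] by (intro mult_left_mono) auto
      also have "\<dots> = 3/2 * m" using W_pos[of j] by simp
      finally have "z j x \<le> 3/2 * m" by (rule order_trans[OF z_w])
      then show ?thesis using z_nn[of j x] by simp
    qed
    show "AE x in lebesgue. norm (rest (z j) x) \<le> 4 * (3/2 * m) * M * (u x * weight x)" for j
      using rest_bound[of "z j", OF zb] by simp
    show "integrable lebesgue (\<lambda>x. 4 * (3/2 * m) * M * (u x * weight x))"
      by (intro integrable_mult_right u_weight_integrable)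
    have z_lim: "(\<lambda>j. z j x) \<longlonglongrightarrow> 0" if x: "x \<noteq> 0" for x
    proof -
      have nx: "0 < norm x" and R: "0 < 4 * r" using x r by auto
      obtain Ca where Ca: "Ca \<ge> 0" "\<forall>e (y::'a) h. 0 < e \<longrightarrow> norm x \<le> norm y \<longrightarrow>
        heat_mix 0 e (4 * r) y \<le> Ca \<and> norm y * heat_mix 0 e (4 * r) y \<le> Ca \<and>
        \<bar>ddir (heat_mix 0 e (4 * r)) y h\<bar> \<le> Ca * norm h \<and> \<bar>ddir2 (heat_mix 0 e (4 * r)) y h\<bar> \<le> Ca * (norm h)\<^sup>2"
        using heat_mix_away[OF nx R, where 'a='a] by blast
      have "z j x \<le> (m * (3/2 * Ca)) * inverse (w j 0)" for j
      proof -
        have "w j x \<le> Ca" unfolding w_def using Ca(2) e(1) by blast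
        then have "(m / w j 0) * (3/2 * w j x) \<le> (m / w j 0) * (3/2 * Ca)"
          using m W_pos[of j] by (intro mult_left_mono) auto
        from order_trans[OF z_w this] show ?thesis by (simp only: divide_inverse mult_ac)
      qed
      moreover have "(\<lambda>j. (m * (3/2 * Ca)) * inverse (w j 0)) \<longlonglongrightarrow> (m * (3/2 * Ca)) * 0"
        by (intro tendsto_mult tendsto_const tendsto_inverse_0_at_top W_lim)
      ultimately show ?thesis
        using z_nn by (intro tendsto_sandwich[of "\<lambda>_. 0" "\<lambda>j. z j x" sequentially "\<lambda>j. (m * (3/2 * Ca)) * inverse (w j 0)"]) auto
    qed
    have "AE x in lebesgue. x \<noteq> (0::'a)" by (rule AE_completion[OF AE_lborel_singleton])
    then show "AE x in lebesgue. (\<lambda>j. rest (z j) x) \<longlonglongrightarrow> 0"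
    proof eventually_elim
      case (elim x)
      have "(\<lambda>j. rest (z j) x) \<longlonglongrightarrow> u x * (- 0 * (indicator (ball 0 1) x * divergence b x) + (indicator (ball 0 1) x * c x) * 0)"
        unfolding rest_def by (intro tendsto_intros z_lim elim)
      then show ?case by simp
    qed
    show "rest (z j) \<in> borel_measurable lebesgue" for j
      by (intro rest_measurable smooth_fun_borel test_functionsD(1)[OF tz])
  qed simp
  then have rl: "(\<lambda>j. \<integral>x. rest (z j) x \<partial>lebesgue) \<longlonglongrightarrow> 0" by simp
  have "(\<lambda>j. - (m * C * I) * inverse (w j 0) + (\<integral>x. rest (z j) x \<partial>lebesgue)) \<longlonglongrightarrow> - (m * C * I) * 0 + 0"
    by (intro tendsto_add tendsto_mult tendsto_const tendsto_inverse_0_at_top W_lim rl)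
  then have "(\<lambda>j. - (m * C * I) * inverse (w j 0) + (\<integral>x. rest (z j) x \<partial>lebesgue)) \<longlonglongrightarrow> 0" by simp
  then show ?thesis using low by (intro LIMSEQ_le_const2) auto
qed

end

section \<open>From the norms in the theorem to the bounds of the drift setting\<close>

lemma norm_frechet_le_onorm:
  assumes "f differentiable (at x)"
  shows "norm (frechet_derivative f (at x) h) \<le> onorm (frechet_derivative f (at x)) * norm h"
  using assms by (intro onorm has_derivative_bounded_linear) (simp add: frechet_derivative_works)

theorem theorem1p3:
  fixes s M :: real
    and b :: "'a::euclidean_space \<Rightarrow> 'a"
    and c u :: "'a \<Rightarrow> real"
  assumes dim: "DIM('a) \<ge> 2"
    and s: "(1/2 < s \<and> s < 1) \<or> (0 < s \<and> s < 1 \<and> (\<forall>x\<in>ball 0 1. b x = 0))"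
    and b: "C_k_on 1 (ball 0 1) b"
    and c: "c \<in> borel_measurable (lebesgue_on (ball 0 1))"
    and bound: "C1_norm (ball 0 1) b + Linf_norm (ball 0 1) c \<le> ereal M"
    and u: "u \<in> weighted_L1 (2 * s)"
    and u_nonneg: "\<And>x. u x \<ge> 0"
    and super: "nonneg_distr (ball 0 1 - {0}) (frac_operator_distr s b c u (ball 0 1 - {0}))"
  shows "\<exists>a \<mu>. a \<ge> 0 \<and> radon_measure_on (ball 0 1) \<mu> \<and> emeasure \<mu> {0} = 0 \<and>
           eq_distr (ball 0 1) (frac_operator_distr s b c u (ball 0 1))
             (\<lambda>\<phi>. measure_distr \<mu> \<phi> + a * dirac_distr 0 \<phi>)"
proof -
  let ?S1 = "SUP x\<in>ball 0 1. ereal (norm (b x))"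
  let ?S2 = "SUP x\<in>ball 0 1. ereal (onorm (frechet_derivative b (at x)))"
  let ?S3 = "Linf_norm (ball 0 1) c"
  have b_diff: "b differentiable (at x)" if "x \<in> ball 0 1" for x
    using b that by (simp add: One_nat_def)
  have b_der: "continuous_on (ball 0 1) (\<lambda>x. frechet_derivative b (at x) i)" if "i \<in> Basis" for i
    using b that by (simp add: One_nat_def)
  have S1: "0 \<le> ?S1" by (rule SUP_upper2[of 0]) auto
  have S2: "0 \<le> ?S2"
    by (rule SUP_upper2[of 0])
      (use b_diff[of 0] in \<open>auto intro!: onorm_pos_le has_derivative_bounded_linear simp: frechet_derivative_works\<close>)
  have sum: "?S1 + ?S2 + ?S3 \<le> ereal M" using bound by (simp add: C1_norm_def)
  have ball_pos: "emeasure lebesgue (ball 0 1 :: 'a set) \<noteq> 0"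
    using content_ball_pos[of 1 "0::'a"] by (auto simp: measure_def)
  have cAE: "AE x in lebesgue_on (ball 0 1). ereal \<bar>c x\<bar> \<le> ?S3"
    unfolding Linf_norm_def by (rule esssup_AE)
  \<comment> \<open>Over a null set an essential supremum could be negative; here the ball has
    positive measure, so a negative value contradicts |c| \<ge> 0.\<close>
  have S3: "0 \<le> ?S3"
  proof (rule ccontr)
    assume "\<not> 0 \<le> ?S3"
    then have neg: "?S3 < 0" by simp
    have "AE x in lebesgue_on (ball 0 1 :: 'a set). False"
      using cAE
    proof eventually_elim
      case (elim x)
      have "(0::ereal) \<le> ereal \<bar>c x\<bar>" by simp
      then have "0 \<le> ?S3" using elim by (rule order_trans)
      then show False using neg by simp
    qed
    then have "ae_filter (lebesgue_on (ball 0 1 :: 'a set)) = bot" by (simp add: eventually_False)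
    then have "emeasure (lebesgue_on (ball 0 1 :: 'a set)) (space (lebesgue_on (ball 0 1 :: 'a set))) = 0"
      by (simp add: ae_filter_eq_bot_iff)
    then show False using ball_pos by (simp add: emeasure_restrict_space)
  qed
  \<comment> \<open>Each norm can be bounded by M separately because the other two are
    nonnegative.\<close>
  have S12: "?S1 \<le> ereal M" "?S2 \<le> ereal M" "?S3 \<le> ereal M"
  proof -
    have "?S1 \<le> ?S1 + ?S2 + ?S3" by (rule add_increasing2[OF S3 add_increasing2[OF S2 order_refl]])
    then show "?S1 \<le> ereal M" using sum by (rule order_trans)
    have "?S2 \<le> ?S1 + ?S2 + ?S3" by (rule add_increasing2[OF S3 add_increasing[OF S1 order_refl]])
    then show "?S2 \<le> ereal M" using sum by (rule order_trans)
    have "?S3 \<le> ?S1 + ?S2 + ?S3" by (rule add_increasing[OF add_nonneg_nonneg[OF S1 S2] order_refl])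
    then show "?S3 \<le> ereal M" using sum by (rule order_trans)
  qed
  have bM: "norm (b x) \<le> M" if "x \<in> ball 0 1" for x
  proof -
    have "ereal (norm (b x)) \<le> ?S1" by (rule SUP_upper[OF that])
    then show ?thesis using S12(1) by (simp only: ereal_less_eq(3)[symmetric])
  qed
  have oM: "onorm (frechet_derivative b (at x)) \<le> M" if "x \<in> ball 0 1" for x
  proof -
    have "ereal (onorm (frechet_derivative b (at x))) \<le> ?S2" by (rule SUP_upper[OF that])
    then show ?thesis using S12(2) by (simp only: ereal_less_eq(3)[symmetric])
  qed
  have M0: "0 \<le> M" using order_trans[OF norm_ge_zero bM[of 0]] by simp
  have cM: "AE x in lebesgue. x \<in> ball 0 1 \<longrightarrow> \<bar>c x\<bar> \<le> M"
  proof -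
    have "AE x in lebesgue_on (ball 0 1). \<bar>c x\<bar> \<le> M"
      using cAE
    proof eventually_elim
      case (elim x)
      then show ?case using S12(3) by (simp only: ereal_less_eq(3)[symmetric])
    qed
    then show ?thesis by (subst (asm) AE_restrict_space_iff) auto
  qed
  \<comment> \<open>Leaves room for the divergence, a sum of n terms of absolute value at most
    M.\<close>
  define N where "N = (real DIM('a) + 1) * M"
  have MN: "M \<le> N" "real DIM('a) * M \<le> N" "0 \<le> N"
    using M0 by (simp_all add: N_def algebra_simps)
  have div: "\<bar>divergence b x\<bar> \<le> N" if x: "x \<in> ball 0 1" for x
  proof -
    have "\<bar>divergence b x\<bar> \<le> (\<Sum>i\<in>Basis. \<bar>frechet_derivative b (at x) i \<bullet> i\<bar>)"
      unfolding divergence_def by (rule sum_abs)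
    also have "\<dots> \<le> (\<Sum>i\<in>(Basis::'a set). M)"
    proof (rule sum_mono)
      fix i :: 'a assume i: "i \<in> Basis"
      have "\<bar>frechet_derivative b (at x) i \<bullet> i\<bar> \<le> norm (frechet_derivative b (at x) i)"
        using Basis_le_norm[OF i] by simp
      also have "\<dots> \<le> onorm (frechet_derivative b (at x)) * norm i"
        by (rule norm_frechet_le_onorm[OF b_diff[OF x]])
      also have "\<dots> \<le> M" using oM[OF x] i by simp
      finally show "\<bar>frechet_derivative b (at x) i \<bullet> i\<bar> \<le> M" .
    qed
    also have "\<dots> = real DIM('a) * M" by simp
    finally show ?thesis using MN(2) by linarith
  qed
  have s': "0 < s" "s < 1" using s by auto
  interpret D: drift_setting s N b c u
  proof
    show "0 < s" "s < 1" by (rule s')+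
    show "u \<in> borel_measurable lebesgue"
      "integrable lebesgue (\<lambda>y. \<bar>u y\<bar> / (1 + norm y powr (real DIM('a) + 2 * s)))"
      using u by (auto simp: weighted_L1_def)
    show "0 \<le> u x" for x by (rule u_nonneg)
    show "0 \<le> N" by (rule MN(3))
    show "b differentiable (at x)" if "x \<in> ball 0 1" for x by (rule b_diff[OF that])
    show "norm (b x) \<le> N" if "x \<in> ball 0 1" for x using bM[OF that] MN(1) by linarith
    show "\<bar>divergence b x\<bar> \<le> N" if "x \<in> ball 0 1" for x by (rule div[OF that])
    have cb: "continuous_on (ball 0 1) b"
      using b_diff by (simp add: continuous_on_eq_continuous_at differentiable_imp_continuous_within)
    have "(\<lambda>x. indicator (ball 0 1) x *\<^sub>R b x) \<in> borel_measurable borel"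
      by (rule borel_measurable_continuous_on_indicator[OF _ cb]) simp
    then show "(\<lambda>x. indicator (ball 0 1) x *\<^sub>R b x) \<in> borel_measurable lebesgue"
      by (intro measurable_completion) simp
    have "continuous_on (ball 0 1) (divergence b)"
      unfolding divergence_def[abs_def] by (intro continuous_on_sum continuous_on_inner b_der continuous_on_const)
    then have "(\<lambda>x. indicator (ball 0 1) x *\<^sub>R divergence b x) \<in> borel_measurable borel"
      by (intro borel_measurable_continuous_on_indicator) simp
    then show "(\<lambda>x. indicator (ball 0 1) x * divergence b x) \<in> borel_measurable lebesgue"
      by (intro measurable_completion) simp
    have "(\<lambda>x. indicator (ball 0 1) x *\<^sub>R c x) \<in> borel_measurable lebesgue"
      using c by (subst (asm) borel_measurable_restrict_space_iff) auto
    then show "(\<lambda>x. indicator (ball 0 1) x * c x) \<in> borel_measurable lebesgue" by simp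
    show "AE x in lebesgue. x \<in> ball 0 1 \<longrightarrow> \<bar>c x\<bar> \<le> N"
      using cM by eventually_elim (use MN(1) in auto)
  qed
  have sup: "0 \<le> D.T f" if f: "f \<in> test_functions (ball 0 1 - {0})" and nn: "\<And>x. 0 \<le> f x" for f
    proof -
    have "0 \<le> frac_operator_distr s b c u (ball 0 1 - {0}) f"
      using super f nn unfolding nonneg_distr_def by blast
    also have "\<dots> = D.T f" by (rule D.frac_operator_distr_eq_T[OF _ f]) auto
    finally show ?thesis .
  qed
  have drift: "1/2 < s \<or> (\<forall>x\<in>ball 0 1. b x = 0)" using s by auto
  interpret P: nonneg_functional "ball 0 1" D.T
  proof
    show "0 \<le> D.T f" if "f \<in> test_functions (ball 0 1)" "\<And>x. 0 \<le> f x" for f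
      by (rule D.T_nonneg[OF dim drift sup that])
  qed (use D.T_add D.T_cmult in auto)
  have z: "(0::'a) \<in> ball 0 1" by simp
  obtain a \<mu> where a: "a \<ge> 0" "radon_measure_on (ball 0 1) \<mu>" "emeasure \<mu> {0::'a} = 0"
    "\<forall>f\<in>test_functions (ball 0 1). D.T f = (\<integral>x. f x \<partial>\<mu>) + a * f 0"
    using P.representation_with_atom[OF z] by blast
  have "eq_distr (ball 0 1) (frac_operator_distr s b c u (ball 0 1))
             (\<lambda>\<phi>. measure_distr \<mu> \<phi> + a * dirac_distr 0 \<phi>)"
    unfolding eq_distr_def measure_distr_def dirac_distr_def
    using a(4) D.frac_operator_distr_eq_T by auto
  then show ?thesis using a(1-3) by blast
qed

end
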